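(* Let $a$ be a random variable with values in $(-1,1)$, with distribution $\Phi(\mathrm{d}x)=\mathrm{P}(a\in \mathrm{d}x)$, satisfying $$\mathrm{E}\Big[\frac{1}{1-|a|}\Big]<\infty .$$ Let $W\sim ID(\mu,\sigma,\pi)$ be an infinitely divisible random variable, and let $\{\varepsilon^{(N)},\,N\ge 1\}$ be a sequence of random variables which belongs to the domain of attraction of $W$, $\{\varepsilon^{(N)}\}\in D(W)$, and is such that $\{\varepsilon^{(N)}\}\in T(\alpha)$ for some $0<\alpha\le 2$. For each $N\ge1$ let $\{\varepsilon^{(N)}(t),\,t\in\mathbb{Z}\}$ be i.i.d. copies of $\varepsilon^{(N)}$, independent of $a$, let $$X^{(N)}(t)=\sum_{k=0}^\infty a^k\varepsilon^{(N)}(t-k),\qquad t\in\mathbb{Z},$$ be the stationary solution of the random-coefficient AR(1) equation $X^{(N)}(t)=aX^{(N)}(t-1)+\varepsilon^{(N)}(t)$, $t\in\mathbb{Z}$, and let $\{X^{(N)}_i(t),\,t\in\mathbb{Z}\}$, $i=1,\dots,N$, be independent copies of $\{X^{(N)}(t),\,t\in\mathbb{Z}\}$ (each copy having its own random coefficient $a_i$ and its own innovations). Then there exists a process $\{\mathfrak{X}(t),\,t\in\mathbb{Z}\}$ such that, as $N\to\infty$, the finite-dimensional distributions of $\big\{\sum_{i=1}^N X^{(N)}_i(t),\ t\in\mathbb{Z}\big\}$ converge weakly to those of $\{\mathfrak{X}(t),\,t\in\mathbb{Z}\}$. The process $\{\mathfrak{X}(t)\}$ is stationary, ergodic, has infinitely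 divisible finite-dimensional distributions, and admits the stochastic integral representation $$\mathfrak{X}(t)=\sum_{s\le t}\int_{(-1,1)}x^{t-s}M_s(\mathrm{d}x),\qquad t\in\mathbb{Z},$$ where $\{M_s,\,s\in\mathbb{Z}\}$ are i.i.d. copies of an infinitely divisible random measure $M\sim W$ on $(-1,1)$ with control measure $\Phi$.
   Context: **Infinitely divisible laws.** $W\sim ID(\mu,\sigma,\pi)$ means that $W$ is infinitely divisible with log-characteristic function $$V(\theta):=\log \mathrm{E}e^{\mathrm{i}\theta W}=\int_{\mathbb{R}}\big(e^{\mathrm{i}\theta y}-1-\mathrm{i}\theta y\mathbf{1}(|y|\le1)\big)\pi(\mathrm{d}y)-\tfrac12\theta^2\sigma^2+\mathrm{i}\theta\mu,\qquad \theta\in\mathbb{R},$$ where $\mu\in\mathbb{R}$, $\sigma\ge0$ and $\pi$ is a L\'evy measure, i.e. a measure on $\mathbb{R}$ with $\pi(\{0\})=0$ and $\int_{\mathbb{R}}(x^2\wedge1)\pi(\mathrm{d}x)<\infty$. **Domain of attraction.** Let $\{\varepsilon^{(N)}\}$ be a sequence of random variables tending to $0$ in probability. Write $\{\varepsilon^{(N)}\}\in D(W)$ if $\big(\mathrm{E}e^{\mathrm{i}\theta\varepsilon^{(N)}}\big)^N\to\mathrm{E}e^{\mathrm{i}\theta W}$ as $N\to\infty$ for all $\theta\in\mathbb{R}$. **Class $T(\alpha)$.** For $0<\alpha\le2$ write $\{\varepsilon^{(N)}\}\in T(\alpha)$ if there is a constant $C$ independent of $N$ and $x$ such that either (i) $\alpha=2$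 and $\mathrm{E}\varepsilon^{(N)}=0$, $N\mathrm{E}(\varepsilon^{(N)})^2\le C$ for all $N$; or (ii) $0<\alpha<2$ and $N\mathrm{P}(|\varepsilon^{(N)}|>x)\le Cx^{-\alpha}$ for all $x>0$ and all $N$; moreover $\mathrm{E}\varepsilon^{(N)}=0$ if $1<\alpha<2$, and the distribution of $\varepsilon^{(N)}$ is symmetric if $\alpha=1$. **Random measure.** $M\sim W$ with control measure $\Phi$ means: $M$ is an independently scattered ($M$ of disjoint sets are independent), a.s. $\sigma$-additive random measure on the Borel subsets of $(-1,1)$ with $\mathrm{E}e^{\mathrm{i}\theta M(A)}=e^{\Phi(A)V(\theta)}$ for every Borel $A\subset(-1,1)$ and $\theta\in\mathbb{R}$. Integrals $\int g\,\mathrm{d}M$ are defined in the usual way (limits in probability of integrals of simple functions), and the series over $s$ converges in probability. *)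

theory Defs
  imports "HOL-Probability.Probability"
begin

section \<open>Infinitely divisible laws on the line\<close>

definition infinitely_divisible :: "real measure \<Rightarrow> bool" where
  "infinitely_divisible L \<longleftrightarrow>
     (\<forall>n::nat. 1 \<le> n \<longrightarrow> (\<exists>\<nu>. prob_space \<nu> \<and> sets \<nu> = sets borel \<and>
        distr (\<Pi>\<^sub>M k\<in>{..<n}. \<nu>) borel (\<lambda>y. \<Sum>k<n. y k) = L))"

definition levy_measure :: "real measure \<Rightarrow> bool" where
  "levy_measure \<pi> \<longleftrightarrow>
     sets \<pi> = sets borel \<and> emeasure \<pi> {0} = 0 \<and>
     (\<integral>\<^sup>+ x. ennreal (min (x\<^sup>2) 1) \<partial>\<pi>) < \<infinity>"

definition levy_exponent :: "real \<Rightarrow> real \<Rightarrow> real measure \<Rightarrow> real \<Rightarrow> complex" where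
  "levy_exponent \<mu> \<sigma> \<pi> \<theta> =
     (CLINT y|\<pi>. iexp (\<theta> * y) - 1 - \<i> * complex_of_real (\<theta> * y * indicator {-1..1} y))
     - complex_of_real (\<theta>\<^sup>2 * \<sigma>\<^sup>2 / 2) + \<i> * complex_of_real (\<theta> * \<mu>)"

definition ID_rv :: "'w measure \<Rightarrow> ('w \<Rightarrow> real) \<Rightarrow> real \<Rightarrow> real \<Rightarrow> real measure \<Rightarrow> bool" where
  "ID_rv P W \<mu> \<sigma> \<pi> \<longleftrightarrow>
     W \<in> borel_measurable P \<and> 0 \<le> \<sigma> \<and> levy_measure \<pi> \<and>
     infinitely_divisible (distr P borel W) \<and>
     (\<forall>\<theta>. char (distr P borel W) \<theta> = exp (levy_exponent \<mu> \<sigma> \<pi> \<theta>))"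

section \<open>Conditions on the innovations\<close>

text \<open>Measurability is not part of the following definition; it is required separately
  wherever the definition is used.\<close>

definition tendsto_in_prob ::
    "'w measure \<Rightarrow> (nat \<Rightarrow> 'w \<Rightarrow> real) \<Rightarrow> ('w \<Rightarrow> real) \<Rightarrow> bool" where
  "tendsto_in_prob P Y Z \<longleftrightarrow>
     (\<forall>e>0. (\<lambda>n. measure P {\<omega> \<in> space P. e < \<bar>Y n \<omega> - Z \<omega>\<bar>}) \<longlonglongrightarrow> 0)"

text \<open>Sequences are indexed by \<open>N \<ge> 1\<close>; their entry at 0 is never constrained.\<close>

definition domain_of_attraction ::
    "'w measure \<Rightarrow> (nat \<Rightarrow> 'w \<Rightarrow> real) \<Rightarrow> ('w \<Rightarrow> real) \<Rightarrow> bool" where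
  "domain_of_attraction P \<epsilon> W \<longleftrightarrow>
     (\<forall>N\<ge>1. \<epsilon> N \<in> borel_measurable P) \<and>
     tendsto_in_prob P \<epsilon> (\<lambda>_. 0) \<and>
     (\<forall>\<theta>. (\<lambda>N. char (distr P borel (\<epsilon> N)) \<theta> ^ N) \<longlonglongrightarrow> char (distr P borel W) \<theta>)"

text \<open>In the second case with \<open>1 < \<alpha>\<close>, integrability of \<open>\<epsilon> N\<close> is a consequence of the tail bound;
  in the first case it follows from square integrability.\<close>

definition class_T :: "'w measure \<Rightarrow> real \<Rightarrow> (nat \<Rightarrow> 'w \<Rightarrow> real) \<Rightarrow> bool" where
  "class_T P \<alpha> \<epsilon> \<longleftrightarrow>
     (\<exists>C::real.
        (\<alpha> = 2 \<and>
         (\<forall>N\<ge>1. integrable P (\<lambda>\<omega>. (\<epsilon> N \<omega>)\<^sup>2) \<and> (LINT \<omega>|P. \<epsilon> N \<omega>) = 0 \<and>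
                real N * (LINT \<omega>|P. (\<epsilon> N \<omega>)\<^sup>2) \<le> C))
      \<or> (0 < \<alpha> \<and> \<alpha> < 2 \<and>
         (\<forall>N\<ge>1. \<forall>x>0. real N * measure P {\<omega> \<in> space P. x < \<bar>\<epsilon> N \<omega>\<bar>} \<le> C * x powr (-\<alpha>)) \<and>
         (1 < \<alpha> \<longrightarrow> (\<forall>N\<ge>1. (LINT \<omega>|P. \<epsilon> N \<omega>) = 0)) \<and>
         (\<alpha> = 1 \<longrightarrow> (\<forall>N\<ge>1. distr P borel (\<lambda>\<omega>. - \<epsilon> N \<omega>) = distr P borel (\<epsilon> N)))))"

section \<open>The random-coefficient AR(1) process\<close>

text \<open>The series is read pointwise. If \<open>\<bar>c\<bar> < 1\<close> and the \<open>e t\<close> are i.i.d. with a law satisfying either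
  condition of \<^const>\<open>class_T\<close>, it converges almost surely.\<close>

definition ar1_series :: "('w \<Rightarrow> real) \<Rightarrow> (int \<Rightarrow> 'w \<Rightarrow> real) \<Rightarrow> int \<Rightarrow> 'w \<Rightarrow> real" where
  "ar1_series c e t \<omega> = (\<Sum>k. c \<omega> ^ k * e (t - int k) \<omega>)"

lemma ar1_series_rec:
  assumes "summable (\<lambda>k. c \<omega> ^ k * e (t - 1 - int k) \<omega>)"
  shows "ar1_series c e t \<omega> = c \<omega> * ar1_series c e (t - 1) \<omega> + e t \<omega>"
proof -
  let ?f = "\<lambda>k. c \<omega> ^ k * e (t - int k) \<omega>"
  have shift: "(\<lambda>k. ?f (Suc k)) = (\<lambda>k. c \<omega> * (c \<omega> ^ k * e (t - 1 - int k) \<omega>))"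
    by (simp add: fun_eq_iff algebra_simps)
  have "summable (\<lambda>k. ?f (Suc k))"
    unfolding shift by (intro summable_mult assms)
  hence "summable ?f"
    by (rule summable_Suc_iff[of ?f, THEN iffD1])
  from suminf_split_head[OF this] have "suminf ?f = (\<Sum>k. ?f (Suc k)) + ?f 0"
    by simp
  thus ?thesis
    unfolding shift by (simp add: ar1_series_def suminf_mult[OF assms])
qed

section \<open>Processes indexed by the integers\<close>

definition fdd :: "'w measure \<Rightarrow> int set \<Rightarrow> (int \<Rightarrow> 'w \<Rightarrow> real) \<Rightarrow> (int \<Rightarrow> real) measure" where
  "fdd P J X = distr P (\<Pi>\<^sub>M t\<in>J. borel) (\<lambda>\<omega>. \<lambda>t\<in>J. X t \<omega>)"

text \<open>Weak convergence of laws on the space of real vectors indexed by \<open>J\<close>, i.e. of functions in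
  \<open>J \<rightarrow>\<^sub>E UNIV\<close> with the product topology.\<close>

definition weak_conv_PiM ::
    "int set \<Rightarrow> (nat \<Rightarrow> (int \<Rightarrow> real) measure) \<Rightarrow> (int \<Rightarrow> real) measure \<Rightarrow> bool" where
  "weak_conv_PiM J L_seq L \<longleftrightarrow>
     (\<forall>g. continuous_map (product_topology (\<lambda>_. euclideanreal) J) euclideanreal g \<and>
          bounded (g ` (J \<rightarrow>\<^sub>E UNIV)) \<longrightarrow>
          (\<lambda>n. LINT x|L_seq n. g x) \<longlonglongrightarrow> (LINT x|L. g x))"

definition infinitely_divisible_PiM :: "int set \<Rightarrow> (int \<Rightarrow> real) measure \<Rightarrow> bool" where
  "infinitely_divisible_PiM J L \<longleftrightarrow>
     (\<forall>n::nat. 1 \<le> n \<longrightarrow> (\<exists>\<nu>. prob_space \<nu> \<and> sets \<nu> = sets (\<Pi>\<^sub>M t\<in>J. borel) \<and>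
        distr (\<Pi>\<^sub>M k\<in>{..<n}. \<nu>) (\<Pi>\<^sub>M t\<in>J. borel) (\<lambda>y. \<lambda>t\<in>J. \<Sum>k<n. y k t) = L))"

definition path_law :: "'w measure \<Rightarrow> (int \<Rightarrow> 'w \<Rightarrow> real) \<Rightarrow> (int \<Rightarrow> real) measure" where
  "path_law P X = distr P (\<Pi>\<^sub>M t\<in>UNIV. borel) (\<lambda>\<omega> t. X t \<omega>)"

definition stationary_process :: "'w measure \<Rightarrow> (int \<Rightarrow> 'w \<Rightarrow> real) \<Rightarrow> bool" where
  "stationary_process P X \<longleftrightarrow> (\<forall>h. path_law P (\<lambda>t. X (t + h)) = path_law P X)"

definition ergodic_process :: "'w measure \<Rightarrow> (int \<Rightarrow> 'w \<Rightarrow> real) \<Rightarrow> bool" where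
  "ergodic_process P X \<longleftrightarrow>
     (\<forall>A \<in> sets (\<Pi>\<^sub>M t\<in>(UNIV :: int set). (borel :: real measure)).
        (\<lambda>x t. x (t + 1)) -` A = A \<longrightarrow>
        measure (path_law P X) A = 0 \<or> measure (path_law P X) A = 1)"

section \<open>Infinitely divisible random measures and their integrals\<close>

abbreviation borel_subsets_I :: "real set set" where
  "borel_subsets_I \<equiv> {A \<in> sets borel. A \<subseteq> {-1<..<1}}"

text \<open>\<open>V\<close> is the log-characteristic function of the law of \<open>W\<close>, \<open>\<Phi>\<close> the control measure.\<close>

definition ID_random_measure ::
    "'w measure \<Rightarrow> (real set \<Rightarrow> 'w \<Rightarrow> real) \<Rightarrow> (real \<Rightarrow> complex) \<Rightarrow> real measure \<Rightarrow> bool" where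
  "ID_random_measure P M V \<Phi> \<longleftrightarrow>
     (\<forall>A\<in>borel_subsets_I. M A \<in> borel_measurable P) \<and>
     (\<forall>A :: nat \<Rightarrow> real set. range A \<subseteq> borel_subsets_I \<and> disjoint_family A \<longrightarrow>
        prob_space.indep_vars P (\<lambda>_. borel) (\<lambda>n. M (A n)) UNIV \<and>
        (AE \<omega> in P. (\<lambda>n. M (A n) \<omega>) sums M (\<Union>n. A n) \<omega>)) \<and>
     (\<forall>A\<in>borel_subsets_I. \<forall>\<theta>.
        char (distr P borel (M A)) \<theta> = exp (complex_of_real (measure \<Phi> A) * V \<theta>))"

text \<open>Independence and equality in law of the \<open>M s\<close> as set-indexed processes.\<close>

definition iid_random_measures :: "'w measure \<Rightarrow> (int \<Rightarrow> real set \<Rightarrow> 'w \<Rightarrow> real) \<Rightarrow> bool" where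
  "iid_random_measures P M \<longleftrightarrow>
     prob_space.indep_vars P (\<lambda>_. \<Pi>\<^sub>M A\<in>borel_subsets_I. borel)
       (\<lambda>s \<omega>. \<lambda>A\<in>borel_subsets_I. M s A \<omega>) UNIV \<and>
     (\<forall>s s'. distr P (\<Pi>\<^sub>M A\<in>borel_subsets_I. borel) (\<lambda>\<omega>. \<lambda>A\<in>borel_subsets_I. M s A \<omega>) =
             distr P (\<Pi>\<^sub>M A\<in>borel_subsets_I. borel) (\<lambda>\<omega>. \<lambda>A\<in>borel_subsets_I. M s' A \<omega>))"

definition simple_random_integral ::
    "(real set \<Rightarrow> 'w \<Rightarrow> real) \<Rightarrow> real set \<Rightarrow> (real \<Rightarrow> real) \<Rightarrow> 'w \<Rightarrow> real" where
  "simple_random_integral M A f \<omega> =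
     (\<Sum>y\<in>f ` {-1<..<1}. y * M {x \<in> A \<inter> {-1<..<1}. f x = y} \<omega>)"

text \<open>\<open>I\<close> is (a version of) the integral of \<open>g\<close> over \<open>(-1,1)\<close>: there are simple functions
  converging to \<open>g\<close> almost everywhere for the control measure whose integrals over every Borel set
  converge in probability, those over \<open>(-1,1)\<close> with limit \<open>I\<close>. Requiring convergence over every Borel
  set makes the limit independent of the approximating sequence (up to null sets).\<close>

definition has_random_integral ::
    "'w measure \<Rightarrow> (real set \<Rightarrow> 'w \<Rightarrow> real) \<Rightarrow> real measure \<Rightarrow> (real \<Rightarrow> real) \<Rightarrow> ('w \<Rightarrow> real) \<Rightarrow> bool"
  where
  "has_random_integral P M \<Phi> g I \<longleftrightarrow>
     I \<in> borel_measurable P \<and>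
     (\<exists>f :: nat \<Rightarrow> real \<Rightarrow> real.
        (\<forall>n. simple_function (restrict_space borel {-1<..<1}) (f n)) \<and>
        (AE x in \<Phi>. (\<lambda>n. f n x) \<longlonglongrightarrow> g x) \<and>
        (\<forall>A\<in>borel_subsets_I. \<exists>L\<in>borel_measurable P.
           tendsto_in_prob P (\<lambda>n. simple_random_integral M A (f n)) L) \<and>
        tendsto_in_prob P (\<lambda>n. simple_random_integral M {-1<..<1} (f n)) I)"

end

theory Submission
  imports Defs
begin

text \<open>Let \<open>\<phi>\<^sub>N\<close> be the characteristic function of \<open>\<epsilon>\<^sup>(\<^sup>N\<^sup>)\<close> and \<open>V\<close> that of \<open>W\<close>, on the logarithmic scale.
  Membership in the class \<open>T(\<alpha>)\<close> gives \<open>N \<bar>\<phi>\<^sub>N(\<theta>) - 1\<bar> \<le> K \<bar>\<theta>\<bar>\<^sup>\<alpha>\<close>; together with attraction to \<open>W\<close> this yields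
  \<open>N (\<phi>\<^sub>N(\<theta>) - 1) \<longrightarrow> V(\<theta>)\<close>, the bound \<open>\<bar>V(\<theta>)\<bar> \<le> K \<bar>\<theta>\<bar>\<^sup>\<alpha>\<close>, and the infinite divisibility of \<open>W\<close> in the
  form that \<open>exp (c V)\<close> is a characteristic function for all \<open>c \<ge> 0\<close>.

  A linear combination \<open>\<Sum>\<theta>\<^sub>t X\<^sup>(\<^sup>N\<^sup>)(t)\<close> equals \<open>\<Sum>\<^sub>j h\<^sub>j(a) \<epsilon>\<^sup>(\<^sup>N\<^sup>)(m - j)\<close> with \<open>h\<^sub>j\<close> decaying geometrically, so its
  characteristic function is \<open>E \<Prod>\<^sub>j \<phi>\<^sub>N(h\<^sub>j(a))\<close>. Since \<open>\<Sum>\<^sub>j E \<bar>h\<^sub>j(a)\<bar>\<^sup>\<alpha>\<close> is finite by the moment condition on \<open>a\<close>,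
  dominated convergence turns \<open>N (E \<Prod>\<^sub>j \<phi>\<^sub>N(h\<^sub>j(a)) - 1)\<close> into \<open>\<Sum>\<^sub>j E V(h\<^sub>j(a))\<close> in the limit, and the \<open>N\<close>-th power
  of the characteristic function converges to the exponential of that sum.

  The random measure comes from Kolmogorov's extension theorem applied to the coordinates \<open>M(A)\<close>, \<open>A\<close>
  Borel; the consistent finite-dimensional laws come from products over atoms. On the two-sided
  product of copies of this space the series defining the limit has the exponent just found, and it is a factor
  of the shift of an i.i.d. sequence, hence stationary and mixing.\<close>

section \<open>Weak convergence of finite-dimensional laws\<close>

text \<open>Two obstacles shape the argument. Attraction to \<open>W\<close> determines the exponent
  only through \<open>exp\<close>, so passing from the limit of the N-th powers to the limit of N
  (char - 1) needs the right branch of the logarithm. The bound of order |theta|^alpha makes the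
  powers equicontinuous, their convergence is then uniform on compact intervals, and continuity
  together with the value 0 at 0 fixes the branch. Secondly, the moment condition makes 1 / (1 -
  |a|^alpha), the sum of all |a|^(k alpha), integrable but not necessarily square integrable, so a
  second-order remainder cannot be integrated by itself and is combined with a first-order bound.
  One inequality carries the estimates: a characteristic function within K |theta|^alpha of 1 forces
  tails of order x^(-alpha). Tightness, convergence of the stochastic integrals and of the series
  that defines the limit, sigma-additivity, and almost sure convergence of the autoregressive series
  all use it.\<close>

instance "fun" :: (type, t0_space) t0_space
proof
  fix f g :: "'a \<Rightarrow> 'b"
  assume "f \<noteq> g"
  then obtain i where "f i \<noteq> g i" by auto
  then obtain U where "open U" "(f i \<in> U) \<noteq> (g i \<in> U)"
    using separation_t0[of "f i" "g i"] by auto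
  moreover have "open ((\<lambda>x :: 'a \<Rightarrow> 'b. x i) -` U)"
    by (intro open_vimage[OF \<open>open U\<close>] continuous_on_product_coordinates)
  ultimately show "\<exists>U. open U \<and> \<not> (f \<in> U \<longleftrightarrow> g \<in> U)"
    by (intro exI[of _ "(\<lambda>x. x i) -` U"]) auto
qed

instance "fun" :: (type, t1_space) t1_space
proof
  fix f g :: "'a \<Rightarrow> 'b"
  assume "f \<noteq> g"
  then obtain i where "f i \<noteq> g i" by auto
  then obtain U where "open U" "f i \<in> U" "g i \<notin> U"
    using separation_t1[of "f i" "g i"] by auto
  moreover have "open ((\<lambda>x :: 'a \<Rightarrow> 'b. x i) -` U)"
    by (intro open_vimage[OF \<open>open U\<close>] continuous_on_product_coordinates)
  ultimately show "\<exists>U. open U \<and> f \<in> U \<and> g \<notin> U"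
    by (intro exI[of _ "(\<lambda>x. x i) -` U"]) auto
qed

text \<open>\<open>function_ring_on\<close>, the setting of the Stone-Weierstrass theorem, asks for
  a Hausdorff type. Real vectors indexed by \<open>F\<close> are functions here, so the function
  type needs its separation classes, each inherited from one distinguishing coordinate.\<close>

instance "fun" :: (type, t2_space) t2_space
proof
  fix f g :: "'a \<Rightarrow> 'b"
  assume "f \<noteq> g"
  then obtain i where "f i \<noteq> g i" by auto
  then obtain U V where UV: "open U" "open V" "f i \<in> U" "g i \<in> V" "U \<inter> V = {}"
    using separation_t2[of "f i" "g i"] by auto
  moreover have "open ((\<lambda>x :: 'a \<Rightarrow> 'b. x i) -` U)" "open ((\<lambda>x :: 'a \<Rightarrow> 'b. x i) -` V)"
    by (intro open_vimage[OF \<open>open U\<close>] open_vimage[OF \<open>open V\<close>] continuous_on_product_coordinates)+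
  ultimately show "\<exists>U V. open U \<and> open V \<and> f \<in> U \<and> g \<in> V \<and> U \<inter> V = {}"
    by (intro exI[of _ "(\<lambda>x. x i) -` U"] exI[of _ "(\<lambda>x. x i) -` V"]) auto
qed

section \<open>Trigonometric polynomials and Stone-Weierstrass approximation on boxes\<close>

definition vchar :: "'i set \<Rightarrow> ('i \<Rightarrow> real) measure \<Rightarrow> ('i \<Rightarrow> real) \<Rightarrow> complex" where
  "vchar F L \<theta> = (CLINT x|L. iexp (\<Sum>i\<in>F. \<theta> i * x i))"

text \<open>The phase \<open>b\<close> lets one base case cover sines, cosines and, with frequency
  0, constants. Only sums have to be built in: closure under products follows from the
  product-to-sum formula for cosines.\<close>

inductive_set trig :: "'i set \<Rightarrow> (('i \<Rightarrow> real) \<Rightarrow> real) set" for F where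
  base: "(\<lambda>x. c * cos ((\<Sum>i\<in>F. \<theta> i * x i) + b)) \<in> trig F"
| add: "f \<in> trig F \<Longrightarrow> g \<in> trig F \<Longrightarrow> (\<lambda>x. f x + g x) \<in> trig F"

lemma trig_const: "(\<lambda>x. c) \<in> trig F"
  using trig.base[of c "\<lambda>_. 0" F 0] by simp

lemma trig_mult:
  assumes "f \<in> trig F" "g \<in> trig F"
  shows "(\<lambda>x. f x * g x) \<in> trig F"
  using assms
proof (induction f rule: trig.induct)
  case (base c \<theta> b)
  from base show ?case
  proof (induction g rule: trig.induct)
    case (base d \<eta> b')
    have "(\<lambda>x. (c * d / 2) * cos ((\<Sum>i\<in>F. (\<theta> i + \<eta> i) * x i) + (b + b')) +
               (c * d / 2) * cos ((\<Sum>i\<in>F. (\<theta> i - \<eta> i) * x i) + (b - b'))) \<in> trig F"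
      by (intro trig.intros)
    also have "(\<lambda>x. (c * d / 2) * cos ((\<Sum>i\<in>F. (\<theta> i + \<eta> i) * x i) + (b + b')) +
                    (c * d / 2) * cos ((\<Sum>i\<in>F. (\<theta> i - \<eta> i) * x i) + (b - b'))) =
        (\<lambda>x. c * cos ((\<Sum>i\<in>F. \<theta> i * x i) + b) * (d * cos ((\<Sum>i\<in>F. \<eta> i * x i) + b')))"
    proof
      fix x
      define u v where "u = (\<Sum>i\<in>F. \<theta> i * x i) + b" and "v = (\<Sum>i\<in>F. \<eta> i * x i) + b'"
      have A: "(\<Sum>i\<in>F. (\<theta> i + \<eta> i) * x i) + (b + b') = u + v"
        by (simp add: u_def v_def sum.distrib algebra_simps)
      have B: "(\<Sum>i\<in>F. (\<theta> i - \<eta> i) * x i) + (b - b') = u - v"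
        by (simp add: u_def v_def sum_subtractf algebra_simps)
      show "(c * d / 2) * cos ((\<Sum>i\<in>F. (\<theta> i + \<eta> i) * x i) + (b + b')) +
          (c * d / 2) * cos ((\<Sum>i\<in>F. (\<theta> i - \<eta> i) * x i) + (b - b')) =
          c * cos ((\<Sum>i\<in>F. \<theta> i * x i) + b) * (d * cos ((\<Sum>i\<in>F. \<eta> i * x i) + b'))"
        unfolding A B u_def[symmetric] v_def[symmetric] cos_add cos_diff by (simp add: field_simps)
    qed
    finally show ?case .
  next
    case (add g h)
    thus ?case by (auto simp: distrib_left intro: trig.add)
  qed
next
  case (add f h)
  thus ?case by (auto simp: distrib_right intro: trig.add)
qed

lemma trig_continuous: "f \<in> trig F \<Longrightarrow> continuous_on S f"
  by (induction rule: trig.induct)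
     (auto intro!: continuous_intros continuous_on_product_then_coordinatewise[OF continuous_on_id])

lemma trig_measurable:
  assumes "f \<in> trig F"
  shows "f \<in> borel_measurable (PiM F (\<lambda>_. borel))"
  using assms by (induction rule: trig.induct) auto

lemma trig_bounded:
  assumes "f \<in> trig F"
  obtains B where "\<And>x. \<bar>f x\<bar> \<le> B" "0 \<le> B"
proof -
  have "\<exists>B\<ge>0. \<forall>x. \<bar>f x\<bar> \<le> B"
    using assms
  proof (induction rule: trig.induct)
    case (base c \<theta> b)
    show ?case
      by (intro exI[of _ "\<bar>c\<bar>"]) (auto simp: abs_mult intro: mult_left_le)
  next
    case (add f g)
    then obtain B C where "0 \<le> B" "0 \<le> C" "\<And>x. \<bar>f x\<bar> \<le> B" "\<And>x. \<bar>g x\<bar> \<le> C" by blast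
    thus ?case
      by (intro exI[of _ "B + C"]) (auto intro: order_trans[OF abs_triangle_ineq] add_mono)
  qed
  thus ?thesis using that by blast
qed

lemma trig_polynomial_comp:
  fixes q :: "real \<Rightarrow> real"
  assumes "real_polynomial_function q" "f \<in> trig F"
  shows "(\<lambda>x. q (f x)) \<in> trig F"
  using assms(1)
proof (induction q rule: real_polynomial_function.induct)
  case (linear q)
  have q: "q y = y * q 1" for y
    using linear_scale[OF bounded_linear.linear[OF linear], of y 1] by simp
  have "(\<lambda>x. q (f x)) = (\<lambda>x. f x * q 1)" by (intro ext q)
  thus ?case using trig_mult[OF assms(2) trig_const[of "q 1"]] by (simp only:)
qed (auto intro: trig_const trig.add trig_mult)

text \<open>Stone-Weierstrass on a compact box. Points are separated by a sine of frequency
  \<open>1 / K\<close>, which maps each coordinate of the box into [-1,1], where the sine is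
  injective.\<close>

lemma trig_approx:
  fixes g :: "('i \<Rightarrow> real) \<Rightarrow> real"
  assumes F: "finite F" and K: "0 < K"
    and g: "continuous_map (product_topology (\<lambda>_. euclideanreal) F) euclideanreal g"
    and e: "0 < e"
  shows "\<exists>p\<in>trig F. \<forall>x\<in>F \<rightarrow>\<^sub>E {-K..K}. \<bar>g x - p x\<bar> < e"
proof -
  \<comment> \<open>The box as a subset of the whole function type: coordinates outside
    \<open>F\<close> are pinned to \<open>undefined\<close>, so it is a product of compact sets over
    all indices.\<close>
  define S :: "('i \<Rightarrow> real) set" where "S = (\<Pi>\<^sub>E i\<in>UNIV. if i \<in> F then {-K..K} else {undefined})"
  have S_eq: "S = (F \<rightarrow>\<^sub>E {-K..K})"
    by (auto simp: S_def PiE_iff extensional_def split: if_splits)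
  interpret function_ring_on "trig F" S
  proof
    have "compactin (product_topology (\<lambda>_. euclidean) UNIV) S"
      unfolding S_def by (subst compactin_PiE) auto
    thus "compact S"
      by (simp add: euclidean_product_topology)
  next
    fix x y assume "x \<in> S" "y \<in> S" "x \<noteq> y"
    then obtain i where i: "i \<in> F" "x i \<noteq> y i" "\<bar>x i\<bar> \<le> K" "\<bar>y i\<bar> \<le> K"
      unfolding S_eq by (metis PiE_ext PiE_mem abs_le_iff atLeastAtMost_iff minus_le_iff)
    define f :: "('i \<Rightarrow> real) \<Rightarrow> real" where
      "f = (\<lambda>x. 1 * cos ((\<Sum>j\<in>F. (if j = i then 1 / K else 0) * x j) + pi / 2))"
    have f: "f z = - sin (z i / K)" for z
    proof -
      have "(\<Sum>j\<in>F. (if j = i then 1 / K else 0) * z j) = (\<Sum>j\<in>F. if j = i then z i / K else 0)"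
        by (intro sum.cong) auto
      also have "\<dots> = z i / K" using i F by simp
      finally show ?thesis by (simp add: f_def cos_add)
    qed
    have "\<bar>x i / K\<bar> \<le> 1" "\<bar>y i / K\<bar> \<le> 1" using i K by (auto simp: field_simps abs_le_iff)
    moreover have "- (pi / 2) \<le> u \<and> u \<le> pi / 2" if "\<bar>u\<bar> \<le> 1" for u
      using that pi_ge_two by linarith
    moreover have "x i / K \<noteq> y i / K" using i K by simp
    ultimately have "sin (x i / K) \<noteq> sin (y i / K)"
      using sin_inj_pi[of "x i / K" "y i / K"] by blast
    hence "f x \<noteq> f y" by (simp add: f)
    moreover have "f \<in> trig F" unfolding f_def by (rule trig.base)
    ultimately show "\<exists>f\<in>trig F. f x \<noteq> f y" by blast
  qed (auto intro: trig_continuous trig.add trig_mult trig_const)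
  \<comment> \<open>\<open>g\<close> is only known to be continuous for the topology of the product
    over \<open>F\<close>. Composition with the restriction is continuous on the whole type and
    agrees with \<open>g\<close> on the box.\<close>
  have "continuous_map euclidean (product_topology (\<lambda>_. euclideanreal) F) (\<lambda>x. restrict x F)"
    by (auto simp: continuous_map_componentwise)
  from continuous_map_compose[OF this g] have "continuous_on UNIV (\<lambda>x. g (restrict x F))"
    by (simp add: o_def)
  hence "continuous_on S (\<lambda>x. g (restrict x F))"
    by (rule continuous_on_subset) auto
  from Stone_Weierstrass_basic[OF this e] obtain p where
    p: "p \<in> trig F" "\<And>x. x \<in> S \<Longrightarrow> \<bar>g (restrict x F) - p x\<bar> < e" by blast
  have "\<bar>g x - p x\<bar> < e" if "x \<in> F \<rightarrow>\<^sub>E {-K..K}" for x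
    using p(2)[of x] that by (auto simp: S_eq PiE_restrict)
  thus ?thesis using p(1) by blast
qed

text \<open>Composing a trigonometric polynomial with a polynomial approximation of the truncation at
  height \<open>B\<close> bounds it globally without leaving the algebra.\<close>

lemma trig_approx_bounded:
  fixes g :: "('i \<Rightarrow> real) \<Rightarrow> real"
  assumes F: "finite F" and K: "0 < K"
    and g: "continuous_map (product_topology (\<lambda>_. euclideanreal) F) euclideanreal g"
    and B: "\<And>x. x \<in> F \<rightarrow>\<^sub>E UNIV \<Longrightarrow> \<bar>g x\<bar> \<le> B"
    and e: "0 < e"
  shows "\<exists>p\<in>trig F. (\<forall>x\<in>F \<rightarrow>\<^sub>E {-K..K}. \<bar>g x - p x\<bar> < e) \<and> (\<forall>x. \<bar>p x\<bar> \<le> B + e)"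
proof -
  obtain p where p: "p \<in> trig F" "\<And>x. x \<in> F \<rightarrow>\<^sub>E {-K..K} \<Longrightarrow> \<bar>g x - p x\<bar> < e / 2"
    using trig_approx[OF F K g, of "e / 2"] e by auto
  obtain M where M: "\<And>x. \<bar>p x\<bar> \<le> M" using trig_bounded[OF p(1)] by auto
  have "0 \<le> B" using B[of "\<lambda>i\<in>F. 0"] by (auto intro: order_trans[OF abs_ge_zero])
  define \<psi> :: "real \<Rightarrow> real" where "\<psi> = (\<lambda>y. max (-B) (min B y))"
  have "continuous_on {-M..M} \<psi>"
    unfolding \<psi>_def by (intro continuous_intros)
  then obtain q where q: "real_polynomial_function q" "\<And>y. y \<in> {-M..M} \<Longrightarrow> \<bar>\<psi> y - q y\<bar> < e / 2"
    using Stone_Weierstrass_real_polynomial_function[of "{-M..M}" \<psi> "e / 2"] e by auto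
  have pq: "\<bar>\<psi> (p x) - q (p x)\<bar> < e / 2" for x
    using q(2)[of "p x"] M[of x] by (auto simp: abs_le_iff)
  show ?thesis
  proof (intro bexI conjI ballI allI)
    show "(\<lambda>x. q (p x)) \<in> trig F" by (rule trig_polynomial_comp[OF q(1) p(1)])
  next
    fix x assume x: "x \<in> F \<rightarrow>\<^sub>E {-K..K}"
    hence "\<bar>g x\<bar> \<le> B" using PiE_mono[of F "\<lambda>_. {-K..K}" "\<lambda>_. UNIV"] by (intro B) auto
    hence "\<bar>g x - \<psi> (p x)\<bar> \<le> \<bar>g x - p x\<bar>"
      by (auto simp: \<psi>_def)
    thus "\<bar>g x - q (p x)\<bar> < e" using p(2)[OF x] pq[of x] by linarith
  next
    fix x
    have "\<bar>\<psi> (p x)\<bar> \<le> B" using \<open>0 \<le> B\<close> by (auto simp: \<psi>_def)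
    thus "\<bar>q (p x)\<bar> \<le> B + e" using pq[of x] e by linarith
  qed
qed

lemma PiE_symmetric_box:
  fixes x :: "'i \<Rightarrow> real"
  assumes "x \<in> F \<rightarrow>\<^sub>E UNIV" "\<And>i. i \<in> F \<Longrightarrow> \<bar>x i\<bar> \<le> K"
  shows "x \<in> F \<rightarrow>\<^sub>E {-K..K}"
proof -
  have "x i \<in> {-K..K}" if "i \<in> F" for i
    using assms(2)[OF that] unfolding atLeastAtMost_iff by linarith
  thus ?thesis using assms(1) by (simp add: PiE_iff)
qed

text \<open>\<open>g\<close> is the pointwise limit of trigonometric polynomials accurate to
  \<open>1 / Suc n\<close> on boxes of half-width \<open>Suc n\<close>. This links the product
  topology, where \<open>g\<close> is continuous, to the product sigma-algebra, where trigonometric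
  polynomials are measurable.\<close>

lemma continuous_map_PiM_measurable:
  fixes g :: "('i \<Rightarrow> real) \<Rightarrow> real"
  assumes F: "finite F"
    and g: "continuous_map (product_topology (\<lambda>_. euclideanreal) F) euclideanreal g"
  shows "g \<in> borel_measurable (PiM F (\<lambda>_. borel))"
proof -
  have "\<exists>p\<in>trig F. \<forall>x\<in>F \<rightarrow>\<^sub>E {-real (Suc n)..real (Suc n)}. \<bar>g x - p x\<bar> < 1 / real (Suc n)" for n
    by (intro trig_approx[OF F _ g]) auto
  then obtain p where p: "\<And>n. p n \<in> trig F"
    "\<And>n x. x \<in> F \<rightarrow>\<^sub>E {-real (Suc n)..real (Suc n)} \<Longrightarrow> \<bar>g x - p n x\<bar> < 1 / real (Suc n)"
    by metis
  show ?thesis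
  proof (rule borel_measurable_LIMSEQ_metric[where f = p])
    fix x :: "'i \<Rightarrow> real" assume "x \<in> space (PiM F (\<lambda>_. borel))"
    hence x: "x \<in> F \<rightarrow>\<^sub>E UNIV" by (simp add: space_PiM)
    obtain m :: nat where m: "(\<Sum>i\<in>F. \<bar>x i\<bar>) \<le> real m" using real_arch_simple by blast
    have xi: "\<bar>x i\<bar> \<le> real m" if "i \<in> F" for i
      using m member_le_sum[OF that, of "\<lambda>i. \<bar>x i\<bar>"] F by auto
    have "\<bar>g x - p n x\<bar> < 1 / real (Suc n)" if "m \<le> n" for n
    proof (rule p(2))
      have "\<bar>x i\<bar> \<le> real (Suc n)" if "i \<in> F" for i
        using xi[OF that] \<open>m \<le> n\<close> by simp
      thus "x \<in> F \<rightarrow>\<^sub>E {-real (Suc n)..real (Suc n)}"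
        by (intro PiE_symmetric_box x)
    qed
    hence ev: "eventually (\<lambda>n. norm (p n x - g x) \<le> 1 / real (Suc n)) sequentially"
      unfolding eventually_sequentially by (intro exI[of _ m]) (auto simp: abs_minus_commute less_imp_le)
    have "(\<lambda>n. p n x - g x) \<longlonglongrightarrow> 0"
      by (rule Lim_null_comparison[OF ev]) (use LIMSEQ_Suc[OF lim_inverse_n'] in \<open>simp add: inverse_eq_divide\<close>)
    thus "(\<lambda>n. p n x) \<longlonglongrightarrow> g x" by (simp add: LIM_zero_iff)
  qed (use p(1) trig_measurable in auto)
qed

lemma norm_integral_le:
  fixes f :: "'a \<Rightarrow> 'b::{banach,second_countable_topology}"
  assumes "integrable M f" "integrable M g" "\<And>x. x \<in> space M \<Longrightarrow> norm (f x) \<le> g x"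
  shows "norm (\<integral>x. f x \<partial>M) \<le> (\<integral>x. g x \<partial>M)"
  using assms by (intro order_trans[OF integral_norm_bound] integral_mono) auto

text \<open>A shifted cosine is the real part of a rotated exponential, so its mean can be read off
  the characteristic function.\<close>

lemma (in prob_space) iexp_expectation_add:
  assumes "f \<in> borel_measurable M"
  shows "(LINT x|M. c * cos (f x + b)) = c * Re (iexp b * (CLINT x|M. iexp (f x)))"
proof -
  have "(LINT x|M. c * cos (f x + b)) = (LINT x|M. Re (complex_of_real c * (iexp b * iexp (f x))))"
    by (intro Bochner_Integration.integral_cong refl) (simp add: cos_add Re_exp Im_exp mult.commute)
  also have "\<dots> = Re (CLINT x|M. complex_of_real c * (iexp b * iexp (f x)))"
    using assms by (intro integral_Re integrable_mult_right integrable_iexp) auto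
  also have "\<dots> = c * Re (iexp b * (CLINT x|M. iexp (f x)))"
    by simp
  finally show ?thesis .
qed

lemma trig_expectation_tendsto:
  fixes L :: "('i \<Rightarrow> real) measure"
  assumes Ls: "\<And>n. prob_space (Ls n)" "\<And>n. sets (Ls n) = sets (PiM F (\<lambda>_. borel))"
    and L: "prob_space L" "sets L = sets (PiM F (\<lambda>_. borel))"
    and conv: "\<And>\<theta>. (\<lambda>n. vchar F (Ls n) \<theta>) \<longlonglongrightarrow> vchar F L \<theta>"
    and p: "p \<in> trig F"
  shows "(\<lambda>n. LINT x|Ls n. p x) \<longlonglongrightarrow> (LINT x|L. p x)"
  using p
proof (induction p rule: trig.induct)
  case (base c \<theta> b)
  have [measurable]: "(\<lambda>x. \<Sum>i\<in>F. \<theta> i * x i) \<in> borel_measurable (Ls n)"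
    "(\<lambda>x. \<Sum>i\<in>F. \<theta> i * x i) \<in> borel_measurable L" for n
    by (simp_all add: measurable_cong_sets[OF Ls(2) refl] measurable_cong_sets[OF L(2) refl])
  show ?case
    unfolding prob_space.iexp_expectation_add[OF Ls(1) \<open>\<And>n. _ \<in> borel_measurable (Ls n)\<close>]
      prob_space.iexp_expectation_add[OF L(1) \<open>_ \<in> borel_measurable L\<close>]
    by (intro tendsto_intros conv[unfolded vchar_def])
next
  case (add f g)
  have int: "integrable M h" if h: "h \<in> trig F" "prob_space M" "sets M = sets (PiM F (\<lambda>_. borel))"
    for h :: "('i \<Rightarrow> real) \<Rightarrow> real" and M
  proof -
    obtain B where "\<And>x. \<bar>h x\<bar> \<le> B" using trig_bounded[OF h(1)] by blast
    moreover have "h \<in> borel_measurable M"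
      using trig_measurable[OF h(1)] by (simp add: measurable_cong_sets[OF h(3) refl])
    ultimately show ?thesis
      using h(2) by (intro finite_measure.integrable_const_bound[where B = B]) (auto simp: prob_space_def)
  qed
  show ?case
    using add Ls L by (subst (1 2) Bochner_Integration.integral_add) (auto intro!: int tendsto_add)
qed

section \<open>Tightness and the continuity theorem in finite dimension\<close>

lemma tight_PiM:
  fixes L :: "('i \<Rightarrow> real) measure"
  assumes F: "finite F" and L: "prob_space L" "sets L = sets (PiM F (\<lambda>_. borel))" and e: "0 < e"
  shows "\<exists>K>0. measure L {x \<in> space L. \<exists>i\<in>F. K < \<bar>x i\<bar>} \<le> e"
proof -
  interpret prob_space L by fact
  have [measurable]: "(\<lambda>x. x i) \<in> borel_measurable L" if "i \<in> F" for i
    using that by (simp add: measurable_cong_sets[OF L(2) refl])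
  define A where "A n = {x \<in> space L. \<exists>i\<in>F. real (Suc n) < \<bar>x i\<bar>}" for n
  have meas: "A n \<in> sets L" for n
    unfolding A_def using F by measurable
  have dec: "decseq A"
  proof (intro decseq_SucI subsetI)
    fix n x assume "x \<in> A (Suc n)"
    then obtain i where i: "x \<in> space L" "i \<in> F" "real (Suc (Suc n)) < \<bar>x i\<bar>" by (auto simp: A_def)
    have "real (Suc n) < \<bar>x i\<bar>" using i(3) by linarith
    thus "x \<in> A n" unfolding A_def using i(1,2) by blast
  qed
  have "(\<Inter>n. A n) = {}"
  proof (intro equals0I)
    fix x assume x: "x \<in> (\<Inter>n. A n)"
    obtain m :: nat where m: "(\<Sum>i\<in>F. \<bar>x i\<bar>) \<le> real m" using real_arch_simple by blast
    from x have "x \<in> A m" by blast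
    then obtain i where "i \<in> F" "real (Suc m) < \<bar>x i\<bar>" by (auto simp: A_def)
    moreover from this have "\<bar>x i\<bar> \<le> (\<Sum>i\<in>F. \<bar>x i\<bar>)"
      using F by (intro member_le_sum) auto
    ultimately show False using m by simp
  qed
  moreover have "(\<lambda>n. measure L (A n)) \<longlonglongrightarrow> measure L (\<Inter>n. A n)"
    using meas dec by (intro finite_Lim_measure_decseq) auto
  ultimately have "(\<lambda>n. measure L (A n)) \<longlonglongrightarrow> 0" by simp
  from order_tendstoD(2)[OF this e] obtain n where "measure L (A n) < e"
    using eventually_sequentially by auto
  thus ?thesis unfolding A_def by (intro exI[of _ "real (Suc n)"]) auto
qed

text \<open>The continuity theorem with tightness as a hypothesis. \<open>g\<close> is replaced by a
  trigonometric polynomial that is close to it on a box carrying nearly all the mass and bounded by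
  \<open>B + e\<close> everywhere; the global bound makes the error off the box independent of the
  size of the box.\<close>

lemma vchar_tendsto_imp_weak_conv:
  fixes L :: "('i \<Rightarrow> real) measure" and g :: "('i \<Rightarrow> real) \<Rightarrow> real"
  assumes F: "finite F"
    and Ls: "\<And>n. prob_space (Ls n)" "\<And>n. sets (Ls n) = sets (PiM F (\<lambda>_. borel))"
    and L: "prob_space L" "sets L = sets (PiM F (\<lambda>_. borel))"
    and conv: "\<And>\<theta>. (\<lambda>n. vchar F (Ls n) \<theta>) \<longlonglongrightarrow> vchar F L \<theta>"
    and tight: "\<And>e. 0 < e \<Longrightarrow> \<exists>K>0. \<forall>n. measure (Ls n) {x \<in> space (Ls n). \<exists>i\<in>F. K < \<bar>x i\<bar>} \<le> e"
    and g: "continuous_map (product_topology (\<lambda>_. euclideanreal) F) euclideanreal g"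
    and B: "bounded (g ` (F \<rightarrow>\<^sub>E UNIV))"
  shows "(\<lambda>n. LINT x|Ls n. g x) \<longlonglongrightarrow> (LINT x|L. g x)"
proof -
  obtain B where B: "\<And>x. x \<in> F \<rightarrow>\<^sub>E UNIV \<Longrightarrow> \<bar>g x\<bar> \<le> B"
    using assms(9) unfolding bounded_iff by auto
  have "0 \<le> B" using B[of "\<lambda>i\<in>F. 0"] by (auto intro: order_trans[OF abs_ge_zero])
  \<comment> \<open>Off the box the two functions differ by at most B + (B + e), and e will be at
    most 1.\<close>
  define D where "D = 2 * B + 1"
  have D: "0 < D" using \<open>0 \<le> B\<close> by (simp add: D_def)
  have approx: "\<bar>(LINT x|M. g x) - (LINT x|M. p x)\<bar> \<le> e + D * d"
    if M: "prob_space M" "sets M = sets (PiM F (\<lambda>_. borel))"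
      and p: "p \<in> trig F" "\<And>x. x \<in> F \<rightarrow>\<^sub>E {-K..K} \<Longrightarrow> \<bar>g x - p x\<bar> < e" "\<And>x. \<bar>p x\<bar> \<le> B + e"
      and e: "0 < e" "e \<le> 1"
      and d: "measure M {x \<in> space M. \<exists>i\<in>F. K < \<bar>x i\<bar>} \<le> d" for M p K e d
  proof -
    interpret M: prob_space M by fact
    have sp: "space M = F \<rightarrow>\<^sub>E UNIV" using sets_eq_imp_space_eq[OF M(2)] by (simp add: space_PiM)
    have [measurable]: "g \<in> borel_measurable M" "p \<in> borel_measurable M"
      using continuous_map_PiM_measurable[OF F g] trig_measurable[OF p(1)]
      by (simp_all add: measurable_cong_sets[OF M(2) refl])
    have [measurable]: "(\<lambda>x. x i) \<in> borel_measurable M" if "i \<in> F" for i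
      using that by (simp add: measurable_cong_sets[OF M(2) refl])
    define Z where "Z = {x \<in> space M. \<exists>i\<in>F. K < \<bar>x i\<bar>}"
    have Z[measurable]: "Z \<in> sets M" unfolding Z_def using F by measurable
    have ig: "integrable M g" by (intro M.integrable_const_bound[where B = B]) (auto simp: sp B)
    have ip: "integrable M p" by (intro M.integrable_const_bound[where B = "B + e"]) (auto simp: p(3))
    have "norm (LINT x|M. g x - p x) \<le> (LINT x|M. e + D * indicator Z x)"
    proof (rule norm_integral_le)
      fix x assume x: "x \<in> space M"
      show "norm (g x - p x) \<le> e + D * indicator Z x"
      proof (cases "x \<in> Z")
        case True
        have "\<bar>g x - p x\<bar> \<le> B + (B + e)"
          using B[of x] p(3)[of x] x by (auto simp: sp)
        thus ?thesis using True e by (simp add: D_def)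
      next
        case False
        hence "x \<in> F \<rightarrow>\<^sub>E {-K..K}" using x by (intro PiE_symmetric_box) (auto simp: Z_def sp not_less)
        thus ?thesis using p(2)[of x] False by simp
      qed
    qed (use ig ip D e in \<open>auto intro!: M.integrable_const_bound[where B = "e + D"] split: split_indicator\<close>)
    also have "\<dots> = e + D * measure M Z"
      using M.prob_space by (subst Bochner_Integration.integral_add) (auto intro!: integrable_mult_right simp: M.emeasure_eq_measure)
    also have "\<dots> \<le> e + D * d" using d D by (auto simp: Z_def)
    also have "(LINT x|M. g x - p x) = (LINT x|M. g x) - (LINT x|M. p x)"
      using ig ip by simp
    finally show ?thesis by simp
  qed
  show ?thesis
  proof (rule LIMSEQ_I)
    fix r :: real assume r: "0 < r"
    \<comment> \<open>Each replacement of \<open>g\<close> by the polynomial costs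
      \<open>e + D * d\<close>, at most r / 4; with the comparison of the polynomial means, below r
      / 4, the total stays below r.\<close>
    define e where "e = min 1 (r / 8)"
    define d where "d = r / (8 * D)"
    have e: "0 < e" "e \<le> 1" "e \<le> r / 8" using r by (auto simp: e_def)
    have d: "0 < d" "D * d = r / 8" using r D by (auto simp: d_def)
    obtain K1 where K1: "0 < K1" "\<And>n. measure (Ls n) {x \<in> space (Ls n). \<exists>i\<in>F. K1 < \<bar>x i\<bar>} \<le> d"
      using tight[OF d(1)] by auto
    obtain K2 where K2: "0 < K2" "measure L {x \<in> space L. \<exists>i\<in>F. K2 < \<bar>x i\<bar>} \<le> d"
      using tight_PiM[OF F L d(1)] by auto
    define K where "K = max K1 K2"
    have K: "0 < K" "K1 \<le> K" "K2 \<le> K" using K1 by (auto simp: K_def)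
    have mono: "measure M {x \<in> space M. \<exists>i\<in>F. K < \<bar>x i\<bar>} \<le> measure M {x \<in> space M. \<exists>i\<in>F. k < \<bar>x i\<bar>}"
      if "prob_space M" "sets M = sets (PiM F (\<lambda>_. borel))" "k \<le> K" for M k
    proof -
      interpret M: prob_space M by fact
      have [measurable]: "(\<lambda>x. x i) \<in> borel_measurable M" if "i \<in> F" for i
        using that by (simp add: measurable_cong_sets[OF \<open>sets M = _\<close> refl])
      show ?thesis
        using that(3) F by (intro M.finite_measure_mono) (auto intro: le_less_trans, measurable)
    qed
    obtain p where p: "p \<in> trig F" "\<And>x. x \<in> F \<rightarrow>\<^sub>E {-K..K} \<Longrightarrow> \<bar>g x - p x\<bar> < e" "\<And>x. \<bar>p x\<bar> \<le> B + e"
      using trig_approx_bounded[OF F K(1) g B e(1)] by auto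
    have "(\<lambda>n. LINT x|Ls n. p x) \<longlonglongrightarrow> (LINT x|L. p x)"
      by (rule trig_expectation_tendsto[OF Ls L conv p(1)])
    from LIMSEQ_D[OF this, of "r / 4"] r obtain n0 where
      n0: "\<And>n. n \<ge> n0 \<Longrightarrow> \<bar>(LINT x|Ls n. p x) - (LINT x|L. p x)\<bar> < r / 4" by auto
    have "\<bar>(LINT x|Ls n. g x) - (LINT x|L. g x)\<bar> < r" if "n \<ge> n0" for n
    proof -
      have "\<bar>(LINT x|Ls n. g x) - (LINT x|Ls n. p x)\<bar> \<le> e + D * d"
        by (rule approx[OF Ls p e(1,2) order_trans[OF mono[OF Ls K(2)] K1(2)]])
      moreover have "\<bar>(LINT x|L. g x) - (LINT x|L. p x)\<bar> \<le> e + D * d"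
        by (rule approx[OF L p e(1,2) order_trans[OF mono[OF L K(3)] K2(2)]])
      ultimately show ?thesis using n0[OF that] e(3) d(2) r by linarith
    qed
    thus "\<exists>no. \<forall>n\<ge>no. norm ((LINT x|Ls n. g x) - (LINT x|L. g x)) < r" by auto
  qed
qed

section \<open>Tail bounds from characteristic functions, and uniqueness\<close>

lemma (in prob_space) integrable_bounded_complex:
  fixes f :: "'a \<Rightarrow> complex"
  assumes "f \<in> borel_measurable M" "\<And>x. x \<in> space M \<Longrightarrow> cmod (f x) \<le> B"
  shows "integrable M f"
  using assms by (intro integrable_const_bound[where B = B]) auto

lemma powr_abs_le_one_plus_square:
  fixes z \<alpha> :: real
  assumes "0 < \<alpha>" "\<alpha> \<le> 2"
  shows "\<bar>z\<bar> powr \<alpha> \<le> 1 + z\<^sup>2"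
proof (cases "\<bar>z\<bar> \<le> 1")
  case True
  have "\<bar>z\<bar> powr \<alpha> \<le> 1 powr \<alpha>"
    using True assms by (intro powr_mono2) auto
  thus ?thesis by (simp add: add_increasing2)
next
  case False
  have "\<bar>z\<bar> powr \<alpha> \<le> \<bar>z\<bar> powr 2"
    using False assms by (intro powr_mono) auto
  also have "\<dots> = z\<^sup>2"
    using False by (subst powr_numeral) auto
  finally show ?thesis by simp
qed

text \<open>Averaging the characteristic function over a Gaussian argument u Z gives E
  exp(-(uX)^2/2), by Fubini. Hence E(1 - exp(-(uX)^2/2)) is at most K u^alpha E|Z|^alpha, and
  |Z|^alpha is at most 1 + Z^2, which has mean 2. With u = 1/x the integrand is at least 1 -
  exp(-1/2), hence at least 1/3, wherever |X| > x. The constant 6 is the product of 2 and 3.\<close>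

lemma tail_bound_char:
  assumes "prob_space P" and X[measurable]: "X \<in> borel_measurable P"
    and \<alpha>: "0 < \<alpha>" "\<alpha> \<le> 2" and "0 \<le> K"
    and char: "\<And>\<theta>. cmod (char (distr P borel X) \<theta> - 1) \<le> K * \<bar>\<theta>\<bar> powr \<alpha>"
    and x: "0 < x"
  shows "measure P {\<omega>\<in>space P. x < \<bar>X \<omega>\<bar>} \<le> 6 * K * x powr (-\<alpha>)"
proof -
  interpret P: prob_space P by fact
  define u where "u = 1 / x"
  have u: "0 < u" using x by (simp add: u_def)
  define m where "m = distr P borel X"
  interpret m: real_distribution m
    unfolding m_def by (intro P.real_distribution_distr X)
  interpret g: real_distribution std_normal_distribution
    by (rule real_dist_normal_dist)
  interpret mg: pair_prob_space m std_normal_distribution ..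
  have int2: "integrable std_normal_distribution (\<lambda>z. 1 + z\<^sup>2)"
    by (intro Bochner_Integration.integrable_add integrable_std_normal_distribution_moment) simp
  have int2_eq: "(LINT z|std_normal_distribution. 1 + z\<^sup>2) = 2"
    using std_normal_distribution_even_moments[of 1]
    by (subst Bochner_Integration.integral_add)
       (auto intro: integrable_std_normal_distribution_moment simp: g.prob_space[simplified] fact_numeral)
  have gauss: "complex_of_real (exp (- (u * y)\<^sup>2 / 2)) = (CLINT z|std_normal_distribution. iexp (u * y * z))" for y
    using fun_cong[OF char_std_normal_distribution, of "u * y"] by (simp add: char_def mult_ac)
  have "complex_of_real (LINT y|m. exp (- (u * y)\<^sup>2 / 2)) = (CLINT y|m. complex_of_real (exp (- (u * y)\<^sup>2 / 2)))"
    by simp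
  also have "\<dots> = (CLINT y|m. CLINT z|std_normal_distribution. iexp (u * y * z))"
    by (simp only: gauss)
  also have "\<dots> = (CLINT z|std_normal_distribution. CLINT y|m. iexp (u * y * z))"
    by (rule mg.Fubini_integral[symmetric]) (auto intro!: mg.P.integrable_bounded_complex[where B = 1] simp: split_def)
  also have "\<dots> = (CLINT z|std_normal_distribution. char m (u * z))"
    by (simp add: char_def mult_ac)
  finally have eq: "complex_of_real (LINT y|m. exp (- (u * y)\<^sup>2 / 2)) = (CLINT z|std_normal_distribution. char m (u * z))" .
  have intg: "integrable std_normal_distribution (\<lambda>z. char m (u * z))"
    by (intro g.integrable_bounded_complex[where B = 1] m.cmod_char_le_1) auto
  have inte: "integrable m (\<lambda>y. exp (- (u * y)\<^sup>2 / 2))"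
    by (intro m.integrable_const_bound[where B = 1]) auto
  have "(LINT y|m. 1 - exp (- (u * y)\<^sup>2 / 2)) = 1 - (LINT y|m. exp (- (u * y)\<^sup>2 / 2))"
    using inte m.prob_space by (subst Bochner_Integration.integral_diff) auto
  also have "\<dots> \<le> cmod (complex_of_real (LINT y|m. exp (- (u * y)\<^sup>2 / 2)) - 1)"
  proof -
    have "complex_of_real r - 1 = complex_of_real (r - 1)" for r by simp
    thus ?thesis by (simp only: norm_of_real abs_minus_commute[of _ 1] abs_ge_self)
  qed
  also have "\<dots> = cmod (CLINT z|std_normal_distribution. char m (u * z) - 1)"
    using intg g.prob_space unfolding eq by (subst Bochner_Integration.integral_diff) auto
  also have "\<dots> \<le> (LINT z|std_normal_distribution. K * u powr \<alpha> * (1 + z\<^sup>2))"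
  proof (rule Bochner_Integration.integral_norm_bound_integral)
    fix z
    have "cmod (char m (u * z) - 1) \<le> K * \<bar>u * z\<bar> powr \<alpha>"
      using char by (simp add: m_def)
    also have "\<dots> = K * u powr \<alpha> * \<bar>z\<bar> powr \<alpha>"
      using u by (simp add: abs_mult powr_mult)
    also have "\<dots> \<le> K * u powr \<alpha> * (1 + z\<^sup>2)"
      using powr_abs_le_one_plus_square[OF \<alpha>] \<open>0 \<le> K\<close> by (intro mult_left_mono) auto
    finally show "cmod (char m (u * z) - 1) \<le> K * u powr \<alpha> * (1 + z\<^sup>2)" .
  qed (use int2 intg in auto)
  also have "\<dots> = 2 * K * u powr \<alpha>"
    using int2_eq by simp
  finally have upper: "(LINT y|m. 1 - exp (- (u * y)\<^sup>2 / 2)) \<le> 2 * K * u powr \<alpha>" .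
  have "exp (1/2 :: real) \<ge> 3/2"
    using exp_ge_add_one_self[of "1/2 :: real"] by simp
  hence e: "exp (-1/2 :: real) \<le> 2/3"
    by (simp add: exp_minus field_simps)
  have "measure m {y. x < \<bar>y\<bar>} / 3 = (LINT y|m. indicator {y. x < \<bar>y\<bar>} y / 3)"
    by simp
  also have "\<dots> \<le> (LINT y|m. 1 - exp (- (u * y)\<^sup>2 / 2))"
  proof (rule integral_mono)
    fix y
    show "indicator {y. x < \<bar>y\<bar>} y / 3 \<le> 1 - exp (- (u * y)\<^sup>2 / 2)"
    proof (cases "x < \<bar>y\<bar>")
      case True
      hence "1 \<le> \<bar>u * y\<bar>" using x by (simp add: u_def field_simps abs_mult)
      hence "1 \<le> (u * y)\<^sup>2" by (metis one_le_power power2_abs)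
      hence "exp (- (u * y)\<^sup>2 / 2) \<le> exp (-1/2)" by simp
      from order_trans[OF this e] show ?thesis using True by simp
    qed simp
  qed (use inte in \<open>auto intro!: m.integrable_const_bound[where B = 1] simp: indicator_def\<close>)
  finally have "measure m {y. x < \<bar>y\<bar>} \<le> 6 * K * u powr \<alpha>"
    using upper by simp
  moreover have "measure m {y. x < \<bar>y\<bar>} = measure P {\<omega>\<in>space P. x < \<bar>X \<omega>\<bar>}"
    unfolding m_def by (subst measure_distr) (auto intro!: arg_cong[where f = "measure P"])
  ultimately show ?thesis
    using x by (simp add: u_def powr_minus powr_divide inverse_eq_divide)
qed

text \<open>Equal characteristic functions make the constant sequence \<open>L1\<close> converge
  weakly to \<open>L2\<close>, so integrals of bounded continuous functions agree. Approximating
  indicators of lower orthants by such functions identifies the two laws on a generator stable under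
  intersection.\<close>

lemma vchar_unique:
  fixes L1 L2 :: "('i \<Rightarrow> real) measure"
  assumes F: "finite F"
    and L1: "prob_space L1" "sets L1 = sets (PiM F (\<lambda>_. borel))"
    and L2: "prob_space L2" "sets L2 = sets (PiM F (\<lambda>_. borel))"
    and eq: "\<And>\<theta>. vchar F L1 \<theta> = vchar F L2 \<theta>"
  shows "L1 = L2"
proof -
  interpret L1: prob_space L1 by fact
  interpret L2: prob_space L2 by fact
  have sp: "space L1 = F \<rightarrow>\<^sub>E UNIV" "space L2 = F \<rightarrow>\<^sub>E UNIV"
    using sets_eq_imp_space_eq[OF L1(2)] sets_eq_imp_space_eq[OF L2(2)] by (auto simp: space_PiM)
  define E :: "real set set" where "E = range atMost"
  \<comment> \<open>\<open>sets_PiM_sigma\<close> takes a cover of the index set by finite sets;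
    \<open>F\<close> is finite, so the cover by \<open>F\<close> alone serves.\<close>
  define G :: "('i \<Rightarrow> real) set set" where
    "G = {{f \<in> F \<rightarrow>\<^sub>E UNIV. \<forall>i\<in>j. f i \<in> A i} | A j. j \<in> {F} \<and> A \<in> Pi j (\<lambda>_. E)}"
  have "\<exists>S\<subseteq>E. countable S \<and> UNIV = \<Union>S"
    by (intro exI[of _ "range (\<lambda>n. {..real n})"]) (auto simp: E_def intro: real_arch_simple)
  hence "sets (PiM F (\<lambda>_. sigma UNIV E)) = sets (sigma (F \<rightarrow>\<^sub>E UNIV) G)"
    unfolding G_def using F by (intro sets_PiM_sigma) auto
  moreover have "(borel :: real measure) = sigma UNIV E"
    unfolding E_def by (simp add: borel_eq_atMost)
  moreover have "G \<subseteq> Pow (F \<rightarrow>\<^sub>E UNIV)" by (auto simp: G_def)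
  ultimately have sets_eq: "sets (PiM F (\<lambda>_. borel)) = sigma_sets (F \<rightarrow>\<^sub>E UNIV) G"
    by (simp only: sets_measure_of)
  have closed_box: "measure L1 {f \<in> F \<rightarrow>\<^sub>E UNIV. \<forall>i\<in>F. f i \<le> a i} = measure L2 {f \<in> F \<rightarrow>\<^sub>E UNIV. \<forall>i\<in>F. f i \<le> a i}" for a
  proof -
    \<comment> \<open>In each coordinate a ramp that is 1 up to \<open>a i\<close> and, for n > 0,
      vanishes from \<open>a i + 1 / n\<close> on.\<close>
    define h :: "nat \<Rightarrow> ('i \<Rightarrow> real) \<Rightarrow> real" where
      "h n f = (\<Prod>i\<in>F. max 0 (min 1 (1 - real n * (f i - a i))))" for n f
    define Z where "Z = {f \<in> F \<rightarrow>\<^sub>E UNIV. \<forall>i\<in>F. f i \<le> a i}"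
    have h01: "0 \<le> h n f" "h n f \<le> 1" for n f
      unfolding h_def by (intro prod_nonneg prod_le_1; simp)+
    have cont: "continuous_map (product_topology (\<lambda>_. euclideanreal) F) euclideanreal (h n)" for n
      unfolding h_def using F
      by (intro continuous_intros continuous_map_product_projection) auto
    have inteq: "(LINT x|L1. h n x) = (LINT x|L2. h n x)" for n
    proof -
      have "(\<lambda>k::nat. LINT x|L1. h n x) \<longlonglongrightarrow> (LINT x|L2. h n x)"
        by (rule vchar_tendsto_imp_weak_conv[OF F L1 L2 _ _ cont])
           (use h01 eq tight_PiM[OF F L1] in \<open>auto simp: bounded_iff intro!: exI[of _ 1]\<close>)
      thus ?thesis by (simp add: LIMSEQ_const_iff)
    qed
    have lim: "(\<lambda>n. h n f) \<longlonglongrightarrow> indicator Z f" if f: "f \<in> F \<rightarrow>\<^sub>E UNIV" for f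
    proof (cases "f \<in> Z")
      case True
      hence "h n f = 1" for n
        unfolding h_def by (intro prod.neutral) (auto simp: Z_def mult_nonneg_nonpos)
      thus ?thesis using True by simp
    next
      case False
      then obtain i where i: "i \<in> F" "a i < f i" using f by (auto simp: Z_def not_le)
      obtain m :: nat where m: "1 / (f i - a i) \<le> real m" using real_arch_simple by blast
      have "h n f = 0" if "m \<le> n" for n
      proof -
        have "1 / (f i - a i) \<le> real n" using m that by linarith
        hence "1 - real n * (f i - a i) \<le> 0" using i by (simp add: field_simps)
        thus ?thesis unfolding h_def using i F by (intro prod_zero bexI[of _ i]) auto
      qed
      hence "eventually (\<lambda>n. h n f = indicator Z f) sequentially"
        using False unfolding eventually_sequentially by auto
      thus ?thesis by (rule tendsto_eventually)
    qed
    have conv: "(\<lambda>n. LINT x|M. h n x) \<longlonglongrightarrow> measure M Z"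
      if M: "prob_space M" "sets M = sets (PiM F (\<lambda>_. borel))" for M
    proof -
      interpret M: prob_space M by fact
      have sp: "space M = F \<rightarrow>\<^sub>E UNIV" using sets_eq_imp_space_eq[OF M(2)] by (simp add: space_PiM)
      have hm: "h n \<in> borel_measurable M" for n
        using continuous_map_PiM_measurable[OF F cont] by (simp add: measurable_cong_sets[OF M(2) refl])
      have [measurable]: "(\<lambda>x. x i) \<in> borel_measurable M" if "i \<in> F" for i
        using that by (simp add: measurable_cong_sets[OF M(2) refl])
      have "{f \<in> space M. \<forall>i\<in>F. f i \<le> a i} \<in> sets M" using F by measurable
      hence Zm: "Z \<in> sets M" by (simp add: Z_def sp)
      have "(\<lambda>n. LINT x|M. h n x) \<longlonglongrightarrow> (LINT x|M. indicator Z x)"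
        by (rule integral_dominated_convergence[where w = "\<lambda>_. 1"])
           (use hm Zm h01 lim sp in \<open>auto simp: abs_le_iff intro: order_trans[OF _ h01(1)]\<close>)
      thus ?thesis using Zm by simp
    qed
    show ?thesis
      using LIMSEQ_unique[OF conv[OF L1] conv[OF L2, folded inteq]] by (simp add: Z_def)
  qed
  have Gbox: "\<exists>a. X = {f \<in> F \<rightarrow>\<^sub>E UNIV. \<forall>i\<in>F. f i \<le> a i}" if X: "X \<in> G" for X
  proof -
    from X obtain A where A: "X = {f \<in> F \<rightarrow>\<^sub>E UNIV. \<forall>i\<in>F. f i \<in> A i}" "A \<in> F \<rightarrow> E"
      by (auto simp: G_def)
    from A(2) have "\<forall>i\<in>F. \<exists>a. A i = {..a}" by (auto simp: E_def)
    then obtain a where "\<And>i. i \<in> F \<Longrightarrow> A i = {..a i}" by metis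
    thus ?thesis using A(1) by (intro exI[of _ a]) auto
  qed
  have boxG: "{f \<in> F \<rightarrow>\<^sub>E UNIV. \<forall>i\<in>F. f i \<le> a i} \<in> G" for a
    unfolding G_def by (rule CollectI, rule exI[of _ "\<lambda>i. {..a i}"], rule exI[of _ F]) (auto simp: E_def)
  show ?thesis
  proof (rule measure_eqI_generator_eq[where E = G and \<Omega> = "F \<rightarrow>\<^sub>E UNIV" and
        A = "\<lambda>n. {f \<in> F \<rightarrow>\<^sub>E UNIV. \<forall>i\<in>F. f i \<le> real n}"])
    show "Int_stable G"
    proof (rule Int_stableI)
      fix X Y assume "X \<in> G" "Y \<in> G"
      from Gbox[OF \<open>X \<in> G\<close>] obtain a where a: "X = {f \<in> F \<rightarrow>\<^sub>E UNIV. \<forall>i\<in>F. f i \<le> a i}" by blast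
      from Gbox[OF \<open>Y \<in> G\<close>] obtain b where b: "Y = {f \<in> F \<rightarrow>\<^sub>E UNIV. \<forall>i\<in>F. f i \<le> b i}" by blast
      from a b have "X \<inter> Y = {f \<in> F \<rightarrow>\<^sub>E UNIV. \<forall>i\<in>F. f i \<le> min (a i) (b i)}" by auto
      thus "X \<inter> Y \<in> G" using boxG[of "\<lambda>i. min (a i) (b i)"] by simp
    qed
    show "G \<subseteq> Pow (F \<rightarrow>\<^sub>E UNIV)" by (auto simp: G_def)
    show "emeasure L1 X = emeasure L2 X" if "X \<in> G" for X
      using Gbox[OF that] closed_box by (auto simp: L1.emeasure_eq_measure L2.emeasure_eq_measure)
    show "sets L1 = sigma_sets (F \<rightarrow>\<^sub>E UNIV) G" "sets L2 = sigma_sets (F \<rightarrow>\<^sub>E UNIV) G"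
      using sets_eq L1(2) L2(2) by auto
    show "range (\<lambda>n. {f \<in> F \<rightarrow>\<^sub>E UNIV. \<forall>i\<in>F. f i \<le> real n}) \<subseteq> G"
      using boxG by auto
    show "(\<Union>n. {f \<in> F \<rightarrow>\<^sub>E UNIV. \<forall>i\<in>F. f i \<le> real n}) = F \<rightarrow>\<^sub>E UNIV"
    proof (intro subset_antisym subsetI)
      fix f :: "'i \<Rightarrow> real" assume f: "f \<in> F \<rightarrow>\<^sub>E UNIV"
      obtain m :: nat where m: "(\<Sum>i\<in>F. \<bar>f i\<bar>) \<le> real m" using real_arch_simple by blast
      have "f i \<le> real m" if "i \<in> F" for i
        using m member_le_sum[OF that, of "\<lambda>i. \<bar>f i\<bar>"] F by auto
      thus "f \<in> (\<Union>n. {f \<in> F \<rightarrow>\<^sub>E UNIV. \<forall>i\<in>F. f i \<le> real n})" using f by auto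
    qed auto
  qed auto
qed

section \<open>Characteristic functions of the innovations\<close>

lemma two_powr_less_one: "x < 0 \<Longrightarrow> (2::real) powr x < 1"
  using powr_less_mono[of x 0 2] by simp

lemmas two_powr_le_one = less_imp_le[OF two_powr_less_one]

lemma power_powr: "0 < x \<Longrightarrow> (x ^ j) powr a = (x powr a) ^ j" for x a :: real
  by (induction j) (auto simp: powr_mult)

text \<open>Values up to 1 are cut at the levels 2^(-j) and bounded through the q-th power, values
  above 1 are cut at 2^j and bounded through the p-th power. The tail bound turns the two series
  into geometric ones with ratios 2^(alpha - q) and 2^(p - alpha), which are below 1 because p <
  alpha < q.\<close>

lemma nn_integral_min_power_le:
  fixes Y :: "'a \<Rightarrow> real" and p q :: nat and \<alpha> D :: real
  assumes Y[measurable]: "Y \<in> borel_measurable M" and Y0: "\<And>x. 0 \<le> Y x" and "0 \<le> D"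
    and pq: "real p < \<alpha>" "\<alpha> < real q"
    and tail: "\<And>y. 0 < y \<Longrightarrow> emeasure M {x\<in>space M. y < Y x} \<le> ennreal (D * y powr (-\<alpha>))"
  shows "(\<integral>\<^sup>+x. ennreal (min (Y x ^ p) (Y x ^ q)) \<partial>M) \<le>
    ennreal (D * (2 ^ q / (1 - 2 powr (\<alpha> - q)) + 2 ^ p / (1 - 2 powr (p - \<alpha>))))"
proof -
  define A where "A j = {x\<in>space M. (1/2) ^ j < Y x}" for j :: nat
  define B where "B j = {x\<in>space M. 2 ^ j < Y x}" for j :: nat
  define f where "f j x = ennreal (2 ^ q * (1 / 2 ^ q) ^ j) * indicator (A j) x" for j x
  define g where "g j x = ennreal (2 ^ p * (2 ^ p) ^ j) * indicator (B j) x" for j x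
  have [measurable]: "A j \<in> sets M" "B j \<in> sets M" for j
    unfolding A_def B_def by measurable
  have term_le: "F j \<le> (\<Sum>j. F j)" for F :: "nat \<Rightarrow> ennreal" and j
    using sum_le_suminf[of F "{j}"] by auto
  have pw: "ennreal (min (Y x ^ p) (Y x ^ q)) \<le> (\<Sum>j. f j x) + (\<Sum>j. g j x)" if x: "x \<in> space M" for x
  proof -
    consider "Y x = 0" | "0 < Y x" "Y x \<le> 1" | "1 < Y x" using Y0[of x] by linarith
    thus ?thesis
    proof cases
      case 1
      have "0 < q" using pq by (cases q) auto
      hence "min (Y x ^ p) (Y x ^ q) \<le> 0" using 1 by (simp add: min_le_iff_disj zero_power)
      thus ?thesis by (simp add: ennreal_neg)
    next
      case 2
      \<comment> \<open>The least such j gives 2^(-j) < Y <= 2 * 2^(-j); the factor 2 is the origin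
        of 2^q in the bound.\<close>
      define j where "j = (LEAST j. (1/2) ^ j < Y x)"
      have ex: "\<exists>j. (1/2) ^ j < Y x" using real_arch_pow_inv[of "Y x" "1/2"] 2 by auto
      have j: "(1/2) ^ j < Y x" unfolding j_def using ex by (rule LeastI_ex)
      have j': "Y x \<le> 2 * (1/2) ^ j"
      proof (cases j)
        case 0 thus ?thesis using 2 by simp
      next
        case (Suc k)
        hence "\<not> (1/2) ^ k < Y x" unfolding j_def by (intro not_less_Least) simp
        thus ?thesis using Suc by simp
      qed
      have "min (Y x ^ p) (Y x ^ q) \<le> (2 * (1/2) ^ j) ^ q"
        using power_mono[OF j' Y0, of q] by linarith
      also have "\<dots> = 2 ^ q * (1 / 2 ^ q) ^ j"
        by (simp add: power_mult_distrib power_divide mult.commute flip: power_mult)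
      finally have "ennreal (min (Y x ^ p) (Y x ^ q)) \<le> f j x"
        using j x by (simp add: f_def A_def ennreal_leI)
      also have "\<dots> \<le> (\<Sum>j. f j x) + (\<Sum>j. g j x)" by (intro add_increasing2 term_le) simp
      finally show ?thesis .
    next
      case 3
      define j where "j = (LEAST j. Y x \<le> 2 ^ Suc j)"
      have ex: "\<exists>j. Y x \<le> 2 ^ Suc j"
      proof -
        obtain n where "Y x < 2 ^ n" using real_arch_pow[of 2 "Y x"] by auto
        also have "(2::real) ^ n \<le> 2 ^ Suc n" by simp
        finally show ?thesis by (auto intro: less_imp_le)
      qed
      have j: "Y x \<le> 2 ^ Suc j" unfolding j_def using ex by (rule LeastI_ex)
      have j': "2 ^ j < Y x"
      proof (cases j)
        case 0 thus ?thesis using 3 by simp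
      next
        case (Suc k)
        hence "\<not> Y x \<le> 2 ^ Suc k" unfolding j_def by (intro not_less_Least) simp
        thus ?thesis using Suc by simp
      qed
      have "min (Y x ^ p) (Y x ^ q) \<le> (2 ^ Suc j) ^ p"
        using power_mono[OF j Y0, of p] by linarith
      also have "\<dots> = 2 ^ p * (2 ^ p) ^ j"
        by (simp add: power_mult_distrib mult.commute flip: power_mult)
      finally have "ennreal (min (Y x ^ p) (Y x ^ q)) \<le> g j x"
        using j' x by (simp add: g_def B_def ennreal_leI)
      also have "\<dots> \<le> (\<Sum>j. f j x) + (\<Sum>j. g j x)" by (intro add_increasing term_le) simp
      finally show ?thesis .
    qed
  qed
  have geo: "(\<Sum>j. ennreal (c * r ^ j)) = ennreal (c / (1 - r))" if "0 \<le> c" "0 \<le> r" "r < 1" for c r :: real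
  proof -
    have "(\<lambda>j. c * r ^ j) sums (c * (1 / (1 - r)))"
      using that by (intro sums_mult geometric_sums) auto
    thus ?thesis using that by (intro suminf_ennreal_eq) auto
  qed
  have "(\<integral>\<^sup>+x. ennreal (min (Y x ^ p) (Y x ^ q)) \<partial>M) \<le> (\<integral>\<^sup>+x. (\<Sum>j. f j x) + (\<Sum>j. g j x) \<partial>M)"
    by (intro nn_integral_mono pw)
  also have "\<dots> = (\<Sum>j. \<integral>\<^sup>+x. f j x \<partial>M) + (\<Sum>j. \<integral>\<^sup>+x. g j x \<partial>M)"
    unfolding f_def g_def by (subst nn_integral_add) (auto simp: nn_integral_suminf)
  also have "\<dots> = (\<Sum>j. ennreal (2 ^ q * (1 / 2 ^ q) ^ j) * emeasure M (A j)) +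
      (\<Sum>j. ennreal (2 ^ p * (2 ^ p) ^ j) * emeasure M (B j))"
    unfolding f_def g_def by (simp add: nn_integral_cmult_indicator)
  also have "\<dots> \<le> (\<Sum>j. ennreal (D * 2 ^ q * (2 powr (\<alpha> - q)) ^ j)) + (\<Sum>j. ennreal (D * 2 ^ p * (2 powr (p - \<alpha>)) ^ j))"
  proof (intro add_mono suminf_le summableI)
    fix j :: nat
    have "ennreal (2 ^ q * (1 / 2 ^ q) ^ j) * emeasure M (A j) \<le>
        ennreal (2 ^ q * (1 / 2 ^ q) ^ j) * ennreal (D * ((1/2) ^ j) powr (-\<alpha>))"
      unfolding A_def by (intro mult_left_mono tail) auto
    also have "\<dots> = ennreal (2 ^ q * (1 / 2 ^ q) ^ j * (D * ((1/2) ^ j) powr (-\<alpha>)))"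
      using \<open>0 \<le> D\<close> by (intro ennreal_mult[symmetric]) auto
    also have "2 ^ q * (1 / 2 ^ q) ^ j * (D * ((1/2) ^ j) powr (-\<alpha>)) = D * 2 ^ q * (2 powr (\<alpha> - q)) ^ j"
    proof -
      have "((1/2) ^ j :: real) powr (-\<alpha>) = (2 powr \<alpha>) ^ j"
        by (simp add: power_powr powr_minus powr_divide field_simps)
      moreover have "1 / 2 ^ q * 2 powr \<alpha> = (2::real) powr (\<alpha> - q)"
        by (simp add: powr_diff powr_realpow)
      ultimately show ?thesis by (simp flip: power_mult_distrib)
    qed
    finally show "ennreal (2 ^ q * (1 / 2 ^ q) ^ j) * emeasure M (A j) \<le> ennreal (D * 2 ^ q * (2 powr (\<alpha> - q)) ^ j)" .
  next
    fix j :: nat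
    have "ennreal (2 ^ p * (2 ^ p) ^ j) * emeasure M (B j) \<le>
        ennreal (2 ^ p * (2 ^ p) ^ j) * ennreal (D * (2 ^ j) powr (-\<alpha>))"
      unfolding B_def by (intro mult_left_mono tail) auto
    also have "\<dots> = ennreal (2 ^ p * (2 ^ p) ^ j * (D * (2 ^ j) powr (-\<alpha>)))"
      using \<open>0 \<le> D\<close> by (intro ennreal_mult[symmetric]) auto
    also have "2 ^ p * (2 ^ p) ^ j * (D * (2 ^ j) powr (-\<alpha>)) = D * 2 ^ p * (2 powr (p - \<alpha>)) ^ j"
    proof -
      have "(2 ^ j :: real) powr (-\<alpha>) = (2 powr (-\<alpha>)) ^ j"
        by (simp add: power_powr)
      moreover have "2 ^ p * 2 powr (-\<alpha>) = (2::real) powr (p - \<alpha>)"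
        by (simp add: powr_diff powr_realpow powr_minus divide_inverse)
      ultimately show ?thesis by (simp flip: power_mult_distrib)
    qed
    finally show "ennreal (2 ^ p * (2 ^ p) ^ j) * emeasure M (B j) \<le> ennreal (D * 2 ^ p * (2 powr (p - \<alpha>)) ^ j)" .
  qed
  also have "\<dots> = ennreal (D * 2 ^ q / (1 - 2 powr (\<alpha> - q))) + ennreal (D * 2 ^ p / (1 - 2 powr (p - \<alpha>)))"
    using pq \<open>0 \<le> D\<close> by (subst (1 2) geo) (auto intro: two_powr_less_one)
  also have "\<dots> = ennreal (D * (2 ^ q / (1 - 2 powr (\<alpha> - q)) + 2 ^ p / (1 - 2 powr (p - \<alpha>))))"
    using pq \<open>0 \<le> D\<close> by (subst ennreal_plus[symmetric])
      (auto simp: distrib_left less_imp_le intro!: divide_nonneg_nonneg two_powr_le_one)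
  finally show ?thesis .
qed

text \<open>This and the next two estimates share the shape 2 min(|y|^p, |y|^q): the exponents (0,1)
  serve alpha < 1, the exponents (1,2) serve alpha > 1, and the exponents (0,2) serve alpha =
  1.\<close>

lemma cmod_iexp_minus_1_le: "cmod (iexp y - 1) \<le> 2 * min (\<bar>y\<bar> ^ 0) (\<bar>y\<bar> ^ 1)"
  using iexp_approx1[of y 0] iexp_approx2[of y 0] by auto

lemma cmod_iexp_minus_1_minus_linear_le: "cmod (iexp y - 1 - \<i> * y) \<le> 2 * min (\<bar>y\<bar> ^ 1) (\<bar>y\<bar> ^ 2)"
proof -
  have "cmod (iexp y - 1 - \<i> * y) \<le> y\<^sup>2 / 2" "cmod (iexp y - 1 - \<i> * y) \<le> 2 * \<bar>y\<bar>"
    using iexp_approx1[of y 1] iexp_approx2[of y 1] by (simp_all add: diff_diff_eq power2_eq_square)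
  moreover from this(1) have "cmod (iexp y - 1 - \<i> * y) \<le> 2 * y\<^sup>2"
    using zero_le_power2[of y] by linarith
  ultimately show ?thesis by (simp add: min_def)
qed

lemma cos_minus_1_le: "\<bar>cos y - 1 :: real\<bar> \<le> 2 * min (\<bar>y\<bar> ^ 0) (\<bar>y\<bar> ^ 2)"
proof -
  have "\<bar>cos y - 1\<bar> = 1 - cos y" using cos_le_one[of y] by simp
  moreover have "1 - cos y \<le> 2" using cos_ge_minus_one[of y] by simp
  moreover have "1 - cos y \<le> y\<^sup>2 / 2"
    using cmod_iexp_minus_1_minus_linear_le[of y] iexp_approx1[of y 1] abs_Re_le_cmod[of "iexp y - 1 - \<i> * y"]
    by (auto simp: diff_diff_eq Re_exp fact_numeral power2_eq_square)
  moreover from this have "1 - cos y \<le> 2 * y\<^sup>2" using zero_le_power2[of y] by linarith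
  ultimately show ?thesis by (auto simp: min_def)
qed

text \<open>For alpha < 1 a bound on iexp - 1 suffices. For alpha >= 1 the linear term of the
  exponential has to be cancelled, through symmetry when alpha = 1 and through the vanishing mean
  when alpha > 1. What remains is bounded by a second moment or by a truncated moment, either of
  which is of order 1 / N by hypothesis.\<close>

lemma class_T_char_bound:
  assumes "prob_space P" and meas: "\<And>N. 1 \<le> N \<Longrightarrow> \<epsilon> N \<in> borel_measurable P"
    and T: "class_T P \<alpha> \<epsilon>"
  shows "\<exists>K\<ge>0. \<forall>N\<ge>1. \<forall>\<theta>. cmod (char (distr P borel (\<epsilon> N)) \<theta> - 1) \<le> K * \<bar>\<theta>\<bar> powr \<alpha> / real N"
proof -
  interpret P: prob_space P by fact
  have char: "char (distr P borel (\<epsilon> N)) \<theta> = (CLINT \<omega>|P. iexp (\<theta> * \<epsilon> N \<omega>))" if "1 \<le> N" for N \<theta>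
    using meas[OF that] by (simp add: char_def integral_distr)
  have iint: "complex_integrable P (\<lambda>\<omega>. iexp (\<theta> * \<epsilon> N \<omega>))" if "1 \<le> N" for N \<theta>
    using meas[OF that] by (intro P.integrable_iexp) auto
  from T obtain C where
    "(\<alpha> = 2 \<and>
         (\<forall>N\<ge>1. integrable P (\<lambda>\<omega>. (\<epsilon> N \<omega>)\<^sup>2) \<and> (LINT \<omega>|P. \<epsilon> N \<omega>) = 0 \<and>
                real N * (LINT \<omega>|P. (\<epsilon> N \<omega>)\<^sup>2) \<le> C))
      \<or> (0 < \<alpha> \<and> \<alpha> < 2 \<and>
         (\<forall>N\<ge>1. \<forall>x>0. real N * measure P {\<omega> \<in> space P. x < \<bar>\<epsilon> N \<omega>\<bar>} \<le> C * x powr (-\<alpha>)) \<and>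
         (1 < \<alpha> \<longrightarrow> (\<forall>N\<ge>1. (LINT \<omega>|P. \<epsilon> N \<omega>) = 0)) \<and>
         (\<alpha> = 1 \<longrightarrow> (\<forall>N\<ge>1. distr P borel (\<lambda>\<omega>. - \<epsilon> N \<omega>) = distr P borel (\<epsilon> N))))"
    unfolding class_T_def by blast
  thus ?thesis
  proof (elim disjE conjE)
    assume "\<alpha> = 2" and
      T2: "\<forall>N\<ge>1. integrable P (\<lambda>\<omega>. (\<epsilon> N \<omega>)\<^sup>2) \<and> (LINT \<omega>|P. \<epsilon> N \<omega>) = 0 \<and> real N * (LINT \<omega>|P. (\<epsilon> N \<omega>)\<^sup>2) \<le> C"
    have "cmod (char (distr P borel (\<epsilon> N)) \<theta> - 1) \<le> (2 * C) * \<bar>\<theta>\<bar> powr \<alpha> / real N" if N: "1 \<le> N" for N \<theta>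
    proof -
      note [measurable] = meas[OF N]
      from T2 N have i2: "integrable P (\<lambda>\<omega>. (\<epsilon> N \<omega>)\<^sup>2)" and mean: "(LINT \<omega>|P. \<epsilon> N \<omega>) = 0"
        and C: "real N * (LINT \<omega>|P. (\<epsilon> N \<omega>)\<^sup>2) \<le> C" by auto
      have i1: "integrable P (\<epsilon> N)" using i2 by (rule P.square_integrable_imp_integrable[rotated]) simp
      have i1': "complex_integrable P (\<lambda>\<omega>. \<i> * (\<theta> * \<epsilon> N \<omega>))"
        using i1 by (intro integrable_mult_right integrable_of_real) auto
      have "(CLINT \<omega>|P. \<i> * (\<theta> * \<epsilon> N \<omega>)) = \<i> * (\<theta> * (LINT \<omega>|P. \<epsilon> N \<omega>))"
        by simp
      hence "char (distr P borel (\<epsilon> N)) \<theta> - 1 = (CLINT \<omega>|P. iexp (\<theta> * \<epsilon> N \<omega>) - 1 - \<i> * (\<theta> * \<epsilon> N \<omega>))"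
        using N iint[OF N] i1' mean P.prob_space by (simp add: char Bochner_Integration.integral_diff)
      also have "cmod \<dots> \<le> (LINT \<omega>|P. 2 * \<theta>\<^sup>2 * (\<epsilon> N \<omega>)\<^sup>2)"
      proof (rule order_trans[OF integral_norm_bound integral_mono])
        fix \<omega>
        show "cmod (iexp (\<theta> * \<epsilon> N \<omega>) - 1 - \<i> * (\<theta> * \<epsilon> N \<omega>)) \<le> 2 * \<theta>\<^sup>2 * (\<epsilon> N \<omega>)\<^sup>2"
          using cmod_iexp_minus_1_minus_linear_le[of "\<theta> * \<epsilon> N \<omega>"] by (simp add: power_mult_distrib)
      qed (use i2 i1' iint[OF N] in auto)
      also have "\<dots> = 2 * \<theta>\<^sup>2 * (LINT \<omega>|P. (\<epsilon> N \<omega>)\<^sup>2)" by simp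
      also have "\<dots> \<le> 2 * \<theta>\<^sup>2 * (C / real N)"
        using C N by (intro mult_left_mono) (auto simp: field_simps)
      also have "\<dots> = (2 * C) * \<bar>\<theta>\<bar> powr \<alpha> / real N"
        using \<open>\<alpha> = 2\<close> by (cases "\<theta> = 0") (auto simp: powr_numeral)
      finally show ?thesis .
    qed
    moreover have "0 \<le> C"
    proof -
      have "0 \<le> real 1 * (LINT \<omega>|P. (\<epsilon> 1 \<omega>)\<^sup>2)" by simp
      also have "\<dots> \<le> C" using T2 by blast
      finally show ?thesis .
    qed
    ultimately show ?thesis by (intro exI[of _ "2 * C"]) auto
  next
    assume \<alpha>: "0 < \<alpha>" "\<alpha> < 2"
      and tail: "\<forall>N\<ge>1. \<forall>x>0. real N * measure P {\<omega> \<in> space P. x < \<bar>\<epsilon> N \<omega>\<bar>} \<le> C * x powr (-\<alpha>)"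
      and mean: "1 < \<alpha> \<longrightarrow> (\<forall>N\<ge>1. (LINT \<omega>|P. \<epsilon> N \<omega>) = 0)"
      and sym: "\<alpha> = 1 \<longrightarrow> (\<forall>N\<ge>1. distr P borel (\<lambda>\<omega>. - \<epsilon> N \<omega>) = distr P borel (\<epsilon> N))"
    have "0 \<le> C"
    proof -
      have "0 \<le> real 1 * measure P {\<omega> \<in> space P. 1 < \<bar>\<epsilon> 1 \<omega>\<bar>}" by simp
      also have "\<dots> \<le> C * 1 powr (-\<alpha>)" using tail[rule_format, of 1 1] by simp
      finally show ?thesis by simp
    qed
    define c where "c p q = 2 ^ q / (1 - 2 powr (\<alpha> - real q)) + 2 ^ p / (1 - 2 powr (real p - \<alpha>))" for p q :: nat
    have nn: "(\<integral>\<^sup>+\<omega>. ennreal (min (\<bar>\<theta> * \<epsilon> N \<omega>\<bar> ^ p) (\<bar>\<theta> * \<epsilon> N \<omega>\<bar> ^ q)) \<partial>P) \<le> ennreal (C / real N * \<bar>\<theta>\<bar> powr \<alpha> * c p q)"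
      if N: "1 \<le> N" and pq: "real p < \<alpha>" "\<alpha> < real q" for N p q \<theta>
      unfolding c_def
    proof (rule nn_integral_min_power_le[OF _ _ _ pq])
      fix y :: real assume y: "0 < y"
      show "emeasure P {x \<in> space P. y < \<bar>\<theta> * \<epsilon> N x\<bar>} \<le> ennreal (C / real N * \<bar>\<theta>\<bar> powr \<alpha> * y powr - \<alpha>)"
      proof (cases "\<theta> = 0")
        case False
        have "{x \<in> space P. y < \<bar>\<theta> * \<epsilon> N x\<bar>} = {x \<in> space P. y / \<bar>\<theta>\<bar> < \<bar>\<epsilon> N x\<bar>}"
          using False by (auto simp: abs_mult field_simps)
        moreover have "measure P {x \<in> space P. y / \<bar>\<theta>\<bar> < \<bar>\<epsilon> N x\<bar>} \<le> C / real N * (y / \<bar>\<theta>\<bar>) powr - \<alpha>"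
          using tail[rule_format, OF N, of "y / \<bar>\<theta>\<bar>"] False y N by (simp add: field_simps)
        moreover have "(y / \<bar>\<theta>\<bar>) powr - \<alpha> = \<bar>\<theta>\<bar> powr \<alpha> * y powr - \<alpha>"
          using y False by (simp add: powr_divide powr_minus field_simps)
        ultimately show ?thesis
          by (simp add: P.emeasure_eq_measure ennreal_leI mult.assoc)
      qed (use y in simp)
    qed (use meas[OF N] \<open>0 \<le> C\<close> in auto)
    have bound: "cmod (CLINT \<omega>|P. h (\<theta> * \<epsilon> N \<omega>)) \<le> 2 * (C / real N * \<bar>\<theta>\<bar> powr \<alpha> * c p q)"
      if N: "1 \<le> N" and pq: "real p < \<alpha>" "\<alpha> < real q" and h: "h \<in> borel_measurable borel"
        and le: "\<And>y. cmod (h y) \<le> 2 * min (\<bar>y\<bar> ^ p) (\<bar>y\<bar> ^ q)" for N p q \<theta> and h :: "real \<Rightarrow> complex"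
    proof (cases "complex_integrable P (\<lambda>\<omega>. h (\<theta> * \<epsilon> N \<omega>))")
      case True
      have c: "0 \<le> c p q" unfolding c_def using pq
        by (intro add_nonneg_nonneg divide_nonneg_nonneg) (auto intro: two_powr_le_one)
      note [measurable] = meas[OF N] h
      have "ennreal (cmod (CLINT \<omega>|P. h (\<theta> * \<epsilon> N \<omega>))) \<le> (\<integral>\<^sup>+\<omega>. ennreal (cmod (h (\<theta> * \<epsilon> N \<omega>))) \<partial>P)"
        by (rule integral_norm_bound_ennreal[OF True])
      also have "\<dots> \<le> (\<integral>\<^sup>+\<omega>. 2 * ennreal (min (\<bar>\<theta> * \<epsilon> N \<omega>\<bar> ^ p) (\<bar>\<theta> * \<epsilon> N \<omega>\<bar> ^ q)) \<partial>P)"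
      proof (intro nn_integral_mono)
        fix \<omega>
        have "ennreal (cmod (h (\<theta> * \<epsilon> N \<omega>))) \<le> ennreal (2 * min (\<bar>\<theta> * \<epsilon> N \<omega>\<bar> ^ p) (\<bar>\<theta> * \<epsilon> N \<omega>\<bar> ^ q))"
          by (intro ennreal_leI le)
        thus "ennreal (cmod (h (\<theta> * \<epsilon> N \<omega>))) \<le> 2 * ennreal (min (\<bar>\<theta> * \<epsilon> N \<omega>\<bar> ^ p) (\<bar>\<theta> * \<epsilon> N \<omega>\<bar> ^ q))"
          by (simp add: ennreal_mult)
      qed
      also have "\<dots> = 2 * (\<integral>\<^sup>+\<omega>. ennreal (min (\<bar>\<theta> * \<epsilon> N \<omega>\<bar> ^ p) (\<bar>\<theta> * \<epsilon> N \<omega>\<bar> ^ q)) \<partial>P)"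
        by (rule nn_integral_cmult) measurable
      also have "\<dots> \<le> 2 * ennreal (C / real N * \<bar>\<theta>\<bar> powr \<alpha> * c p q)"
        by (intro mult_left_mono nn N pq) auto
      also have "\<dots> = ennreal (2 * (C / real N * \<bar>\<theta>\<bar> powr \<alpha> * c p q))"
        using \<open>0 \<le> C\<close> c by (subst ennreal_mult[of 2]) auto
      finally show ?thesis using \<open>0 \<le> C\<close> c by (subst (asm) ennreal_le_iff) auto
    next
      \<comment> \<open>A non-integrable function has integral 0 by convention, so the bound reduces
        to nonnegativity of its right-hand side.\<close>
      case False
      have "0 \<le> c p q" unfolding c_def using pq
        by (intro add_nonneg_nonneg divide_nonneg_nonneg) (auto intro: two_powr_le_one)
      thus ?thesis using False \<open>0 \<le> C\<close> by (simp add: not_integrable_integral_eq)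
    qed
    have c0: "0 \<le> c p q" if "real p < \<alpha>" "\<alpha> < real q" for p q
      unfolding c_def using that
      by (intro add_nonneg_nonneg divide_nonneg_nonneg) (auto intro: two_powr_le_one)
    have "\<exists>c\<ge>0. \<forall>N\<ge>1. \<forall>\<theta>. cmod (char (distr P borel (\<epsilon> N)) \<theta> - 1) \<le> 2 * (C / real N * \<bar>\<theta>\<bar> powr \<alpha> * c)"
    proof -
      consider "\<alpha> < 1" | "\<alpha> = 1" | "1 < \<alpha>" by linarith
      thus ?thesis
      proof cases
        case 1
        have "cmod (char (distr P borel (\<epsilon> N)) \<theta> - 1) \<le> 2 * (C / real N * \<bar>\<theta>\<bar> powr \<alpha> * c 0 1)" if N: "1 \<le> N" for N \<theta>
        proof -
          have "char (distr P borel (\<epsilon> N)) \<theta> - 1 = (CLINT \<omega>|P. iexp (\<theta> * \<epsilon> N \<omega>) - 1)"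
            using iint[OF N] P.prob_space by (simp add: char[OF N] Bochner_Integration.integral_diff)
          thus ?thesis
            using bound[OF N, of 0 1 "\<lambda>y. iexp y - 1" \<theta>] 1 \<alpha> cmod_iexp_minus_1_le by simp
        qed
        thus ?thesis using c0[of 0 1] 1 \<alpha> by (intro exI[of _ "c 0 1"]) auto
      next
        case 2
        have "cmod (char (distr P borel (\<epsilon> N)) \<theta> - 1) \<le> 2 * (C / real N * \<bar>\<theta>\<bar> powr \<alpha> * c 0 2)" if N: "1 \<le> N" for N \<theta>
        proof -
          note [measurable] = meas[OF N]
          have "char (distr P borel (\<epsilon> N)) \<theta> = char (distr P borel (\<lambda>\<omega>. - \<epsilon> N \<omega>)) \<theta>"
            using sym 2 N by simp
          also have "\<dots> = (CLINT \<omega>|P. iexp ((-\<theta>) * \<epsilon> N \<omega>))"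
            by (simp add: char_def integral_distr)
          \<comment> \<open>By symmetry the values at theta and -theta coincide; their sum minus 2
            is the mean of twice cos - 1, which is quadratic near 0.\<close>
          finally have "2 * (char (distr P borel (\<epsilon> N)) \<theta> - 1) =
              (CLINT \<omega>|P. iexp (\<theta> * \<epsilon> N \<omega>)) + (CLINT \<omega>|P. iexp ((-\<theta>) * \<epsilon> N \<omega>)) - (CLINT \<omega>|P. 2)"
            using char[OF N, of \<theta>] P.prob_space by simp
          also have "\<dots> = (CLINT \<omega>|P. iexp (\<theta> * \<epsilon> N \<omega>) + iexp ((-\<theta>) * \<epsilon> N \<omega>) - 2)"
            using iint[OF N, of \<theta>] iint[OF N, of "-\<theta>"]
            by (subst Bochner_Integration.integral_diff) (auto simp: Bochner_Integration.integral_add)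
          also have "\<dots> = (CLINT \<omega>|P. 2 * complex_of_real (cos (\<theta> * \<epsilon> N \<omega>) - 1))"
            by (intro Bochner_Integration.integral_cong refl) (simp add: complex_eq_iff Re_exp Im_exp)
          also have "\<dots> = 2 * (CLINT \<omega>|P. complex_of_real (cos (\<theta> * \<epsilon> N \<omega>) - 1))"
            by (rule integral_mult_right_zero)
          finally have "char (distr P borel (\<epsilon> N)) \<theta> - 1 = (CLINT \<omega>|P. complex_of_real (cos (\<theta> * \<epsilon> N \<omega>) - 1))"
            by (simp only: mult_cancel_left) simp
          thus ?thesis
            using bound[OF N, of 0 2 "\<lambda>y. complex_of_real (cos y - 1)" \<theta>] 2 cos_minus_1_le
            by (simp del: of_real_diff)
        qed
        thus ?thesis using c0[of 0 2] 2 by (intro exI[of _ "c 0 2"]) auto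
      next
        case 3
        have "cmod (char (distr P borel (\<epsilon> N)) \<theta> - 1) \<le> 2 * (C / real N * \<bar>\<theta>\<bar> powr \<alpha> * c 1 2)" if N: "1 \<le> N" for N \<theta>
        proof -
          note [measurable] = meas[OF N]
          \<comment> \<open>The condition on the mean carries information only for integrable
            variables, since other integrals are 0 by convention. Integrability follows from y <= 1
            + min(y, y^2) and the tail bound.\<close>
          have i1: "integrable P (\<epsilon> N)"
          proof (rule integrableI_bounded)
            have "(\<integral>\<^sup>+\<omega>. ennreal (norm (\<epsilon> N \<omega>)) \<partial>P) \<le> (\<integral>\<^sup>+\<omega>. 1 + ennreal (min (\<bar>1 * \<epsilon> N \<omega>\<bar> ^ 1) (\<bar>1 * \<epsilon> N \<omega>\<bar> ^ 2)) \<partial>P)"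
            proof (intro nn_integral_mono)
              fix \<omega>
              have y: "y \<le> 1 + min y (y\<^sup>2)" if "0 \<le> y" for y :: real
                using that sum_squares_ge_zero[of "y - 1/2" 0] by (auto simp: min_def power2_eq_square algebra_simps)
              have "ennreal \<bar>\<epsilon> N \<omega>\<bar> \<le> ennreal (1 + min \<bar>\<epsilon> N \<omega>\<bar> (\<bar>\<epsilon> N \<omega>\<bar>\<^sup>2))"
                by (intro ennreal_leI y abs_ge_zero)
              thus "ennreal (norm (\<epsilon> N \<omega>)) \<le> 1 + ennreal (min (\<bar>1 * \<epsilon> N \<omega>\<bar> ^ 1) (\<bar>1 * \<epsilon> N \<omega>\<bar> ^ 2))"
                by (simp add: ennreal_plus)
            qed
            also have "\<dots> = 1 + (\<integral>\<^sup>+\<omega>. ennreal (min (\<bar>1 * \<epsilon> N \<omega>\<bar> ^ 1) (\<bar>1 * \<epsilon> N \<omega>\<bar> ^ 2)) \<partial>P)"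
              by (subst nn_integral_add) (auto simp: P.emeasure_space_1)
            also have "\<dots> \<le> 1 + ennreal (C / real N * \<bar>1\<bar> powr \<alpha> * c 1 2)"
              using 3 \<alpha> by (intro add_mono nn N) auto
            also have "\<dots> < \<infinity>" by simp
            finally show "(\<integral>\<^sup>+\<omega>. ennreal (norm (\<epsilon> N \<omega>)) \<partial>P) < \<infinity>" .
          qed measurable
          have i1': "complex_integrable P (\<lambda>\<omega>. \<i> * (\<theta> * \<epsilon> N \<omega>))"
            using i1 by (intro integrable_mult_right integrable_of_real) auto
          have "(CLINT \<omega>|P. \<i> * (\<theta> * \<epsilon> N \<omega>)) = \<i> * (\<theta> * (LINT \<omega>|P. \<epsilon> N \<omega>))"
            by simp
          hence "char (distr P borel (\<epsilon> N)) \<theta> - 1 = (CLINT \<omega>|P. iexp (\<theta> * \<epsilon> N \<omega>) - 1 - \<i> * complex_of_real (\<theta> * \<epsilon> N \<omega>))"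
            using N iint[OF N] i1' mean 3 P.prob_space by (simp add: char Bochner_Integration.integral_diff)
          thus ?thesis
            using bound[OF N, of 1 2 "\<lambda>y. iexp y - 1 - \<i> * complex_of_real y" \<theta>] 3 \<alpha> cmod_iexp_minus_1_minus_linear_le
            by (simp del: of_real_mult)
        qed
        thus ?thesis using c0[of 1 2] 3 \<alpha> by (intro exI[of _ "c 1 2"]) auto
      qed
    qed
    then obtain c where "0 \<le> c"
      "\<And>N \<theta>. 1 \<le> N \<Longrightarrow> cmod (char (distr P borel (\<epsilon> N)) \<theta> - 1) \<le> 2 * (C / real N * \<bar>\<theta>\<bar> powr \<alpha> * c)" by blast
    thus ?thesis using \<open>0 \<le> C\<close>
      by (intro exI[of _ "2 * C * c"]) (auto simp: mult_ac)
  qed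
qed

section \<open>The limiting exponent\<close>

lemma integral_PiM_iexp_sum:
  fixes M :: "'i \<Rightarrow> real measure"
  assumes I: "finite I" and M: "\<And>i. i \<in> I \<Longrightarrow> real_distribution (M i)"
  shows "(CLINT x|PiM I M. iexp (\<Sum>i\<in>I. c i * x i)) = (\<Prod>i\<in>I. char (M i) (c i))"
proof -
  \<comment> \<open>\<open>product_prob_space\<close> wants a probability measure at every index, so
    indices outside \<open>I\<close> receive a point mass.\<close>
  define M' where "M' i = (if i \<in> I then M i else return borel 0)" for i
  have M': "real_distribution (M' i)" for i
    using M by (auto simp: M'_def real_distribution_def real_distribution_axioms_def prob_space_return)
  interpret product_prob_space M' I
    using M' by (intro product_prob_spaceI) (simp add: real_distribution_def)
  have "(CLINT x|PiM I M. iexp (\<Sum>i\<in>I. c i * x i)) = (CLINT x|PiM I M'. iexp (\<Sum>i\<in>I. c i * x i))"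
    by (intro arg_cong2[where f = "integral\<^sup>L"] PiM_cong refl) (auto simp: M'_def)
  also have "\<dots> = (CLINT x|PiM I M'. (\<Prod>i\<in>I. iexp (c i * x i)))"
    using I by (intro Bochner_Integration.integral_cong refl) (simp add: exp_sum sum_distrib_left)
  also have "\<dots> = (\<Prod>i\<in>I. CLINT y|M' i. iexp (c i * y))"
  proof (rule product_integral_prod[OF I])
    fix i assume "i \<in> I"
    have ps: "prob_space (M' i)" using M' by (simp add: real_distribution_def)
    have sets: "sets (M' i) = sets borel"
      using M'[of i] by (simp add: real_distribution_def real_distribution_axioms_def)
    show "complex_integrable (M' i) (\<lambda>y. iexp (c i * y))"
      using ps by (rule prob_space.integrable_iexp) (simp_all add: measurable_cong_sets[OF sets refl])
  qed
  also have "\<dots> = (\<Prod>i\<in>I. char (M i) (c i))"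
    by (intro prod.cong refl) (auto simp: M'_def char_def)
  finally show ?thesis .
qed

text \<open>Realises powers of a characteristic function as characteristic functions, so that
  general inequalities such as \<open>char_modulus\<close> apply to the powers.\<close>

lemma convolution_power_exists:
  assumes \<mu>: "real_distribution \<mu>"
  obtains \<nu> where "real_distribution \<nu>" "\<And>\<theta>. char \<nu> \<theta> = char \<mu> \<theta> ^ m"
proof -
  interpret real_distribution \<mu> by fact
  define Q where "Q = PiM {..<m} (\<lambda>_. \<mu>)"
  interpret Q: prob_space Q unfolding Q_def by (intro prob_space_PiM prob_space_axioms)
  have [measurable]: "(\<lambda>x. \<Sum>i<m. x i) \<in> borel_measurable Q"
    unfolding Q_def by (intro borel_measurable_sum) (auto intro: measurable_compose[OF measurable_component_singleton])
  define \<nu> where "\<nu> = distr Q borel (\<lambda>x. \<Sum>i<m. x i)"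
  have "real_distribution \<nu>" unfolding \<nu>_def by (intro Q.real_distribution_distr) measurable
  moreover have "char \<nu> \<theta> = char \<mu> \<theta> ^ m" for \<theta>
  proof -
    have "char \<nu> \<theta> = (CLINT x|Q. iexp (\<Sum>i<m. \<theta> * x i))"
      by (simp add: char_def \<nu>_def integral_distr sum_distrib_left)
    also have "\<dots> = char \<mu> \<theta> ^ m"
      unfolding Q_def using \<mu> by (subst integral_PiM_iexp_sum) auto
    finally show ?thesis .
  qed
  ultimately show ?thesis by (rule that)
qed

text \<open>The difference is at most E|e^(itX) - e^(isX)|, and the square of this mean is at most
  the mean of the square, 2 - 2 Re char(t - s). Closeness to 1 near 0 therefore controls the
  oscillation everywhere.\<close>

lemma char_modulus:
  assumes "real_distribution \<mu>"
  shows "cmod (char \<mu> t - char \<mu> s) \<le> sqrt (2 * cmod (char \<mu> (t - s) - 1))"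
proof -
  interpret real_distribution \<mu> by fact
  define Z where "Z x = cmod (iexp (t * x) - iexp (s * x))" for x
  have Z2: "(Z x)\<^sup>2 = 2 - 2 * Re (iexp ((t - s) * x))" for x
  proof -
    have "(Z x)\<^sup>2 = (cos (t * x) - cos (s * x))\<^sup>2 + (sin (t * x) - sin (s * x))\<^sup>2"
      by (simp add: Z_def cmod_power2 Re_exp Im_exp)
    also have "\<dots> = ((cos (t * x))\<^sup>2 + (sin (t * x))\<^sup>2) + ((cos (s * x))\<^sup>2 + (sin (s * x))\<^sup>2)
        - 2 * (cos (t * x) * cos (s * x) + sin (t * x) * sin (s * x))"
      by (simp only: power2_diff) algebra
    also have "\<dots> = 2 - 2 * cos (t * x - s * x)"
      by (simp add: cos_diff)
    finally show ?thesis by (simp add: Re_exp algebra_simps)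
  qed
  have int1: "complex_integrable \<mu> (\<lambda>x. iexp (t * x))" for t by (intro integrable_iexp) auto
  have Zb: "Z x \<le> 2" "0 \<le> Z x" for x
    unfolding Z_def by (auto intro: order_trans[OF norm_triangle_ineq4])
  have [measurable]: "Z \<in> borel_measurable \<mu>" unfolding Z_def by measurable
  have iZ: "integrable \<mu> Z"
    by (intro integrable_const_bound[where B = 2]) (use Zb in auto)
  have iZ2: "integrable \<mu> (\<lambda>x. (Z x)\<^sup>2)"
  proof (intro integrable_const_bound[where B = "2\<^sup>2"] AE_I2)
    show "norm ((Z x)\<^sup>2) \<le> 2\<^sup>2" for x
      using power_mono[OF Zb, of x 2] by simp
  qed measurable
  have "cmod (char \<mu> t - char \<mu> s) = cmod (CLINT x|\<mu>. iexp (t * x) - iexp (s * x))"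
    using int1[of t] int1[of s] by (simp add: char_def)
  also have "\<dots> \<le> (LINT x|\<mu>. Z x)"
    unfolding Z_def by (rule integral_norm_bound)
  finally have 1: "cmod (char \<mu> t - char \<mu> s) \<le> expectation Z" .
  have "(expectation Z)\<^sup>2 \<le> expectation (\<lambda>x. (Z x)\<^sup>2)"
    using variance_eq[OF iZ iZ2] variance_positive[of Z] by simp
  also have "\<dots> = 2 - 2 * Re (char \<mu> (t - s))"
  proof -
    have "expectation (\<lambda>x. 2 - 2 * Re (iexp ((t - s) * x))) = expectation (\<lambda>x. 2) - expectation (\<lambda>x. 2 * Re (iexp ((t - s) * x)))"
      by (intro Bochner_Integration.integral_diff integrable_mult_right integrable_Re int1) auto
    also have "expectation (\<lambda>x. 2 * Re (iexp ((t - s) * x))) = 2 * Re (char \<mu> (t - s))"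
      unfolding char_def integral_Re[OF int1, symmetric] by (rule integral_mult_right_zero)
    finally show ?thesis using prob_space by (simp add: Z2)
  qed
  also have "\<dots> \<le> 2 * cmod (char \<mu> (t - s) - 1)"
    using abs_Re_le_cmod[of "char \<mu> (t - s) - 1"] by simp
  finally have "expectation Z \<le> sqrt (2 * cmod (char \<mu> (t - s) - 1))"
    by (rule real_le_rsqrt)
  with 1 show ?thesis by simp
qed

text \<open>\<open>exp (d s)\<close> stays in the open right half-plane, so Im d never meets pi/2 or
  -pi/2. The image of the interval under Im d is connected and contains 0, hence it lies strictly
  between these values, where the principal branch inverts \<open>exp\<close>.\<close>

lemma continuous_lift_eq_Ln:
  fixes d :: "real \<Rightarrow> complex"
  assumes d: "continuous_on {-R..R} d" "d 0 = 0" and t: "t \<in> {-R..R}"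
    and lt: "\<And>s. s \<in> {-R..R} \<Longrightarrow> cmod (exp (d s) - 1) < 1"
  shows "d t = Ln (exp (d t))"
proof -
  have Re: "0 < Re (exp (d s))" if "s \<in> {-R..R}" for s
    using lt[OF that] abs_Re_le_cmod[of "exp (d s) - 1"] by simp
  have "connected ((\<lambda>s. Im (d s)) ` {-R..R})"
    by (intro connected_continuous_image continuous_intros d) auto
  note Icc = connected_contains_Icc[OF this]
  have "0 \<in> (\<lambda>s. Im (d s)) ` {-R..R}" using t d(2) by (intro image_eqI[of _ _ 0]) auto
  moreover have "Im (d t) \<in> (\<lambda>s. Im (d s)) ` {-R..R}" using t by (rule imageI)
  ultimately have "{0..Im (d t)} \<subseteq> (\<lambda>s. Im (d s)) ` {-R..R}" "{Im (d t)..0} \<subseteq> (\<lambda>s. Im (d s)) ` {-R..R}"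
    using Icc by blast+
  hence conn: "c \<in> (\<lambda>s. Im (d s)) ` {-R..R}" if "0 \<le> c \<and> c \<le> Im (d t) \<or> Im (d t) \<le> c \<and> c \<le> 0" for c
    using that by (meson atLeastAtMost_iff subsetD)
  have no: "\<bar>c\<bar> \<noteq> pi / 2" if "c \<in> (\<lambda>s. Im (d s)) ` {-R..R}" for c
  proof
    assume c: "\<bar>c\<bar> = pi / 2"
    obtain s where s: "s \<in> {-R..R}" "c = Im (d s)" using \<open>c \<in> _\<close> by auto
    have "cos c = cos \<bar>c\<bar>" by simp
    hence "cos c = 0" using c by simp
    thus False using Re[OF s(1)] s(2) by (simp add: Re_exp)
  qed
  have "\<bar>Im (d t)\<bar> < pi / 2"
  proof (rule ccontr)
    assume "\<not> \<bar>Im (d t)\<bar> < pi / 2"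
    hence "pi / 2 \<le> Im (d t) \<or> Im (d t) \<le> - (pi / 2)" by linarith
    thus False
    proof
      assume "pi / 2 \<le> Im (d t)"
      from no[OF conn[of "pi / 2"]] this show False by simp
    next
      assume "Im (d t) \<le> - (pi / 2)"
      from no[OF conn[of "- (pi / 2)"]] this show False by simp
    qed
  qed
  hence "- pi < Im (d t)" "Im (d t) \<le> pi" using pi_gt_zero by linarith+
  thus ?thesis by (simp add: Ln_exp)
qed

text \<open>\<open>bound\<close> is all that is retained from membership in the class T; later
  estimates use it in place of tail and moment conditions. Continuity of \<open>V\<close> together
  with \<open>V 0 = 0\<close> selects the distinguished logarithm of the limit.\<close>

locale char_sequence =
  fixes \<mu> :: "nat \<Rightarrow> real measure" and V :: "real \<Rightarrow> complex" and K \<alpha> :: real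
  assumes dist: "\<And>N. 1 \<le> N \<Longrightarrow> real_distribution (\<mu> N)"
    and \<alpha>: "0 < \<alpha>" "\<alpha> \<le> 2" and K: "0 \<le> K"
    and bound: "\<And>N \<theta>. 1 \<le> N \<Longrightarrow> cmod (char (\<mu> N) \<theta> - 1) \<le> K * \<bar>\<theta>\<bar> powr \<alpha> / real N"
    and V: "continuous_on UNIV V" "V 0 = 0"
    and lim: "\<And>\<theta>. (\<lambda>N. char (\<mu> N) \<theta> ^ N) \<longlonglongrightarrow> exp (V \<theta>)"
begin

lemma power_bound:
  assumes "1 \<le> N"
  shows "cmod (char (\<mu> N) \<theta> ^ m - 1) \<le> real m / real N * K * \<bar>\<theta>\<bar> powr \<alpha>"
proof -
  interpret real_distribution "\<mu> N" using dist assms by auto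
  have "cmod (char (\<mu> N) \<theta> ^ m - 1 ^ m) \<le> real m * cmod (char (\<mu> N) \<theta> - 1)"
    by (rule norm_power_diff) (auto simp: cmod_char_le_1)
  also have "\<dots> \<le> real m * (K * \<bar>\<theta>\<bar> powr \<alpha> / real N)"
    by (intro mult_left_mono bound assms) auto
  finally show ?thesis by simp
qed

text \<open>The modulus is the same for all N: the factor N produced by the power cancels the 1 / N
  in \<open>bound\<close>.\<close>

lemma power_modulus:
  assumes "1 \<le> N"
  shows "cmod (char (\<mu> N) t ^ N - char (\<mu> N) s ^ N) \<le> sqrt (2 * K * \<bar>t - s\<bar> powr \<alpha>)"
proof -
  obtain \<nu> where \<nu>: "real_distribution \<nu>" "\<And>\<theta>. char \<nu> \<theta> = char (\<mu> N) \<theta> ^ N"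
    using convolution_power_exists[OF dist[OF assms]] by blast
  have "cmod (char \<nu> t - char \<nu> s) \<le> sqrt (2 * cmod (char \<nu> (t - s) - 1))"
    by (rule char_modulus[OF \<nu>(1)])
  also have "\<dots> \<le> sqrt (2 * K * \<bar>t - s\<bar> powr \<alpha>)"
    using power_bound[OF assms, of "t - s" N] assms by (auto simp: \<nu>)
  finally show ?thesis by (simp add: \<nu>)
qed

text \<open>Pointwise convergence and a common modulus of continuity, inherited by the limit, give
  uniform convergence on compact intervals: comparing through a finite net costs three times eta /
  3.\<close>

lemma power_uniform:
  assumes \<eta>: "0 < \<eta>"
  shows "eventually (\<lambda>N. \<forall>t\<in>{-R..R}. cmod (char (\<mu> N) t ^ N - exp (V t)) < \<eta>) sequentially"
proof -
  have "((\<lambda>h. sqrt (2 * K * \<bar>h\<bar> powr \<alpha>)) \<longlongrightarrow> sqrt (2 * K * \<bar>0\<bar> powr \<alpha>)) (at 0)"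
    using \<alpha> by (intro tendsto_intros tendsto_powr2) auto
  hence "eventually (\<lambda>h. sqrt (2 * K * \<bar>h\<bar> powr \<alpha>) < \<eta> / 3) (at 0)"
    using \<eta> by (intro order_tendstoD(2)) auto
  then obtain \<delta> where \<delta>: "0 < \<delta>" "\<And>h. h \<noteq> 0 \<Longrightarrow> \<bar>h\<bar> < \<delta> \<Longrightarrow> sqrt (2 * K * \<bar>h\<bar> powr \<alpha>) < \<eta> / 3"
    by (auto simp: eventually_at dist_real_def)
  have mod: "sqrt (2 * K * \<bar>t - s\<bar> powr \<alpha>) < \<eta> / 3" if "\<bar>t - s\<bar> < \<delta>" for t s
    using \<delta>(2)[of "t - s"] that \<eta> by (cases "t = s") auto
  have modV: "cmod (exp (V t) - exp (V s)) \<le> sqrt (2 * K * \<bar>t - s\<bar> powr \<alpha>)" for t s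
  proof (rule LIMSEQ_le_const2)
    show "(\<lambda>N. cmod (char (\<mu> N) t ^ N - char (\<mu> N) s ^ N)) \<longlonglongrightarrow> cmod (exp (V t) - exp (V s))"
      by (intro tendsto_intros lim)
    show "\<exists>n. \<forall>N\<ge>n. cmod (char (\<mu> N) t ^ N - char (\<mu> N) s ^ N) \<le> sqrt (2 * K * \<bar>t - s\<bar> powr \<alpha>)"
      using power_modulus by blast
  qed
  obtain G where G: "finite G" "{-R..R} \<subseteq> (\<Union>x\<in>G. ball x \<delta>)"
    using seq_compact_imp_totally_bounded[OF compact_imp_seq_compact[OF compact_Icc[of "-R" R]]] \<delta>(1) by blast
  have "eventually (\<lambda>N. \<forall>g\<in>G. cmod (char (\<mu> N) g ^ N - exp (V g)) < \<eta> / 3) sequentially"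
  proof (intro eventually_ball_finite ballI G(1))
    fix g
    have "0 < \<eta> / 3" using \<eta> by simp
    from tendstoD[OF lim this] show "eventually (\<lambda>N. cmod (char (\<mu> N) g ^ N - exp (V g)) < \<eta> / 3) sequentially"
      by (simp only: dist_norm)
  qed
  with eventually_ge_at_top[of 1] show ?thesis
  proof eventually_elim
    case (elim N)
    show ?case
    proof
      fix t assume "t \<in> {-R..R}"
      then obtain g where g: "g \<in> G" "\<bar>t - g\<bar> < \<delta>" using G(2) by (force simp: dist_real_def)
      have "cmod (char (\<mu> N) t ^ N - exp (V t)) \<le> cmod (char (\<mu> N) t ^ N - char (\<mu> N) g ^ N) +
          (cmod (char (\<mu> N) g ^ N - exp (V g)) + cmod (exp (V t) - exp (V g)))"
        using norm_triangle_ineq[of "char (\<mu> N) t ^ N - char (\<mu> N) g ^ N" "char (\<mu> N) g ^ N - exp (V t)"]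
          norm_triangle_ineq4[of "char (\<mu> N) g ^ N - exp (V g)" "exp (V t) - exp (V g)"] by simp
      moreover have "cmod (char (\<mu> N) t ^ N - char (\<mu> N) g ^ N) < \<eta> / 3"
        using power_modulus[of N t g] elim(1) mod[OF g(2)] by linarith
      moreover have "cmod (exp (V t) - exp (V g)) < \<eta> / 3"
        using modV[of t g] mod[OF g(2)] by linarith
      ultimately show "cmod (char (\<mu> N) t ^ N - exp (V t)) < \<eta>" using elim(2) g(1) by fastforce
    qed
  qed
qed

lemma small_bound:
  "eventually (\<lambda>N. 1 \<le> N \<and> (\<forall>t\<in>{-R..R}. cmod (char (\<mu> N) t - 1) < 1 / 2)) sequentially"
proof -
  have "(\<lambda>N. K * \<bar>R\<bar> powr \<alpha> / real N) \<longlonglongrightarrow> 0"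
    by (rule lim_const_over_n)
  hence "eventually (\<lambda>N. K * \<bar>R\<bar> powr \<alpha> / real N < 1 / 2) sequentially"
    by (rule order_tendstoD) simp
  with eventually_ge_at_top[of 1] show ?thesis
  proof eventually_elim
    case (elim N)
    have "cmod (char (\<mu> N) t - 1) < 1 / 2" if "t \<in> {-R..R}" for t
    proof -
      have "cmod (char (\<mu> N) t - 1) \<le> K * \<bar>t\<bar> powr \<alpha> / real N" by (rule bound[OF elim(1)])
      also have "\<dots> \<le> K * \<bar>R\<bar> powr \<alpha> / real N"
        using K \<alpha> that by (intro divide_right_mono mult_left_mono powr_mono2) auto
      finally show ?thesis using elim by linarith
    qed
    with elim show ?case by blast
  qed
qed

text \<open>Both \<open>N Ln (char (\<mu> N))\<close> and \<open>V\<close> are continuous logarithms vanishing at 0, so they can be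
  compared through their exponentials.\<close>

lemma Ln_tendsto: "(\<lambda>N. of_nat N * Ln (char (\<mu> N) \<theta>)) \<longlonglongrightarrow> V \<theta>"
proof -
  define R where "R = \<bar>\<theta>\<bar>"
  have \<theta>: "\<theta> \<in> {-R..R}" by (auto simp: R_def)
  define d where "d N t = of_nat N * Ln (char (\<mu> N) t) - V t" for N t
  have "continuous_on {-R..R} (\<lambda>t. cmod (exp (- V t)))"
    by (intro continuous_intros continuous_on_subset[OF V(1)]) auto
  hence "bounded ((\<lambda>t. cmod (exp (- V t))) ` {-R..R})"
    by (intro compact_imp_bounded compact_continuous_image) auto
  then obtain B where B: "0 < B" "\<And>t. t \<in> {-R..R} \<Longrightarrow> cmod (exp (- V t)) \<le> B"
    by (auto simp: bounded_pos)
  \<comment> \<open>With tolerance 1 / B the number exp(d N t) - 1, equal to (char^N - exp V)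
    exp(-V), has modulus below 1, as \<open>continuous_lift_eq_Ln\<close> demands.\<close>
  have B': "0 < 1 / B" using B by simp
  have ev: "eventually (\<lambda>N. d N \<theta> = Ln (exp (d N \<theta>)) \<and> exp (d N \<theta>) = char (\<mu> N) \<theta> ^ N / exp (V \<theta>)) sequentially"
    using small_bound[of R] power_uniform[OF B', of R]
  proof eventually_elim
    case (elim N)
    hence "1 \<le> N" by simp
    then interpret real_distribution "\<mu> N" using dist by simp
    have nz: "char (\<mu> N) t \<noteq> 0" "Re (char (\<mu> N) t) > 0" if "t \<in> {-R..R}" for t
    proof -
      have "cmod (char (\<mu> N) t - 1) < 1 / 2" using elim that by blast
      with abs_Re_le_cmod[of "char (\<mu> N) t - 1"] show "Re (char (\<mu> N) t) > 0" by simp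
      thus "char (\<mu> N) t \<noteq> 0" by auto
    qed
    have ed: "exp (d N t) = char (\<mu> N) t ^ N / exp (V t)" if "t \<in> {-R..R}" for t
      using nz[OF that] by (simp add: d_def exp_diff exp_of_nat_mult)
    have "continuous_on {-R..R} (\<lambda>t. Ln (char (\<mu> N) t))"
    proof (rule continuous_on_Ln')
      show "continuous_on {-R..R} (char (\<mu> N))"
        using isCont_char by (simp add: continuous_at_imp_continuous_on)
      show "char (\<mu> N) t \<notin> \<real>\<^sub>\<le>\<^sub>0" if "t \<in> {-R..R}" for t
        using nz[OF that] by (auto simp: complex_nonpos_Reals_iff)
    qed
    hence cont: "continuous_on {-R..R} (d N)"
      unfolding d_def
      by (intro continuous_on_diff continuous_on_mult continuous_on_const continuous_on_subset[OF V(1)]) auto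
    have lt: "cmod (exp (d N t) - 1) < 1" if t: "t \<in> {-R..R}" for t
    proof -
      have "exp (d N t) - 1 = (char (\<mu> N) t ^ N - exp (V t)) * exp (- V t)"
        by (simp add: ed[OF t] exp_minus field_simps)
      hence "cmod (exp (d N t) - 1) = cmod (char (\<mu> N) t ^ N - exp (V t)) * cmod (exp (- V t))"
        by (simp add: norm_mult)
      also have "\<dots> \<le> cmod (char (\<mu> N) t ^ N - exp (V t)) * B"
        by (intro mult_left_mono B t) auto
      also have "\<dots> < 1 / B * B"
        using elim t B by (intro mult_strict_right_mono) auto
      finally show ?thesis using B by simp
    qed
    have d0: "d N 0 = 0" using V by (simp add: d_def char_zero)
    show ?case
      using continuous_lift_eq_Ln[OF cont d0 \<theta> lt] ed[OF \<theta>] by simp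
  qed
  have "(\<lambda>N. Ln (char (\<mu> N) \<theta> ^ N / exp (V \<theta>))) \<longlonglongrightarrow> Ln (exp (V \<theta>) / exp (V \<theta>))"
    by (intro tendsto_intros lim) auto
  hence "(\<lambda>N. Ln (char (\<mu> N) \<theta> ^ N / exp (V \<theta>))) \<longlonglongrightarrow> 0" by simp
  hence "(\<lambda>N. d N \<theta>) \<longlonglongrightarrow> 0"
    by (rule Lim_transform_eventually) (use ev in \<open>auto elim!: eventually_mono\<close>)
  thus ?thesis by (simp add: d_def LIM_zero_iff)
qed

text \<open>Ln(1 + z) - z is of order |z|^2 and z is of order 1 / N, so even after multiplication by
  N the difference to the logarithmic form vanishes.\<close>

lemma diff_tendsto: "(\<lambda>N. of_nat N * (char (\<mu> N) \<theta> - 1)) \<longlonglongrightarrow> V \<theta>"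
proof -
  define z where "z N = char (\<mu> N) \<theta> - 1" for N
  have "(\<lambda>N. of_nat N * (Ln (1 + z N) - z N)) \<longlonglongrightarrow> 0"
  proof (rule Lim_null_comparison)
    show "(\<lambda>N. 2 * (K * \<bar>\<theta>\<bar> powr \<alpha>)\<^sup>2 / real N) \<longlonglongrightarrow> 0"
      by (rule lim_const_over_n)
    show "eventually (\<lambda>N. norm (of_nat N * (Ln (1 + z N) - z N)) \<le> 2 * (K * \<bar>\<theta>\<bar> powr \<alpha>)\<^sup>2 / real N) sequentially"
      using small_bound[of "\<bar>\<theta>\<bar>"]
    proof eventually_elim
      case (elim N)
      have "\<theta> \<in> {-\<bar>\<theta>\<bar>..\<bar>\<theta>\<bar>}" by auto
      hence z: "cmod (z N) < 1 / 2" and N: "1 \<le> N" using elim unfolding z_def by blast+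
      have "cmod (Ln (1 + z N) - z N) \<le> (cmod (z N))\<^sup>2 / (1 - cmod (z N))"
        by (rule Ln_approx_linear) (use z in simp)
      also have "\<dots> \<le> (cmod (z N))\<^sup>2 / (1 / 2)"
        using z by (intro divide_left_mono) auto
      also have "\<dots> = 2 * (cmod (z N))\<^sup>2" by simp
      also have "\<dots> \<le> 2 * (K * \<bar>\<theta>\<bar> powr \<alpha> / real N)\<^sup>2"
        using bound[OF N, of \<theta>] by (intro mult_left_mono power_mono) (auto simp: z_def)
      finally have "real N * cmod (Ln (1 + z N) - z N) \<le> real N * (2 * (K * \<bar>\<theta>\<bar> powr \<alpha> / real N)\<^sup>2)"
        by (intro mult_left_mono) auto
      also have "\<dots> = 2 * (K * \<bar>\<theta>\<bar> powr \<alpha>)\<^sup>2 / real N"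
        using N by (simp add: power2_eq_square field_simps)
      finally show ?case by (simp add: norm_mult)
    qed
  qed
  from tendsto_diff[OF Ln_tendsto this, of \<theta>] show ?thesis
    by (simp add: z_def algebra_simps)
qed

lemma V_bound: "cmod (V \<theta>) \<le> K * \<bar>\<theta>\<bar> powr \<alpha>"
proof (rule LIMSEQ_le_const2)
  show "(\<lambda>N. cmod (of_nat N * (char (\<mu> N) \<theta> - 1))) \<longlonglongrightarrow> cmod (V \<theta>)"
    by (rule tendsto_norm[OF diff_tendsto])
  show "\<exists>n. \<forall>N\<ge>n. cmod (of_nat N * (char (\<mu> N) \<theta> - 1)) \<le> K * \<bar>\<theta>\<bar> powr \<alpha>"
  proof (intro exI[of _ 1] allI impI)
    fix N :: nat assume N: "1 \<le> N"
    have "cmod (of_nat N * (char (\<mu> N) \<theta> - 1)) = real N * cmod (char (\<mu> N) \<theta> - 1)"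
      by (simp only: norm_mult norm_of_nat)
    also have "\<dots> \<le> real N * (K * \<bar>\<theta>\<bar> powr \<alpha> / real N)"
      by (intro mult_left_mono bound N) auto
    finally show "cmod (of_nat N * (char (\<mu> N) \<theta> - 1)) \<le> K * \<bar>\<theta>\<bar> powr \<alpha>" using N by simp
  qed
qed

lemma V_Re: "Re (V \<theta>) \<le> 0"
proof (rule LIMSEQ_le_const2)
  show "(\<lambda>N. Re (of_nat N * (char (\<mu> N) \<theta> - 1))) \<longlonglongrightarrow> Re (V \<theta>)"
    by (rule tendsto_Re[OF diff_tendsto])
  show "\<exists>n. \<forall>N\<ge>n. Re (of_nat N * (char (\<mu> N) \<theta> - 1)) \<le> 0"
  proof (intro exI[of _ 1] allI impI)
    fix N :: nat assume "1 \<le> N"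
    then interpret real_distribution "\<mu> N" using dist by simp
    have "Re (char (\<mu> N) \<theta>) \<le> 1"
      using cmod_char_le_1[of \<theta>] complex_Re_le_cmod[of "char (\<mu> N) \<theta>"] by linarith
    thus "Re (of_nat N * (char (\<mu> N) \<theta> - 1)) \<le> 0" by (simp add: mult_nonneg_nonpos)
  qed
qed

text \<open>Convolving \<open>\<mu> N\<close> with itself as often as the integer part of c N says
  gives a characteristic function that tends to exp(c V), by the convergence of the logarithms. The
  bound on the powers gives a common tail bound, so these laws are tight, and a subsequential weak
  limit is the law sought.\<close>

lemma exp_scaled_exists:
  assumes c: "0 \<le> c"
  shows "\<exists>\<nu>. real_distribution \<nu> \<and> (\<forall>\<theta>. char \<nu> \<theta> = exp (of_real c * V \<theta>))"
proof -
  define m where "m N = nat \<lfloor>c * real N\<rfloor>" for N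
  have m: "real (m N) \<le> c * real N" for N using c by (simp add: m_def)
  \<comment> \<open>\<open>Suc N\<close> throughout, because the hypotheses on
    \<open>\<mu> N\<close> start at N = 1.\<close>
  have "\<exists>\<nu>. real_distribution \<nu> \<and> (\<forall>\<theta>. char \<nu> \<theta> = char (\<mu> (Suc N)) \<theta> ^ m (Suc N))" for N
  proof -
    have "real_distribution (\<mu> (Suc N))" by (rule dist) simp
    then obtain \<nu> where "real_distribution \<nu>" "\<And>\<theta>. char \<nu> \<theta> = char (\<mu> (Suc N)) \<theta> ^ m (Suc N)"
      by (rule convolution_power_exists[where m = "m (Suc N)"]) blast
    thus ?thesis by blast
  qed
  hence "\<forall>N. \<exists>\<nu>. real_distribution \<nu> \<and> (\<forall>\<theta>. char \<nu> \<theta> = char (\<mu> (Suc N)) \<theta> ^ m (Suc N))" by blast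
  from choice[OF this] obtain \<nu> where \<nu>: "\<And>N. real_distribution (\<nu> N)"
    "\<And>N \<theta>. char (\<nu> N) \<theta> = char (\<mu> (Suc N)) \<theta> ^ m (Suc N)" by blast
  have tail: "measure (\<nu> N) {x. y < \<bar>x\<bar>} \<le> 6 * (c * K) * y powr (-\<alpha>)" if y: "0 < y" for N y
  proof -
    interpret real_distribution "\<nu> N" by (rule \<nu>)
    have "distr (\<nu> N) borel (\<lambda>x. x) = \<nu> N"
      using distr_id2[of borel "\<nu> N"] by (simp add: id_def)
    moreover have "cmod (char (\<nu> N) \<theta> - 1) \<le> c * K * \<bar>\<theta>\<bar> powr \<alpha>" for \<theta>
    proof -
      have "cmod (char (\<nu> N) \<theta> - 1) \<le> real (m (Suc N)) / real (Suc N) * (K * \<bar>\<theta>\<bar> powr \<alpha>)"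
        using power_bound[of "Suc N" \<theta> "m (Suc N)"] by (simp add: \<nu> mult_ac)
      also have "\<dots> \<le> c * (K * \<bar>\<theta>\<bar> powr \<alpha>)"
        using m[of "Suc N"] K by (intro mult_right_mono) (auto simp: field_simps)
      finally show ?thesis by (simp add: mult_ac)
    qed
    ultimately show ?thesis
      using tail_bound_char[of "\<nu> N" "\<lambda>x. x" \<alpha> "c * K" y] \<alpha> K c y prob_space_axioms by simp
  qed
  have "tight \<nu>"
    unfolding tight_def
  proof (intro conjI allI impI \<nu>)
    fix e :: real assume e: "0 < e"
    have "((\<lambda>y. 6 * (c * K) * y powr (-\<alpha>)) \<longlongrightarrow> 6 * (c * K) * 0) at_top"
      using \<alpha> by (intro tendsto_intros tendsto_neg_powr filterlim_ident) auto
    hence "eventually (\<lambda>y. 6 * (c * K) * y powr (-\<alpha>) < e) at_top"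
      using e by (intro order_tendstoD(2)) auto
    with eventually_gt_at_top[of 0] have "eventually (\<lambda>y. 0 < y \<and> 6 * (c * K) * y powr (-\<alpha>) < e) at_top"
      by eventually_elim auto
    then obtain y where y: "0 < y" "6 * (c * K) * y powr (-\<alpha>) < e"
      unfolding eventually_at_top_linorder by blast
    \<comment> \<open>Doubling y makes room for the half-open interval in the definition of
      \<open>tight\<close>.\<close>
    have "1 - e < measure (\<nu> N) {-(2*y)<..2*y}" for N
    proof -
      interpret real_distribution "\<nu> N" by (rule \<nu>)
      have "1 = prob (- {x. y < \<bar>x\<bar>}) + prob {x. y < \<bar>x\<bar>}"
        using prob_compl[of "{x. y < \<bar>x\<bar>}"] by (simp add: Compl_eq_Diff_UNIV)
      moreover have "prob (- {x. y < \<bar>x\<bar>}) \<le> prob {-(2*y)<..2*y}"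
        using y by (intro finite_measure_mono) auto
      ultimately show ?thesis using tail[OF y(1), of N] y(2) by linarith
    qed
    thus "\<exists>a b. a < b \<and> (\<forall>n. 1 - e < measure (\<nu> n) {a<..b})"
      using y by (intro exI[of _ "-(2*y)"] exI[of _ "2*y"]) auto
  qed
  then obtain r M where M: "strict_mono r" "real_distribution M" "weak_conv_m (\<nu> \<circ> id \<circ> r) M"
    using tight_imp_convergent_subsubsequence[of \<nu> id] by (auto simp: strict_mono_id)
  have "char M \<theta> = exp (of_real c * V \<theta>)" for \<theta>
  proof -
    have "(\<lambda>N. real (m N) / real N) \<longlonglongrightarrow> c"
    proof (rule tendsto_sandwich)
      show "eventually (\<lambda>N. c - 1 / real N \<le> real (m N) / real N) sequentially"
        using eventually_gt_at_top[of 0]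
      proof eventually_elim
        case (elim N)
        have "c * real N - 1 \<le> real (m N)" using c by (simp add: m_def)
        hence "(c * real N - 1) / real N \<le> real (m N) / real N" by (intro divide_right_mono) auto
        thus ?case using elim by (simp add: diff_divide_distrib)
      qed
      show "eventually (\<lambda>N. real (m N) / real N \<le> c) sequentially"
        using eventually_gt_at_top[of 0] by eventually_elim (use m in \<open>simp add: field_simps\<close>)
      show "(\<lambda>N. c - 1 / real N) \<longlonglongrightarrow> c"
        using tendsto_diff[OF tendsto_const lim_const_over_n[of 1], of c] by simp
    qed auto
    hence "(\<lambda>N. complex_of_real (real (m N) / real N) * (of_nat N * Ln (char (\<mu> N) \<theta>))) \<longlonglongrightarrow> of_real c * V \<theta>"
      by (intro tendsto_mult tendsto_of_real Ln_tendsto)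
    hence "(\<lambda>N. exp (complex_of_real (real (m N) / real N) * (of_nat N * Ln (char (\<mu> N) \<theta>)))) \<longlonglongrightarrow> exp (of_real c * V \<theta>)"
      by (rule tendsto_exp)
    moreover have "eventually (\<lambda>N. exp (complex_of_real (real (m N) / real N) * (of_nat N * Ln (char (\<mu> N) \<theta>))) =
        char (\<mu> N) \<theta> ^ m N) sequentially"
      using small_bound[of "\<bar>\<theta>\<bar>"]
    proof eventually_elim
      case (elim N)
      have "\<theta> \<in> {-\<bar>\<theta>\<bar>..\<bar>\<theta>\<bar>}" by auto
      hence "cmod (char (\<mu> N) \<theta> - 1) < 1 / 2" "1 \<le> N" using elim by blast+
      hence "char (\<mu> N) \<theta> \<noteq> 0" by auto
      thus ?case using \<open>1 \<le> N\<close> by (simp add: exp_of_nat_mult)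
    qed
    ultimately have "(\<lambda>N. char (\<mu> N) \<theta> ^ m N) \<longlonglongrightarrow> exp (of_real c * V \<theta>)"
      by (rule Lim_transform_eventually)
    from LIMSEQ_Suc[OF this] have "(\<lambda>N. char (\<nu> N) \<theta>) \<longlonglongrightarrow> exp (of_real c * V \<theta>)" by (simp add: \<nu>)
    from LIMSEQ_subseq_LIMSEQ[OF this M(1)] have "(\<lambda>n. char ((\<nu> \<circ> id \<circ> r) n) \<theta>) \<longlonglongrightarrow> exp (of_real c * V \<theta>)"
      by (simp add: o_def)
    moreover have "(\<lambda>n. char ((\<nu> \<circ> id \<circ> r) n) \<theta>) \<longlonglongrightarrow> char M \<theta>"
      by (rule levy_continuity1[OF _ M(2,3)]) (simp add: \<nu>)
    ultimately show ?thesis by (rule LIMSEQ_unique[rotated])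
  qed
  thus ?thesis using M(2) by blast
qed

end

section \<open>Continuity of the Levy exponent\<close>

lemma levy_exponent_0: "levy_exponent \<mu> \<sigma> \<pi> 0 = 0"
  by (simp add: levy_exponent_def)

text \<open>For |y| <= 1 the compensated integrand is quadratic in theta y, beyond that it is
  bounded by 2. Both fit under a multiple of min(y^2, 1) that is uniform for bounded theta, so
  dominated convergence applies along convergent sequences.\<close>

lemma levy_exponent_continuous:
  assumes \<pi>: "levy_measure \<pi>"
  shows "continuous_on UNIV (levy_exponent \<mu> \<sigma> \<pi>)"
proof -
  define f where "f \<theta> y = iexp (\<theta> * y) - 1 - \<i> * complex_of_real (\<theta> * y * indicator {-1..1} y)" for \<theta> y :: real
  have sets: "sets \<pi> = sets borel" using \<pi> by (simp add: levy_measure_def)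
  have meas: "f \<theta> \<in> borel_measurable \<pi>" for \<theta>
    unfolding f_def measurable_cong_sets[OF sets refl] by measurable
  have b: "cmod (f \<theta> y) \<le> (2 + 2 * \<theta>\<^sup>2) * min (y\<^sup>2) 1" for \<theta> y
  proof (cases "\<bar>y\<bar> \<le> 1")
    case True
    have "cmod (f \<theta> y) \<le> 2 * (\<theta> * y)\<^sup>2"
      using True cmod_iexp_minus_1_minus_linear_le[of "\<theta> * y"] by (auto simp: f_def abs_le_iff)
    also have "\<dots> = 2 * \<theta>\<^sup>2 * y\<^sup>2" by (simp add: power_mult_distrib)
    also have "\<dots> \<le> (2 + 2 * \<theta>\<^sup>2) * y\<^sup>2" by (intro mult_right_mono) auto
    also have "y\<^sup>2 = min (y\<^sup>2) 1" using True by (simp add: abs_square_le_1)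
    finally show ?thesis .
  next
    case False
    have "1 \<le> y\<^sup>2" using False by (metis less_imp_le not_le one_le_power power2_abs)
    moreover have "cmod (f \<theta> y) \<le> 2"
      using False cmod_iexp_minus_1_le[of "\<theta> * y"] by (auto simp: f_def indicator_def abs_le_iff)
    ultimately show ?thesis by (simp add: add_increasing2)
  qed
  have int: "integrable \<pi> (\<lambda>y. c * min (y\<^sup>2) 1)" for c :: real
  proof (intro integrable_mult_right integrableI_nonneg)
    show "(\<lambda>y. min (y\<^sup>2) 1) \<in> borel_measurable \<pi>"
      unfolding measurable_cong_sets[OF sets refl] by measurable
  qed (use \<pi> in \<open>auto simp: levy_measure_def\<close>)
  have "continuous_on UNIV (\<lambda>\<theta>. CLINT y|\<pi>. f \<theta> y)"
  proof (rule continuous_on_sequentiallyI)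
    fix u :: "nat \<Rightarrow> real" and a assume u: "u \<longlonglongrightarrow> a"
    then obtain B where B: "\<And>n. \<bar>u n\<bar> \<le> B" by (metis Bseq_def convergent_imp_Bseq convergentI real_norm_def)
    show "(\<lambda>n. CLINT y|\<pi>. f (u n) y) \<longlonglongrightarrow> (CLINT y|\<pi>. f a y)"
    proof (rule integral_dominated_convergence[where w = "\<lambda>y. (2 + 2 * B\<^sup>2) * min (y\<^sup>2) 1"])
      show "AE y in \<pi>. (\<lambda>n. f (u n) y) \<longlonglongrightarrow> f a y"
        unfolding f_def by (intro AE_I2 tendsto_intros u)
      show "AE y in \<pi>. norm (f (u n) y) \<le> (2 + 2 * B\<^sup>2) * min (y\<^sup>2) 1" for n
      proof (intro AE_I2 order_trans[OF b] mult_right_mono mult_left_mono add_left_mono)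
        show "(u n)\<^sup>2 \<le> B\<^sup>2" using power_mono[OF B[of n], of 2] by simp
      qed auto
    qed (use meas int in auto)
  qed
  thus ?thesis
    unfolding levy_exponent_def f_def by (intro continuous_intros) auto
qed

section \<open>Convergence in probability and independence\<close>

context prob_space
begin

lemma prob_abs_triangle:
  fixes X Y Z :: "'a \<Rightarrow> real"
  assumes [measurable]: "X \<in> borel_measurable M" "Y \<in> borel_measurable M" "Z \<in> borel_measurable M"
  shows "prob {\<omega>\<in>space M. e < \<bar>X \<omega> - Z \<omega>\<bar>} \<le>
    prob {\<omega>\<in>space M. e / 2 < \<bar>X \<omega> - Y \<omega>\<bar>} + prob {\<omega>\<in>space M. e / 2 < \<bar>Y \<omega> - Z \<omega>\<bar>}"
proof -
  have "prob {\<omega>\<in>space M. e < \<bar>X \<omega> - Z \<omega>\<bar>} \<le>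
      prob ({\<omega>\<in>space M. e / 2 < \<bar>X \<omega> - Y \<omega>\<bar>} \<union> {\<omega>\<in>space M. e / 2 < \<bar>Y \<omega> - Z \<omega>\<bar>})"
  proof (rule finite_measure_mono)
    show "{\<omega>\<in>space M. e < \<bar>X \<omega> - Z \<omega>\<bar>} \<subseteq> {\<omega>\<in>space M. e / 2 < \<bar>X \<omega> - Y \<omega>\<bar>} \<union> {\<omega>\<in>space M. e / 2 < \<bar>Y \<omega> - Z \<omega>\<bar>}"
    proof
      fix \<omega> assume w: "\<omega> \<in> {\<omega>\<in>space M. e < \<bar>X \<omega> - Z \<omega>\<bar>}"
      hence "e < \<bar>X \<omega> - Z \<omega>\<bar>" by simp
      hence "e / 2 < \<bar>X \<omega> - Y \<omega>\<bar> \<or> e / 2 < \<bar>Y \<omega> - Z \<omega>\<bar>" by linarith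
      thus "\<omega> \<in> {\<omega>\<in>space M. e / 2 < \<bar>X \<omega> - Y \<omega>\<bar>} \<union> {\<omega>\<in>space M. e / 2 < \<bar>Y \<omega> - Z \<omega>\<bar>}"
        using w by auto
    qed
  qed measurable
  also have "\<dots> \<le> prob {\<omega>\<in>space M. e / 2 < \<bar>X \<omega> - Y \<omega>\<bar>} + prob {\<omega>\<in>space M. e / 2 < \<bar>Y \<omega> - Z \<omega>\<bar>}"
    by (rule measure_Un_le) measurable
  finally show ?thesis .
qed

lemma AE_tendsto_imp_in_prob:
  fixes Y :: "nat \<Rightarrow> 'a \<Rightarrow> real"
  assumes [measurable]: "\<And>n. Y n \<in> borel_measurable M" "L \<in> borel_measurable M"
    and ae: "AE \<omega> in M. (\<lambda>n. Y n \<omega>) \<longlonglongrightarrow> L \<omega>"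
  shows "tendsto_in_prob M Y L"
  unfolding tendsto_in_prob_def
proof (intro allI impI)
  fix e :: real assume e: "0 < e"
  have "(\<lambda>n. LINT \<omega>|M. indicator {\<omega>\<in>space M. e < \<bar>Y n \<omega> - L \<omega>\<bar>} \<omega> :: real) \<longlonglongrightarrow> (LINT \<omega>|M. 0)"
  proof (rule integral_dominated_convergence[where w = "\<lambda>_. 1"])
    show "AE \<omega> in M. (\<lambda>n. indicator {\<omega>\<in>space M. e < \<bar>Y n \<omega> - L \<omega>\<bar>} \<omega> :: real) \<longlonglongrightarrow> 0"
      using ae
    proof eventually_elim
      case (elim \<omega>)
      from tendstoD[OF elim e] have "eventually (\<lambda>n. \<bar>Y n \<omega> - L \<omega>\<bar> < e) sequentially"
        by (simp add: dist_real_def)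
      hence "eventually (\<lambda>n. indicator {\<omega>\<in>space M. e < \<bar>Y n \<omega> - L \<omega>\<bar>} \<omega> = (0::real)) sequentially"
        by eventually_elim auto
      thus ?case by (rule tendsto_eventually)
    qed
  qed (auto simp: indicator_def)
  moreover have "(LINT \<omega>|M. indicator {\<omega>\<in>space M. e < \<bar>Y n \<omega> - L \<omega>\<bar>} \<omega> :: real) = prob {\<omega>\<in>space M. e < \<bar>Y n \<omega> - L \<omega>\<bar>}" for n
    unfolding Bochner_Integration.integral_indicator by (auto intro!: arg_cong[where f = prob])
  ultimately show "(\<lambda>n. prob {\<omega>\<in>space M. e < \<bar>Y n \<omega> - L \<omega>\<bar>}) \<longlonglongrightarrow> 0" by simp
qed

definition cauchy_in_prob :: "(nat \<Rightarrow> 'a \<Rightarrow> real) \<Rightarrow> bool" where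
  "cauchy_in_prob Y \<longleftrightarrow> (\<forall>e>0. \<forall>d>0. \<exists>m0. \<forall>m\<ge>m0. \<forall>n\<ge>m.
     prob {\<omega>\<in>space M. e < \<bar>Y n \<omega> - Y m \<omega>\<bar>} \<le> d)"

text \<open>A subsequence whose k-th increment exceeds 2^(-k) with probability at most 2^(-k)
  converges almost surely by Borel-Cantelli; the Cauchy property then carries the whole sequence to
  the same limit.\<close>

lemma cauchy_in_prob_convergent:
  assumes Y[measurable]: "\<And>n. Y n \<in> borel_measurable M" and cau: "cauchy_in_prob Y"
  shows "\<exists>L\<in>borel_measurable M. tendsto_in_prob M Y L"
proof -
  have "\<forall>k. \<exists>m0. \<forall>m\<ge>m0. \<forall>n\<ge>m. prob {\<omega>\<in>space M. (1/2)^k < \<bar>Y n \<omega> - Y m \<omega>\<bar>} \<le> (1/2)^k"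
    using cau unfolding cauchy_in_prob_def by simp
  from choice[OF this] obtain r0 where r0:
    "\<And>k m n. r0 k \<le> m \<Longrightarrow> m \<le> n \<Longrightarrow> prob {\<omega>\<in>space M. (1/2)^k < \<bar>Y n \<omega> - Y m \<omega>\<bar>} \<le> (1/2)^k" by blast
  \<comment> \<open>Adding k and all thresholds up to k makes the indices nondecreasing and
    unbounded while they stay above \<open>r0 k\<close>.\<close>
  define r where "r k = k + (\<Sum>j\<le>k. r0 j)" for k
  have r: "r0 k \<le> r k" "r k \<le> r (Suc k)" "k \<le> r k" for k
    using member_le_sum[of k "{..k}" r0] by (auto simp: r_def)
  define A where "A k = {\<omega>\<in>space M. (1/2)^k < \<bar>Y (r (Suc k)) \<omega> - Y (r k) \<omega>\<bar>}" for k
  have A[measurable]: "A k \<in> sets M" for k unfolding A_def by measurable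
  have ae: "AE \<omega> in M. convergent (\<lambda>k. Y (r k) \<omega>)"
  proof -
    have "AE \<omega> in M. eventually (\<lambda>k. \<omega> \<in> space M - A k) sequentially"
    proof (rule borel_cantelli_AE1)
      have "summable (\<lambda>k. measure M (A k))"
        by (rule summable_comparison_test'[of "\<lambda>k. (1/2::real)^k" 0])
           (use r0 r in \<open>auto simp: A_def intro!: summable_geometric\<close>)
      thus "summable (\<lambda>k. measure M (A k))" .
    qed (auto simp: emeasure_eq_measure)
    thus ?thesis
    proof eventually_elim
      case (elim \<omega>)
      then obtain k0 where k0: "\<And>k. k0 \<le> k \<Longrightarrow> \<bar>Y (r (Suc k)) \<omega> - Y (r k) \<omega>\<bar> \<le> (1/2)^k"
        by (fastforce simp: eventually_sequentially A_def not_less)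
      have "summable (\<lambda>k. Y (r (Suc k)) \<omega> - Y (r k) \<omega>)"
        by (rule summable_comparison_test'[of "\<lambda>k. (1/2::real)^k" k0]) (use k0 in auto)
      hence "convergent (\<lambda>n. \<Sum>k<n. Y (r (Suc k)) \<omega> - Y (r k) \<omega>)"
        by (simp add: summable_iff_convergent)
      hence "convergent (\<lambda>n. Y (r n) \<omega> - Y (r 0) \<omega>)"
        using sum_lessThan_telescope[of "\<lambda>k. Y (r k) \<omega>"] by simp
      thus ?case by (simp add: convergent_diff_const_right_iff)
    qed
  qed
  define L where "L \<omega> = lim (\<lambda>k. Y (r k) \<omega>)" for \<omega>
  have L[measurable]: "L \<in> borel_measurable M"
    unfolding L_def by (rule borel_measurable_lim_metric) measurable
  have "AE \<omega> in M. (\<lambda>k. Y (r k) \<omega>) \<longlonglongrightarrow> L \<omega>"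
    using ae by eventually_elim (simp add: L_def convergent_LIMSEQ_iff)
  hence sub: "tendsto_in_prob M (\<lambda>k. Y (r k)) L"
    by (intro AE_tendsto_imp_in_prob) measurable
  have "tendsto_in_prob M Y L"
    unfolding tendsto_in_prob_def
  proof (intro allI impI LIMSEQ_I)
    fix e d :: real assume e: "0 < e" and d: "0 < d"
    from cau e d obtain m0 where m0: "\<And>m n. m0 \<le> m \<Longrightarrow> m \<le> n \<Longrightarrow> prob {\<omega>\<in>space M. e / 2 < \<bar>Y n \<omega> - Y m \<omega>\<bar>} \<le> d / 3"
      unfolding cauchy_in_prob_def by (metis half_gt_zero divide_pos_pos zero_less_numeral)
    have "(\<lambda>k. prob {\<omega>\<in>space M. e / 2 < \<bar>Y (r k) \<omega> - L \<omega>\<bar>}) \<longlonglongrightarrow> 0"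
      using e by (intro sub[unfolded tendsto_in_prob_def, rule_format]) simp
    from order_tendstoD(2)[OF this, of "d / 3"] d obtain k0 where
      k0: "\<And>k. k0 \<le> k \<Longrightarrow> prob {\<omega>\<in>space M. e / 2 < \<bar>Y (r k) \<omega> - L \<omega>\<bar>} < d / 3"
      by (auto simp: eventually_sequentially)
    have "prob {\<omega>\<in>space M. e < \<bar>Y n \<omega> - L \<omega>\<bar>} < d" if n: "m0 \<le> n" for n
    proof -
      define k where "k = max k0 n"
      have "n \<le> r k" using r(3)[of k] by (simp add: k_def)
      have "prob {\<omega>\<in>space M. e < \<bar>Y n \<omega> - L \<omega>\<bar>} \<le>
          prob {\<omega>\<in>space M. e / 2 < \<bar>Y n \<omega> - Y (r k) \<omega>\<bar>} + prob {\<omega>\<in>space M. e / 2 < \<bar>Y (r k) \<omega> - L \<omega>\<bar>}"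
        by (rule prob_abs_triangle) measurable
      moreover have "prob {\<omega>\<in>space M. e / 2 < \<bar>Y n \<omega> - Y (r k) \<omega>\<bar>} \<le> d / 3"
        using m0[OF n \<open>n \<le> r k\<close>] by (simp add: abs_minus_commute)
      moreover have "prob {\<omega>\<in>space M. e / 2 < \<bar>Y (r k) \<omega> - L \<omega>\<bar>} < d / 3"
        by (rule k0) (simp add: k_def)
      ultimately show ?thesis using d by linarith
    qed
    thus "\<exists>no. \<forall>n\<ge>no. norm (prob {\<omega>\<in>space M. e < \<bar>Y n \<omega> - L \<omega>\<bar>} - 0) < d" by auto
  qed
  with L show ?thesis by blast
qed

lemma tendsto_in_prob_AE_unique:
  assumes [measurable]: "\<And>n. Y n \<in> borel_measurable M" "L \<in> borel_measurable M" "L' \<in> borel_measurable M"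
    and L: "tendsto_in_prob M Y L" and L': "tendsto_in_prob M Y L'"
  shows "AE \<omega> in M. L \<omega> = L' \<omega>"
proof -
  have zero: "prob {\<omega>\<in>space M. e < \<bar>L \<omega> - L' \<omega>\<bar>} = 0" if e: "0 < e" for e
  proof -
    have e2: "0 < e / 2" using e by simp
    have "(\<lambda>n. prob {\<omega>\<in>space M. e / 2 < \<bar>Y n \<omega> - L \<omega>\<bar>} + prob {\<omega>\<in>space M. e / 2 < \<bar>Y n \<omega> - L' \<omega>\<bar>}) \<longlonglongrightarrow> 0 + 0"
      by (intro tendsto_add L[unfolded tendsto_in_prob_def, rule_format, OF e2] L'[unfolded tendsto_in_prob_def, rule_format, OF e2])
    moreover have "prob {\<omega>\<in>space M. e < \<bar>L \<omega> - L' \<omega>\<bar>} \<le>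
        prob {\<omega>\<in>space M. e / 2 < \<bar>Y n \<omega> - L \<omega>\<bar>} + prob {\<omega>\<in>space M. e / 2 < \<bar>Y n \<omega> - L' \<omega>\<bar>}" for n
      using prob_abs_triangle[of L "Y n" L' e] by (simp add: abs_minus_commute)
    ultimately have "prob {\<omega>\<in>space M. e < \<bar>L \<omega> - L' \<omega>\<bar>} \<le> 0 + 0"
      by (intro LIMSEQ_le_const) auto
    thus ?thesis by (simp add: measure_le_0_iff)
  qed
  have "AE \<omega> in M. \<forall>n::nat. \<not> 1 / real (Suc n) < \<bar>L \<omega> - L' \<omega>\<bar>"
  proof (subst AE_all_countable, intro allI)
    fix n :: nat
    have "emeasure M {\<omega>\<in>space M. 1 / real (Suc n) < \<bar>L \<omega> - L' \<omega>\<bar>} = 0"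
      using zero[of "1 / real (Suc n)"] by (simp add: emeasure_eq_measure)
    thus "AE \<omega> in M. \<not> 1 / real (Suc n) < \<bar>L \<omega> - L' \<omega>\<bar>"
      by (intro AE_I[of _ _ "{\<omega>\<in>space M. 1 / real (Suc n) < \<bar>L \<omega> - L' \<omega>\<bar>}"]) auto
  qed
  thus ?thesis
  proof eventually_elim
    case (elim \<omega>)
    show ?case
    proof (rule ccontr)
      assume "L \<omega> \<noteq> L' \<omega>"
      hence "0 < \<bar>L \<omega> - L' \<omega>\<bar>" by simp
      then obtain n where "inverse (real (Suc n)) < \<bar>L \<omega> - L' \<omega>\<bar>" using reals_Archimedean by blast
      thus False using elim by (simp add: inverse_eq_divide)
    qed
  qed
qed

lemma tendsto_in_prob_add:
  assumes [measurable]: "\<And>n. Y n \<in> borel_measurable M" "\<And>n. Z n \<in> borel_measurable M"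
      "L \<in> borel_measurable M" "L' \<in> borel_measurable M"
    and L: "tendsto_in_prob M Y L" and L': "tendsto_in_prob M Z L'"
  shows "tendsto_in_prob M (\<lambda>n \<omega>. Y n \<omega> + Z n \<omega>) (\<lambda>\<omega>. L \<omega> + L' \<omega>)"
  unfolding tendsto_in_prob_def
proof (intro allI impI)
  fix e :: real assume e: "0 < e"
  have e2: "0 < e / 2" using e by simp
  have "(\<lambda>n. prob {\<omega>\<in>space M. e / 2 < \<bar>Y n \<omega> - L \<omega>\<bar>} + prob {\<omega>\<in>space M. e / 2 < \<bar>Z n \<omega> - L' \<omega>\<bar>}) \<longlonglongrightarrow> 0 + 0"
    by (intro tendsto_add L[unfolded tendsto_in_prob_def, rule_format, OF e2] L'[unfolded tendsto_in_prob_def, rule_format, OF e2])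
  hence lim: "(\<lambda>n. prob {\<omega>\<in>space M. e / 2 < \<bar>Y n \<omega> - L \<omega>\<bar>} + prob {\<omega>\<in>space M. e / 2 < \<bar>Z n \<omega> - L' \<omega>\<bar>}) \<longlonglongrightarrow> 0"
    by simp
  have le: "prob {\<omega>\<in>space M. e < \<bar>Y n \<omega> + Z n \<omega> - (L \<omega> + L' \<omega>)\<bar>} \<le>
      prob {\<omega>\<in>space M. e / 2 < \<bar>Y n \<omega> - L \<omega>\<bar>} + prob {\<omega>\<in>space M. e / 2 < \<bar>Z n \<omega> - L' \<omega>\<bar>}" for n
    using prob_abs_triangle[of "\<lambda>\<omega>. Y n \<omega> + Z n \<omega>" "\<lambda>\<omega>. L \<omega> + Z n \<omega>" "\<lambda>\<omega>. L \<omega> + L' \<omega>" e] by simp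
  show "(\<lambda>n. prob {\<omega>\<in>space M. e < \<bar>Y n \<omega> + Z n \<omega> - (L \<omega> + L' \<omega>)\<bar>}) \<longlonglongrightarrow> 0"
    by (rule tendsto_sandwich[OF _ _ tendsto_const lim]) (use le in auto)
qed

lemma tendsto_in_prob_cmult:
  assumes L: "tendsto_in_prob M Y L"
  shows "tendsto_in_prob M (\<lambda>n \<omega>. c * Y n \<omega>) (\<lambda>\<omega>. c * L \<omega>)"
proof (cases "c = 0")
  case False
  have "e < \<bar>c * y - c * l\<bar> \<longleftrightarrow> e / \<bar>c\<bar> < \<bar>y - l\<bar>" for e y l :: real
    using False by (simp add: pos_divide_less_eq abs_mult flip: right_diff_distrib) (simp add: mult.commute)
  thus ?thesis using L False unfolding tendsto_in_prob_def by simp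
qed (simp add: tendsto_in_prob_def)

lemma tendsto_in_prob_sum:
  assumes "finite I" and [measurable]: "\<And>i n. i \<in> I \<Longrightarrow> Y i n \<in> borel_measurable M"
      "\<And>i. i \<in> I \<Longrightarrow> L i \<in> borel_measurable M"
    and L: "\<And>i. i \<in> I \<Longrightarrow> tendsto_in_prob M (Y i) (L i)"
  shows "tendsto_in_prob M (\<lambda>n \<omega>. \<Sum>i\<in>I. Y i n \<omega>) (\<lambda>\<omega>. \<Sum>i\<in>I. L i \<omega>)"
  using assms
proof (induction I)
  case empty thus ?case by (simp add: tendsto_in_prob_def)
next
  case (insert i I)
  have "tendsto_in_prob M (\<lambda>n \<omega>. Y i n \<omega> + (\<Sum>i\<in>I. Y i n \<omega>)) (\<lambda>\<omega>. L i \<omega> + (\<Sum>i\<in>I. L i \<omega>))"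
    using insert.prems by (intro tendsto_in_prob_add insert.IH borel_measurable_sum) auto
  thus ?case using insert.hyps by simp
qed

lemma tendsto_in_prob_iexp:
  assumes Y[measurable]: "\<And>n. Y n \<in> borel_measurable M" and L'[measurable]: "L \<in> borel_measurable M"
    and L: "tendsto_in_prob M Y L"
  shows "(\<lambda>n. CLINT \<omega>|M. iexp (Y n \<omega>)) \<longlonglongrightarrow> (CLINT \<omega>|M. iexp (L \<omega>))"
proof (rule LIMSEQ_I)
  fix r :: real assume r: "0 < r"
  define e where "e = r / 4"
  have e: "0 < e" using r by (simp add: e_def)
  from L e have "(\<lambda>n. prob {\<omega>\<in>space M. e < \<bar>Y n \<omega> - L \<omega>\<bar>}) \<longlonglongrightarrow> 0"
    unfolding tendsto_in_prob_def by simp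
  from order_tendstoD(2)[OF this e] obtain n0 where
    n0: "\<And>n. n0 \<le> n \<Longrightarrow> prob {\<omega>\<in>space M. e < \<bar>Y n \<omega> - L \<omega>\<bar>} < e"
    by (auto simp: eventually_sequentially)
  have "cmod ((CLINT \<omega>|M. iexp (Y n \<omega>)) - (CLINT \<omega>|M. iexp (L \<omega>))) < r" if n: "n0 \<le> n" for n
  proof -
    define Z where "Z = {\<omega>\<in>space M. e < \<bar>Y n \<omega> - L \<omega>\<bar>}"
    have [measurable]: "Z \<in> sets M" unfolding Z_def by measurable
    have int: "complex_integrable M (\<lambda>\<omega>. iexp (Y n \<omega>))" "complex_integrable M (\<lambda>\<omega>. iexp (L \<omega>))"
      by (intro integrable_iexp; simp)+
    have "(CLINT \<omega>|M. iexp (Y n \<omega>)) - (CLINT \<omega>|M. iexp (L \<omega>)) = (CLINT \<omega>|M. iexp (Y n \<omega>) - iexp (L \<omega>))"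
      using int by simp
    also have "cmod \<dots> \<le> (LINT \<omega>|M. e + 2 * indicator Z \<omega>)"
    proof (rule norm_integral_le)
      fix \<omega> assume w: "\<omega> \<in> space M"
      have eq: "iexp (Y n \<omega>) - iexp (L \<omega>) = iexp (L \<omega>) * (iexp (Y n \<omega> - L \<omega>) - 1)"
        by (simp add: right_diff_distrib flip: exp_add)
      have "cmod (iexp (Y n \<omega>) - iexp (L \<omega>)) \<le> 2 * min 1 \<bar>Y n \<omega> - L \<omega>\<bar>"
        unfolding eq norm_mult using cmod_iexp_minus_1_le[of "Y n \<omega> - L \<omega>"] by simp
      moreover have "cmod (iexp (Y n \<omega>) - iexp (L \<omega>)) \<le> \<bar>Y n \<omega> - L \<omega>\<bar>"
        unfolding eq norm_mult using iexp_approx1[of "Y n \<omega> - L \<omega>" 0] by simp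
      ultimately show "cmod (iexp (Y n \<omega>) - iexp (L \<omega>)) \<le> e + 2 * indicator Z \<omega>"
        using w e by (auto simp: Z_def indicator_def)
    qed (use int e in \<open>auto intro!: integrable_const_bound[where B = "e + 2"] simp: indicator_def\<close>)
    also have "\<dots> = e + 2 * prob Z"
      using prob_space by (subst Bochner_Integration.integral_add) (auto simp: emeasure_eq_measure)
    also have "\<dots> < r" using n0[OF n] r by (simp add: Z_def e_def)
    finally show ?thesis .
  qed
  thus "\<exists>no. \<forall>n\<ge>no. norm ((CLINT \<omega>|M. iexp (Y n \<omega>)) - (CLINT \<omega>|M. iexp (L \<omega>))) < r" by auto
qed

text \<open>Ottaviani's inequality. \<open>B k\<close> says that k is the first index where the
  increment from m exceeds 2e; it depends on the variables before k. \<open>C k\<close> says that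
  the remaining increment is at most e; it depends on the variables from k on. The two are
  independent and together force |S_N - S_m| > e.\<close>

lemma ottaviani:
  fixes X :: "nat \<Rightarrow> 'a \<Rightarrow> real" and d e :: real
  assumes ind: "indep_vars (\<lambda>_. borel) X (UNIV :: nat set)" and mN: "m \<le> N"
    and d: "d < 1"
    and le: "\<And>k. m \<le> k \<Longrightarrow> k \<le> N \<Longrightarrow> prob {\<omega>\<in>space M. e < \<bar>(\<Sum>i<N. X i \<omega>) - (\<Sum>i<k. X i \<omega>)\<bar>} \<le> d"
  shows "prob {\<omega>\<in>space M. \<exists>k\<in>{m..N}. 2 * e < \<bar>(\<Sum>i<k. X i \<omega>) - (\<Sum>i<m. X i \<omega>)\<bar>} \<le> d / (1 - d)"
proof -
  define S where "S k \<omega> = (\<Sum>i<k. X i \<omega>)" for k \<omega>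
  have X[measurable]: "X i \<in> borel_measurable M" for i
    using ind by (auto simp: indep_vars_def)
  have S[measurable]: "S k \<in> borel_measurable M" for k unfolding S_def by (intro borel_measurable_sum X)
  define B where "B k = {\<omega>\<in>space M. 2 * e < \<bar>S k \<omega> - S m \<omega>\<bar> \<and> (\<forall>j\<in>{m..<k}. \<bar>S j \<omega> - S m \<omega>\<bar> \<le> 2 * e)}" for k
  define C where "C k = {\<omega>\<in>space M. \<bar>S N \<omega> - S k \<omega>\<bar> \<le> e}" for k
  have [measurable]: "B k \<in> sets M" "C k \<in> sets M" for k
    unfolding B_def C_def by measurable
  have disj: "disjoint_family_on B {m..N}"
  proof (unfold disjoint_family_on_def, intro ballI impI equals0I)
    have no: False if "k \<in> {m..N}" "k < l" "\<omega> \<in> B k" "\<omega> \<in> B l" for k l \<omega>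
    proof -
      have "k \<in> {m..<l}" using that by auto
      hence "\<bar>S k \<omega> - S m \<omega>\<bar> \<le> 2 * e" using that(4) unfolding B_def by blast
      thus False using that(3) by (simp add: B_def)
    qed
    fix k l \<omega> assume "k \<in> {m..N}" "l \<in> {m..N}" "k \<noteq> l" "\<omega> \<in> B k \<inter> B l"
    thus False using no[of k l \<omega>] no[of l k \<omega>] by (metis IntD1 IntD2 nat_neq_iff)
  qed
  have Un: "{\<omega>\<in>space M. \<exists>k\<in>{m..N}. 2 * e < \<bar>S k \<omega> - S m \<omega>\<bar>} = (\<Union>k\<in>{m..N}. B k)"
  proof (intro subset_antisym subsetI)
    fix \<omega> assume w: "\<omega> \<in> {\<omega>\<in>space M. \<exists>k\<in>{m..N}. 2 * e < \<bar>S k \<omega> - S m \<omega>\<bar>}"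
    define k where "k = (LEAST k. k \<in> {m..N} \<and> 2 * e < \<bar>S k \<omega> - S m \<omega>\<bar>)"
    have k: "k \<in> {m..N} \<and> 2 * e < \<bar>S k \<omega> - S m \<omega>\<bar>" unfolding k_def by (rule LeastI_ex) (use w in auto)
    have "\<bar>S j \<omega> - S m \<omega>\<bar> \<le> 2 * e" if "j \<in> {m..<k}" for j
    proof -
      have "\<not> (j \<in> {m..N} \<and> 2 * e < \<bar>S j \<omega> - S m \<omega>\<bar>)"
        using that unfolding k_def by (intro not_less_Least) simp
      thus ?thesis using that k by auto
    qed
    with k w show "\<omega> \<in> (\<Union>k\<in>{m..N}. B k)" by (auto simp: B_def)
  qed (auto simp: B_def)
  have indep: "prob (B k \<inter> C k) = prob (B k) * prob (C k)" if k: "k \<in> {m..N}" for k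
  proof -
    have iv: "indep_var (PiM {..<k} (\<lambda>_. borel)) (\<lambda>\<omega>. restrict (\<lambda>i. X i \<omega>) {..<k})
        (PiM {k..<N} (\<lambda>_. borel)) (\<lambda>\<omega>. restrict (\<lambda>i. X i \<omega>) {k..<N})"
      by (rule indep_var_restrict[OF ind]) auto
    define B' where "B' = {x\<in>space (PiM {..<k} (\<lambda>_. borel :: real measure)). 2 * e < \<bar>(\<Sum>i<k. x i) - (\<Sum>i<m. x i)\<bar> \<and>
        (\<forall>j\<in>{m..<k}. \<bar>(\<Sum>i<j. x i) - (\<Sum>i<m. x i)\<bar> \<le> 2 * e)}"
    define C' where "C' = {x\<in>space (PiM {k..<N} (\<lambda>_. borel :: real measure)). \<bar>\<Sum>i=k..<N. x i\<bar> \<le> e}"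
    have ms: "(\<lambda>x. \<Sum>i<j. x i) \<in> borel_measurable (PiM {..<k} (\<lambda>_. borel :: real measure))" if "j \<le> k" for j
      using that by (intro borel_measurable_sum measurable_component_singleton) auto
    note [measurable] = ms[of m] ms[of k]
    have ms': "(\<lambda>x. \<Sum>i<j. x i) \<in> borel_measurable (PiM {..<k} (\<lambda>_. borel :: real measure))" if "j \<in> {m..<k}" for j
      using that by (intro ms) auto
    have "m \<le> k" "k \<le> N" using k by auto
    note [measurable] = ms[OF \<open>m \<le> k\<close>] ms'
    have B': "B' \<in> sets (PiM {..<k} (\<lambda>_. borel))"
      unfolding B'_def by measurable
    have C': "C' \<in> sets (PiM {k..<N} (\<lambda>_. borel))"
      unfolding C'_def by measurable
    have SN: "S N \<omega> - S k \<omega> = (\<Sum>i=k..<N. X i \<omega>)" for \<omega>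
      unfolding S_def using sum_diff_nat_ivl[of 0 k N "\<lambda>i. X i \<omega>"] \<open>k \<le> N\<close> by (simp add: atLeast0LessThan)
    have restr: "(\<Sum>i<j. restrict (\<lambda>i. X i \<omega>) {..<k} i) = S j \<omega>" if "j \<le> k" for j \<omega>
      unfolding S_def using that by (intro sum.cong) auto
    have BB: "(\<lambda>\<omega>. restrict (\<lambda>i. X i \<omega>) {..<k}) -` B' \<inter> space M = B k"
      using \<open>m \<le> k\<close> restr by (auto simp: B'_def B_def space_PiM)
    have CC: "(\<lambda>\<omega>. restrict (\<lambda>i. X i \<omega>) {k..<N}) -` C' \<inter> space M = C k"
      by (auto simp: C'_def C_def space_PiM SN)
    have "B k \<inter> C k = (\<lambda>\<omega>. (restrict (\<lambda>i. X i \<omega>) {..<k}, restrict (\<lambda>i. X i \<omega>) {k..<N})) -` (B' \<times> C') \<inter> space M"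
      unfolding BB[symmetric] CC[symmetric] by auto
    thus ?thesis using indep_varD[OF iv B' C'] by (simp add: BB CC)
  qed
  have CK: "1 - d \<le> prob (C k)" if "k \<in> {m..N}" for k
  proof -
    have "C k = space M - {\<omega>\<in>space M. e < \<bar>S N \<omega> - S k \<omega>\<bar>}" by (auto simp: C_def)
    hence "prob (C k) = 1 - prob {\<omega>\<in>space M. e < \<bar>S N \<omega> - S k \<omega>\<bar>}" by (simp add: prob_compl)
    thus ?thesis using le[of k] that by (simp add: S_def)
  qed
  have "(1 - d) * prob (\<Union>k\<in>{m..N}. B k) = (\<Sum>k\<in>{m..N}. prob (B k) * (1 - d))"
    using disj by (subst finite_measure_finite_Union) (auto simp: sum_distrib_left mult.commute)
  also have "\<dots> \<le> (\<Sum>k\<in>{m..N}. prob (B k \<inter> C k))"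
    using CK by (intro sum_mono) (auto simp: indep intro!: mult_left_mono)
  also have "\<dots> = prob (\<Union>k\<in>{m..N}. B k \<inter> C k)"
    using disj by (intro finite_measure_finite_Union[symmetric]) (auto simp: disjoint_family_on_def)
  also have "\<dots> \<le> prob {\<omega>\<in>space M. e < \<bar>S N \<omega> - S m \<omega>\<bar>}"
    by (intro finite_measure_mono) (auto simp: B_def C_def)
  also have "\<dots> \<le> d" using le[of m] mN by (simp add: S_def)
  finally show ?thesis
    using d unfolding S_def[symmetric] Un by (simp add: field_simps)
qed

text \<open>For independent summands the maximal inequality turns the Cauchy property in probability
  into almost sure convergence. It is needed because additivity of the random measure is an almost
  sure statement.\<close>

lemma indep_sum_AE_convergent:
  fixes X :: "nat \<Rightarrow> 'a \<Rightarrow> real"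
  assumes ind: "indep_vars (\<lambda>_. borel) X (UNIV :: nat set)"
    and cau: "cauchy_in_prob (\<lambda>n \<omega>. \<Sum>i<n. X i \<omega>)"
  shows "AE \<omega> in M. convergent (\<lambda>n. \<Sum>i<n. X i \<omega>)"
proof -
  define S where "S k \<omega> = (\<Sum>i<k. X i \<omega>)" for k \<omega>
  have X[measurable]: "X i \<in> borel_measurable M" for i
    using ind by (auto simp: indep_vars_def)
  have S[measurable]: "S k \<in> borel_measurable M" for k unfolding S_def by (intro borel_measurable_sum X)
  have small: "AE \<omega> in M. \<exists>m. \<forall>k\<ge>m. \<bar>S k \<omega> - S m \<omega>\<bar> \<le> e" if e: "0 < e" for e
  proof -
    define F where "F = {\<omega>\<in>space M. \<forall>m. \<exists>k\<ge>m. e < \<bar>S k \<omega> - S m \<omega>\<bar>}"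
    have [measurable]: "F \<in> sets M" unfolding F_def by measurable
    have le: "prob F \<le> d" if d: "0 < d" for d
    proof -
      \<comment> \<open>d' <= 1/2 gives d' / (1 - d') <= 2 d' <= d.\<close>
      define d' where "d' = min (d / 2) (1 / 2)"
      have d': "0 < d'" "d' < 1" "d' / (1 - d') \<le> d"
      proof -
        show "0 < d'" "d' < 1" using d by (auto simp: d'_def)
        have "d' / (1 - d') \<le> d' / (1 / 2)" using \<open>0 < d'\<close> by (intro divide_left_mono) (auto simp: d'_def)
        thus "d' / (1 - d') \<le> d" by (auto simp: d'_def)
      qed
      have "0 < e / 2" using e by simp
      from cau[unfolded cauchy_in_prob_def, rule_format, OF this d'(1)]
      obtain m where m: "\<And>k n. m \<le> k \<Longrightarrow> k \<le> n \<Longrightarrow> prob {\<omega>\<in>space M. e / 2 < \<bar>S n \<omega> - S k \<omega>\<bar>} \<le> d'"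
        unfolding S_def by blast
      define G where "G N = {\<omega>\<in>space M. \<exists>k\<in>{m..m+N}. e < \<bar>S k \<omega> - S m \<omega>\<bar>}" for N
      have [measurable]: "G N \<in> sets M" for N unfolding G_def by measurable
      have GN: "prob (G N) \<le> d" for N
        using ottaviani[OF ind _ d'(2), of m "m + N" "e / 2"] m d'(3) by (simp add: G_def S_def)
      have "incseq G" unfolding incseq_def G_def by fastforce
      hence "(\<lambda>N. prob (G N)) \<longlonglongrightarrow> prob (\<Union>N. G N)"
        by (intro finite_Lim_measure_incseq) auto
      hence "prob (\<Union>N. G N) \<le> d" by (rule LIMSEQ_le_const2) (use GN in auto)
      moreover have "F \<subseteq> (\<Union>N. G N)"
      proof
        fix \<omega> assume w: "\<omega> \<in> F"
        then obtain k where "k \<ge> m" "e < \<bar>S k \<omega> - S m \<omega>\<bar>" unfolding F_def by blast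
        hence "\<omega> \<in> G (k - m)" using w by (auto simp: G_def F_def)
        thus "\<omega> \<in> (\<Union>N. G N)" by blast
      qed
      hence "prob F \<le> prob (\<Union>N. G N)" by (intro finite_measure_mono) auto
      ultimately show ?thesis by simp
    qed
    have "prob F \<le> 0"
    proof (rule ccontr)
      assume "\<not> prob F \<le> 0"
      thus False using le[of "prob F / 2"] by simp
    qed
    hence "emeasure M F = 0" by (simp add: emeasure_eq_measure measure_le_0_iff)
    thus ?thesis by (intro AE_I[of _ _ F]) (auto simp: F_def not_le not_less)
  qed
  have "AE \<omega> in M. \<forall>n::nat. \<exists>m. \<forall>k\<ge>m. \<bar>S k \<omega> - S m \<omega>\<bar> \<le> 1 / real (Suc n)"
    by (subst AE_all_countable) (auto intro!: small)
  thus ?thesis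
  proof eventually_elim
    case (elim \<omega>)
    have "Cauchy (\<lambda>k. S k \<omega>)"
    proof (rule metric_CauchyI)
      fix e :: real assume "0 < e"
      then obtain n where n: "inverse (real (Suc n)) < e / 2" using reals_Archimedean[of "e / 2"] by auto
      from elim obtain m where m: "\<And>k. k \<ge> m \<Longrightarrow> \<bar>S k \<omega> - S m \<omega>\<bar> \<le> 1 / real (Suc n)" by blast
      have "dist (S k \<omega>) (S l \<omega>) < e" if "k \<ge> m" "l \<ge> m" for k l
        using m[OF that(1)] m[OF that(2)] n by (simp add: dist_real_def inverse_eq_divide)
      thus "\<exists>M. \<forall>m\<ge>M. \<forall>n\<ge>M. dist (S m \<omega>) (S n \<omega>) < e" by blast
    qed
    thus ?case unfolding S_def by (simp add: Cauchy_convergent_iff)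
  qed
qed

text \<open>A joint characteristic function that factorises is that of the product law, so
  uniqueness gives independence of each finite subfamily, and independence is a condition on finite
  subfamilies.\<close>

lemma indep_vars_if_char_prod:
  fixes X :: "'i \<Rightarrow> 'a \<Rightarrow> real"
  assumes X: "\<And>i. i \<in> I \<Longrightarrow> X i \<in> borel_measurable M"
    and char: "\<And>J c. finite J \<Longrightarrow> J \<subseteq> I \<Longrightarrow>
      (CLINT \<omega>|M. iexp (\<Sum>j\<in>J. c j * X j \<omega>)) = (\<Prod>j\<in>J. char (distr M borel (X j)) (c j))"
  shows "indep_vars (\<lambda>_. borel) X I"
proof -
  have fin: "indep_vars (\<lambda>_. borel) X J" if J: "finite J" "J \<subseteq> I" "J \<noteq> {}" for J
  proof -
    have XJ[measurable]: "X i \<in> borel_measurable M" if "i \<in> J" for i using X J that by auto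
    have dist: "real_distribution (distr M borel (X j))" if "j \<in> J" for j
      using XJ[OF that] by (rule real_distribution_distr)
    have [measurable]: "(\<lambda>\<omega>. \<lambda>i\<in>J. X i \<omega>) \<in> measurable M (PiM J (\<lambda>_. borel))"
      by (rule measurable_restrict) measurable
    have "distr M (PiM J (\<lambda>_. borel)) (\<lambda>\<omega>. \<lambda>i\<in>J. X i \<omega>) = PiM J (\<lambda>i. distr M borel (X i))"
    proof (rule vchar_unique[OF J(1)])
      show "prob_space (distr M (PiM J (\<lambda>_. borel)) (\<lambda>\<omega>. \<lambda>i\<in>J. X i \<omega>))"
        by (rule prob_space_distr) measurable
      show "prob_space (PiM J (\<lambda>i. distr M borel (X i)))"
        using dist by (intro prob_space_PiM) (simp add: real_distribution_def)
      show "sets (PiM J (\<lambda>i. distr M borel (X i))) = sets (PiM J (\<lambda>_. borel))"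
        by (intro sets_PiM_cong) auto
      fix \<theta>
      have "vchar J (distr M (PiM J (\<lambda>_. borel)) (\<lambda>\<omega>. \<lambda>i\<in>J. X i \<omega>)) \<theta> =
          (CLINT \<omega>|M. iexp (\<Sum>j\<in>J. \<theta> j * X j \<omega>))"
        unfolding vchar_def using J by (subst integral_distr) auto
      also have "\<dots> = (\<Prod>j\<in>J. char (distr M borel (X j)) (\<theta> j))" by (rule char[OF J(1,2)])
      also have "\<dots> = vchar J (PiM J (\<lambda>i. distr M borel (X i))) \<theta>"
        unfolding vchar_def by (rule integral_PiM_iexp_sum[OF J(1) dist, symmetric])
      finally show "vchar J (distr M (PiM J (\<lambda>_. borel)) (\<lambda>\<omega>. \<lambda>i\<in>J. X i \<omega>)) \<theta> =
          vchar J (PiM J (\<lambda>i. distr M borel (X i))) \<theta>" .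
    qed simp
    thus ?thesis using J by (subst indep_vars_iff_distr_eq_PiM') auto
  qed
  show ?thesis
    unfolding indep_vars_def
    using X fin by (subst indep_sets_finite_index_sets) (auto simp: indep_vars_def)
qed

end

text \<open>A measure-preserving map pulls back limits in probability. This moves stochastic
  integrals from one canonical space to each coordinate of a product, and the series at time 0 to
  other times.\<close>

lemma tendsto_in_prob_distr:
  assumes f: "f \<in> measurable Q Q0" "distr Q Q0 f = Q0"
    and [measurable]: "\<And>n. Y n \<in> borel_measurable Q0" "L \<in> borel_measurable Q0"
    and L: "tendsto_in_prob Q0 Y L"
  shows "tendsto_in_prob Q (\<lambda>n \<omega>. Y n (f \<omega>)) (\<lambda>\<omega>. L (f \<omega>))"
proof -
  have "measure Q {\<omega> \<in> space Q. e < \<bar>Y n (f \<omega>) - L (f \<omega>)\<bar>} = measure Q0 {\<omega> \<in> space Q0. e < \<bar>Y n \<omega> - L \<omega>\<bar>}" for e n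
  proof -
    have "measure Q0 {\<omega> \<in> space Q0. e < \<bar>Y n \<omega> - L \<omega>\<bar>} = measure (distr Q Q0 f) {\<omega> \<in> space Q0. e < \<bar>Y n \<omega> - L \<omega>\<bar>}"
      by (simp only: f(2))
    also have "\<dots> = measure Q (f -` {\<omega> \<in> space Q0. e < \<bar>Y n \<omega> - L \<omega>\<bar>} \<inter> space Q)"
      by (rule measure_distr[OF f(1)]) measurable
    also have "f -` {\<omega> \<in> space Q0. e < \<bar>Y n \<omega> - L \<omega>\<bar>} \<inter> space Q = {\<omega> \<in> space Q. e < \<bar>Y n (f \<omega>) - L (f \<omega>)\<bar>}"
      using measurable_space[OF f(1)] by auto
    finally show ?thesis ..
  qed
  thus ?thesis using L unfolding tendsto_in_prob_def by simp
qed

section \<open>Existence of the random measure\<close>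

text \<open>The derivative of \<open>exp\<close> has modulus at most 1 on the half-plane Re z <= 0,
  which is convex and contains both w and 0.\<close>

lemma cmod_exp_minus_1_le:
  assumes "Re w \<le> 0"
  shows "cmod (exp w - 1) \<le> cmod w"
proof -
  have "cmod (exp w - exp 0) \<le> 1 * cmod (w - 0)"
  proof (rule field_differentiable_bound[of "{z. Re z \<le> 0}"])
    show "convex {z. Re z \<le> 0}" by (rule convex_halfspace_Re_le)
    show "(exp has_field_derivative exp z) (at z within {z. Re z \<le> 0})" for z
      by (rule DERIV_subset[OF DERIV_exp]) simp
  qed (use assms in auto)
  thus ?thesis by simp
qed

text \<open>What is left of the innovations after the limit: an exponent whose nonnegative multiples
  are all exponents of laws. It is kept apart from the sequence of laws because the construction is
  run again with V / n to obtain n-th roots. The function in \<open>\<Phi>_moment\<close> is the sum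
  of |x|^(k alpha) over k.\<close>

locale levy_control =
  fixes V :: "real \<Rightarrow> complex" and K \<alpha> :: real and \<Phi> :: "real measure"
  assumes V_cont: "continuous_on UNIV V" and V_0: "V 0 = 0"
    and V_bound: "\<And>\<theta>. cmod (V \<theta>) \<le> K * \<bar>\<theta>\<bar> powr \<alpha>" and V_Re: "\<And>\<theta>. Re (V \<theta>) \<le> 0"
    and \<alpha>: "0 < \<alpha>" "\<alpha> \<le> 2" and K: "0 \<le> K"
    and scaled: "\<And>c. 0 \<le> c \<Longrightarrow> \<exists>\<nu>. real_distribution \<nu> \<and> (\<forall>\<theta>. char \<nu> \<theta> = exp (of_real c * V \<theta>))"
    and \<Phi>_dist: "real_distribution \<Phi>"
    and \<Phi>_I: "AE x in \<Phi>. x \<in> {-1<..<1}"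
    and \<Phi>_moment: "integrable \<Phi> (\<lambda>x. 1 / (1 - \<bar>x\<bar> powr \<alpha>))"
begin

sublocale \<Phi>: real_distribution \<Phi> by (rule \<Phi>_dist)

lemma V_measurable[measurable]: "V \<in> borel_measurable borel"
  using V_cont by (rule borel_measurable_continuous_onI)

lemma V_integrable:
  assumes f[measurable]: "f \<in> borel_measurable borel" and B: "AE x in \<Phi>. \<bar>f x\<bar> \<le> B"
  shows "complex_integrable \<Phi> (\<lambda>x. V (f x))"
proof (rule \<Phi>.integrable_const_bound)
  show "AE x in \<Phi>. cmod (V (f x)) \<le> K * B powr \<alpha>"
    using B
  proof eventually_elim
    case (elim x)
    have "cmod (V (f x)) \<le> K * \<bar>f x\<bar> powr \<alpha>" by (rule V_bound)
    also have "\<dots> \<le> K * B powr \<alpha>" using elim K \<alpha> by (intro mult_left_mono powr_mono2) auto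
    finally show ?case .
  qed
qed measurable

lemma V_integral_bound:
  assumes f[measurable]: "f \<in> borel_measurable borel" and B: "AE x in \<Phi>. \<bar>f x\<bar> \<le> B"
  shows "cmod (CLINT x|\<Phi>. V (\<theta> * f x)) \<le> K * (LINT x|\<Phi>. \<bar>f x\<bar> powr \<alpha>) * \<bar>\<theta>\<bar> powr \<alpha>"
proof -
  have B': "AE x in \<Phi>. \<bar>\<theta> * f x\<bar> \<le> \<bar>\<theta>\<bar> * B"
    using B by eventually_elim (auto simp: abs_mult intro: mult_left_mono)
  have int: "integrable \<Phi> (\<lambda>x. \<bar>f x\<bar> powr \<alpha>)"
  proof (rule \<Phi>.integrable_const_bound)
    show "AE x in \<Phi>. norm (\<bar>f x\<bar> powr \<alpha>) \<le> B powr \<alpha>"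
      using B by eventually_elim (use \<alpha> in \<open>auto intro: powr_mono2\<close>)
  qed measurable
  have "cmod (CLINT x|\<Phi>. V (\<theta> * f x)) \<le> (LINT x|\<Phi>. K * \<bar>\<theta>\<bar> powr \<alpha> * \<bar>f x\<bar> powr \<alpha>)"
  proof (rule norm_integral_le)
    show "cmod (V (\<theta> * f x)) \<le> K * \<bar>\<theta>\<bar> powr \<alpha> * \<bar>f x\<bar> powr \<alpha>" for x
      using V_bound[of "\<theta> * f x"] by (simp add: abs_mult powr_mult mult_ac)
  qed (use int V_integrable[OF _ B'] in auto)
  thus ?thesis by (simp add: mult_ac)
qed

lemma V_integral_Re: "Re (CLINT x|\<Phi>. V (f x)) \<le> 0"
proof (cases "complex_integrable \<Phi> (\<lambda>x. V (f x))")
  case True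
  hence "Re (CLINT x|\<Phi>. V (f x)) = (LINT x|\<Phi>. Re (V (f x)))" by (rule integral_Re[symmetric])
  also have "\<dots> \<le> 0" using V_Re Bochner_Integration.integral_nonneg[of \<Phi> "\<lambda>x. - Re (V (f x))"] by simp
  finally show ?thesis .
qed (simp add: not_integrable_integral_eq)

lemma tail_bound_V:
  assumes P: "prob_space P" and X: "X \<in> borel_measurable P"
    and f[measurable]: "f \<in> borel_measurable borel" and B: "AE x in \<Phi>. \<bar>f x\<bar> \<le> B"
    and char: "\<And>\<theta>. (CLINT \<omega>|P. iexp (\<theta> * X \<omega>)) = exp (CLINT x|\<Phi>. V (\<theta> * f x))"
    and e: "0 < e"
  shows "measure P {\<omega>\<in>space P. e < \<bar>X \<omega>\<bar>} \<le> 6 * (K * (LINT x|\<Phi>. \<bar>f x\<bar> powr \<alpha>)) * e powr (-\<alpha>)"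
proof (rule tail_bound_char[OF P X \<alpha> _ _ e])
  fix \<theta>
  have "char (distr P borel X) \<theta> = exp (CLINT x|\<Phi>. V (\<theta> * f x))"
    using char[of \<theta>] X by (simp add: char_def integral_distr)
  hence "cmod (char (distr P borel X) \<theta> - 1) \<le> cmod (CLINT x|\<Phi>. V (\<theta> * f x))"
    using cmod_exp_minus_1_le[OF V_integral_Re] by simp
  also have "\<dots> \<le> K * (LINT x|\<Phi>. \<bar>f x\<bar> powr \<alpha>) * \<bar>\<theta>\<bar> powr \<alpha>"
    by (rule V_integral_bound[OF f B])
  finally show "cmod (char (distr P borel X) \<theta> - 1) \<le> K * (LINT x|\<Phi>. \<bar>f x\<bar> powr \<alpha>) * \<bar>\<theta>\<bar> powr \<alpha>" .
qed (use K in \<open>auto intro!: mult_nonneg_nonneg Bochner_Integration.integral_nonneg\<close>)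

lemma integral_indicator_times:
  assumes "A \<in> sets borel"
  shows "(CLINT x|\<Phi>. indicator A x * z) = of_real (measure \<Phi> A) * z"
proof -
  have "(CLINT x|\<Phi>. indicator A x * z) = (CLINT x|\<Phi>. indicator A x *\<^sub>R z)"
    by (intro Bochner_Integration.integral_cong refl) (auto simp: indicator_def)
  also have "\<dots> = measure \<Phi> A *\<^sub>R z"
    using assms by (subst integral_scaleR_left) (auto simp: \<Phi>.emeasure_eq_measure)
  finally show ?thesis by (simp add: scaleR_conv_of_real)
qed

text \<open>All linear combinations of the \<open>m A\<close> are prescribed at once; independence, additivity and the
  one-dimensional characteristic functions are special cases.\<close>

definition char_field :: "'w measure \<Rightarrow> (real set \<Rightarrow> 'w \<Rightarrow> real) \<Rightarrow> bool" where
  "char_field P m \<longleftrightarrow> prob_space P \<and> (\<forall>A\<in>borel_subsets_I. m A \<in> borel_measurable P) \<and>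
     (\<forall>F c. finite F \<longrightarrow> F \<subseteq> borel_subsets_I \<longrightarrow>
        (CLINT \<omega>|P. iexp (\<Sum>A\<in>F. c A * m A \<omega>)) = exp (CLINT x|\<Phi>. V (\<Sum>A\<in>F. c A * indicator A x)))"

lemma char_field_measurable:
  assumes "char_field P m" "A \<in> borel_subsets_I"
  shows "m A \<in> borel_measurable P"
  using assms unfolding char_field_def by blast

lemma char_field_prob_space: "char_field P m \<Longrightarrow> prob_space P"
  unfolding char_field_def by blast

text \<open>\<open>char_field\<close> speaks of finite sets of Borel sets, hence not directly of
  families with repetitions; coefficients that belong to the same set are merged into
  \<open>d\<close>.\<close>

lemma char_field_family:
  assumes m: "char_field P m" and J: "finite J" "\<And>j. j \<in> J \<Longrightarrow> A j \<in> borel_subsets_I"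
  shows "(CLINT \<omega>|P. iexp (\<Sum>j\<in>J. c j * m (A j) \<omega>)) = exp (CLINT x|\<Phi>. V (\<Sum>j\<in>J. c j * indicator (A j) x))"
proof -
  define d where "d B = (\<Sum>j\<in>{j\<in>J. A j = B}. c j)" for B
  have eq: "(\<Sum>j\<in>J. c j * g (A j)) = (\<Sum>B\<in>A ` J. d B * g B)" for g :: "real set \<Rightarrow> real"
  proof -
    have "(\<Sum>j\<in>J. c j * g (A j)) = (\<Sum>B\<in>A ` J. \<Sum>j\<in>{j\<in>J. A j = B}. c j * g (A j))"
      by (rule sum.image_gen[OF J(1)])
    also have "\<dots> = (\<Sum>B\<in>A ` J. d B * g B)"
      by (intro sum.cong refl) (auto simp: d_def sum_distrib_right)
    finally show ?thesis .
  qed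
  have "finite (A ` J)" "A ` J \<subseteq> borel_subsets_I" using J by auto
  thus ?thesis using m unfolding char_field_def eq[of "\<lambda>B. m B _"] eq[of "\<lambda>B. indicator B _"] by blast
qed

text \<open>\<open>B S\<close> is the atom of points lying in exactly the members of
  \<open>S\<close>. Independent variables with exponent \<Phi>(B S) V are attached to the atoms, and
  each A receives the sum over the atoms with A in S. On \<open>B S\<close> the step function with
  coefficients c is constant, equal to the sum of c over S, which yields the exponent
  claimed.\<close>

lemma finite_dim_exists:
  assumes F: "finite F" "F \<subseteq> borel_subsets_I"
  shows "\<exists>L. prob_space L \<and> sets L = sets (PiM F (\<lambda>_. borel)) \<and>
    (\<forall>c. vchar F L c = exp (CLINT x|\<Phi>. V (\<Sum>A\<in>F. c A * indicator A x)))"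
proof -
  define B where "B S = {x. {A\<in>F. x \<in> A} = S}" for S
  have B[measurable]: "B S \<in> sets borel" for S
  proof -
    have Fb: "A \<in> sets borel" if "A \<in> F" for A using F that by auto
    show ?thesis
    proof (cases "S \<subseteq> F")
      case True
      hence "({A\<in>F. x \<in> A} = S) = (\<forall>A\<in>F. x \<in> A \<longleftrightarrow> A \<in> S)" for x by blast
      hence "B S = {x\<in>space borel. \<forall>A\<in>F. x \<in> A \<longleftrightarrow> A \<in> S}" by (simp add: B_def)
      also have "\<dots> \<in> sets borel"
      proof (intro sets.sets_Collect_finite_All F(1))
        fix A assume "A \<in> F"
        have "{x\<in>space borel. x \<in> A \<longleftrightarrow> A \<in> S} = (if A \<in> S then A else - A)" by auto
        thus "{x\<in>space borel. x \<in> A \<longleftrightarrow> A \<in> S} \<in> sets borel" using Fb[OF \<open>A \<in> F\<close>] by auto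
      qed
      finally show ?thesis .
    next
      case False
      hence "B S = {}" by (auto simp: B_def)
      thus ?thesis by simp
    qed
  qed
  have "\<forall>S. \<exists>\<nu>. real_distribution \<nu> \<and> (\<forall>\<theta>. char \<nu> \<theta> = exp (of_real (measure \<Phi> (B S)) * V \<theta>))"
    using scaled by simp
  from choice[OF this] obtain \<nu> where \<nu>: "\<And>S. real_distribution (\<nu> S)"
    "\<And>S \<theta>. char (\<nu> S) \<theta> = exp (of_real (measure \<Phi> (B S)) * V \<theta>)" by blast
  define R where "R = PiM (Pow F) \<nu>"
  interpret R: prob_space R
    unfolding R_def using \<nu>(1) by (intro prob_space_PiM) (simp add: real_distribution_def)
  have setsR: "sets R = sets (PiM (Pow F) (\<lambda>_. borel))"
    unfolding R_def using \<nu>(1) by (intro sets_PiM_cong) (auto simp: real_distribution_def real_distribution_axioms_def)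
  define T where "T x = (\<lambda>A\<in>F. \<Sum>S\<in>{S\<in>Pow F. A \<in> S}. x S)" for x :: "real set set \<Rightarrow> real"
  have T[measurable]: "T \<in> measurable R (PiM F (\<lambda>_. borel))"
    unfolding T_def measurable_cong_sets[OF setsR refl]
    by (intro measurable_restrict borel_measurable_sum measurable_component_singleton) auto
  define L where "L = distr R (PiM F (\<lambda>_. borel)) T"
  have "vchar F L c = exp (CLINT x|\<Phi>. V (\<Sum>A\<in>F. c A * indicator A x))" for c
  proof -
    have "vchar F L c = (CLINT x|R. iexp (\<Sum>A\<in>F. c A * T x A))"
      unfolding vchar_def L_def by (rule integral_distr[OF T]) measurable
    also have "\<dots> = (CLINT x|R. iexp (\<Sum>S\<in>Pow F. (\<Sum>A\<in>S. c A) * x S))"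
    proof (intro Bochner_Integration.integral_cong refl arg_cong[where f = "\<lambda>x. iexp x"])
      fix x
      have "(\<Sum>A\<in>F. c A * T x A) = (\<Sum>A\<in>F. \<Sum>S\<in>{S\<in>Pow F. A \<in> S}. c A * x S)"
        by (simp add: T_def sum_distrib_left)
      also have "\<dots> = (\<Sum>S\<in>Pow F. \<Sum>A\<in>{A\<in>F. A \<in> S}. c A * x S)"
        using F(1) by (intro sum.swap_restrict) auto
      also have "\<dots> = (\<Sum>S\<in>Pow F. (\<Sum>A\<in>S. c A) * x S)"
      proof (intro sum.cong refl)
        fix S assume "S \<in> Pow F"
        hence "{A\<in>F. A \<in> S} = S" by auto
        thus "(\<Sum>A\<in>{A\<in>F. A \<in> S}. c A * x S) = (\<Sum>A\<in>S. c A) * x S" by (simp add: sum_distrib_right)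
      qed
      finally show "(\<Sum>A\<in>F. c A * T x A) = (\<Sum>S\<in>Pow F. (\<Sum>A\<in>S. c A) * x S)" .
    qed
    also have "\<dots> = (\<Prod>S\<in>Pow F. char (\<nu> S) (\<Sum>A\<in>S. c A))"
      unfolding R_def using F(1) \<nu>(1) by (intro integral_PiM_iexp_sum) auto
    also have "\<dots> = exp (\<Sum>S\<in>Pow F. of_real (measure \<Phi> (B S)) * V (\<Sum>A\<in>S. c A))"
      using F(1) by (simp add: \<nu> exp_sum)
    also have "(\<Sum>S\<in>Pow F. of_real (measure \<Phi> (B S)) * V (\<Sum>A\<in>S. c A)) =
        (\<Sum>S\<in>Pow F. CLINT x|\<Phi>. indicator (B S) x * V (\<Sum>A\<in>S. c A))"
      by (intro sum.cong refl integral_indicator_times[symmetric] B)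
    also have "\<dots> = (CLINT x|\<Phi>. \<Sum>S\<in>Pow F. indicator (B S) x * V (\<Sum>A\<in>S. c A))"
      by (rule Bochner_Integration.integral_sum[symmetric])
         (auto intro!: \<Phi>.integrable_const_bound[where B = "cmod (V _)"] simp: indicator_def)
    also have "\<dots> = (CLINT x|\<Phi>. V (\<Sum>A\<in>F. c A * indicator A x))"
    proof (intro Bochner_Integration.integral_cong refl)
      fix x
      define S0 where "S0 = {A\<in>F. x \<in> A}"
      have "(\<Sum>S\<in>Pow F. indicator (B S) x * V (\<Sum>A\<in>S. c A)) = (\<Sum>S\<in>Pow F. if S = S0 then V (\<Sum>A\<in>S. c A) else 0)"
        by (intro sum.cong refl) (auto simp: B_def S0_def)
      also have "\<dots> = V (\<Sum>A\<in>S0. c A)"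
        using F(1) by (subst sum.delta) (auto simp: S0_def)
      also have "(\<Sum>A\<in>S0. c A) = (\<Sum>A\<in>F. c A * indicator A x)"
        unfolding S0_def sum.inter_filter[OF F(1)] by (intro sum.cong) (auto simp: indicator_def)
      finally show "(\<Sum>S\<in>Pow F. indicator (B S) x * V (\<Sum>A\<in>S. c A)) = V (\<Sum>A\<in>F. c A * indicator A x)" .
    qed
    finally show ?thesis .
  qed
  moreover have "prob_space L" unfolding L_def by (rule R.prob_space_distr) measurable
  moreover have "sets L = sets (PiM F (\<lambda>_. borel))" by (simp add: L_def)
  ultimately show ?thesis by blast
qed

lemma char_field_exists:
  "\<exists>P0 :: (real set \<Rightarrow> real) measure. sets P0 = sets (PiM borel_subsets_I (\<lambda>_. borel)) \<and>
    char_field P0 (\<lambda>A \<omega>. \<omega> A)"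
proof -
  define good where "good F L \<longleftrightarrow> prob_space L \<and> sets L = sets (PiM F (\<lambda>_. borel)) \<and>
    (\<forall>c. vchar F L c = exp (CLINT x|\<Phi>. V (\<Sum>A\<in>F. c A * indicator A x)))" for F and L :: "(real set \<Rightarrow> real) measure"
  define L where "L F = (SOME L. good F L)" for F
  have "good F (L F)" if F: "finite F" "F \<subseteq> borel_subsets_I" for F
    unfolding L_def by (rule someI_ex) (unfold good_def, rule finite_dim_exists[OF F])
  hence L: "\<And>F. finite F \<Longrightarrow> F \<subseteq> borel_subsets_I \<Longrightarrow> prob_space (L F)"
    "\<And>F. finite F \<Longrightarrow> F \<subseteq> borel_subsets_I \<Longrightarrow> sets (L F) = sets (PiM F (\<lambda>_. borel))"
    "\<And>F c. finite F \<Longrightarrow> F \<subseteq> borel_subsets_I \<Longrightarrow> vchar F (L F) c = exp (CLINT x|\<Phi>. V (\<Sum>A\<in>F. c A * indicator A x))"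
    by (simp_all add: good_def)
  have proj: "L J = distr (L H) (PiM J (\<lambda>_. borel)) (\<lambda>f. restrict f J)"
    if JH: "J \<subseteq> H" "finite H" "H \<subseteq> borel_subsets_I" for J H
  proof -
    have J: "finite J" "J \<subseteq> borel_subsets_I" using JH finite_subset by auto
    interpret LH: prob_space "L H" using L(1) JH by simp
    have [measurable]: "(\<lambda>f. restrict f J) \<in> measurable (L H) (PiM J (\<lambda>_. borel))"
      unfolding measurable_cong_sets[OF L(2)[OF JH(2,3)] refl]
      using JH(1) by (intro measurable_restrict measurable_component_singleton) auto
    show ?thesis
    proof (rule vchar_unique[OF J(1)])
      fix c :: "real set \<Rightarrow> real"
      \<comment> \<open>Coefficients outside \<open>J\<close> are set to 0, so the marginal on
        \<open>J\<close> of the larger law has the characteristic function of \<open>L J\<close>;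
        uniqueness then gives consistency.\<close>
      define c' where "c' A = (if A \<in> J then c A else 0)" for A
      have eq: "(\<Sum>A\<in>H. c' A * g A) = (\<Sum>A\<in>J. c A * g A)" for g :: "real set \<Rightarrow> real"
        using JH by (intro sum.mono_neutral_cong_right) (auto simp: c'_def)
      have "vchar J (distr (L H) (PiM J (\<lambda>_. borel)) (\<lambda>f. restrict f J)) c =
          (CLINT x|L H. iexp (\<Sum>A\<in>J. c A * restrict x J A))"
        unfolding vchar_def by (rule integral_distr) measurable
      also have "\<dots> = vchar H (L H) c'"
        unfolding vchar_def eq by simp
      also have "\<dots> = vchar J (L J) c"
        using L(3)[OF JH(2,3), of c'] L(3)[OF J, of c] by (simp only: eq)
      finally show "vchar J (L J) c = vchar J (distr (L H) (PiM J (\<lambda>_. borel)) (\<lambda>f. restrict f J)) c" by simp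
    next
      show "prob_space (L J)" "sets (L J) = sets (PiM J (\<lambda>_. borel))"
        using L(1,2)[OF J] .
      show "prob_space (distr (L H) (PiM J (\<lambda>_. borel)) (\<lambda>f. restrict f J))"
        by (rule LH.prob_space_distr) measurable
    qed simp
  qed
  interpret PP: polish_projective borel_subsets_I L
  proof (intro polish_projective.intro projective_family.intro)
    show "L J = distr (L H) (PiM J (\<lambda>_. borel)) (\<lambda>f. restrict f J)"
      if "J \<subseteq> H" "finite H" "H \<subseteq> borel_subsets_I" for J H by (rule proj[OF that])
    show "prob_space (L J)" if "finite J" "J \<subseteq> borel_subsets_I" for J by (rule L(1)[OF that])
  qed
  have distr_lim: "distr PP.lim (PiM J (\<lambda>_. borel)) (\<lambda>f. restrict f J) = L J"
    if J: "finite J" "J \<subseteq> borel_subsets_I" for J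
  proof (rule measure_eqI)
    fix X assume "X \<in> sets (distr PP.lim (PiM J (\<lambda>_. borel)) (\<lambda>f. restrict f J))"
    hence X: "X \<in> sets (PiM J (\<lambda>_. borel))" by simp
    have "(\<lambda>f. restrict f J) \<in> measurable PP.lim (PiM J (\<lambda>_. borel))"
      unfolding measurable_cong_sets[OF PP.sets_lim refl]
      using J(2) by (intro measurable_restrict measurable_component_singleton) auto
    hence "emeasure (distr PP.lim (PiM J (\<lambda>_. borel)) (\<lambda>f. restrict f J)) X =
        emeasure PP.lim (prod_emb borel_subsets_I (\<lambda>_. borel) J X)"
      using X by (subst emeasure_distr) (auto simp: prod_emb_def space_PiM)
    also have "\<dots> = emeasure (L J) X" by (rule PP.emeasure_lim_emb[OF J(2,1) X])
    finally show "emeasure (distr PP.lim (PiM J (\<lambda>_. borel)) (\<lambda>f. restrict f J)) X = emeasure (L J) X" .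
  qed (use L J in auto)
  have "char_field PP.lim (\<lambda>A \<omega>. \<omega> A)"
    unfolding char_field_def
  proof (intro conjI ballI allI impI)
    show "prob_space PP.lim" by (rule PP.P.prob_space_axioms)
    show "(\<lambda>\<omega>. \<omega> A) \<in> borel_measurable PP.lim" if "A \<in> borel_subsets_I" for A
      unfolding measurable_cong_sets[OF PP.sets_lim refl] using that by (rule measurable_component_singleton)
    fix F and c :: "real set \<Rightarrow> real" assume F: "finite F" "F \<subseteq> borel_subsets_I"
    have r: "(\<lambda>f. restrict f F) \<in> measurable PP.lim (PiM F (\<lambda>_. borel))"
      unfolding measurable_cong_sets[OF PP.sets_lim refl]
      using F(2) by (intro measurable_restrict measurable_component_singleton) auto
    have "vchar F (L F) c = vchar F (distr PP.lim (PiM F (\<lambda>_. borel)) (\<lambda>f. restrict f F)) c"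
      by (simp only: distr_lim[OF F])
    also have "\<dots> = (CLINT x|PP.lim. iexp (\<Sum>A\<in>F. c A * restrict x F A))"
      unfolding vchar_def by (rule integral_distr[OF r]) measurable
    also have "\<dots> = (CLINT x|PP.lim. iexp (\<Sum>A\<in>F. c A * x A))" by simp
    finally show "(CLINT \<omega>|PP.lim. iexp (\<Sum>A\<in>F. c A * \<omega> A)) = exp (CLINT x|\<Phi>. V (\<Sum>A\<in>F. c A * indicator A x))"
      by (simp only: L(3)[OF F])
  qed
  thus ?thesis using PP.sets_lim by blast
qed

lemma char_field_marginal:
  assumes m: "char_field P m" and A: "A \<in> borel_subsets_I"
  shows "char (distr P borel (m A)) \<theta> = exp (of_real (measure \<Phi> A) * V \<theta>)"
proof -
  have mA: "m A \<in> borel_measurable P" by (rule char_field_measurable[OF m A])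
  have Ab[measurable]: "A \<in> sets borel" using A by simp
  \<comment> \<open>A one-element index set presents the single variable as a family.\<close>
  have "char (distr P borel (m A)) \<theta> = (CLINT \<omega>|P. iexp (\<Sum>j\<in>{()}. \<theta> * m A \<omega>))"
    using mA by (simp add: char_def integral_distr)
  also have "\<dots> = exp (CLINT x|\<Phi>. V (\<Sum>j\<in>{()}. \<theta> * indicator A x))"
    using A by (intro char_field_family[OF m]) auto
  also have "(CLINT x|\<Phi>. V (\<Sum>j\<in>{()}. \<theta> * indicator A x)) = (CLINT x|\<Phi>. indicator A x * V \<theta>)"
    by (intro Bochner_Integration.integral_cong refl) (auto simp: indicator_def V_0)
  also have "\<dots> = of_real (measure \<Phi> A) * V \<theta>" by (rule integral_indicator_times) measurable
  finally show ?thesis .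
qed

text \<open>On disjoint sets at most one indicator is nonzero at each point. Since V vanishes at 0,
  the exponent of the combination is the sum of the separate exponents, so the characteristic
  function factorises.\<close>

lemma char_field_indep:
  fixes A :: "nat \<Rightarrow> real set"
  assumes m: "char_field P m" and A: "range A \<subseteq> borel_subsets_I" "disjoint_family A"
  shows "prob_space.indep_vars P (\<lambda>_. borel) (\<lambda>n. m (A n)) UNIV"
proof -
  interpret P: prob_space P using m by (rule char_field_prob_space)
  have Ab[measurable]: "A n \<in> sets borel" for n using A by auto
  show ?thesis
  proof (rule P.indep_vars_if_char_prod)
    show "m (A i) \<in> borel_measurable P" for i using A(1) by (intro char_field_measurable[OF m]) auto
    fix J :: "nat set" and c assume J: "finite J"
    have "(CLINT \<omega>|P. iexp (\<Sum>j\<in>J. c j * m (A j) \<omega>)) = exp (CLINT x|\<Phi>. V (\<Sum>j\<in>J. c j * indicator (A j) x))"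
      using A by (intro char_field_family[OF m J]) auto
    also have "(CLINT x|\<Phi>. V (\<Sum>j\<in>J. c j * indicator (A j) x)) = (CLINT x|\<Phi>. \<Sum>j\<in>J. indicator (A j) x * V (c j))"
    proof (intro Bochner_Integration.integral_cong refl)
      fix x
      show "V (\<Sum>j\<in>J. c j * indicator (A j) x) = (\<Sum>j\<in>J. indicator (A j) x * V (c j))"
      proof (cases "\<exists>i\<in>J. x \<in> A i")
        case True
        then obtain i where i: "i \<in> J" "x \<in> A i" by blast
        have ind: "x \<in> A j \<longleftrightarrow> j = i" for j
          using i A(2) by (auto simp: disjoint_family_on_def)
        have "(\<Sum>j\<in>J. c j * indicator (A j) x) = (\<Sum>j\<in>J. if j = i then c j else 0)"
          by (intro sum.cong refl) (auto simp: ind)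
        moreover have "(\<Sum>j\<in>J. indicator (A j) x * V (c j)) = (\<Sum>j\<in>J. if j = i then V (c j) else 0)"
          by (intro sum.cong refl) (auto simp: ind)
        ultimately show ?thesis using i J by (simp add: sum.delta)
      next
        case False
        hence "(\<Sum>j\<in>J. c j * indicator (A j) x) = 0" "(\<Sum>j\<in>J. indicator (A j) x * V (c j)) = 0"
          by (auto intro!: sum.neutral)
        thus ?thesis by (simp add: V_0)
      qed
    qed
    also have "\<dots> = (\<Sum>j\<in>J. CLINT x|\<Phi>. indicator (A j) x * V (c j))"
      by (rule Bochner_Integration.integral_sum)
         (auto intro!: \<Phi>.integrable_const_bound[where B = "cmod (V _)"] simp: indicator_def)
    also have "\<dots> = (\<Sum>j\<in>J. of_real (measure \<Phi> (A j)) * V (c j))"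
      by (intro sum.cong refl integral_indicator_times Ab)
    also have "exp \<dots> = (\<Prod>j\<in>J. char (distr P borel (m (A j))) (c j))"
      unfolding exp_sum[OF J]
    proof (intro prod.cong refl)
      fix j
      have "A j \<in> borel_subsets_I" using A by auto
      thus "exp (of_real (measure \<Phi> (A j)) * V (c j)) = char (distr P borel (m (A j))) (c j)"
        by (rule char_field_marginal[OF m, symmetric])
    qed
    finally show "(CLINT \<omega>|P. iexp (\<Sum>j\<in>J. c j * m (A j) \<omega>)) = (\<Prod>j\<in>J. char (distr P borel (m (A j))) (c j))" .
  qed
qed

text \<open>The size in probability of a linear combination is governed by the \<Phi>-integral of
  the alpha-th power of the corresponding step function. This has the role that the L2 isometry
  plays for square integrable noise.\<close>

lemma char_field_tail:
  assumes m: "char_field P m" and J: "finite J" "\<And>j. j \<in> J \<Longrightarrow> A j \<in> borel_subsets_I" and e: "0 < e"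
  shows "measure P {\<omega>\<in>space P. e < \<bar>\<Sum>j\<in>J. c j * m (A j) \<omega>\<bar>} \<le>
    6 * (K * (LINT x|\<Phi>. \<bar>\<Sum>j\<in>J. c j * indicator (A j) x\<bar> powr \<alpha>)) * e powr (-\<alpha>)"
proof (rule tail_bound_V[OF _ _ _ _ _ e])
  show "prob_space P" using m by (rule char_field_prob_space)
  show "(\<lambda>\<omega>. \<Sum>j\<in>J. c j * m (A j) \<omega>) \<in> borel_measurable P"
    by (intro borel_measurable_sum borel_measurable_times borel_measurable_const char_field_measurable[OF m] J)
  show "(\<lambda>x. \<Sum>j\<in>J. c j * indicator (A j) x) \<in> borel_measurable borel"
    using J by (intro borel_measurable_sum borel_measurable_times borel_measurable_const borel_measurable_indicator) auto
  show "AE x in \<Phi>. \<bar>\<Sum>j\<in>J. c j * indicator (A j) x\<bar> \<le> (\<Sum>j\<in>J. \<bar>c j\<bar>)"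
    by (intro AE_I2 order_trans[OF sum_abs] sum_mono) (auto simp: abs_mult indicator_def)
  show "(CLINT \<omega>|P. iexp (\<theta> * (\<Sum>j\<in>J. c j * m (A j) \<omega>))) = exp (CLINT x|\<Phi>. V (\<theta> * (\<Sum>j\<in>J. c j * indicator (A j) x)))" for \<theta>
    using char_field_family[OF m J, where c = "\<lambda>j. \<theta> * c j"] by (simp only: sum_distrib_left mult.assoc)
qed

text \<open>S n - S k and S n - m U correspond to step functions dominated by the indicator of the
  union of the later sets, whose mass \<open>r\<close> tends to 0. The first estimate makes the
  independent series converge almost surely, the second identifies its limit.\<close>

lemma char_field_sigma_additive:
  fixes A :: "nat \<Rightarrow> real set"
  assumes m: "char_field P m" and A: "range A \<subseteq> borel_subsets_I" "disjoint_family A"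
  shows "AE \<omega> in P. (\<lambda>n. m (A n) \<omega>) sums m (\<Union>n. A n) \<omega>"
proof -
  interpret P: prob_space P using m by (rule char_field_prob_space)
  define U where "U = (\<Union>n. A n)"
  have Ab[measurable]: "A n \<in> sets borel" for n using A by auto
  have AI: "A n \<in> borel_subsets_I" for n using A by auto
  have UI: "U \<in> borel_subsets_I" unfolding U_def using A by auto
  have mA[measurable]: "m (A n) \<in> borel_measurable P" "m U \<in> borel_measurable P" for n
    by (intro char_field_measurable[OF m] AI UI)+
  define S where "S n \<omega> = (\<Sum>i<n. m (A i) \<omega>)" for n \<omega>
  have S[measurable]: "S n \<in> borel_measurable P" for n
    unfolding S_def by (intro borel_measurable_sum mA)
  define r where "r n = measure \<Phi> (\<Union>i\<in>{n..}. A i)" for n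
  have "r \<longlonglongrightarrow> measure \<Phi> (\<Inter>n. \<Union>i\<in>{n..}. A i)"
  proof (unfold r_def, intro \<Phi>.finite_Lim_measure_decseq)
    show "decseq (\<lambda>n. \<Union>i\<in>{n..}. A i)"
      unfolding decseq_def by (intro allI impI UN_mono) auto
  qed auto
  moreover have "(\<Inter>n. \<Union>i\<in>{n..}. A i) = {}"
  proof (intro equals0I)
    fix x assume x: "x \<in> (\<Inter>n. \<Union>i\<in>{n..}. A i)"
    then obtain i where "x \<in> A i" by auto
    moreover from x obtain j where "j \<ge> Suc i" "x \<in> A j" by blast
    ultimately show False using A(2) unfolding disjoint_family_on_def
      by (metis IntI UNIV_I emptyE not_less_eq_eq order_refl)
  qed
  ultimately have r: "r \<longlonglongrightarrow> 0" by simp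
  have indpow: "\<bar>\<bar>indicator B x :: real\<bar> powr \<alpha>\<bar> = indicator B x" for B x
    using \<alpha> by (auto simp: indicator_def)
  have ind_le: "measure P {\<omega>\<in>space P. e < \<bar>Z \<omega>\<bar>} \<le> 6 * (K * r n) * e powr (-\<alpha>)"
    if Z: "\<And>\<omega>. Z \<omega> = (\<Sum>j\<in>J. c j * m (B j) \<omega>)" and J: "finite J" "\<And>j. j \<in> J \<Longrightarrow> B j \<in> borel_subsets_I"
      and le: "\<And>x. \<bar>\<Sum>j\<in>J. c j * indicator (B j) x\<bar> \<le> indicator (\<Union>i\<in>{n..}. A i) x" and e: "0 < e"
    for Z and J :: "nat set" and c :: "nat \<Rightarrow> real" and B :: "nat \<Rightarrow> real set" and n e
  proof -
    have "(LINT x|\<Phi>. \<bar>\<Sum>j\<in>J. c j * indicator (B j) x\<bar> powr \<alpha>) \<le> (LINT x|\<Phi>. indicator (\<Union>i\<in>{n..}. A i) x)"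
    proof (rule integral_mono')
      show "\<bar>\<Sum>j\<in>J. c j * indicator (B j) x\<bar> powr \<alpha> \<le> indicator (\<Union>i\<in>{n..}. A i) x" for x
      proof -
        have "\<bar>\<Sum>j\<in>J. c j * indicator (B j) x\<bar> powr \<alpha> \<le> (indicator (\<Union>i\<in>{n..}. A i) x :: real) powr \<alpha>"
          using \<alpha> by (intro powr_mono2 le) auto
        also have "\<dots> = indicator (\<Union>i\<in>{n..}. A i) x" by (simp add: indicator_def)
        finally show ?thesis .
      qed
    qed (auto simp: \<Phi>.emeasure_eq_measure)
    also have "\<dots> = r n" unfolding r_def by simp
    finally have "6 * (K * (LINT x|\<Phi>. \<bar>\<Sum>j\<in>J. c j * indicator (B j) x\<bar> powr \<alpha>)) * e powr (-\<alpha>) \<le> 6 * (K * r n) * e powr (-\<alpha>)"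
      using K by (intro mult_right_mono mult_left_mono) auto
    thus ?thesis unfolding Z using char_field_tail[where A = B and c = c, OF m J e] by linarith
  qed
  have inc: "measure P {\<omega>\<in>space P. e < \<bar>S n \<omega> - S k \<omega>\<bar>} \<le> 6 * (K * r k) * e powr (-\<alpha>)" if kn: "k \<le> n" and e: "0 < e" for k n e
  proof (rule ind_le[of "\<lambda>\<omega>. S n \<omega> - S k \<omega>" "\<lambda>_. 1" A "{k..<n}" k e, OF _ _ _ _ e])
    show "S n \<omega> - S k \<omega> = (\<Sum>j=k..<n. 1 * m (A j) \<omega>)" for \<omega>
      unfolding S_def using sum_diff_nat_ivl[of 0 k n "\<lambda>i. m (A i) \<omega>"] kn by (simp add: atLeast0LessThan)
    fix x
    have "(\<Sum>j=k..<n. 1 * indicator (A j) x) = (indicator (\<Union>j\<in>{k..<n}. A j) x :: real)"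
      using A(2) by (subst indicator_UN_disjoint) (auto simp: disjoint_family_on_def)
    thus "\<bar>\<Sum>j=k..<n. 1 * indicator (A j) x\<bar> \<le> (indicator (\<Union>i\<in>{k..}. A i) x :: real)"
      by (auto simp: indicator_def split: if_splits)
  qed (use AI in auto)
  have lim: "measure P {\<omega>\<in>space P. e < \<bar>S n \<omega> - m U \<omega>\<bar>} \<le> 6 * (K * r n) * e powr (-\<alpha>)" if e: "0 < e" for n e
  \<comment> \<open>The extra index n carries the set \<open>U\<close> with coefficient -1, the
    indices below n carry the sets \<open>A j\<close>.\<close>
  proof (rule ind_le[of "\<lambda>\<omega>. S n \<omega> - m U \<omega>" "\<lambda>j. if j < n then 1 else -1"
        "\<lambda>j. if j < n then A j else U" "{..n}" n e, OF _ _ _ _ e])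
    have split: "(\<Sum>j\<le>n. (if j < n then 1 else -1) * g (if j < n then A j else U)) = (\<Sum>j<n. g (A j)) - g U" for g :: "real set \<Rightarrow> real"
      by (simp add: lessThan_Suc_atMost[symmetric])
    show "S n \<omega> - m U \<omega> = (\<Sum>j\<le>n. (if j < n then 1 else -1) * m (if j < n then A j else U) \<omega>)" for \<omega>
      unfolding S_def using split[of "\<lambda>B. m B \<omega>"] by simp
    fix x
    have "(\<Sum>j<n. indicator (A j) x) = (indicator (\<Union>j\<in>{..<n}. A j) x :: real)"
      using A(2) by (subst indicator_UN_disjoint) (auto simp: disjoint_family_on_def)
    moreover have "(indicator U x :: real) = indicator (\<Union>j\<in>{..<n}. A j) x + indicator (\<Union>i\<in>{n..}. A i) x"
    proof -
      have "U = (\<Union>j\<in>{..<n}. A j) \<union> (\<Union>i\<in>{n..}. A i)"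
      proof -
        have "(UNIV :: nat set) = {..<n} \<union> {n..}" by auto
        thus ?thesis unfolding U_def UN_Un[symmetric] by (rule arg_cong)
      qed
      moreover have "(\<Union>j\<in>{..<n}. A j) \<inter> (\<Union>i\<in>{n..}. A i) = {}"
      proof (intro equals0I, elim IntE UN_E)
        fix x i j assume "i \<in> {..<n}" "j \<in> {n..}" "x \<in> A i" "x \<in> A j"
        thus False using disjoint_family_onD[OF A(2), of i j] by auto
      qed
      ultimately show ?thesis by (simp add: indicator_disj_union)
    qed
    ultimately show "\<bar>\<Sum>j\<le>n. (if j < n then 1 else -1) * indicator (if j < n then A j else U) x\<bar> \<le> (indicator (\<Union>i\<in>{n..}. A i) x :: real)"
      unfolding split[of "\<lambda>B. indicator B x"] by simp
  qed (use AI UI in auto)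
  have small: "(\<lambda>n. 6 * (K * r n) * e powr (-\<alpha>)) \<longlonglongrightarrow> 0" for e
    using tendsto_mult[OF tendsto_mult[OF tendsto_const[of 6] tendsto_mult[OF tendsto_const[of K] r]] tendsto_const[of "e powr (-\<alpha>)"]] by simp
  have "P.cauchy_in_prob S"
    unfolding P.cauchy_in_prob_def
  proof (intro allI impI)
    fix e d :: real assume e: "0 < e" and d: "0 < d"
    from order_tendstoD(2)[OF small d, of e] obtain m0 where
      m0: "\<And>k. m0 \<le> k \<Longrightarrow> 6 * (K * r k) * e powr (-\<alpha>) < d" by (auto simp: eventually_sequentially)
    show "\<exists>m0. \<forall>m\<ge>m0. \<forall>n\<ge>m. P.prob {\<omega> \<in> space P. e < \<bar>S n \<omega> - S m \<omega>\<bar>} \<le> d"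
      using order_trans[OF inc[OF _ e] less_imp_le[OF m0]] by blast
  qed
  from P.indep_sum_AE_convergent[OF char_field_indep[OF m A] this[unfolded S_def]]
  have ae: "AE \<omega> in P. convergent (\<lambda>n. S n \<omega>)" by (simp add: S_def)
  define L where "L \<omega> = lim (\<lambda>n. S n \<omega>)" for \<omega>
  have L[measurable]: "L \<in> borel_measurable P" unfolding L_def by (rule borel_measurable_lim_metric) (rule S)
  have aeL: "AE \<omega> in P. (\<lambda>n. S n \<omega>) \<longlonglongrightarrow> L \<omega>"
    using ae by eventually_elim (simp add: L_def convergent_LIMSEQ_iff)
  have "tendsto_in_prob P S (m U)"
    unfolding tendsto_in_prob_def
  proof (intro allI impI)
    fix e :: real assume e: "0 < e"
    show "(\<lambda>n. P.prob {\<omega> \<in> space P. e < \<bar>S n \<omega> - m U \<omega>\<bar>}) \<longlonglongrightarrow> 0"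
      by (rule tendsto_sandwich[OF _ _ tendsto_const small[of e]]) (use lim[OF e] in auto)
  qed
  with P.AE_tendsto_imp_in_prob[OF S L aeL] have "AE \<omega> in P. L \<omega> = m U \<omega>"
    using S L mA(2) by (intro P.tendsto_in_prob_AE_unique[of S]) auto
  with aeL show ?thesis
    by eventually_elim (simp add: sums_def S_def U_def)
qed

lemma char_field_ID: "char_field P m \<Longrightarrow> ID_random_measure P m V \<Phi>"
  unfolding ID_random_measure_def
  by (intro conjI ballI allI impI; (elim conjE)?)
     (rule char_field_measurable char_field_indep char_field_sigma_additive char_field_marginal; assumption)+

end

section \<open>Factors of i.i.d. sequences\<close>

text \<open>A Dynkin argument for limits of set functions: domination by \<open>prob\<close> lets
  Tannery's theorem exchange the limit with a countable disjoint union. The limiting total mass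
  \<open>c\<close> is left free so that the lemma serves for either of the two events in a mixing
  statement.\<close>

lemma (in prob_space) dynkin_tendsto:
  fixes \<mu>s :: "nat \<Rightarrow> 'a set \<Rightarrow> real"
  assumes G: "Int_stable G" "G \<subseteq> Pow (space M)" "sets M = sigma_sets (space M) G"
    and compl: "\<And>n A. A \<in> sets M \<Longrightarrow> \<mu>s n (space M - A) = \<mu>s n (space M) - \<mu>s n A"
    and union: "\<And>n A. range A \<subseteq> sets M \<Longrightarrow> disjoint_family A \<Longrightarrow> (\<lambda>i::nat. \<mu>s n (A i)) sums \<mu>s n (\<Union>i. A i)"
    and bound: "\<And>n A. A \<in> sets M \<Longrightarrow> 0 \<le> \<mu>s n A \<and> \<mu>s n A \<le> prob A"
    and top: "(\<lambda>n. \<mu>s n (space M)) \<longlonglongrightarrow> c"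
    and basic: "\<And>A. A \<in> G \<Longrightarrow> (\<lambda>n. \<mu>s n A) \<longlonglongrightarrow> c * prob A"
    and A: "A \<in> sets M"
  shows "(\<lambda>n. \<mu>s n A) \<longlonglongrightarrow> c * prob A"
  using A unfolding G(3)
proof (induction A rule: sigma_sets_induct_disjoint[OF G(1,2), consumes 1, case_names basic empty compl union])
  case (basic A) thus ?case by (rule assms(8))
next
  case empty
  have "\<mu>s n {} = 0" for n using bound[of "{}" n] by simp
  thus ?case by simp
next
  case (compl A)
  hence A: "A \<in> sets M" by (simp add: G(3))
  have "(\<lambda>n. \<mu>s n (space M) - \<mu>s n A) \<longlonglongrightarrow> c - c * prob A"
    by (intro tendsto_diff top compl.IH)
  thus ?case using A by (simp add: assms(4) prob_compl right_diff_distrib)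
next
  case (union A)
  hence A: "range A \<subseteq> sets M" by (simp add: G(3))
  have sums: "(\<lambda>i. prob (A i)) sums prob (\<Union>i. A i)"
    by (rule finite_measure_UNION[OF A union.hyps(1)])
  have "(\<lambda>n. \<Sum>i. \<mu>s n (A i)) \<longlonglongrightarrow> (\<Sum>i. c * prob (A i))"
  proof (rule conjunct2[OF conjunct2[OF tannerys_theorem[where M = "\<lambda>i. prob (A i)"]]])
    show "(\<lambda>n. \<mu>s n (A i)) \<longlonglongrightarrow> c * prob (A i)" for i by (rule union.IH)
    show "\<forall>\<^sub>F (k, n) in sequentially \<times>\<^sub>F sequentially. norm (\<mu>s n (A k)) \<le> prob (A k)"
      using bound A by (intro always_eventually) auto
  qed (use sums in \<open>auto simp: sums_iff\<close>)
  moreover have "(\<Sum>i. \<mu>s n (A i)) = \<mu>s n (\<Union>i. A i)" for n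
    using assms(5)[OF A union.hyps(1), of n] by (simp add: sums_iff)
  moreover have "(\<Sum>i. c * prob (A i)) = c * prob (\<Union>i. A i)"
    using sums by (simp add: suminf_mult sums_iff)
  ultimately show ?case by simp
qed

section \<open>The shift on a two-sided product space\<close>

definition shift :: "int \<Rightarrow> (int \<Rightarrow> 'a) \<Rightarrow> int \<Rightarrow> 'a" where
  "shift t \<omega> = (\<lambda>s. \<omega> (s + t))"

lemma shift_shift: "shift s (shift t \<omega>) = shift (s + t) \<omega>"
  by (simp add: shift_def add.assoc)

context prob_space
begin

abbreviation two_sided :: "(int \<Rightarrow> 'a) measure" where
  "two_sided \<equiv> PiM UNIV (\<lambda>_. M)"

lemma prob_space_two_sided: "prob_space two_sided"
  by (intro prob_space_PiM prob_space_axioms)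

lemma shift_measurable[measurable]: "shift t \<in> measurable two_sided two_sided"
proof -
  have "(\<lambda>\<omega>. \<lambda>s\<in>UNIV. \<omega> (s + t)) \<in> measurable two_sided two_sided"
    by (intro measurable_restrict measurable_component_singleton) auto
  thus ?thesis by (simp add: shift_def[abs_def] restrict_UNIV)
qed

lemma distr_shift: "distr two_sided two_sided (shift t) = two_sided"
proof -
  have "distr two_sided two_sided (\<lambda>\<omega>. \<lambda>s\<in>UNIV. \<omega> (s + t)) = two_sided"
    by (rule distr_PiM_reindex) (auto intro: prob_space_axioms simp: inj_on_def)
  thus ?thesis by (simp add: shift_def[abs_def] restrict_UNIV)
qed

lemma measure_shift:
  assumes "B \<in> sets two_sided"
  shows "measure two_sided (shift t -` B \<inter> space two_sided) = measure two_sided B"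
proof -
  have "measure (distr two_sided two_sided (shift t)) B = measure two_sided (shift t -` B \<inter> space two_sided)"
    by (rule measure_distr[OF shift_measurable assms])
  thus ?thesis by (simp add: distr_shift)
qed

lemma measure_cylinder:
  assumes "finite J" "\<And>j. j \<in> J \<Longrightarrow> E j \<in> events"
  shows "measure two_sided {\<omega>\<in>space two_sided. \<forall>j\<in>J. \<omega> j \<in> E j} = (\<Prod>j\<in>J. prob (E j))"
proof -
  interpret R: product_prob_space "\<lambda>_::int. M" UNIV by (intro product_prob_spaceI prob_space_axioms)
  have "emeasure two_sided {\<omega>\<in>space two_sided. \<forall>j\<in>J. \<omega> j \<in> E j} = (\<Prod>j\<in>J. emeasure M (E j))"
    using assms by (intro R.emeasure_PiM_Collect) auto
  also have "\<dots> = ennreal (\<Prod>j\<in>J. prob (E j))"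
    using assms(1) by (simp add: emeasure_eq_measure prod_ennreal)
  finally show ?thesis by (simp add: measure_def prod_nonneg)
qed

lemma prod_algebra_cylinder:
  assumes "A \<in> prod_algebra (UNIV :: int set) (\<lambda>_. M)"
  obtains J E where "finite J" "\<And>j. E j \<in> events" "A = {\<omega>\<in>space two_sided. \<forall>j\<in>J. \<omega> j \<in> E j}"
proof -
  from assms obtain J E where JE: "A = prod_emb UNIV (\<lambda>_. M) J (\<Pi>\<^sub>E j\<in>J. E j)" "finite J"
    "\<And>i. i \<in> J \<Longrightarrow> E i \<in> events"
    by (rule prod_algebraE) blast
  define E' where "E' j = (if j \<in> J then E j else {})" for j
  have "A = {\<omega>\<in>space two_sided. \<forall>j\<in>J. \<omega> j \<in> E' j}"
    unfolding JE(1) by (auto simp: prod_emb_def space_PiM E'_def PiE_iff)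
  thus ?thesis using JE by (intro that[of J E']) (auto simp: E'_def)
qed

lemma shift_mixing:
  assumes A: "A \<in> sets two_sided" and B: "B \<in> sets two_sided"
  shows "(\<lambda>n. measure two_sided (A \<inter> (shift (int n) -` B \<inter> space two_sided))) \<longlonglongrightarrow>
    measure two_sided A * measure two_sided B"
proof -
  interpret Q: prob_space two_sided by (rule prob_space_two_sided)
  define G where "G = prod_algebra (UNIV :: int set) (\<lambda>_. M)"
  have G: "Int_stable G" "G \<subseteq> Pow (space two_sided)" "sets two_sided = sigma_sets (space two_sided) G"
    unfolding G_def using prod_algebra_sets_into_space[of UNIV "\<lambda>_::int. M"]
    by (auto simp: Int_stable_prod_algebra sets_PiM space_PiM)
  define T where "T n B = shift (int n) -` B \<inter> space two_sided" for n and B :: "(int \<Rightarrow> 'a) set"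
  have T[measurable]: "T n B \<in> sets two_sided" if "B \<in> sets two_sided" for n B
    unfolding T_def using that by measurable
  have TB: "Q.prob (T n B) = Q.prob B" if "B \<in> sets two_sided" for n B
    unfolding T_def by (rule measure_shift[OF that])
  have Tsp: "T n (space two_sided) = space two_sided" for n
    using measurable_space[OF shift_measurable[of "int n"]] by (auto simp: T_def)
  have cyl: "(\<lambda>n. Q.prob (A \<inter> T n B)) \<longlonglongrightarrow> Q.prob B * Q.prob A" if AB: "A \<in> G" "B \<in> G" for A B
  proof -
    obtain J E where A: "finite J" "\<And>j. E j \<in> events" "A = {\<omega>\<in>space two_sided. \<forall>j\<in>J. \<omega> j \<in> E j}"
      using AB(1) unfolding G_def by (rule prod_algebra_cylinder) blast
    obtain H F where B: "finite H" "\<And>j. F j \<in> events" "B = {\<omega>\<in>space two_sided. \<forall>j\<in>H. \<omega> j \<in> F j}"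
      using AB(2) unfolding G_def by (rule prod_algebra_cylinder) blast
    obtain b where b: "\<And>j. j \<in> J \<union> H \<Longrightarrow> \<bar>j\<bar> \<le> b"
      by (rule that[of "Max (insert 0 (abs ` (J \<union> H)))"]) (use A(1) B(1) in \<open>auto intro!: Max_ge\<close>)
    \<comment> \<open>All coordinates in \<open>J\<close> and \<open>H\<close> lie between -b and b,
      so a shift by more than 2b separates \<open>J\<close> from the translate of
      \<open>H\<close>.\<close>
    have "Q.prob (A \<inter> T n B) = Q.prob B * Q.prob A" if n: "nat (2 * b + 1) \<le> n" for n
    proof -
      define H' where "H' = (\<lambda>j. j + int n) ` H"
      have disj: "J \<inter> H' = {}"
      proof (intro equals0I)
        fix i assume "i \<in> J \<inter> H'"
        then obtain j where "i \<in> J" "j \<in> H" "i = j + int n" by (auto simp: H'_def)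
        thus False using b[of i] b[of j] n by auto
      qed
      define EF where "EF i = (if i \<in> J then E i else F (i - int n))" for i
      have notJ: "j + int n \<notin> J" if "j \<in> H" for j using disj that by (auto simp: H'_def)
      have TnB: "T n B = {\<omega>\<in>space two_sided. \<forall>j\<in>H. \<omega> (j + int n) \<in> F j}"
        using measurable_space[OF shift_measurable[of "int n"]] by (auto simp: T_def B(3) shift_def)
      have "A \<inter> T n B = {\<omega>\<in>space two_sided. \<forall>i\<in>J \<union> H'. \<omega> i \<in> EF i}"
      proof -
        have "(\<forall>i\<in>J. \<omega> i \<in> EF i) = (\<forall>j\<in>J. \<omega> j \<in> E j)" for \<omega>
          by (intro ball_cong) (auto simp: EF_def)
        moreover have "(\<forall>i\<in>H'. \<omega> i \<in> EF i) = (\<forall>j\<in>H. \<omega> (j + int n) \<in> F j)" for \<omega>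
        proof -
          have "(\<forall>i\<in>H'. \<omega> i \<in> EF i) = (\<forall>j\<in>H. \<omega> (j + int n) \<in> EF (j + int n))"
            unfolding H'_def by blast
          also have "\<dots> = (\<forall>j\<in>H. \<omega> (j + int n) \<in> F j)"
            by (intro ball_cong refl) (simp add: EF_def notJ)
          finally show ?thesis .
        qed
        ultimately show ?thesis by (auto simp: A(3) TnB ball_Un)
      qed
      hence "Q.prob (A \<inter> T n B) = (\<Prod>i\<in>J \<union> H'. prob (EF i))"
        using A B by (simp only:) (intro measure_cylinder, auto simp: H'_def EF_def)
      also have "\<dots> = (\<Prod>i\<in>J. prob (EF i)) * (\<Prod>i\<in>H'. prob (EF i))"
        using A B disj by (intro prod.union_disjoint) (auto simp: H'_def)
      also have "(\<Prod>i\<in>J. prob (EF i)) = Q.prob A"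
        unfolding A(3) using A by (subst measure_cylinder) (auto simp: EF_def)
      also have "(\<Prod>i\<in>H'. prob (EF i)) = (\<Prod>j\<in>H. prob (F j))"
        unfolding H'_def by (subst prod.reindex) (auto intro!: prod.cong simp: EF_def notJ)
      also have "\<dots> = Q.prob B"
        unfolding B(3) using B by (subst measure_cylinder) auto
      finally show ?thesis by simp
    qed
    hence "eventually (\<lambda>n. Q.prob (A \<inter> T n B) = Q.prob B * Q.prob A) sequentially"
      unfolding eventually_sequentially by blast
    thus ?thesis by (rule tendsto_eventually)
  qed
  have step1: "(\<lambda>n. Q.prob (A \<inter> T n B)) \<longlonglongrightarrow> Q.prob B * Q.prob A" if A: "A \<in> sets two_sided" and B: "B \<in> G" for A B
  proof (rule Q.dynkin_tendsto[OF G _ _ _ _ _ A])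
    have Bs: "B \<in> sets two_sided" using B G(3) by auto
    note [measurable] = T[OF Bs]
    show "Q.prob ((space two_sided - A) \<inter> T n B) = Q.prob (space two_sided \<inter> T n B) - Q.prob (A \<inter> T n B)"
      if A: "A \<in> sets two_sided" for n A
    proof -
      have "(space two_sided - A) \<inter> T n B = (space two_sided \<inter> T n B) - (A \<inter> T n B)"
        by (auto simp: T_def)
      thus ?thesis using A T[OF Bs] by (simp only:) (intro Q.finite_measure_Diff, auto simp: T_def)
    qed
    show "(\<lambda>i. Q.prob (A i \<inter> T n B)) sums Q.prob ((\<Union>i. A i) \<inter> T n B)"
      if A: "range A \<subseteq> sets two_sided" "disjoint_family A" for n and A :: "nat \<Rightarrow> _"
    proof -
      have "(\<lambda>i. Q.prob (A i \<inter> T n B)) sums Q.prob (\<Union>i. A i \<inter> T n B)"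
        using A T[OF Bs] by (intro Q.finite_measure_UNION) (auto simp: disjoint_family_on_def)
      thus ?thesis by simp
    qed
    show "0 \<le> Q.prob (A \<inter> T n B) \<and> Q.prob (A \<inter> T n B) \<le> Q.prob A" if "A \<in> sets two_sided" for n A
      using that by (auto intro: Q.finite_measure_mono)
    have "space two_sided \<inter> T n B = T n B" for n by (auto simp: T_def)
    thus "(\<lambda>n. Q.prob (space two_sided \<inter> T n B)) \<longlonglongrightarrow> Q.prob B" by (simp add: TB[OF Bs])
    show "(\<lambda>n. Q.prob (A \<inter> T n B)) \<longlonglongrightarrow> Q.prob B * Q.prob A" if "A \<in> G" for A
      by (rule cyl[OF that B])
  qed
  have "(\<lambda>n. Q.prob (A \<inter> T n B)) \<longlonglongrightarrow> Q.prob A * Q.prob B"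
  proof (rule Q.dynkin_tendsto[OF G _ _ _ _ _ B])
    have TD: "T n (space two_sided - B) = space two_sided - T n B" for n B
      using measurable_space[OF shift_measurable[of "int n"]] by (auto simp: T_def)
    show "Q.prob (A \<inter> T n (space two_sided - B)) = Q.prob (A \<inter> T n (space two_sided)) - Q.prob (A \<inter> T n B)"
      if B: "B \<in> sets two_sided" for n B
    proof -
      have "A \<inter> T n (space two_sided - B) = A - (A \<inter> T n B)" "A \<inter> T n (space two_sided) = A"
        using sets.sets_into_space[OF A] by (auto simp: TD Tsp)
      thus ?thesis using A T[OF B] by (simp only:) (intro Q.finite_measure_Diff, auto)
    qed
    show "(\<lambda>i. Q.prob (A \<inter> T n (B i))) sums Q.prob (A \<inter> T n (\<Union>i. B i))"
      if B: "range B \<subseteq> sets two_sided" "disjoint_family B" for n and B :: "nat \<Rightarrow> _"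
    proof -
      have "T n (B i) \<in> sets two_sided" for i using B by (intro T) auto
      hence "(\<lambda>i. Q.prob (A \<inter> T n (B i))) sums Q.prob (\<Union>i. A \<inter> T n (B i))"
        using A B(2) by (intro Q.finite_measure_UNION) (auto simp: disjoint_family_on_def T_def)
      moreover have "(\<Union>i. A \<inter> T n (B i)) = A \<inter> T n (\<Union>i. B i)" by (auto simp: T_def)
      ultimately show ?thesis by simp
    qed
    show "0 \<le> Q.prob (A \<inter> T n B) \<and> Q.prob (A \<inter> T n B) \<le> Q.prob B" if B: "B \<in> sets two_sided" for n B
      using Q.finite_measure_mono[of "A \<inter> T n B" "T n B"] T[OF B] TB[OF B] by auto
    show "(\<lambda>n. Q.prob (A \<inter> T n (space two_sided))) \<longlonglongrightarrow> Q.prob A"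
      using sets.sets_into_space[OF A] by (simp add: Tsp Int_absorb2)
    show "(\<lambda>n. Q.prob (A \<inter> T n B)) \<longlonglongrightarrow> Q.prob A * Q.prob B" if "B \<in> G" for B
      using step1[OF A that] by (simp add: mult.commute)
  qed
  thus ?thesis by (simp add: T_def)
qed

lemma two_sided_factor_stationary:
  assumes X: "X \<in> borel_measurable two_sided"
  shows "stationary_process two_sided (\<lambda>t \<omega>. X (shift t \<omega>))"
  unfolding stationary_process_def path_law_def
proof
  fix h
  have m: "(\<lambda>\<omega> t. X (shift t \<omega>)) \<in> measurable two_sided (PiM UNIV (\<lambda>_. borel))"
    using measurable_restrict[of UNIV "\<lambda>t \<omega>. X (shift t \<omega>)" two_sided "\<lambda>_. borel"]
      measurable_compose[OF shift_measurable X] by (simp add: restrict_UNIV)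
  have "distr two_sided (PiM UNIV (\<lambda>_. borel)) (\<lambda>\<omega> t. X (shift t \<omega>)) =
      distr (distr two_sided two_sided (shift h)) (PiM UNIV (\<lambda>_. borel)) (\<lambda>\<omega> t. X (shift t \<omega>))"
    by (simp only: distr_shift)
  also have "\<dots> = distr two_sided (PiM UNIV (\<lambda>_. borel)) (\<lambda>\<omega> t. X (shift (t + h) \<omega>))"
    by (subst distr_distr[OF m shift_measurable]) (simp add: o_def shift_shift)
  finally show "distr two_sided (PiM UNIV (\<lambda>_. borel)) (\<lambda>\<omega> t. X (shift (t + h) \<omega>)) =
      distr two_sided (PiM UNIV (\<lambda>_. borel)) (\<lambda>\<omega> t. X (shift t \<omega>))" by simp
qed

text \<open>An invariant set of paths pulls back to an event E that equals all its shifts, so mixing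
  gives P(E) = P(E)^2.\<close>

lemma two_sided_factor_ergodic:
  assumes X: "X \<in> borel_measurable two_sided"
  shows "ergodic_process two_sided (\<lambda>t \<omega>. X (shift t \<omega>))"
  unfolding ergodic_process_def
proof (intro ballI impI)
  fix A assume A: "A \<in> sets (PiM (UNIV :: int set) (\<lambda>_. borel :: real measure))"
    and inv: "(\<lambda>x t. x (t + 1)) -` A = A"
  interpret Q: prob_space two_sided by (rule prob_space_two_sided)
  define Y where "Y \<omega> = (\<lambda>t. X (shift t \<omega>))" for \<omega>
  have Y[measurable]: "Y \<in> measurable two_sided (PiM UNIV (\<lambda>_. borel))"
    unfolding Y_def[abs_def] using measurable_restrict[of UNIV "\<lambda>t \<omega>. X (shift t \<omega>)" two_sided "\<lambda>_. borel"]
      measurable_compose[OF shift_measurable X] by (simp add: restrict_UNIV)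
  define E where "E = Y -` A \<inter> space two_sided"
  have E: "E \<in> sets two_sided" unfolding E_def using A by measurable
  have "(\<lambda>t. x (t + int n)) \<in> A \<longleftrightarrow> x \<in> A" for x n
  proof (induction n arbitrary: x)
    case (Suc n)
    have "(\<lambda>t. x (t + int (Suc n))) = (\<lambda>t. (\<lambda>t. x (t + int n)) (t + 1))" by (simp add: add_ac)
    hence "(\<lambda>t. x (t + int (Suc n))) \<in> A \<longleftrightarrow> (\<lambda>t. x (t + int n)) \<in> (\<lambda>x t. x (t + 1)) -` A" by simp
    thus ?case using Suc inv by simp
  qed simp
  moreover have "Y (shift (int n) \<omega>) = (\<lambda>t. Y \<omega> (t + int n))" for n \<omega>
    by (simp add: Y_def shift_shift)
  ultimately have "shift (int n) -` E \<inter> space two_sided = E" for n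
    using measurable_space[OF shift_measurable[of "int n"]] by (auto simp: E_def)
  hence "(\<lambda>n::nat. Q.prob E) \<longlonglongrightarrow> Q.prob E * Q.prob E"
    using shift_mixing[OF E E] by simp
  hence "Q.prob E = Q.prob E * Q.prob E" by (simp add: LIMSEQ_const_iff)
  hence "Q.prob E = 0 \<or> Q.prob E = 1" by simp
  moreover have "measure (path_law two_sided (\<lambda>t \<omega>. X (shift t \<omega>))) A = Q.prob E"
    unfolding path_law_def E_def Y_def[symmetric] by (rule measure_distr[OF Y[unfolded eta_contract_eq] A])
  ultimately show "measure (path_law two_sided (\<lambda>t \<omega>. X (shift t \<omega>))) A = 0 \<or>
      measure (path_law two_sided (\<lambda>t \<omega>. X (shift t \<omega>))) A = 1" by simp
qed

lemma integral_two_sided_prod: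
  fixes f :: "int \<Rightarrow> 'a \<Rightarrow> complex"
  assumes S: "finite S" and f: "\<And>s. s \<in> S \<Longrightarrow> integrable M (f s)"
  shows "(CLINT \<omega>|two_sided. \<Prod>s\<in>S. f s (\<omega> s)) = (\<Prod>s\<in>S. CLINT x|M. f s x)"
proof -
  interpret R: product_prob_space "\<lambda>_::int. M" UNIV by (intro product_prob_spaceI prob_space_axioms)
  have r: "(\<lambda>\<omega>. restrict \<omega> S) \<in> measurable two_sided (PiM S (\<lambda>_. M))"
    by (intro measurable_restrict measurable_component_singleton) auto
  have fm: "(\<lambda>\<omega>. \<Prod>s\<in>S. f s (\<omega> s)) \<in> borel_measurable (PiM S (\<lambda>_. M))"
    using f by (intro borel_measurable_prod measurable_compose[OF measurable_component_singleton] borel_measurable_integrable)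
  have "(CLINT \<omega>|two_sided. \<Prod>s\<in>S. f s (\<omega> s)) = (CLINT \<omega>|two_sided. \<Prod>s\<in>S. f s (restrict \<omega> S s))"
    by (intro Bochner_Integration.integral_cong refl prod.cong) auto
  also have "\<dots> = (CLINT \<omega>|distr two_sided (PiM S (\<lambda>_. M)) (\<lambda>\<omega>. restrict \<omega> S). \<Prod>s\<in>S. f s (\<omega> s))"
    by (rule integral_distr[OF r fm, symmetric])
  also have "\<dots> = (CLINT \<omega>|PiM S (\<lambda>_. M). \<Prod>s\<in>S. f s (\<omega> s))"
    using S by (subst R.distr_PiM_restrict_finite) auto
  also have "\<dots> = (\<Prod>s\<in>S. CLINT x|M. f s x)"
    by (rule R.product_integral_prod[OF S f])
  finally show ?thesis .
qed

end

section \<open>Integrals with respect to the random measure\<close>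

abbreviation (input) unit_I :: "real set" where "unit_I \<equiv> {-1<..<1}"

text \<open>Rounding down to multiples of \<open>1 / Suc n\<close>. The error is uniform in x, so
  its alpha-th power is integrated at once, and a bounded g takes finitely many values after
  rounding.\<close>

definition grid_approx :: "(real \<Rightarrow> real) \<Rightarrow> nat \<Rightarrow> real \<Rightarrow> real" where
  "grid_approx g n x = of_int \<lfloor>real (Suc n) * g x\<rfloor> / real (Suc n)"

lemma grid_approx_dist: "\<bar>grid_approx g n x - g x\<bar> \<le> 1 / real (Suc n)"
proof -
  have "\<bar>of_int \<lfloor>real (Suc n) * g x\<rfloor> - real (Suc n) * g x\<bar> \<le> 1" by linarith
  hence "\<bar>of_int \<lfloor>real (Suc n) * g x\<rfloor> - real (Suc n) * g x\<bar> / real (Suc n) \<le> 1 / real (Suc n)"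
    by (intro divide_right_mono) auto
  moreover have "grid_approx g n x - g x = (of_int \<lfloor>real (Suc n) * g x\<rfloor> - real (Suc n) * g x) / real (Suc n)"
    by (simp add: grid_approx_def diff_divide_distrib)
  ultimately show ?thesis by (simp only: abs_divide abs_of_nat)
qed

lemma grid_approx_tendsto: "(\<lambda>n. grid_approx g n x) \<longlonglongrightarrow> g x"
proof -
  have "(\<lambda>n. grid_approx g n x - g x) \<longlonglongrightarrow> 0"
    by (rule Lim_null_comparison[OF always_eventually LIMSEQ_Suc[OF lim_1_over_n]])
       (use grid_approx_dist in auto)
  thus ?thesis by (simp add: LIM_zero_iff)
qed

lemma grid_approx_measurable[measurable]:
  assumes [measurable]: "g \<in> borel_measurable M"
  shows "grid_approx g n \<in> borel_measurable M"
proof -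
  have "(\<lambda>x. of_int \<lfloor>c * g x\<rfloor> / c) \<in> borel_measurable M" for c :: real by measurable
  thus ?thesis unfolding grid_approx_def[abs_def] .
qed

lemma grid_approx_simple:
  assumes g: "g \<in> borel_measurable borel" "\<And>x. x \<in> unit_I \<Longrightarrow> \<bar>g x\<bar> \<le> 1"
  shows "simple_function (restrict_space borel unit_I) (grid_approx g n)"
proof (rule simple_function_borel_measurable)
  show "grid_approx g n \<in> borel_measurable (restrict_space borel unit_I)"
    by (rule measurable_restrict_space1) (use g in measurable)
  have "grid_approx g n ` unit_I \<subseteq> (\<lambda>z. of_int z / real (Suc n)) ` {- int (Suc n)..int (Suc n)}"
  proof (intro image_subsetI)
    fix x assume "x \<in> unit_I"
    hence "\<bar>real (Suc n) * g x\<bar> \<le> real (Suc n)"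
      using g(2)[of x] mult_left_mono[of "\<bar>g x\<bar>" 1 "real (Suc n)"] by (simp add: abs_mult)
    hence "- real (Suc n) \<le> real (Suc n) * g x" "real (Suc n) * g x \<le> real (Suc n)" by linarith+
    hence "\<lfloor>real (Suc n) * g x\<rfloor> \<in> {- int (Suc n)..int (Suc n)}"
      unfolding atLeastAtMost_iff le_floor_iff floor_le_iff
      by (intro conjI; simp only: of_int_minus of_int_of_nat_eq; linarith)
    thus "grid_approx g n x \<in> (\<lambda>z. of_int z / real (Suc n)) ` {- int (Suc n)..int (Suc n)}"
      unfolding grid_approx_def by (rule imageI)
  qed
  hence "finite (grid_approx g n ` unit_I)" by (rule finite_subset) simp
  thus "finite (grid_approx g n ` space (restrict_space borel unit_I))"
    by (simp add: space_restrict_space)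
qed

text \<open>The coefficient of the innovation at time \<open>m - j\<close> in \<open>\<Sum>t\<in>J. \<theta> t * X t\<close>, given that the
  autoregressive coefficient is \<open>x\<close>; all of \<open>J\<close> is meant to lie below \<open>m\<close>.\<close>

definition moving_kernel :: "int \<Rightarrow> int set \<Rightarrow> (int \<Rightarrow> real) \<Rightarrow> nat \<Rightarrow> real \<Rightarrow> real" where
  "moving_kernel m J \<theta> j x = (\<Sum>t\<in>J. (if m - int j \<le> t then \<theta> t else 0) * x ^ nat (t - m + int j))"

context levy_control
begin

lemma
  assumes f: "simple_function (restrict_space borel unit_I) f"
  shows simple_function_I_finite: "finite (f ` unit_I)"
    and simple_function_I_level: "A \<in> borel_subsets_I \<Longrightarrow> {x \<in> A \<inter> unit_I. f x = y} \<in> borel_subsets_I"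
proof -
  show "finite (f ` unit_I)"
    using f by (simp add: simple_function_def space_restrict_space)
  assume A: "A \<in> borel_subsets_I"
  have "f -` {y} \<inter> space (restrict_space borel unit_I) \<in> sets (restrict_space borel unit_I)"
    by (rule simple_functionD(2)[OF f])
  hence "f -` {y} \<inter> unit_I \<in> sets borel"
    by (auto simp: space_restrict_space sets_restrict_space)
  moreover have "{x \<in> A \<inter> unit_I. f x = y} = A \<inter> (f -` {y} \<inter> unit_I)" by auto
  ultimately show "{x \<in> A \<inter> unit_I. f x = y} \<in> borel_subsets_I" using A by auto
qed

lemma simple_random_integral_measurable:
  assumes m: "char_field P m" and A: "A \<in> borel_subsets_I"
    and f: "simple_function (restrict_space borel unit_I) f"
  shows "simple_random_integral m A f \<in> borel_measurable P"
  unfolding simple_random_integral_def[abs_def]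
  by (intro borel_measurable_sum borel_measurable_times borel_measurable_const
      char_field_measurable[OF m] simple_function_I_level[OF f A])

context
  fixes P :: "'w measure" and m :: "real set \<Rightarrow> 'w \<Rightarrow> real" and S :: "'k set" and A :: "'k \<Rightarrow> real set" and f :: "'k \<Rightarrow> real \<Rightarrow> real" and a :: "'k \<Rightarrow> real"
  assumes m: "char_field P m" and S: "finite S" and A: "\<And>k. k \<in> S \<Longrightarrow> A k \<in> borel_subsets_I"
    and f: "\<And>k. k \<in> S \<Longrightarrow> simple_function (restrict_space borel unit_I) (f k)"
begin

text \<open>\<open>D\<close> pairs each index with a value of its simple function, and
  \<open>lev\<close> is the corresponding level set inside \<open>A k\<close>. This flattens a
  combination of simple integrals into one linear combination of field values, to which
  \<open>char_field_family\<close> and \<open>char_field_tail\<close> apply.\<close>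

private definition "D = (SIGMA k:S. f k ` unit_I)"
private definition "lev p = {x \<in> A (fst p) \<inter> unit_I. f (fst p) x = snd p}"

private lemma D: "finite D" "p \<in> D \<Longrightarrow> lev p \<in> borel_subsets_I"
proof -
  show "finite D" unfolding D_def using S f simple_function_I_finite by (intro finite_SigmaI) auto
  show "p \<in> D \<Longrightarrow> lev p \<in> borel_subsets_I"
    unfolding lev_def D_def by (intro simple_function_I_level A f) auto
qed

private lemma D_sum: "(\<Sum>k\<in>S. a k * simple_random_integral m (A k) (f k) \<omega>) = (\<Sum>p\<in>D. (a (fst p) * snd p) * m (lev p) \<omega>)"
proof -
  have "(\<Sum>k\<in>S. a k * simple_random_integral m (A k) (f k) \<omega>) =
      (\<Sum>k\<in>S. \<Sum>y\<in>f k ` unit_I. (a k * y) * m (lev (k, y)) \<omega>)"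
    by (simp add: simple_random_integral_def sum_distrib_left lev_def mult.assoc)
  also have "\<dots> = (\<Sum>(k, y)\<in>D. (a k * y) * m (lev (k, y)) \<omega>)"
    unfolding D_def using S f simple_function_I_finite by (intro sum.Sigma) auto
  finally show ?thesis by (simp add: split_def)
qed

private lemma D_ind: "(\<Sum>p\<in>D. (a (fst p) * snd p) * indicator (lev p) x) = (\<Sum>k\<in>S. a k * (indicator (A k) x * f k x))"
proof -
  have "(\<Sum>p\<in>D. (a (fst p) * snd p) * indicator (lev p) x) = (\<Sum>(k, y)\<in>D. (a k * y) * indicator (lev (k, y)) x)"
    by (simp add: split_def)
  also have "\<dots> = (\<Sum>k\<in>S. \<Sum>y\<in>f k ` unit_I. (a k * y) * indicator (lev (k, y)) x)"
    unfolding D_def using S f simple_function_I_finite by (intro sum.Sigma[symmetric]) auto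
  also have "\<dots> = (\<Sum>k\<in>S. a k * (indicator (A k) x * f k x))"
  proof (intro sum.cong refl)
    fix k assume k: "k \<in> S"
    show "(\<Sum>y\<in>f k ` unit_I. (a k * y) * indicator (lev (k, y)) x) = a k * (indicator (A k) x * f k x)"
    proof (cases "x \<in> A k")
      case True
      hence xI: "x \<in> unit_I" using A[OF k] by auto
      have "(\<Sum>y\<in>f k ` unit_I. (a k * y) * indicator (lev (k, y)) x) = (\<Sum>y\<in>f k ` unit_I. if y = f k x then a k * y else 0)"
        using True xI by (intro sum.cong refl) (auto simp: lev_def)
      also have "\<dots> = a k * f k x"
        using simple_function_I_finite[OF f[OF k]] xI by (subst sum.delta) auto
      finally show ?thesis using True by simp
    next
      case False
      thus ?thesis by (auto simp: lev_def intro!: sum.neutral)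
    qed
  qed
  finally show ?thesis .
qed

lemma char_field_simple:
  "(CLINT \<omega>|P. iexp (\<Sum>k\<in>S. a k * simple_random_integral m (A k) (f k) \<omega>)) =
    exp (CLINT x|\<Phi>. V (\<Sum>k\<in>S. a k * (indicator (A k) x * f k x)))"
  unfolding D_sum D_ind[symmetric] by (rule char_field_family[OF m D])

lemma char_field_simple_tail:
  assumes e: "0 < e"
  shows "measure P {\<omega>\<in>space P. e < \<bar>\<Sum>k\<in>S. a k * simple_random_integral m (A k) (f k) \<omega>\<bar>} \<le>
    6 * (K * (LINT x|\<Phi>. \<bar>\<Sum>k\<in>S. a k * (indicator (A k) x * f k x)\<bar> powr \<alpha>)) * e powr (-\<alpha>)"
  unfolding D_sum D_ind[symmetric] by (rule char_field_tail[OF m D e])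

end

text \<open>For k <= n the two grid approximations differ by at most 2 / Suc k, so by the tail
  estimate their integrals over \<open>A\<close> are Cauchy in probability.\<close>

lemma simple_random_integral_tendsto:
  assumes m: "char_field P m" and A: "A \<in> borel_subsets_I"
    and g: "g \<in> borel_measurable borel" "\<And>x. x \<in> unit_I \<Longrightarrow> \<bar>g x\<bar> \<le> 1"
  shows "\<exists>L\<in>borel_measurable P. tendsto_in_prob P (\<lambda>n. simple_random_integral m A (grid_approx g n)) L"
proof -
  interpret P: prob_space P using m by (rule char_field_prob_space)
  note simple = grid_approx_simple[OF g]
  have Ab[measurable]: "A \<in> sets borel" using A by simp
  note [measurable] = g(1)
  have inc: "P.prob {\<omega>\<in>space P. e < \<bar>simple_random_integral m A (grid_approx g n) \<omega> - simple_random_integral m A (grid_approx g k) \<omega>\<bar>}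
      \<le> 6 * (K * (2 / real (Suc k)) powr \<alpha>) * e powr (-\<alpha>)" if e: "0 < e" and kn: "k \<le> n" for e k n
  proof -
    \<comment> \<open>\<open>bool\<close> indexes the two integrals to be subtracted, with signs 1
      and -1.\<close>
    define a where "a b = (if b then 1 else -1 :: real)" for b
    define f where "f b = (if b then grid_approx g n else grid_approx g k)" for b
    have "P.prob {\<omega>\<in>space P. e < \<bar>\<Sum>b\<in>UNIV. a b * simple_random_integral m A (f b) \<omega>\<bar>} \<le>
        6 * (K * (LINT x|\<Phi>. \<bar>\<Sum>b\<in>UNIV. a b * (indicator A x * f b x)\<bar> powr \<alpha>)) * e powr (-\<alpha>)"
      by (rule char_field_simple_tail[OF m _ A _ e]) (auto simp: f_def intro: simple)
    moreover have "(\<Sum>b\<in>UNIV. a b * simple_random_integral m A (f b) \<omega>) =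
        simple_random_integral m A (grid_approx g n) \<omega> - simple_random_integral m A (grid_approx g k) \<omega>" for \<omega>
      by (simp add: UNIV_bool a_def f_def)
    moreover have "(\<Sum>b\<in>UNIV. a b * (indicator A x * f b x)) = indicator A x * (grid_approx g n x - grid_approx g k x)" for x
      by (simp add: UNIV_bool a_def f_def right_diff_distrib)
    moreover have "(LINT x|\<Phi>. \<bar>indicator A x * (grid_approx g n x - grid_approx g k x)\<bar> powr \<alpha>) \<le> (LINT x|\<Phi>. (2 / real (Suc k)) powr \<alpha>)"
    proof (rule integral_mono')
      show "\<bar>indicator A x * (grid_approx g n x - grid_approx g k x)\<bar> powr \<alpha> \<le> (2 / real (Suc k)) powr \<alpha>" for x
      proof (rule powr_mono2)
        have "1 / real (Suc n) \<le> 1 / real (Suc k)" using kn by (intro divide_left_mono) auto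
        hence "\<bar>grid_approx g n x - grid_approx g k x\<bar> \<le> 2 / real (Suc k)"
          using grid_approx_dist[of g n x] grid_approx_dist[of g k x] by linarith
        thus "\<bar>indicator A x * (grid_approx g n x - grid_approx g k x)\<bar> \<le> 2 / real (Suc k)"
          by (simp add: indicator_def)
      qed (use \<alpha> in auto)
    qed auto
    moreover have "(LINT x|\<Phi>. (2 / real (Suc k)) powr \<alpha>) = (2 / real (Suc k)) powr \<alpha>"
      using \<Phi>.prob_space by simp
    ultimately have "P.prob {\<omega>\<in>space P. e < \<bar>simple_random_integral m A (grid_approx g n) \<omega> - simple_random_integral m A (grid_approx g k) \<omega>\<bar>}
        \<le> 6 * (K * (LINT x|\<Phi>. \<bar>indicator A x * (grid_approx g n x - grid_approx g k x)\<bar> powr \<alpha>)) * e powr (-\<alpha>)"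
      "(LINT x|\<Phi>. \<bar>indicator A x * (grid_approx g n x - grid_approx g k x)\<bar> powr \<alpha>) \<le> (2 / real (Suc k)) powr \<alpha>"
      by simp_all
    thus ?thesis using K by (elim order_trans) (intro mult_right_mono mult_left_mono, auto)
  qed
  have lim0: "(\<lambda>k. 6 * (K * (2 / real (Suc k)) powr \<alpha>) * e powr (-\<alpha>)) \<longlonglongrightarrow> 0" for e
  proof -
    have "(\<lambda>k. (2 / real (Suc k)) powr \<alpha>) \<longlonglongrightarrow> 0 powr \<alpha>"
      using \<alpha> LIMSEQ_Suc[OF lim_const_over_n[of 2]] by (intro tendsto_powr2) auto
    hence "(\<lambda>k. (2 / real (Suc k)) powr \<alpha>) \<longlonglongrightarrow> 0" by simp
    from tendsto_mult[OF tendsto_mult[OF tendsto_const[of 6] tendsto_mult[OF tendsto_const[of K] this]] tendsto_const[of "e powr (-\<alpha>)"]]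
    show ?thesis by simp
  qed
  have "P.cauchy_in_prob (\<lambda>n. simple_random_integral m A (grid_approx g n))"
    unfolding P.cauchy_in_prob_def
  proof (intro allI impI)
    fix e d :: real assume e: "0 < e" and d: "0 < d"
    from order_tendstoD(2)[OF lim0 d, of e] obtain m0 where
      m0: "\<And>k. m0 \<le> k \<Longrightarrow> 6 * (K * (2 / real (Suc k)) powr \<alpha>) * e powr (-\<alpha>) < d" by (auto simp: eventually_sequentially)
    show "\<exists>m0. \<forall>k\<ge>m0. \<forall>n\<ge>k. P.prob {\<omega>\<in>space P. e < \<bar>simple_random_integral m A (grid_approx g n) \<omega> - simple_random_integral m A (grid_approx g k) \<omega>\<bar>} \<le> d"
      using order_trans[OF inc[OF e] less_imp_le[OF m0]] by blast
  qed
  thus ?thesis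
    by (intro P.cauchy_in_prob_convergent simple_random_integral_measurable[OF m A simple])
qed

lemma unit_I_borel: "unit_I \<in> borel_subsets_I" by simp

text \<open>The same grid sequence works for every Borel set, as \<open>has_random_integral\<close>
  demands.\<close>

lemma has_random_integral_grid:
  assumes m: "char_field P m"
    and g: "g \<in> borel_measurable borel" "\<And>x. x \<in> unit_I \<Longrightarrow> \<bar>g x\<bar> \<le> 1"
    and L: "L \<in> borel_measurable P" "tendsto_in_prob P (\<lambda>n. simple_random_integral m unit_I (grid_approx g n)) L"
  shows "has_random_integral P m \<Phi> g L"
  unfolding has_random_integral_def
  using L grid_approx_simple[OF g] grid_approx_tendsto simple_random_integral_tendsto[OF m _ g]
  by (intro conjI exI[of _ "grid_approx g"]) auto

definition F0 :: "(real set \<Rightarrow> real) measure" where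
  "F0 = (SOME P0. sets P0 = sets (PiM borel_subsets_I (\<lambda>_. borel)) \<and> char_field P0 (\<lambda>A \<omega>. \<omega> A))"

lemma F0: "sets F0 = sets (PiM borel_subsets_I (\<lambda>_. borel))" "char_field F0 (\<lambda>A \<omega>. \<omega> A)"
  using someI_ex[OF char_field_exists] unfolding F0_def by blast+

sublocale F0: prob_space F0 by (rule char_field_prob_space[OF F0(2)])

lemma power_le_1_I: "x \<in> unit_I \<Longrightarrow> \<bar>x ^ k\<bar> \<le> (1 :: real)"
  by (auto simp: power_abs intro!: power_le_one)

text \<open>Chosen once on the canonical space \<open>F0\<close>. On the product space every time
  applies this one measurable function to its own coordinate, which is what makes the limit process
  compatible with the shift.\<close>

definition power_integral :: "nat \<Rightarrow> (real set \<Rightarrow> real) \<Rightarrow> real" where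
  "power_integral k = (SOME L. L \<in> borel_measurable F0 \<and>
     tendsto_in_prob F0 (\<lambda>n. simple_random_integral (\<lambda>A \<omega>. \<omega> A) unit_I (grid_approx (\<lambda>x. x ^ k) n)) L)"

lemma power_integral:
  "power_integral k \<in> borel_measurable F0"
  "tendsto_in_prob F0 (\<lambda>n. simple_random_integral (\<lambda>A \<omega>. \<omega> A) unit_I (grid_approx (\<lambda>x. x ^ k) n)) (power_integral k)"
proof -
  have "\<exists>L. L \<in> borel_measurable F0 \<and> tendsto_in_prob F0 (\<lambda>n. simple_random_integral (\<lambda>A \<omega>. \<omega> A) unit_I (grid_approx (\<lambda>x. x ^ k) n)) L"
    using simple_random_integral_tendsto[OF F0(2) unit_I_borel, of "\<lambda>x. x ^ k"] power_le_1_I by auto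
  from someI_ex[OF this] show "power_integral k \<in> borel_measurable F0"
    "tendsto_in_prob F0 (\<lambda>n. simple_random_integral (\<lambda>A \<omega>. \<omega> A) unit_I (grid_approx (\<lambda>x. x ^ k) n)) (power_integral k)"
    unfolding power_integral_def by blast+
qed

text \<open>\<open>char_field_simple\<close> is the case of simple functions. The limit is taken
  through convergence in probability on the left and through continuity of V under a uniform bound
  on the right.\<close>

lemma power_integral_char:
  fixes a :: "'t \<Rightarrow> real"
  assumes S: "finite S"
  shows "(CLINT \<omega>|F0. iexp (\<Sum>t\<in>S. a t * power_integral (\<kappa> t) \<omega>)) = exp (CLINT x|\<Phi>. V (\<Sum>t\<in>S. a t * x ^ \<kappa> t))"
proof -
  define f where "f n t = grid_approx (\<lambda>x. x ^ \<kappa> t) n" for n t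
  have simple: "simple_function (restrict_space borel unit_I) (f n t)" for n t
    unfolding f_def using power_le_1_I by (intro grid_approx_simple) auto
  have fm[measurable]: "f n t \<in> borel_measurable borel" for n t unfolding f_def by measurable
  have sm: "simple_random_integral (\<lambda>A \<omega>. \<omega> A) unit_I (f n t) \<in> borel_measurable F0" for n t
    by (rule simple_random_integral_measurable[OF F0(2) unit_I_borel simple])
  have "tendsto_in_prob F0 (\<lambda>n \<omega>. \<Sum>t\<in>S. a t * simple_random_integral (\<lambda>A \<omega>. \<omega> A) unit_I (f n t) \<omega>)
      (\<lambda>\<omega>. \<Sum>t\<in>S. a t * power_integral (\<kappa> t) \<omega>)"
    using S sm power_integral unfolding f_def
    by (intro F0.tendsto_in_prob_sum F0.tendsto_in_prob_cmult borel_measurable_times borel_measurable_const) auto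
  hence "(\<lambda>n. CLINT \<omega>|F0. iexp (\<Sum>t\<in>S. a t * simple_random_integral (\<lambda>A \<omega>. \<omega> A) unit_I (f n t) \<omega>)) \<longlonglongrightarrow>
      (CLINT \<omega>|F0. iexp (\<Sum>t\<in>S. a t * power_integral (\<kappa> t) \<omega>))"
    using sm power_integral(1)
    by (intro F0.tendsto_in_prob_iexp borel_measurable_sum borel_measurable_times borel_measurable_const) auto
  moreover have "(CLINT \<omega>|F0. iexp (\<Sum>t\<in>S. a t * simple_random_integral (\<lambda>A \<omega>. \<omega> A) unit_I (f n t) \<omega>)) =
      exp (CLINT x|\<Phi>. V (\<Sum>t\<in>S. a t * (indicator unit_I x * f n t x)))" for n
    by (rule char_field_simple[OF F0(2) S unit_I_borel simple])
  moreover have "(\<lambda>n. exp (CLINT x|\<Phi>. V (\<Sum>t\<in>S. a t * (indicator unit_I x * f n t x)))) \<longlonglongrightarrow>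
      exp (CLINT x|\<Phi>. V (\<Sum>t\<in>S. a t * x ^ \<kappa> t))"
  proof (rule tendsto_exp, rule integral_dominated_convergence)
    show "AE x in \<Phi>. (\<lambda>n. V (\<Sum>t\<in>S. a t * (indicator unit_I x * f n t x))) \<longlonglongrightarrow> V (\<Sum>t\<in>S. a t * x ^ \<kappa> t)"
      using \<Phi>_I
    proof eventually_elim
      case (elim x)
      have "(\<lambda>n. \<Sum>t\<in>S. a t * (indicator unit_I x * f n t x)) \<longlonglongrightarrow> (\<Sum>t\<in>S. a t * (indicator unit_I x * x ^ \<kappa> t))"
        unfolding f_def by (intro tendsto_sum tendsto_mult tendsto_const grid_approx_tendsto)
      hence "(\<lambda>n. \<Sum>t\<in>S. a t * (indicator unit_I x * f n t x)) \<longlonglongrightarrow> (\<Sum>t\<in>S. a t * x ^ \<kappa> t)"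
        using elim by simp
      moreover have "isCont V y" for y using V_cont by (simp add: continuous_on_eq_continuous_at)
      ultimately show ?case by (rule isCont_tendsto_compose[rotated])
    qed
    \<comment> \<open>The factor 2 bounds a power of absolute value at most 1 plus a grid error of
      at most 1.\<close>
    show "AE x in \<Phi>. norm (V (\<Sum>t\<in>S. a t * (indicator unit_I x * f n t x))) \<le> K * (\<Sum>t\<in>S. \<bar>a t\<bar> * 2) powr \<alpha>" for n
      using \<Phi>_I
    proof eventually_elim
      case (elim x)
      have "\<bar>f n t x\<bar> \<le> 2" for t
      proof -
        have "1 / real (Suc n) \<le> 1" by simp
        thus ?thesis using grid_approx_dist[of "\<lambda>x. x ^ \<kappa> t" n x] power_le_1_I[OF elim, of "\<kappa> t"] unfolding f_def by linarith
      qed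
      hence "\<bar>\<Sum>t\<in>S. a t * (indicator unit_I x * f n t x)\<bar> \<le> (\<Sum>t\<in>S. \<bar>a t\<bar> * 2)"
        using elim by (intro order_trans[OF sum_abs] sum_mono) (auto simp: abs_mult intro: mult_left_mono)
      hence "K * \<bar>\<Sum>t\<in>S. a t * (indicator unit_I x * f n t x)\<bar> powr \<alpha> \<le> K * (\<Sum>t\<in>S. \<bar>a t\<bar> * 2) powr \<alpha>"
        using K \<alpha> by (intro mult_left_mono powr_mono2) auto
      thus ?case using V_bound order_trans by blast
    qed
  qed auto
  ultimately show ?thesis using LIMSEQ_unique by fastforce
qed

end

section \<open>The limit process\<close>

lemma sum_lessThan_shift_if:
  fixes f :: "nat \<Rightarrow> 'b::comm_monoid_add"
  shows "(\<Sum>j<n. if d \<le> j then f j else 0) = (\<Sum>k<n - d. f (k + d))"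
proof (induction n)
  case (Suc n)
  thus ?case by (cases "d \<le> n") (auto simp: Suc_diff_le)
qed simp

text \<open>\<open>D\<close> bounds the distance from the points of \<open>J\<close> up to
  \<open>m\<close>, so every exponent that contributes to the kernel is at least j - D. Truncated
  subtraction gives exponent 0 for the first D indices, where no decay is claimed.\<close>

lemma moving_kernel_abs_le:
  assumes J: "finite J" and D: "\<And>t. t \<in> J \<Longrightarrow> m - t \<le> int D" and x: "x \<in> unit_I"
  shows "\<bar>moving_kernel m J \<theta> j x\<bar> \<le> (\<Sum>t\<in>J. \<bar>\<theta> t\<bar>) * \<bar>x\<bar> ^ (j - D)"
proof -
  have "\<bar>moving_kernel m J \<theta> j x\<bar> \<le> (\<Sum>t\<in>J. \<bar>(if m - int j \<le> t then \<theta> t else 0) * x ^ nat (t - m + int j)\<bar>)"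
    unfolding moving_kernel_def by (rule sum_abs)
  also have "\<dots> \<le> (\<Sum>t\<in>J. \<bar>\<theta> t\<bar> * \<bar>x\<bar> ^ (j - D))"
  proof (intro sum_mono)
    fix t assume t: "t \<in> J"
    show "\<bar>(if m - int j \<le> t then \<theta> t else 0) * x ^ nat (t - m + int j)\<bar> \<le> \<bar>\<theta> t\<bar> * \<bar>x\<bar> ^ (j - D)"
    proof (cases "m - int j \<le> t")
      case True
      have "j - D \<le> nat (t - m + int j)" using D[OF t] by linarith
      hence "\<bar>x\<bar> ^ nat (t - m + int j) \<le> \<bar>x\<bar> ^ (j - D)"
        using x by (intro power_decreasing) auto
      thus ?thesis using True by (simp add: abs_mult power_abs mult_left_mono)
    qed simp
  qed
  finally show ?thesis by (simp add: sum_distrib_right)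
qed

lemma abs_power_powr:
  assumes "0 < \<alpha>"
  shows "\<bar>x ^ k :: real\<bar> powr \<alpha> = (\<bar>x\<bar> powr \<alpha>) ^ k"
proof (cases "x = 0")
  case True
  thus ?thesis using assms by (cases k) auto
next
  case False
  thus ?thesis by (simp add: power_abs power_powr)
qed

text \<open>Apart from the common factor, the first D summands contribute at most 1 each and the
  others form a geometric series with ratio |x|^alpha.\<close>

lemma moving_kernel_sum_le:
  assumes J: "finite J" and D: "\<And>t. t \<in> J \<Longrightarrow> m - t \<le> int D" and x: "x \<in> unit_I" and \<alpha>: "0 < \<alpha>"
  shows "(\<Sum>j<n. \<bar>moving_kernel m J \<theta> j x\<bar> powr \<alpha>) \<le> (\<Sum>t\<in>J. \<bar>\<theta> t\<bar>) powr \<alpha> * (real D + 1 / (1 - \<bar>x\<bar> powr \<alpha>))"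
proof -
  define u where "u = \<bar>x\<bar> powr \<alpha>"
  define B where "B = (\<Sum>t\<in>J. \<bar>\<theta> t\<bar>)"
  have B: "0 \<le> B" by (simp add: B_def sum_nonneg)
  have "u < 1 powr \<alpha>" unfolding u_def using x \<alpha> by (intro powr_less_mono2) auto
  hence u: "0 \<le> u" "u < 1" by (auto simp: u_def)
  have term_le: "\<bar>moving_kernel m J \<theta> j x\<bar> powr \<alpha> \<le> B powr \<alpha> * u ^ (j - D)" for j
  proof -
    have "\<bar>moving_kernel m J \<theta> j x\<bar> powr \<alpha> \<le> (B * \<bar>x\<bar> ^ (j - D)) powr \<alpha>"
      unfolding B_def using \<alpha> by (intro powr_mono2 moving_kernel_abs_le[OF J D x]) auto
    also have "\<dots> = B powr \<alpha> * u ^ (j - D)"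
      using B abs_power_powr[OF \<alpha>, of x "j - D"] by (simp add: powr_mult u_def power_abs)
    finally show ?thesis .
  qed
  have "(\<Sum>j<n. u ^ (j - D)) \<le> (\<Sum>j<n + D. u ^ (j - D))"
    using u by (intro sum_mono2) auto
  also have "\<dots> = (\<Sum>j<D. u ^ (j - D)) + (\<Sum>j=D..<n + D. u ^ (j - D))"
    by (subst sum.atLeastLessThan_concat[of 0 D "n + D", symmetric, unfolded atLeast0LessThan]) auto
  also have "(\<Sum>j=D..<n + D. u ^ (j - D)) = (\<Sum>j<n. u ^ j)"
    using sum.shift_bounds_nat_ivl[of "\<lambda>j. u ^ (j - D)" 0 D n] by (simp add: atLeast0LessThan)
  also have "(\<Sum>j<n. u ^ j) \<le> 1 / (1 - u)"
    using u sum_le_suminf[of "\<lambda>j. u ^ j" "{..<n}"] suminf_geometric[of u] by (simp add: summable_geometric)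
  also have "(\<Sum>j<D. u ^ (j - D)) = real D" by simp
  finally have geo: "(\<Sum>j<n. u ^ (j - D)) \<le> real D + 1 / (1 - u)" by simp
  have "(\<Sum>j<n. \<bar>moving_kernel m J \<theta> j x\<bar> powr \<alpha>) \<le> B powr \<alpha> * (\<Sum>j<n. u ^ (j - D))"
    unfolding sum_distrib_left by (intro sum_mono term_le)
  also have "\<dots> \<le> B powr \<alpha> * (real D + 1 / (1 - u))"
    using geo by (intro mult_left_mono) auto
  finally show ?thesis by (simp add: B_def u_def)
qed

lemma moving_kernel_measurable[measurable]: "moving_kernel m J \<theta> j \<in> borel_measurable borel"
  unfolding moving_kernel_def[abs_def] by measurable

text \<open>Powers of x are themselves kernels, so summability of E|a|^(k alpha) is a special case
  of summability for kernels.\<close>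

lemma moving_kernel_single: "moving_kernel 0 {0} (\<lambda>_. 1) j x = x ^ j"
  by (simp add: moving_kernel_def)

lemma finite_int_depth:
  fixes J :: "int set"
  assumes "finite J"
  obtains D where "\<And>t. t \<in> J \<Longrightarrow> m - t \<le> int D"
proof (rule that)
  fix t assume "t \<in> J"
  hence "nat (m - t) \<le> (\<Sum>t\<in>J. nat (m - t))" using assms by (intro member_le_sum) auto
  thus "m - t \<le> int (\<Sum>t\<in>J. nat (m - t))" by linarith
qed

lemma tendsto_in_prob_subseq:
  assumes "tendsto_in_prob P Y L" "filterlim r at_top sequentially"
  shows "tendsto_in_prob P (\<lambda>n. Y (r n)) L"
  using assms unfolding tendsto_in_prob_def by (auto intro: filterlim_compose)

context levy_control
begin

lemma moving_kernel_bounded: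
  assumes J: "finite J"
  shows "AE x in \<Phi>. \<bar>moving_kernel m J \<theta> j x\<bar> \<le> (\<Sum>t\<in>J. \<bar>\<theta> t\<bar>)"
  using \<Phi>_I
proof eventually_elim
  case (elim x)
  obtain D where D: "\<And>t. t \<in> J \<Longrightarrow> m - t \<le> int D" using finite_int_depth[OF J] by blast
  have "\<bar>moving_kernel m J \<theta> j x\<bar> \<le> (\<Sum>t\<in>J. \<bar>\<theta> t\<bar>) * \<bar>x\<bar> ^ (j - D)"
    by (rule moving_kernel_abs_le[OF J D elim])
  also have "\<dots> \<le> (\<Sum>t\<in>J. \<bar>\<theta> t\<bar>) * 1"
    using elim by (intro mult_left_mono power_le_one) (auto intro: sum_nonneg)
  finally show ?case by simp
qed

lemma moving_kernel_powr_integrable: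
  assumes J: "finite J"
  shows "integrable \<Phi> (\<lambda>x. \<bar>moving_kernel m J \<theta> j x\<bar> powr \<alpha>)"
proof (rule \<Phi>.integrable_const_bound)
  show "AE x in \<Phi>. norm (\<bar>moving_kernel m J \<theta> j x\<bar> powr \<alpha>) \<le> (\<Sum>t\<in>J. \<bar>\<theta> t\<bar>) powr \<alpha>"
    using moving_kernel_bounded[OF J, of m \<theta> j] by eventually_elim (use \<alpha> in \<open>auto intro: powr_mono2\<close>)
qed measurable

text \<open>One integrable function dominates all partial sums. The moment condition on the
  coefficient enters the limit theorem through it.\<close>

lemma moving_kernel_dominant:
  assumes J: "finite J"
  obtains w where "integrable \<Phi> w" "\<And>n. AE x in \<Phi>. (\<Sum>j<n. \<bar>moving_kernel m J \<theta> j x\<bar> powr \<alpha>) \<le> w x"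
proof -
  obtain D where D: "\<And>t. t \<in> J \<Longrightarrow> m - t \<le> int D" using finite_int_depth[OF J] by blast
  show ?thesis
  proof (rule that)
    show "integrable \<Phi> (\<lambda>x. (\<Sum>t\<in>J. \<bar>\<theta> t\<bar>) powr \<alpha> * (real D + 1 / (1 - \<bar>x\<bar> powr \<alpha>)))"
      using \<Phi>_moment by (intro integrable_mult_right Bochner_Integration.integrable_add) auto
    show "AE x in \<Phi>. (\<Sum>j<n. \<bar>moving_kernel m J \<theta> j x\<bar> powr \<alpha>) \<le> (\<Sum>t\<in>J. \<bar>\<theta> t\<bar>) powr \<alpha> * (real D + 1 / (1 - \<bar>x\<bar> powr \<alpha>))" for n
      using \<Phi>_I by eventually_elim (rule moving_kernel_sum_le[OF J D _ \<alpha>(1)])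
  qed
qed

lemma moving_kernel_summable:
  assumes J: "finite J"
  shows "summable (\<lambda>j. LINT x|\<Phi>. \<bar>moving_kernel m J \<theta> j x\<bar> powr \<alpha>)"
proof -
  obtain w where w: "integrable \<Phi> w" "\<And>n. AE x in \<Phi>. (\<Sum>j<n. \<bar>moving_kernel m J \<theta> j x\<bar> powr \<alpha>) \<le> w x"
    using moving_kernel_dominant[OF J] by blast
  show ?thesis
  proof (rule bounded_imp_summable)
    fix n
    have "(\<Sum>j\<le>n. LINT x|\<Phi>. \<bar>moving_kernel m J \<theta> j x\<bar> powr \<alpha>) = (LINT x|\<Phi>. (\<Sum>j<Suc n. \<bar>moving_kernel m J \<theta> j x\<bar> powr \<alpha>))"
      unfolding lessThan_Suc_atMost using moving_kernel_powr_integrable[OF J]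
      by (intro Bochner_Integration.integral_sum[symmetric]) auto
    also have "\<dots> \<le> (LINT x|\<Phi>. w x)"
      by (intro integral_mono_AE Bochner_Integration.integrable_sum moving_kernel_powr_integrable[OF J] w)
    finally show "(\<Sum>j\<le>n. LINT x|\<Phi>. \<bar>moving_kernel m J \<theta> j x\<bar> powr \<alpha>) \<le> (LINT x|\<Phi>. w x)" .
  qed auto
qed

lemma moving_exponent_bound:
  assumes J: "finite J"
  shows "cmod (CLINT x|\<Phi>. V (moving_kernel m J \<theta> j x)) \<le> K * (LINT x|\<Phi>. \<bar>moving_kernel m J \<theta> j x\<bar> powr \<alpha>)"
  using V_integral_bound[OF moving_kernel_measurable moving_kernel_bounded[OF J], of 1 m \<theta> j] by simp

lemma moving_exponent_summable:
  assumes J: "finite J"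
  shows "summable (\<lambda>j. CLINT x|\<Phi>. V (moving_kernel m J \<theta> j x))"
  by (rule summable_comparison_test'[OF summable_mult[OF moving_kernel_summable[OF J], of K]])
     (use moving_exponent_bound[OF J] in blast)

abbreviation Q :: "(int \<Rightarrow> real set \<Rightarrow> real) measure" where
  "Q \<equiv> F0.two_sided"

sublocale Q: prob_space Q by (rule F0.prob_space_two_sided)

lemma Q_component[measurable]: "(\<lambda>\<omega>. \<omega> s) \<in> measurable Q F0"
  by (rule measurable_component_singleton) simp

lemma distr_Q_component: "distr Q F0 (\<lambda>\<omega>. \<omega> s) = F0"
  by (rule distr_PiM_component) (auto intro: F0.prob_space_axioms)

lemmas [measurable] = power_integral(1)

text \<open>Injectivity of \<open>\<sigma>\<close> makes the coordinates involved independent, so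
  exponents add over j. At one time the inner sum is the integral of a single polynomial.\<close>

lemma Q_char:
  fixes \<sigma> :: "'j \<Rightarrow> int" and c :: "'j \<Rightarrow> 't \<Rightarrow> real"
  assumes S: "finite S" "inj_on \<sigma> S" and T: "finite T"
  shows "(CLINT \<omega>|Q. iexp (\<Sum>j\<in>S. \<Sum>t\<in>T. c j t * power_integral (\<kappa> j t) (\<omega> (\<sigma> j)))) =
    exp (\<Sum>j\<in>S. CLINT x|\<Phi>. V (\<Sum>t\<in>T. c j t * x ^ \<kappa> j t))"
proof -
  define f where "f j \<eta> = iexp (\<Sum>t\<in>T. c j t * power_integral (\<kappa> j t) \<eta>)" for j \<eta>
  define i where "i = the_inv_into S \<sigma>"
  have i: "i (\<sigma> j) = j" if "j \<in> S" for j
    unfolding i_def by (rule the_inv_into_f_f[OF S(2) that])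
  have "(\<lambda>\<eta>. \<Sum>t\<in>T. c j t * power_integral (\<kappa> j t) \<eta>) \<in> borel_measurable F0" for j
    by (intro borel_measurable_sum borel_measurable_times borel_measurable_const power_integral(1))
  hence int: "complex_integrable F0 (f j)" for j
    unfolding f_def by (intro F0.integrable_iexp) auto
  have "(CLINT \<omega>|Q. iexp (\<Sum>j\<in>S. \<Sum>t\<in>T. c j t * power_integral (\<kappa> j t) (\<omega> (\<sigma> j)))) =
      (CLINT \<omega>|Q. \<Prod>j\<in>S. f j (\<omega> (\<sigma> j)))"
    using S(1) by (intro Bochner_Integration.integral_cong refl) (simp add: f_def exp_sum sum_distrib_left)
  also have "\<dots> = (CLINT \<omega>|Q. \<Prod>s\<in>\<sigma> ` S. f (i s) (\<omega> s))"
    using S(2) by (intro Bochner_Integration.integral_cong refl) (simp add: prod.reindex i cong: prod.cong)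
  also have "\<dots> = (\<Prod>s\<in>\<sigma> ` S. CLINT \<eta>|F0. f (i s) \<eta>)"
    using S(1) int by (intro F0.integral_two_sided_prod) auto
  also have "\<dots> = (\<Prod>j\<in>S. CLINT \<eta>|F0. f j \<eta>)"
    using S(2) by (simp add: prod.reindex i cong: prod.cong)
  also have "\<dots> = (\<Prod>j\<in>S. exp (CLINT x|\<Phi>. V (\<Sum>t\<in>T. c j t * x ^ \<kappa> j t)))"
    unfolding f_def by (intro prod.cong refl power_integral_char T)
  also have "\<dots> = exp (\<Sum>j\<in>S. CLINT x|\<Phi>. V (\<Sum>t\<in>T. c j t * x ^ \<kappa> j t))"
    using S(1) by (simp add: exp_sum)
  finally show ?thesis .
qed

text \<open>The series at time 0 only; every other time is reached by \<open>shift\<close>.\<close>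

definition past_sum :: "nat \<Rightarrow> (int \<Rightarrow> real set \<Rightarrow> real) \<Rightarrow> real" where
  "past_sum n \<omega> = (\<Sum>k<n. power_integral k (\<omega> (- int k)))"

lemma past_sum_measurable[measurable]: "past_sum n \<in> borel_measurable Q"
  unfolding past_sum_def[abs_def]
  by (intro borel_measurable_sum measurable_compose[OF Q_component power_integral(1)])

text \<open>The exponent of an increment is at most K |theta|^alpha times a section of the
  convergent series \<open>q\<close>, so the general tail bound applies.\<close>

lemma past_sum_cauchy: "Q.cauchy_in_prob past_sum"
proof -
  define q where "q k = (LINT x|\<Phi>. \<bar>x ^ k\<bar> powr \<alpha>)" for k
  have q: "summable q" "\<And>k. 0 \<le> q k"
    using moving_kernel_summable[of "{0}" 0 "\<lambda>_. 1"] by (auto simp: q_def[abs_def] moving_kernel_single)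
  have inc: "Q.prob {\<omega>\<in>space Q. e < \<bar>past_sum n \<omega> - past_sum m \<omega>\<bar>} \<le> 6 * (K * (\<Sum>k=m..<n. q k)) * e powr (-\<alpha>)"
    if e: "0 < e" and mn: "m \<le> n" for e m n
  proof (rule tail_bound_char[OF Q.prob_space_axioms _ \<alpha> _ _ e])
    show "(\<lambda>\<omega>. past_sum n \<omega> - past_sum m \<omega>) \<in> borel_measurable Q" by measurable
    show "0 \<le> K * (\<Sum>k=m..<n. q k)" using K q by (intro mult_nonneg_nonneg sum_nonneg) auto
    fix \<theta>
    have diff: "past_sum n \<omega> - past_sum m \<omega> = (\<Sum>k=m..<n. power_integral k (\<omega> (- int k)))" for \<omega>
      unfolding past_sum_def using sum_diff_nat_ivl[of 0 m n "\<lambda>k. power_integral k (\<omega> (- int k))"] mn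
      by (simp add: atLeast0LessThan)
    have "char (distr Q borel (\<lambda>\<omega>. past_sum n \<omega> - past_sum m \<omega>)) \<theta> =
        (CLINT \<omega>|Q. iexp (\<theta> * (past_sum n \<omega> - past_sum m \<omega>)))"
      unfolding char_def by (rule integral_distr) measurable
    also have "\<dots> = (CLINT \<omega>|Q. iexp (\<Sum>k=m..<n. \<Sum>t\<in>{()}. \<theta> * power_integral k (\<omega> (- int k))))"
      by (simp only: diff sum_distrib_left) simp
    also have "\<dots> = exp (\<Sum>k=m..<n. CLINT x|\<Phi>. V (\<Sum>t\<in>{()}. \<theta> * x ^ k))"
      by (rule Q_char) (auto simp: inj_on_def)
    also have "\<dots> = exp (\<Sum>k=m..<n. CLINT x|\<Phi>. V (\<theta> * x ^ k))" by simp
    finally have ch: "char (distr Q borel (\<lambda>\<omega>. past_sum n \<omega> - past_sum m \<omega>)) \<theta> =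
        exp (\<Sum>k=m..<n. CLINT x|\<Phi>. V (\<theta> * x ^ k))" .
    have "cmod (char (distr Q borel (\<lambda>\<omega>. past_sum n \<omega> - past_sum m \<omega>)) \<theta> - 1) \<le> cmod (\<Sum>k=m..<n. CLINT x|\<Phi>. V (\<theta> * x ^ k))"
      unfolding ch by (rule cmod_exp_minus_1_le) (auto simp: Re_sum intro!: sum_nonpos V_integral_Re)
    also have "\<dots> \<le> (\<Sum>k=m..<n. K * q k * \<bar>\<theta>\<bar> powr \<alpha>)"
    proof (intro order_trans[OF norm_sum] sum_mono)
      fix k
      have "AE x in \<Phi>. \<bar>x ^ k\<bar> \<le> 1" using \<Phi>_I by eventually_elim (rule power_le_1_I)
      thus "cmod (CLINT x|\<Phi>. V (\<theta> * x ^ k)) \<le> K * q k * \<bar>\<theta>\<bar> powr \<alpha>"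
        unfolding q_def by (intro V_integral_bound) auto
    qed
    also have "\<dots> = K * (\<Sum>k=m..<n. q k) * \<bar>\<theta>\<bar> powr \<alpha>"
      by (simp add: sum_distrib_left sum_distrib_right)
    finally show "cmod (char (distr Q borel (\<lambda>\<omega>. past_sum n \<omega> - past_sum m \<omega>)) \<theta> - 1) \<le> K * (\<Sum>k=m..<n. q k) * \<bar>\<theta>\<bar> powr \<alpha>" .
  qed
  show ?thesis
    unfolding Q.cauchy_in_prob_def
  proof (intro allI impI)
    fix e d :: real assume e: "0 < e" and d: "0 < d"
    \<comment> \<open>\<open>K + 1\<close> instead of \<open>K\<close> keeps the constant positive
      when K = 0, so that d / c is a positive threshold.\<close>
    define c where "c = 6 * (K + 1) * e powr (-\<alpha>)"
    have c: "0 < c" using K e by (simp add: c_def)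
    hence "0 < d / c" using d by simp
    then obtain m0 where m0: "\<And>m n. m0 \<le> m \<Longrightarrow> norm (\<Sum>k=m..<n. q k) < d / c"
      using q(1) unfolding summable_Cauchy by blast
    have "Q.prob {\<omega>\<in>space Q. e < \<bar>past_sum n \<omega> - past_sum m \<omega>\<bar>} \<le> d" if "m0 \<le> m" "m \<le> n" for m n
    proof -
      have s: "0 \<le> (\<Sum>k=m..<n. q k)" "(\<Sum>k=m..<n. q k) < d / c" using m0[OF that(1), of n] q(2) by (auto intro: sum_nonneg)
      have "Q.prob {\<omega>\<in>space Q. e < \<bar>past_sum n \<omega> - past_sum m \<omega>\<bar>} \<le> 6 * (K * (\<Sum>k=m..<n. q k)) * e powr (-\<alpha>)"
        by (rule inc[OF e that(2)])
      also have "\<dots> \<le> 6 * ((K + 1) * (\<Sum>k=m..<n. q k)) * e powr (-\<alpha>)"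
        using s K by (intro mult_right_mono mult_left_mono) auto
      also have "\<dots> = c * (\<Sum>k=m..<n. q k)" by (simp add: c_def)
      also have "\<dots> \<le> c * (d / c)" using s c by (intro mult_left_mono) auto
      finally show ?thesis using c by simp
    qed
    thus "\<exists>m0. \<forall>m\<ge>m0. \<forall>n\<ge>m. Q.prob {\<omega>\<in>space Q. e < \<bar>past_sum n \<omega> - past_sum m \<omega>\<bar>} \<le> d" by blast
  qed
qed

definition X0 :: "(int \<Rightarrow> real set \<Rightarrow> real) \<Rightarrow> real" where
  "X0 = (SOME L. L \<in> borel_measurable Q \<and> tendsto_in_prob Q past_sum L)"

lemma X0: "X0 \<in> borel_measurable Q" "tendsto_in_prob Q past_sum X0"
proof -
  have "\<exists>L. L \<in> borel_measurable Q \<and> tendsto_in_prob Q past_sum L"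
    using Q.cauchy_in_prob_convergent[OF past_sum_measurable past_sum_cauchy] by auto
  from someI_ex[OF this] show "X0 \<in> borel_measurable Q" "tendsto_in_prob Q past_sum X0"
    unfolding X0_def by blast+
qed

text \<open>Defined through the shift rather than by a limit at each time, so that stationarity and
  ergodicity become statements about factors of an i.i.d. sequence.\<close>

definition X :: "int \<Rightarrow> (int \<Rightarrow> real set \<Rightarrow> real) \<Rightarrow> real" where
  "X t \<omega> = X0 (shift t \<omega>)"

lemma X_measurable[measurable]: "X t \<in> borel_measurable Q"
  unfolding X_def[abs_def] by (rule measurable_compose[OF F0.shift_measurable X0(1)])

lemma past_sum_shift_tendsto: "tendsto_in_prob Q (\<lambda>n \<omega>. past_sum n (shift t \<omega>)) (X t)"
  unfolding X_def[abs_def]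
  by (rule tendsto_in_prob_distr[OF F0.shift_measurable F0.distr_shift past_sum_measurable X0])

lemma X_series: "tendsto_in_prob Q (\<lambda>n \<omega>. \<Sum>s = t - int n..t. power_integral (nat (t - s)) (\<omega> s)) (X t)"
proof -
  \<comment> \<open>There are n + 1 times from t - n to t, hence \<open>Suc n\<close>.\<close>
  have "past_sum (Suc n) (shift t \<omega>) = (\<Sum>s = t - int n..t. power_integral (nat (t - s)) (\<omega> s))" for n \<omega>
    unfolding past_sum_def shift_def
    by (rule sum.reindex_bij_witness[of _ "\<lambda>s. nat (t - s)" "\<lambda>k. t - int k"]) (auto simp: add.commute)
  moreover have "tendsto_in_prob Q (\<lambda>n \<omega>. past_sum (Suc n) (shift t \<omega>)) (X t)"
    by (rule tendsto_in_prob_subseq[OF past_sum_shift_tendsto filterlim_Suc])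
  ultimately show ?thesis by simp
qed

text \<open>The double sum over times and lags is regrouped by the time m - j of the random measure.
  Measures at different times are independent, and the integrand belonging to m - j is
  \<open>moving_kernel m J \<theta> j\<close>.\<close>

lemma X_char:
  assumes J: "finite J" "\<And>t. t \<in> J \<Longrightarrow> t \<le> m"
  shows "(CLINT \<omega>|Q. iexp (\<Sum>t\<in>J. \<theta> t * X t \<omega>)) = exp (\<Sum>j. CLINT x|\<Phi>. V (moving_kernel m J \<theta> j x))"
proof -
  define d where "d t = nat (m - t)" for t
  \<comment> \<open>The number of terms is reduced by the lag \<open>d t\<close> behind m, so that
    all the sums stop at the same oldest time m - n + 1.\<close>
  define Y where "Y n \<omega> = (\<Sum>t\<in>J. \<theta> t * past_sum (n - d t) (shift t \<omega>))" for n \<omega>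
  have pm: "(\<lambda>\<omega>. past_sum n (shift t \<omega>)) \<in> borel_measurable Q" for n t
    by (rule measurable_compose[OF F0.shift_measurable past_sum_measurable])
  have Ym: "Y n \<in> borel_measurable Q" for n
    unfolding Y_def by (intro borel_measurable_sum borel_measurable_times borel_measurable_const pm)
  have "filterlim (\<lambda>n. n - d t) at_top sequentially" for t
    by (rule filterlim_minus_const_nat_at_top)
  hence "tendsto_in_prob Q (\<lambda>n \<omega>. past_sum (n - d t) (shift t \<omega>)) (X t)" for t
    by (rule tendsto_in_prob_subseq[OF past_sum_shift_tendsto])
  hence "tendsto_in_prob Q Y (\<lambda>\<omega>. \<Sum>t\<in>J. \<theta> t * X t \<omega>)"
    unfolding Y_def[abs_def] using J(1)
    by (intro Q.tendsto_in_prob_sum Q.tendsto_in_prob_cmult borel_measurable_times borel_measurable_const pm X_measurable)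
  hence lim: "(\<lambda>n. CLINT \<omega>|Q. iexp (Y n \<omega>)) \<longlonglongrightarrow> (CLINT \<omega>|Q. iexp (\<Sum>t\<in>J. \<theta> t * X t \<omega>))"
    by (intro Q.tendsto_in_prob_iexp Ym borel_measurable_sum borel_measurable_times borel_measurable_const X_measurable)
  have "(CLINT \<omega>|Q. iexp (Y n \<omega>)) = exp (\<Sum>j<n. CLINT x|\<Phi>. V (moving_kernel m J \<theta> j x))" for n
  proof -
    have "Y n \<omega> = (\<Sum>j<n. \<Sum>t\<in>J. (if m - int j \<le> t then \<theta> t else 0) * power_integral (nat (t - m + int j)) (\<omega> (m - int j)))" for \<omega>
    proof -
      have "\<theta> t * past_sum (n - d t) (shift t \<omega>) =
          (\<Sum>j<n. (if m - int j \<le> t then \<theta> t else 0) * power_integral (nat (t - m + int j)) (\<omega> (m - int j)))" if t: "t \<in> J" for t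
      proof -
        have dt: "int (d t) = m - t" using J(2)[OF t] by (simp add: d_def)
        have "\<theta> t * past_sum (n - d t) (shift t \<omega>) =
            (\<Sum>k<n - d t. \<theta> t * power_integral (nat (t - m + int (k + d t))) (\<omega> (m - int (k + d t))))"
          unfolding past_sum_def shift_def sum_distrib_left
          by (intro sum.cong refl) (simp add: dt algebra_simps)
        also have "\<dots> = (\<Sum>j<n. if d t \<le> j then \<theta> t * power_integral (nat (t - m + int j)) (\<omega> (m - int j)) else 0)"
          by (rule sum_lessThan_shift_if[symmetric])
        also have "\<dots> = (\<Sum>j<n. (if m - int j \<le> t then \<theta> t else 0) * power_integral (nat (t - m + int j)) (\<omega> (m - int j)))"
        proof (intro sum.cong refl)
          fix j
          have "d t \<le> j \<longleftrightarrow> m - int j \<le> t" using dt by linarith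
          thus "(if d t \<le> j then \<theta> t * power_integral (nat (t - m + int j)) (\<omega> (m - int j)) else 0) =
              (if m - int j \<le> t then \<theta> t else 0) * power_integral (nat (t - m + int j)) (\<omega> (m - int j))" by simp
        qed
        finally show ?thesis .
      qed
      hence "Y n \<omega> = (\<Sum>t\<in>J. \<Sum>j<n. (if m - int j \<le> t then \<theta> t else 0) * power_integral (nat (t - m + int j)) (\<omega> (m - int j)))"
        unfolding Y_def by (intro sum.cong refl)
      also have "\<dots> = (\<Sum>j<n. \<Sum>t\<in>J. (if m - int j \<le> t then \<theta> t else 0) * power_integral (nat (t - m + int j)) (\<omega> (m - int j)))"
        by (rule sum.swap)
      finally show ?thesis .
    qed
    hence "(CLINT \<omega>|Q. iexp (Y n \<omega>)) = (CLINT \<omega>|Q. iexp (\<Sum>j<n. \<Sum>t\<in>J. (if m - int j \<le> t then \<theta> t else 0) *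
        power_integral (nat (t - m + int j)) (\<omega> (m - int j))))"
      by (simp only:)
    also have "\<dots> = exp (\<Sum>j<n. CLINT x|\<Phi>. V (\<Sum>t\<in>J. (if m - int j \<le> t then \<theta> t else 0) * x ^ nat (t - m + int j)))"
      by (rule Q_char) (use J in \<open>auto simp: inj_on_def\<close>)
    finally show ?thesis by (simp only: moving_kernel_def)
  qed
  moreover have "(\<lambda>n. exp (\<Sum>j<n. CLINT x|\<Phi>. V (moving_kernel m J \<theta> j x))) \<longlonglongrightarrow>
      exp (\<Sum>j. CLINT x|\<Phi>. V (moving_kernel m J \<theta> j x))"
    by (intro tendsto_exp summable_LIMSEQ moving_exponent_summable J)
  ultimately show ?thesis using lim LIMSEQ_unique by fastforce
qed

lemma char_field_Q: "char_field Q (\<lambda>A \<omega>. \<omega> s A)"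
proof -
  have "(CLINT \<omega>|Q. iexp (\<Sum>A\<in>F. c A * \<omega> s A)) = exp (CLINT x|\<Phi>. V (\<Sum>A\<in>F. c A * indicator A x))"
    if F: "finite F" "F \<subseteq> borel_subsets_I" for F c
  proof -
    have m: "(\<lambda>\<eta>. iexp (\<Sum>A\<in>F. c A * \<eta> A)) \<in> borel_measurable F0"
    proof -
      have "(\<lambda>\<eta>. \<Sum>A\<in>F. c A * \<eta> A) \<in> borel_measurable F0"
        using F by (intro borel_measurable_sum borel_measurable_times borel_measurable_const char_field_measurable[OF F0(2)]) auto
      thus ?thesis by measurable
    qed
    have "(CLINT \<omega>|Q. iexp (\<Sum>A\<in>F. c A * \<omega> s A)) = (CLINT \<eta>|distr Q F0 (\<lambda>\<omega>. \<omega> s). iexp (\<Sum>A\<in>F. c A * \<eta> A))"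
      by (rule integral_distr[OF Q_component m, symmetric])
    also have "\<dots> = exp (CLINT x|\<Phi>. V (\<Sum>A\<in>F. c A * indicator A x))"
      using F0(2) F unfolding distr_Q_component char_field_def by blast
    finally show ?thesis .
  qed
  moreover have "(\<lambda>\<omega>. \<omega> s A) \<in> borel_measurable Q" if "A \<in> borel_subsets_I" for A
    by (rule measurable_compose[OF Q_component char_field_measurable[OF F0(2) that]])
  ultimately show ?thesis using Q.prob_space_axioms unfolding char_field_def by blast
qed

lemma power_has_random_integral:
  "has_random_integral Q (\<lambda>A \<omega>. \<omega> s A) \<Phi> (\<lambda>x. x ^ k) (\<lambda>\<omega>. power_integral k (\<omega> s))"
proof (rule has_random_integral_grid[OF char_field_Q])
  show "(\<lambda>\<omega>. power_integral k (\<omega> s)) \<in> borel_measurable Q" by measurable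
  have "simple_random_integral (\<lambda>A \<omega>. \<omega> A) unit_I (grid_approx (\<lambda>x. x ^ k) n) \<in> borel_measurable F0" for n
    by (intro simple_random_integral_measurable[OF F0(2) unit_I_borel] grid_approx_simple power_le_1_I) measurable
  from tendsto_in_prob_distr[OF Q_component distr_Q_component this power_integral]
  have "tendsto_in_prob Q (\<lambda>n \<omega>. simple_random_integral (\<lambda>A \<omega>. \<omega> A) unit_I (grid_approx (\<lambda>x. x ^ k) n) (\<omega> s))
      (\<lambda>\<omega>. power_integral k (\<omega> s))" .
  thus "tendsto_in_prob Q (\<lambda>n. simple_random_integral (\<lambda>A \<omega>. \<omega> s A) unit_I (grid_approx (\<lambda>x. x ^ k) n)) (\<lambda>\<omega>. power_integral k (\<omega> s))"
    by (simp add: simple_random_integral_def[abs_def])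
qed (use power_le_1_I in auto)

lemma Q_iid: "iid_random_measures Q (\<lambda>s A \<omega>. \<omega> s A)"
proof -
  have id: "(\<lambda>\<eta>. \<lambda>A\<in>borel_subsets_I. \<eta> A) \<in> measurable F0 (PiM borel_subsets_I (\<lambda>_. borel))"
    by (intro measurable_restrict char_field_measurable[OF F0(2)])
  have r: "(\<lambda>\<omega>. \<lambda>A\<in>borel_subsets_I. \<omega> s A) \<in> measurable Q (PiM borel_subsets_I (\<lambda>_. borel))" for s
    by (rule measurable_compose[OF Q_component id])
  have "distr Q (PiM borel_subsets_I (\<lambda>_. borel)) (\<lambda>\<omega>. \<lambda>A\<in>borel_subsets_I. \<omega> s A) =
      distr F0 (PiM borel_subsets_I (\<lambda>_. borel)) (\<lambda>\<eta>. \<lambda>A\<in>borel_subsets_I. \<eta> A)" for s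
    using distr_distr[OF id Q_component, of s] by (simp add: distr_Q_component o_def)
  moreover have "Q.indep_vars (\<lambda>_. PiM borel_subsets_I (\<lambda>_. borel)) (\<lambda>s \<omega>. \<lambda>A\<in>borel_subsets_I. \<omega> s A) UNIV"
  proof -
    have "Q.indep_vars (\<lambda>_. F0) (\<lambda>s \<omega>. \<omega> s) UNIV"
      using Q_component distr_Q_component
      by (subst Q.indep_vars_iff_distr_eq_PiM) (auto simp: restrict_UNIV distr_id2)
    from Q.indep_vars_compose2[OF this, of "\<lambda>_ \<eta>. \<lambda>A\<in>borel_subsets_I. \<eta> A" "\<lambda>_. PiM borel_subsets_I (\<lambda>_. borel)"] id
    show ?thesis by simp
  qed
  ultimately show ?thesis unfolding iid_random_measures_def by simp
qed

lemma X_stationary: "stationary_process Q X"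
  using F0.two_sided_factor_stationary[OF X0(1)] by (simp add: X_def[abs_def])

lemma X_ergodic: "ergodic_process Q X"
  using F0.two_sided_factor_ergodic[OF X0(1)] by (simp add: X_def[abs_def])

end

section \<open>Characteristic functions of the pre-limit processes\<close>

text \<open>Conditioning on the random coefficient by Fubini: its joint law with the other variables
  is a product, and once the coefficient is frozen the inner integral factorises.\<close>

lemma (in prob_space) expectation_iexp_mixed:
  fixes X :: "'i \<Rightarrow> 'a \<Rightarrow> real" and \<sigma> :: "'j \<Rightarrow> 'i" and h :: "'j \<Rightarrow> real \<Rightarrow> real"
  assumes ind: "indep_vars (\<lambda>_. borel) X I" and i0: "i0 \<in> I"
    and S: "finite S" "inj_on \<sigma> S" "\<sigma> ` S \<subseteq> I - {i0}"
    and law: "\<And>j. j \<in> S \<Longrightarrow> distr M borel (X (\<sigma> j)) = \<mu>"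
    and h: "\<And>j. j \<in> S \<Longrightarrow> h j \<in> borel_measurable borel"
  shows "(CLINT \<omega>|M. iexp (\<Sum>j\<in>S. h j (X i0 \<omega>) * X (\<sigma> j) \<omega>)) =
    (CLINT x|distr M borel (X i0). \<Prod>j\<in>S. char \<mu> (h j x))"
proof -
  define B where "B = \<sigma> ` S"
  have rv: "X i \<in> borel_measurable M" if "i \<in> I" for i
    using ind that by (auto simp: indep_vars_def)
  have BI: "B \<subseteq> I" "{i0} \<inter> B = {}" using S by (auto simp: B_def)
  define ts where "ts = the_inv_into S \<sigma>"
  have ts: "ts (\<sigma> j) = j" if "j \<in> S" for j
    unfolding ts_def by (rule the_inv_into_f_f[OF S(2) that])
  have iv: "indep_var (PiM {i0} (\<lambda>_. borel)) (\<lambda>\<omega>. \<lambda>i\<in>{i0}. X i \<omega>) (PiM B (\<lambda>_. borel)) (\<lambda>\<omega>. \<lambda>i\<in>B. X i \<omega>)"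
    using BI i0 by (intro indep_var_restrict[OF ind]) auto
  have rv0: "(\<lambda>\<omega>. \<lambda>i\<in>{i0}. X i \<omega>) \<in> measurable M (PiM {i0} (\<lambda>_. borel))"
    using rv i0 by (intro measurable_restrict) auto
  have rvB: "(\<lambda>\<omega>. \<lambda>i\<in>B. X i \<omega>) \<in> measurable M (PiM B (\<lambda>_. borel))"
    using BI rv by (intro measurable_restrict) auto
  define L where "L = distr M (PiM {i0} (\<lambda>_. borel)) (\<lambda>\<omega>. \<lambda>i\<in>{i0}. X i \<omega>)"
  define R where "R = distr M (PiM B (\<lambda>_. borel)) (\<lambda>\<omega>. \<lambda>i\<in>B. X i \<omega>)"
  interpret L: prob_space L unfolding L_def using rv0 by (rule prob_space_distr)
  interpret R: prob_space R unfolding R_def using rvB by (rule prob_space_distr)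
  interpret LR: pair_prob_space L R ..
  have setsL: "sets L = sets (PiM {i0} (\<lambda>_. borel))" and setsR: "sets R = sets (PiM B (\<lambda>_. borel))"
    by (simp_all add: L_def R_def)
  have joint: "L \<Otimes>\<^sub>M R = distr M (PiM {i0} (\<lambda>_. borel) \<Otimes>\<^sub>M PiM B (\<lambda>_. borel)) (\<lambda>\<omega>. (\<lambda>i\<in>{i0}. X i \<omega>, \<lambda>i\<in>B. X i \<omega>))"
    using iv unfolding indep_var_distribution_eq L_def R_def by blast
  have Rprod: "R = PiM B (\<lambda>b. distr M borel (X b))"
  proof (cases "B = {}")
    \<comment> \<open>The characterisation of independence by product laws wants a nonempty index
      set; for empty \<open>B\<close> both laws live on a single point.\<close>
    case True
    have "indep_vars (\<lambda>_. borel) X {}" by (rule indep_vars_subset[OF ind]) simp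
    have "space R = {\<lambda>_. undefined}" using sets_eq_imp_space_eq[OF setsR] True by (simp add: space_PiM)
    show ?thesis
    proof (rule vchar_unique[of B])
      show "vchar B R \<theta> = vchar B (PiM B (\<lambda>b. distr M borel (X b))) \<theta>" for \<theta>
        using True R.prob_space prob_space.prob_space[OF prob_space_PiM[of "{}" "\<lambda>b. distr M borel (X b)"]]
        by (simp add: vchar_def)
      show "finite B" using S(1) by (simp add: B_def)
      show "prob_space R" by (rule R.prob_space_axioms)
      show "sets R = sets (PiM B (\<lambda>_. borel))" by (rule setsR)
      show "prob_space (PiM B (\<lambda>b. distr M borel (X b)))" by (rule prob_space_PiM) (simp add: True)
      show "sets (PiM B (\<lambda>b. distr M borel (X b))) = sets (PiM B (\<lambda>_. borel))" by (rule sets_PiM_cong) auto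
    qed
  next
    case False
    have "indep_vars (\<lambda>_. borel) X B" by (rule indep_vars_subset[OF ind BI(1)])
    thus ?thesis unfolding R_def
      using False rv BI by (subst (asm) indep_vars_iff_distr_eq_PiM') auto
  qed
  have vm: "(\<lambda>v. v (\<sigma> j)) \<in> borel_measurable (PiM B (\<lambda>_. borel))" if "j \<in> S" for j
    using that by (intro measurable_component_singleton) (auto simp: B_def)
  have um: "(\<lambda>u. u i0) \<in> borel_measurable (PiM {i0} (\<lambda>_. borel :: real measure))"
    by (rule measurable_component_singleton) simp
  have charm: "char \<mu> \<in> borel_measurable borel" if "j \<in> S" for j
  proof -
    have "X (\<sigma> j) \<in> borel_measurable M" using S(3) that by (intro rv) auto
    hence "real_distribution \<mu>" using law[OF that] real_distribution_distr by metis
    thus ?thesis by (rule real_distribution.char_measurable)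
  qed
  have F: "(\<lambda>(u, v). iexp (\<Sum>j\<in>S. h j (u i0) * v (\<sigma> j))) \<in> borel_measurable (PiM {i0} (\<lambda>_. borel) \<Otimes>\<^sub>M PiM B (\<lambda>_. borel))"
  proof -
    have "(\<lambda>p. \<Sum>j\<in>S. h j (fst p i0) * snd p (\<sigma> j)) \<in> borel_measurable (PiM {i0} (\<lambda>_. borel) \<Otimes>\<^sub>M PiM B (\<lambda>_. borel))"
      by (intro borel_measurable_sum borel_measurable_times measurable_compose[OF measurable_compose[OF measurable_fst um] h]
          measurable_compose[OF measurable_snd vm])
    hence "(\<lambda>p. iexp (\<Sum>j\<in>S. h j (fst p i0) * snd p (\<sigma> j))) \<in> borel_measurable (PiM {i0} (\<lambda>_. borel) \<Otimes>\<^sub>M PiM B (\<lambda>_. borel))"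
      by measurable
    thus ?thesis by (simp only: split_def)
  qed
  have pm: "(\<lambda>\<omega>. (\<lambda>i\<in>{i0}. X i \<omega>, \<lambda>i\<in>B. X i \<omega>)) \<in> measurable M (PiM {i0} (\<lambda>_. borel) \<Otimes>\<^sub>M PiM B (\<lambda>_. borel))"
    by (intro measurable_Pair rv0 rvB)
  have "(CLINT \<omega>|M. iexp (\<Sum>j\<in>S. h j (X i0 \<omega>) * X (\<sigma> j) \<omega>)) =
      (CLINT \<omega>|M. (\<lambda>(u, v). iexp (\<Sum>j\<in>S. h j (u i0) * v (\<sigma> j))) (\<lambda>i\<in>{i0}. X i \<omega>, \<lambda>i\<in>B. X i \<omega>))"
    by (intro Bochner_Integration.integral_cong refl) (simp add: B_def cong: sum.cong)
  also have "\<dots> = (CLINT p|L \<Otimes>\<^sub>M R. (\<lambda>(u, v). iexp (\<Sum>j\<in>S. h j (u i0) * v (\<sigma> j))) p)"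
    unfolding joint by (rule integral_distr[OF pm F, symmetric])
  also have "\<dots> = (CLINT u|L. CLINT v|R. iexp (\<Sum>j\<in>S. h j (u i0) * v (\<sigma> j)))"
  proof (rule LR.integral_fst[symmetric])
    have "(\<lambda>(u, v). iexp (\<Sum>j\<in>S. h j (u i0) * v (\<sigma> j))) \<in> borel_measurable (L \<Otimes>\<^sub>M R)"
      using F by (simp add: measurable_cong_sets[OF sets_pair_measure_cong[OF setsL setsR] refl])
    thus "complex_integrable (L \<Otimes>\<^sub>M R) (\<lambda>(u, v). iexp (\<Sum>j\<in>S. h j (u i0) * v (\<sigma> j)))"
      by (intro LR.P.integrable_bounded_complex[where B = 1]) (auto simp: split_def)
  qed
  also have "\<dots> = (CLINT u|L. \<Prod>j\<in>S. char \<mu> (h j (u i0)))"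
  proof (intro Bochner_Integration.integral_cong refl)
    fix u
    have "(\<Sum>j\<in>S. h j (u i0) * v (\<sigma> j)) = (\<Sum>b\<in>B. h (ts b) (u i0) * v b)" for v :: "'i \<Rightarrow> real"
      unfolding B_def using S(2) by (simp add: sum.reindex ts cong: sum.cong)
    hence "(CLINT v|R. iexp (\<Sum>j\<in>S. h j (u i0) * v (\<sigma> j))) = (CLINT v|PiM B (\<lambda>b. distr M borel (X b)). iexp (\<Sum>b\<in>B. h (ts b) (u i0) * v b))"
      by (simp only: Rprod)
    also have "\<dots> = (\<Prod>b\<in>B. char (distr M borel (X b)) (h (ts b) (u i0)))"
      using S(1) BI rv by (intro integral_PiM_iexp_sum real_distribution_distr) (auto simp: B_def)
    also have "\<dots> = (\<Prod>j\<in>S. char \<mu> (h j (u i0)))"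
      unfolding B_def using S(2) law by (simp add: prod.reindex ts cong: prod.cong)
    finally show "(CLINT v|R. iexp (\<Sum>j\<in>S. h j (u i0) * v (\<sigma> j))) = (\<Prod>j\<in>S. char \<mu> (h j (u i0)))" .
  qed
  also have "\<dots> = (CLINT \<omega>|M. \<Prod>j\<in>S. char \<mu> (h j ((\<lambda>i\<in>{i0}. X i \<omega>) i0)))"
    unfolding L_def
  proof (rule integral_distr[OF rv0])
    show "(\<lambda>u. \<Prod>j\<in>S. char \<mu> (h j (u i0))) \<in> borel_measurable (PiM {i0} (\<lambda>_. borel))"
      by (intro borel_measurable_prod measurable_compose[OF um measurable_compose[OF h charm]])
  qed
  also have "\<dots> = (CLINT x|distr M borel (X i0). \<Prod>j\<in>S. char \<mu> (h j x))"
  proof -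
    have "(\<lambda>x. \<Prod>j\<in>S. char \<mu> (h j x)) \<in> borel_measurable borel"
      by (intro borel_measurable_prod measurable_compose[OF h charm])
    thus ?thesis using rv[OF i0] by (simp add: integral_distr)
  qed
  finally show ?thesis .
qed

text \<open>Borel-Cantelli: at level r^k the tail bounds sum geometrically with ratio
  r^(-alpha).\<close>

lemma (in prob_space) AE_geometric_bound:
  fixes e :: "nat \<Rightarrow> 'a \<Rightarrow> real"
  assumes [measurable]: "\<And>k. e k \<in> borel_measurable M"
    and tail: "\<And>k x. 0 < x \<Longrightarrow> prob {\<omega>\<in>space M. x < \<bar>e k \<omega>\<bar>} \<le> C * x powr (-\<alpha>)"
    and \<alpha>: "0 < \<alpha>" and r: "1 < r"
  shows "AE \<omega> in M. eventually (\<lambda>k. \<bar>e k \<omega>\<bar> \<le> r ^ k) sequentially"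
proof -
  define A where "A k = {\<omega>\<in>space M. r ^ k < \<bar>e k \<omega>\<bar>}" for k
  have A[measurable]: "A k \<in> events" for k unfolding A_def by measurable
  have pos: "0 < r powr (-\<alpha>)" using r by simp
  have lt1: "r powr (-\<alpha>) < 1" using r \<alpha> powr_less_mono[of "-\<alpha>" 0 r] by simp
  have "prob (A k) \<le> C * (r powr (-\<alpha>)) ^ k" for k
    unfolding A_def using tail[of "r ^ k" k] r power_powr[of r k "-\<alpha>"] by simp
  hence "summable (\<lambda>k. prob (A k))"
    using pos lt1 by (intro summable_comparison_test'[OF summable_mult[OF summable_geometric[of "r powr (-\<alpha>)"], of C], of 0]) auto
  hence "AE \<omega> in M. eventually (\<lambda>k. \<omega> \<in> space M - A k) sequentially"
    by (intro borel_cantelli_AE1) (auto simp: emeasure_eq_measure)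
  thus ?thesis
    by eventually_elim (auto elim!: eventually_mono simp: A_def not_less)
qed

text \<open>The coefficient is random, so no single growth rate suits all outcomes. Almost surely
  all the rates 1 + 1 / Suc p bound the innovations eventually, and for each value of |c| below 1
  some rate leaves the product with |c| below 1.\<close>

lemma (in prob_space) AE_ar1_summable:
  fixes e :: "int \<Rightarrow> 'a \<Rightarrow> real"
  assumes e: "\<And>t. e t \<in> borel_measurable M"
    and tail: "\<And>t x. 0 < x \<Longrightarrow> prob {\<omega>\<in>space M. x < \<bar>e t \<omega>\<bar>} \<le> C * x powr (-\<alpha>)"
    and \<alpha>: "0 < \<alpha>" and c: "AE \<omega> in M. c \<omega> \<in> unit_I"
  shows "AE \<omega> in M. \<forall>t. summable (\<lambda>k. c \<omega> ^ k * e (t - int k) \<omega>)"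
proof -
  have "AE \<omega> in M. eventually (\<lambda>k. \<bar>e (t - int k) \<omega>\<bar> \<le> (1 + 1 / real (Suc p)) ^ k) sequentially" for t p
    by (rule AE_geometric_bound[OF e tail \<alpha>]) auto
  hence "AE \<omega> in M. \<forall>t p. eventually (\<lambda>k. \<bar>e (t - int k) \<omega>\<bar> \<le> (1 + 1 / real (Suc p)) ^ k) sequentially"
    by (simp add: AE_all_countable)
  thus ?thesis using c
  proof eventually_elim
    case (elim \<omega>)
    show ?case
    proof
      fix t
      have c1: "\<bar>c \<omega>\<bar> < 1" using elim by auto
      have "(\<lambda>p. \<bar>c \<omega>\<bar> * (1 + 1 / real (Suc p))) \<longlonglongrightarrow> \<bar>c \<omega>\<bar> * (1 + 0)"
        by (intro tendsto_intros LIMSEQ_Suc[OF lim_1_over_n])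
      hence "eventually (\<lambda>p. \<bar>c \<omega>\<bar> * (1 + 1 / real (Suc p)) < 1) sequentially"
        using c1 by (intro order_tendstoD(2)) auto
      then obtain p where p: "\<bar>c \<omega>\<bar> * (1 + 1 / real (Suc p)) < 1"
        by (auto simp: eventually_sequentially)
      define q where "q = \<bar>c \<omega>\<bar> * (1 + 1 / real (Suc p))"
      have q: "0 \<le> q" "q < 1" using p by (auto simp: q_def)
      from elim(1) have "eventually (\<lambda>k. \<bar>e (t - int k) \<omega>\<bar> \<le> (1 + 1 / real (Suc p)) ^ k) sequentially" by blast
      then obtain k0 where "\<And>k. k0 \<le> k \<Longrightarrow> \<bar>e (t - int k) \<omega>\<bar> \<le> (1 + 1 / real (Suc p)) ^ k"
        unfolding eventually_sequentially by blast
      hence "norm (c \<omega> ^ k * e (t - int k) \<omega>) \<le> q ^ k" if "k0 \<le> k" for k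
        using that by (simp add: q_def power_mult_distrib abs_mult power_abs mult_left_mono)
      thus "summable (\<lambda>k. c \<omega> ^ k * e (t - int k) \<omega>)"
        using q by (intro summable_comparison_test'[OF summable_geometric[of q]]) auto
    qed
  qed
qed

section \<open>The AR(1) values as limits of finite moving averages\<close>

lemma ar1_series_measurable:
  assumes "c \<in> borel_measurable M" "\<And>t. e t \<in> borel_measurable M"
  shows "ar1_series c e t \<in> borel_measurable M"
  unfolding ar1_series_def[abs_def] using assms by measurable

lemma moving_average_partial_sum:
  assumes J: "\<And>t. t \<in> J \<Longrightarrow> t \<le> m"
  shows "(\<Sum>j<n. moving_kernel m J \<theta> j c * e (m - int j)) =
    (\<Sum>t\<in>J. \<theta> t * (\<Sum>k<n - nat (m - t). c ^ k * e (t - int k)))"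
proof -
  have inner: "\<theta> t * (\<Sum>k<n - nat (m - t). c ^ k * e (t - int k)) =
      (\<Sum>j<n. (if m - int j \<le> t then \<theta> t else 0) * c ^ nat (t - m + int j) * e (m - int j))" if t: "t \<in> J" for t
  proof -
    define d where "d = nat (m - t)"
    have dt: "int d = m - t" using J[OF t] by (simp add: d_def)
    have "\<theta> t * (\<Sum>k<n - d. c ^ k * e (t - int k)) =
        (\<Sum>k<n - d. \<theta> t * c ^ nat (t - m + int (k + d)) * e (m - int (k + d)))"
      unfolding sum_distrib_left by (intro sum.cong refl) (simp add: dt algebra_simps)
    also have "\<dots> = (\<Sum>j<n. if d \<le> j then \<theta> t * c ^ nat (t - m + int j) * e (m - int j) else 0)"
      by (rule sum_lessThan_shift_if[symmetric])
    also have "\<dots> = (\<Sum>j<n. (if m - int j \<le> t then \<theta> t else 0) * c ^ nat (t - m + int j) * e (m - int j))"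
    proof (intro sum.cong refl)
      fix j
      have "d \<le> j \<longleftrightarrow> m - int j \<le> t" using dt by linarith
      thus "(if d \<le> j then \<theta> t * c ^ nat (t - m + int j) * e (m - int j) else 0) =
          (if m - int j \<le> t then \<theta> t else 0) * c ^ nat (t - m + int j) * e (m - int j)" by simp
    qed
    finally show ?thesis by (simp add: d_def)
  qed
  have "(\<Sum>j<n. moving_kernel m J \<theta> j c * e (m - int j)) =
      (\<Sum>j<n. \<Sum>t\<in>J. (if m - int j \<le> t then \<theta> t else 0) * c ^ nat (t - m + int j) * e (m - int j))"
    by (simp add: moving_kernel_def sum_distrib_right)
  also have "\<dots> = (\<Sum>t\<in>J. \<Sum>j<n. (if m - int j \<le> t then \<theta> t else 0) * c ^ nat (t - m + int j) * e (m - int j))"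
    by (rule sum.swap)
  also have "\<dots> = (\<Sum>t\<in>J. \<theta> t * (\<Sum>k<n - nat (m - t). c ^ k * e (t - int k)))"
    by (intro sum.cong refl inner[symmetric])
  finally show ?thesis .
qed

text \<open>The characteristic function is kept as a limit of integrals of finite products, which
  avoids infinite products later. The approximating integrals depend only on the law of the
  coefficient and on \<open>\<mu>\<close>.\<close>

lemma (in prob_space) ar1_char_tendsto:
  fixes X :: "'i \<Rightarrow> 'a \<Rightarrow> real" and \<sigma> :: "int \<Rightarrow> 'i"
  assumes ind: "indep_vars (\<lambda>_. borel) X I" and i0: "i0 \<in> I"
    and \<sigma>: "inj \<sigma>" "range \<sigma> \<subseteq> I - {i0}"
    and law: "\<And>t. distr M borel (X (\<sigma> t)) = \<mu>"
    and tail: "\<And>t x. 0 < x \<Longrightarrow> prob {\<omega>\<in>space M. x < \<bar>X (\<sigma> t) \<omega>\<bar>} \<le> C * x powr (-\<alpha>)"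
    and \<alpha>: "0 < \<alpha>" and c: "AE \<omega> in M. X i0 \<omega> \<in> unit_I"
    and J: "finite J" "\<And>t. t \<in> J \<Longrightarrow> t \<le> m"
  shows "(\<lambda>n. CLINT x|distr M borel (X i0). \<Prod>j<n. char \<mu> (moving_kernel m J \<theta> j x)) \<longlonglongrightarrow>
    (CLINT \<omega>|M. iexp (\<Sum>t\<in>J. \<theta> t * ar1_series (X i0) (\<lambda>t. X (\<sigma> t)) t \<omega>))"
proof -
  have rv: "X i \<in> borel_measurable M" if "i \<in> I" for i
    using ind that by (auto simp: indep_vars_def)
  have rv\<sigma>: "X (\<sigma> t) \<in> borel_measurable M" for t using \<sigma> by (intro rv) auto
  have rv0: "X i0 \<in> borel_measurable M" by (rule rv[OF i0])
  have "(CLINT \<omega>|M. iexp (\<Sum>j<n. moving_kernel m J \<theta> j (X i0 \<omega>) * X (\<sigma> (m - int j)) \<omega>)) =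
      (CLINT x|distr M borel (X i0). \<Prod>j<n. char \<mu> (moving_kernel m J \<theta> j x))" for n
  proof (rule expectation_iexp_mixed[OF ind i0, where \<sigma> = "\<lambda>j. \<sigma> (m - int j)"])
    show "inj_on (\<lambda>j. \<sigma> (m - int j)) {..<n}"
      by (auto simp: inj_on_def dest!: injD[OF \<sigma>(1)])
    show "(\<lambda>j. \<sigma> (m - int j)) ` {..<n} \<subseteq> I - {i0}" using \<sigma>(2) by auto
  qed (use law in auto)
  moreover have ae: "AE \<omega> in M. \<forall>t. summable (\<lambda>k. X i0 \<omega> ^ k * X (\<sigma> (t - int k)) \<omega>)"
    by (rule AE_ar1_summable[of "\<lambda>t. X (\<sigma> t)", OF rv\<sigma> _ \<alpha> c]) (rule tail)
  moreover have "(\<lambda>n. CLINT \<omega>|M. iexp (\<Sum>j<n. moving_kernel m J \<theta> j (X i0 \<omega>) * X (\<sigma> (m - int j)) \<omega>)) \<longlonglongrightarrow>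
      (CLINT \<omega>|M. iexp (\<Sum>t\<in>J. \<theta> t * ar1_series (X i0) (\<lambda>t. X (\<sigma> t)) t \<omega>))"
  proof (rule integral_dominated_convergence[where w = "\<lambda>_. 1"])
    have am: "ar1_series (X i0) (\<lambda>t. X (\<sigma> t)) t \<in> borel_measurable M" for t
      by (rule ar1_series_measurable[OF rv0 rv\<sigma>])
    have "(\<lambda>\<omega>. \<Sum>t\<in>J. \<theta> t * ar1_series (X i0) (\<lambda>t. X (\<sigma> t)) t \<omega>) \<in> borel_measurable M"
      by (intro borel_measurable_sum borel_measurable_times borel_measurable_const am)
    thus "(\<lambda>\<omega>. iexp (\<Sum>t\<in>J. \<theta> t * ar1_series (X i0) (\<lambda>t. X (\<sigma> t)) t \<omega>)) \<in> borel_measurable M"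
      by measurable
    have "(\<lambda>\<omega>. \<Sum>j<n. moving_kernel m J \<theta> j (X i0 \<omega>) * X (\<sigma> (m - int j)) \<omega>) \<in> borel_measurable M" for n
      by (intro borel_measurable_sum borel_measurable_times rv\<sigma> measurable_compose[OF rv0 moving_kernel_measurable])
    thus "(\<lambda>\<omega>. iexp (\<Sum>j<n. moving_kernel m J \<theta> j (X i0 \<omega>) * X (\<sigma> (m - int j)) \<omega>)) \<in> borel_measurable M" for n
      by measurable
    show "AE \<omega> in M. (\<lambda>n. iexp (\<Sum>j<n. moving_kernel m J \<theta> j (X i0 \<omega>) * X (\<sigma> (m - int j)) \<omega>)) \<longlonglongrightarrow>
        iexp (\<Sum>t\<in>J. \<theta> t * ar1_series (X i0) (\<lambda>t. X (\<sigma> t)) t \<omega>)"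
      using ae
    proof eventually_elim
      case (elim \<omega>)
      have "(\<lambda>n. \<Sum>k<n - nat (m - t). X i0 \<omega> ^ k * X (\<sigma> (t - int k)) \<omega>) \<longlonglongrightarrow> ar1_series (X i0) (\<lambda>t. X (\<sigma> t)) t \<omega>" for t
        unfolding ar1_series_def
        by (rule filterlim_compose[OF summable_LIMSEQ filterlim_minus_const_nat_at_top]) (use elim in blast)
      hence "(\<lambda>n. \<Sum>t\<in>J. \<theta> t * (\<Sum>k<n - nat (m - t). X i0 \<omega> ^ k * X (\<sigma> (t - int k)) \<omega>)) \<longlonglongrightarrow>
          (\<Sum>t\<in>J. \<theta> t * ar1_series (X i0) (\<lambda>t. X (\<sigma> t)) t \<omega>)"
        by (intro tendsto_sum tendsto_mult tendsto_const)
      hence "(\<lambda>n. \<Sum>j<n. moving_kernel m J \<theta> j (X i0 \<omega>) * X (\<sigma> (m - int j)) \<omega>) \<longlonglongrightarrow>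
          (\<Sum>t\<in>J. \<theta> t * ar1_series (X i0) (\<lambda>t. X (\<sigma> t)) t \<omega>)"
        using moving_average_partial_sum[OF J(2), of J \<theta> "X i0 \<omega>" "\<lambda>t. X (\<sigma> t) \<omega>"] by simp
      thus ?case by (intro tendsto_intros)
    qed
  qed auto
  ultimately show ?thesis by simp
qed

text \<open>In the second bound the induction adds the error (w n - 1) times the previous deviation
  of the product from 1. By the first bound it is at most |w n - 1| times the previous sum s, which
  fits into the growth of the square of s.\<close>

lemma cmod_prod_minus_sum_le:
  fixes w :: "nat \<Rightarrow> complex"
  assumes w: "\<And>j. cmod (w j) \<le> 1"
  shows "cmod ((\<Prod>j<n. w j) - 1) \<le> (\<Sum>j<n. cmod (w j - 1))"
    and "cmod ((\<Prod>j<n. w j) - 1 - (\<Sum>j<n. w j - 1)) \<le> (\<Sum>j<n. cmod (w j - 1))\<^sup>2"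
proof -
  show 1: "cmod ((\<Prod>j<n. w j) - 1) \<le> (\<Sum>j<n. cmod (w j - 1))" for n
    using norm_prod_diff[of "{..<n}" w "\<lambda>_. 1"] w by simp
  show "cmod ((\<Prod>j<n. w j) - 1 - (\<Sum>j<n. w j - 1)) \<le> (\<Sum>j<n. cmod (w j - 1))\<^sup>2"
  proof (induction n)
    case (Suc n)
    define s where "s = (\<Sum>j<n. cmod (w j - 1))"
    have s: "0 \<le> s" by (simp add: s_def sum_nonneg)
    have "(\<Prod>j<Suc n. w j) - 1 - (\<Sum>j<Suc n. w j - 1) =
        ((\<Prod>j<n. w j) - 1 - (\<Sum>j<n. w j - 1)) + (w n - 1) * ((\<Prod>j<n. w j) - 1)"
      by (simp add: algebra_simps)
    also have "cmod \<dots> \<le> s\<^sup>2 + cmod (w n - 1) * s"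
      using Suc 1[of n] unfolding s_def
      by (intro order_trans[OF norm_triangle_ineq] add_mono) (auto simp: norm_mult intro: mult_left_mono)
    also have "\<dots> \<le> (s + cmod (w n - 1))\<^sup>2"
      using s by (simp add: power2_sum)
    finally show ?case by (simp add: s_def)
  qed simp
qed

text \<open>z N is of order 1 / N, so N (Ln(1 + z N) - z N), bounded by a multiple of N |z N|^2,
  vanishes and the logarithm may be linearised.\<close>

lemma power_tendsto_exp:
  fixes z :: "nat \<Rightarrow> complex"
  assumes z: "(\<lambda>N. of_nat N * z N) \<longlonglongrightarrow> \<Psi>"
  shows "(\<lambda>N. (1 + z N) ^ N) \<longlonglongrightarrow> exp \<Psi>"
proof -
  have z0: "z \<longlonglongrightarrow> 0"
  proof -
    have "(\<lambda>N. (of_nat N * z N) * (1 / of_nat N)) \<longlonglongrightarrow> \<Psi> * 0"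
      by (intro tendsto_mult z lim_1_over_n)
    moreover have "eventually (\<lambda>N. (of_nat N * z N) * (1 / of_nat N) = z N) sequentially"
      using eventually_gt_at_top[of 0] by eventually_elim auto
    ultimately show ?thesis by (simp add: tendsto_cong)
  qed
  have half: "eventually (\<lambda>N. cmod (z N) < 1 / 2) sequentially"
    using tendstoD[OF z0, of "1 / 2"] by (simp add: dist_norm)
  have "(\<lambda>N. of_nat N * (Ln (1 + z N) - z N)) \<longlonglongrightarrow> 0"
  proof (rule Lim_null_comparison)
    have "(\<lambda>N. 2 * (cmod (of_nat N * z N) * cmod (z N))) \<longlonglongrightarrow> 2 * (cmod \<Psi> * cmod 0)"
      by (intro tendsto_intros z z0)
    thus "(\<lambda>N. 2 * (cmod (of_nat N * z N) * cmod (z N))) \<longlonglongrightarrow> 0" by simp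
    show "eventually (\<lambda>N. norm (of_nat N * (Ln (1 + z N) - z N)) \<le> 2 * (cmod (of_nat N * z N) * cmod (z N))) sequentially"
      using half
    proof eventually_elim
      case (elim N)
      have "cmod (Ln (1 + z N) - z N) \<le> (cmod (z N))\<^sup>2 / (1 - cmod (z N))"
        by (rule Ln_approx_linear) (use elim in simp)
      also have "\<dots> \<le> (cmod (z N))\<^sup>2 / (1 / 2)"
        using elim by (intro divide_left_mono) auto
      finally have "real N * cmod (Ln (1 + z N) - z N) \<le> real N * (2 * (cmod (z N))\<^sup>2)"
        by (intro mult_left_mono) auto
      thus ?case by (simp add: norm_mult power2_eq_square mult_ac)
    qed
  qed
  from tendsto_add[OF this z] have "(\<lambda>N. of_nat N * Ln (1 + z N)) \<longlonglongrightarrow> \<Psi>"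
    by (simp add: algebra_simps)
  hence "(\<lambda>N. exp (of_nat N * Ln (1 + z N))) \<longlonglongrightarrow> exp \<Psi>" by (rule tendsto_exp)
  moreover have "eventually (\<lambda>N. exp (of_nat N * Ln (1 + z N)) = (1 + z N) ^ N) sequentially"
    using half
  proof eventually_elim
    case (elim N)
    have "1 + z N \<noteq> 0"
    proof
      assume "1 + z N = 0"
      hence "z N = -1" by (simp only: add_eq_0_iff)
      thus False using elim by simp
    qed
    thus ?case by (simp add: exp_of_nat_mult)
  qed
  ultimately show ?thesis by (rule Lim_transform_eventually)
qed

text \<open>\<open>E N\<close> stands for the characteristic function of the values of one of the \<open>N\<close> processes at the
  times in \<open>J\<close>, at the fixed argument \<open>\<theta>\<close>.\<close>

locale triangular_array = char_sequence \<mu> V K \<alpha> + LC: levy_control V K \<alpha> \<Phi>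
  for \<mu> :: "nat \<Rightarrow> real measure" and V :: "real \<Rightarrow> complex" and K \<alpha> :: real and \<Phi> :: "real measure" +
  fixes E :: "nat \<Rightarrow> complex" and m :: int and J :: "int set" and \<theta> :: "int \<Rightarrow> real"
  assumes J: "finite J"
    and E: "\<And>N. 1 \<le> N \<Longrightarrow> (\<lambda>n. CLINT x|\<Phi>. \<Prod>j<n. char (\<mu> N) (moving_kernel m J \<theta> j x)) \<longlonglongrightarrow> E N"
begin

abbreviation h :: "nat \<Rightarrow> real \<Rightarrow> real" where "h \<equiv> moving_kernel m J \<theta>"

abbreviation H :: "nat \<Rightarrow> real" where "H j \<equiv> LINT x|\<Phi>. \<bar>h j x\<bar> powr \<alpha>"

lemma kernel_char_measurable:
  assumes "1 \<le> N"
  shows "(\<lambda>x. char (\<mu> N) (h j x)) \<in> borel_measurable \<Phi>"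
proof -
  interpret real_distribution "\<mu> N" by (rule dist[OF assms])
  show ?thesis by measurable
qed

lemma kernel_char_le_1:
  assumes "1 \<le> N"
  shows "cmod (char (\<mu> N) y) \<le> 1"
proof -
  interpret real_distribution "\<mu> N" by (rule dist[OF assms])
  show ?thesis by (rule cmod_char_le_1)
qed

lemma kernel_char_integrable:
  assumes "1 \<le> N"
  shows "complex_integrable \<Phi> (\<lambda>x. char (\<mu> N) (h j x))"
  by (intro LC.\<Phi>.integrable_bounded_complex[where B = 1] kernel_char_measurable[OF assms] kernel_char_le_1[OF assms])

lemma kernel_prod_integrable:
  assumes "1 \<le> N"
  shows "complex_integrable \<Phi> (\<lambda>x. \<Prod>j<n. char (\<mu> N) (h j x))"
proof (intro LC.\<Phi>.integrable_bounded_complex[where B = 1] borel_measurable_prod kernel_char_measurable[OF assms])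
  fix x
  have "(\<Prod>j<n. cmod (char (\<mu> N) (h j x))) \<le> 1"
    by (intro prod_le_1) (auto simp: kernel_char_le_1[OF assms])
  thus "cmod (\<Prod>j<n. char (\<mu> N) (h j x)) \<le> 1" by (simp add: prod_norm)
qed

lemma scaled_term_bound:
  assumes N: "1 \<le> N"
  shows "cmod (CLINT x|\<Phi>. of_nat N * (char (\<mu> N) (h j x) - 1)) \<le> K * H j"
proof -
  have "cmod (CLINT x|\<Phi>. of_nat N * (char (\<mu> N) (h j x) - 1)) \<le> (LINT x|\<Phi>. K * \<bar>h j x\<bar> powr \<alpha>)"
  proof (rule norm_integral_le)
    show "complex_integrable \<Phi> (\<lambda>x. of_nat N * (char (\<mu> N) (h j x) - 1))"
      using kernel_char_integrable[OF N] by (intro integrable_mult_right Bochner_Integration.integrable_diff) auto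
    show "integrable \<Phi> (\<lambda>x. K * \<bar>h j x\<bar> powr \<alpha>)"
      by (intro integrable_mult_right LC.moving_kernel_powr_integrable J)
    show "cmod (of_nat N * (char (\<mu> N) (h j x) - 1)) \<le> K * \<bar>h j x\<bar> powr \<alpha>" for x
      using bound[OF N, of "h j x"] N by (simp only: norm_mult norm_of_nat) (simp add: field_simps)
  qed
  thus ?thesis by simp
qed

text \<open>Valid for every N >= 1 and not only in the limit; the tightness estimate
  \<open>sum_Y_tail\<close> rests on it.\<close>

lemma E_bound:
  assumes N: "1 \<le> N"
  shows "cmod (E N - 1) \<le> K / real N * (\<Sum>j. H j)"
proof (rule LIMSEQ_le_const2)
  show "(\<lambda>n. cmod ((CLINT x|\<Phi>. \<Prod>j<n. char (\<mu> N) (h j x)) - 1)) \<longlonglongrightarrow> cmod (E N - 1)"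
    by (intro tendsto_intros E N)
  have "cmod ((CLINT x|\<Phi>. \<Prod>j<n. char (\<mu> N) (h j x)) - 1) \<le> K / real N * (\<Sum>j. H j)" for n
  proof -
    have "(CLINT x|\<Phi>. \<Prod>j<n. char (\<mu> N) (h j x)) - 1 = (CLINT x|\<Phi>. (\<Prod>j<n. char (\<mu> N) (h j x)) - 1)"
      using kernel_prod_integrable[OF N] LC.\<Phi>.prob_space by (subst Bochner_Integration.integral_diff) auto
    also have "cmod \<dots> \<le> (LINT x|\<Phi>. (\<Sum>j<n. K / real N * \<bar>h j x\<bar> powr \<alpha>))"
    proof (rule norm_integral_le)
      show "complex_integrable \<Phi> (\<lambda>x. (\<Prod>j<n. char (\<mu> N) (h j x)) - 1)"
        using kernel_prod_integrable[OF N] by auto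
      show "integrable \<Phi> (\<lambda>x. \<Sum>j<n. K / real N * \<bar>h j x\<bar> powr \<alpha>)"
        by (intro Bochner_Integration.integrable_sum integrable_mult_right LC.moving_kernel_powr_integrable J)
      show "cmod ((\<Prod>j<n. char (\<mu> N) (h j x)) - 1) \<le> (\<Sum>j<n. K / real N * \<bar>h j x\<bar> powr \<alpha>)" for x
        by (rule order_trans[OF cmod_prod_minus_sum_le(1)])
           (use kernel_char_le_1[OF N] bound[OF N] in \<open>auto intro!: sum_mono\<close>)
    qed
    also have "\<dots> = K / real N * (\<Sum>j<n. H j)"
      by (subst Bochner_Integration.integral_sum) (auto simp: sum_distrib_left intro!: LC.moving_kernel_powr_integrable J)
    also have "\<dots> \<le> K / real N * (\<Sum>j. H j)"
      using K by (intro mult_left_mono sum_le_suminf LC.moving_kernel_summable J) auto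
    finally show ?thesis .
  qed
  thus "\<exists>n0. \<forall>n\<ge>n0. cmod ((CLINT x|\<Phi>. \<Prod>j<n. char (\<mu> N) (h j x)) - 1) \<le> K / real N * (\<Sum>j. H j)" by blast
qed

text \<open>Two exchanges of limits: dominated convergence in the integral for fixed j, then
  Tannery's theorem over j. The alpha-th powers of the kernels and their integrals serve as
  majorants.\<close>

lemma scaled_sum_tendsto:
  "(\<lambda>N. \<Sum>j. CLINT x|\<Phi>. of_nat N * (char (\<mu> N) (h j x) - 1)) \<longlonglongrightarrow> (\<Sum>j. CLINT x|\<Phi>. V (h j x))"
proof -
  have lim: "(\<lambda>N. CLINT x|\<Phi>. of_nat (Suc N) * (char (\<mu> (Suc N)) (h j x) - 1)) \<longlonglongrightarrow> (CLINT x|\<Phi>. V (h j x))" for j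
  proof (rule integral_dominated_convergence[where w = "\<lambda>x. K * \<bar>h j x\<bar> powr \<alpha>"])
    show "integrable \<Phi> (\<lambda>x. K * \<bar>h j x\<bar> powr \<alpha>)"
      by (intro integrable_mult_right LC.moving_kernel_powr_integrable J)
    show "AE x in \<Phi>. (\<lambda>N. of_nat (Suc N) * (char (\<mu> (Suc N)) (h j x) - 1)) \<longlonglongrightarrow> V (h j x)"
      by (intro AE_I2 LIMSEQ_Suc[OF diff_tendsto])
    show "AE x in \<Phi>. norm (of_nat (Suc N) * (char (\<mu> (Suc N)) (h j x) - 1)) \<le> K * \<bar>h j x\<bar> powr \<alpha>" for N
    proof (rule AE_I2)
      fix x
      have "norm (of_nat (Suc N) * (char (\<mu> (Suc N)) (h j x) - 1)) = real (Suc N) * cmod (char (\<mu> (Suc N)) (h j x) - 1)"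
        by (simp only: norm_mult norm_of_nat)
      also have "\<dots> \<le> real (Suc N) * (K * \<bar>h j x\<bar> powr \<alpha> / real (Suc N))"
        by (intro mult_left_mono bound) auto
      finally show "norm (of_nat (Suc N) * (char (\<mu> (Suc N)) (h j x) - 1)) \<le> K * \<bar>h j x\<bar> powr \<alpha>" by simp
    qed
    show "(\<lambda>x. of_nat (Suc N) * (char (\<mu> (Suc N)) (h j x) - 1)) \<in> borel_measurable \<Phi>" for N
      by (intro borel_measurable_times borel_measurable_const borel_measurable_diff kernel_char_measurable) auto
    show "(\<lambda>x. V (h j x)) \<in> borel_measurable \<Phi>"
      by measurable
  qed
  have "(\<lambda>N. \<Sum>j. CLINT x|\<Phi>. of_nat (Suc N) * (char (\<mu> (Suc N)) (h j x) - 1)) \<longlonglongrightarrow> (\<Sum>j. CLINT x|\<Phi>. V (h j x))"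
  proof (rule conjunct2[OF conjunct2[OF tannerys_theorem[where M = "\<lambda>j. K * H j"]]])
    show "\<forall>\<^sub>F (j, N) in sequentially \<times>\<^sub>F sequentially. norm (CLINT x|\<Phi>. of_nat (Suc N) * (char (\<mu> (Suc N)) (h j x) - 1)) \<le> K * H j"
    proof (intro always_eventually allI, clarify)
      fix j N show "norm (CLINT x|\<Phi>. of_nat (Suc N) * (char (\<mu> (Suc N)) (h j x) - 1)) \<le> K * H j"
        by (rule scaled_term_bound) simp
    qed
    show "summable (\<lambda>j. K * H j)" by (intro summable_mult LC.moving_kernel_summable J)
  qed (use lim in auto)
  thus ?thesis by (rule LIMSEQ_imp_Suc)
qed

text \<open>The second-order remainder at x is at most (K w x)^2 / N, but w is only known to be
  integrable. The minimum with the first-order bound 2 K w x has an integrable majorant, while the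
  quadratic bound makes it tend to 0 pointwise; dominated convergence then applies.\<close>

lemma E_expansion:
  "(\<lambda>N. of_nat N * (E N - 1) - (\<Sum>j. CLINT x|\<Phi>. of_nat N * (char (\<mu> N) (h j x) - 1))) \<longlonglongrightarrow> 0"
proof -
  obtain w where w: "integrable \<Phi> w" "\<And>n. AE x in \<Phi>. (\<Sum>j<n. \<bar>h j x\<bar> powr \<alpha>) \<le> w x"
    using LC.moving_kernel_dominant[OF J] by blast
  have w0: "AE x in \<Phi>. 0 \<le> w x" using w(2)[of 0] by simp
  define b where "b N x = min (2 * (K * w x)) ((K * w x)\<^sup>2 / real N)" for N x
  have wm[measurable]: "w \<in> borel_measurable \<Phi>" using w(1) by (rule borel_measurable_integrable)
  have bm: "b N \<in> borel_measurable \<Phi>" for N unfolding b_def by measurable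
  have b_le: "AE x in \<Phi>. norm (b N x) \<le> 2 * (K * w x)" for N
    using w0 by eventually_elim (use K in \<open>auto simp: b_def\<close>)
  have bint: "integrable \<Phi> (b N)" for N
    by (rule Bochner_Integration.integrable_bound[OF _ bm, of "\<lambda>x. 2 * (K * w x)"])
       (use w(1) b_le[of N] in \<open>auto elim!: eventually_mono\<close>)
  have blim: "(\<lambda>N. LINT x|\<Phi>. b N x) \<longlonglongrightarrow> (LINT x|\<Phi>. 0)"
  proof (rule integral_dominated_convergence[where w = "\<lambda>x. 2 * (K * w x)"])
    show "AE x in \<Phi>. (\<lambda>N. b N x) \<longlonglongrightarrow> 0"
      using w0
    proof eventually_elim
      case (elim x)
      show ?case
        by (rule tendsto_sandwich[OF _ _ tendsto_const lim_const_over_n[of "(K * w x)\<^sup>2"]])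
           (use elim K in \<open>auto simp: b_def\<close>)
    qed
  qed (use w(1) bm b_le in auto)
  have key: "cmod (of_nat N * (E N - 1) - (\<Sum>j. CLINT x|\<Phi>. of_nat N * (char (\<mu> N) (h j x) - 1))) \<le> (LINT x|\<Phi>. b N x)"
    if N: "1 \<le> N" for N
  proof (rule LIMSEQ_le_const2)
    have "summable (\<lambda>j. CLINT x|\<Phi>. of_nat N * (char (\<mu> N) (h j x) - 1))"
      by (rule summable_comparison_test'[OF summable_mult[OF LC.moving_kernel_summable[OF J], of K]])
         (use scaled_term_bound[OF N] in blast)
    thus "(\<lambda>n. cmod (of_nat N * ((CLINT x|\<Phi>. \<Prod>j<n. char (\<mu> N) (h j x)) - 1) - (\<Sum>j<n. CLINT x|\<Phi>. of_nat N * (char (\<mu> N) (h j x) - 1)))) \<longlonglongrightarrow>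
        cmod (of_nat N * (E N - 1) - (\<Sum>j. CLINT x|\<Phi>. of_nat N * (char (\<mu> N) (h j x) - 1)))"
      by (intro tendsto_intros E N summable_LIMSEQ)
    have "cmod (of_nat N * ((CLINT x|\<Phi>. \<Prod>j<n. char (\<mu> N) (h j x)) - 1) - (\<Sum>j<n. CLINT x|\<Phi>. of_nat N * (char (\<mu> N) (h j x) - 1))) \<le> (LINT x|\<Phi>. b N x)" for n
    proof -
      define g where "g x = of_nat N * ((\<Prod>j<n. char (\<mu> N) (h j x)) - 1 - (\<Sum>j<n. char (\<mu> N) (h j x) - 1))" for x
      have int: "complex_integrable \<Phi> g"
        unfolding g_def using kernel_prod_integrable[OF N] kernel_char_integrable[OF N]
        by (intro integrable_mult_right Bochner_Integration.integrable_diff Bochner_Integration.integrable_sum) auto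
      have "(CLINT x|\<Phi>. g x) = of_nat N * ((CLINT x|\<Phi>. \<Prod>j<n. char (\<mu> N) (h j x)) - 1) - (\<Sum>j<n. CLINT x|\<Phi>. of_nat N * (char (\<mu> N) (h j x) - 1))"
      proof -
        have "(CLINT x|\<Phi>. g x) = of_nat N * (CLINT x|\<Phi>. (\<Prod>j<n. char (\<mu> N) (h j x)) - 1 - (\<Sum>j<n. char (\<mu> N) (h j x) - 1))"
          unfolding g_def by (rule integral_mult_right_zero)
        also have "(CLINT x|\<Phi>. (\<Prod>j<n. char (\<mu> N) (h j x)) - 1 - (\<Sum>j<n. char (\<mu> N) (h j x) - 1)) =
            (CLINT x|\<Phi>. (\<Prod>j<n. char (\<mu> N) (h j x))) - 1 - (\<Sum>j<n. CLINT x|\<Phi>. char (\<mu> N) (h j x) - 1)"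
          using kernel_prod_integrable[OF N] kernel_char_integrable[OF N] LC.\<Phi>.prob_space
          by (simp add: Bochner_Integration.integral_diff Bochner_Integration.integral_sum)
        finally show ?thesis
          unfolding integral_mult_right_zero by (simp add: right_diff_distrib sum_distrib_left)
      qed
      moreover have "cmod (CLINT x|\<Phi>. g x) \<le> (LINT x|\<Phi>. b N x)"
      proof (rule order_trans[OF integral_norm_bound integral_mono_AE])
        show "integrable \<Phi> (\<lambda>x. norm (g x))" using int by simp
        show "integrable \<Phi> (b N)" by (rule bint)
        show "AE x in \<Phi>. norm (g x) \<le> b N x"
          using w(2)[of n]
        proof eventually_elim
          case (elim x)
          define s where "s = (\<Sum>j<n. cmod (char (\<mu> N) (h j x) - 1))"
          define P where "P = (\<Prod>j<n. char (\<mu> N) (h j x)) - 1"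
          define R where "R = (\<Sum>j<n. char (\<mu> N) (h j x) - 1)"
          have s0: "0 \<le> s" by (simp add: s_def sum_nonneg)
          have "s \<le> (\<Sum>j<n. K * \<bar>h j x\<bar> powr \<alpha> / real N)"
            unfolding s_def by (intro sum_mono bound N)
          also have "\<dots> = K / real N * (\<Sum>j<n. \<bar>h j x\<bar> powr \<alpha>)" by (simp add: sum_distrib_left)
          also have "\<dots> \<le> K / real N * w x" using elim K by (intro mult_left_mono) auto
          finally have sw: "real N * s \<le> K * w x" using N by (simp add: field_simps)
          have P: "cmod P \<le> s" "cmod (P - R) \<le> s\<^sup>2"
            unfolding P_def R_def s_def using cmod_prod_minus_sum_le[of "\<lambda>j. char (\<mu> N) (h j x)"] kernel_char_le_1[OF N] by auto
          have "cmod R \<le> s" unfolding R_def s_def by (rule norm_sum)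
          hence "cmod (P - R) \<le> 2 * s" using P(1) norm_triangle_ineq4[of P R] by linarith
          hence 1: "real N * cmod (P - R) \<le> 2 * (K * w x)"
            using sw mult_left_mono[of "cmod (P - R)" "2 * s" "real N"] by simp
          have "real N * cmod (P - R) \<le> real N * s\<^sup>2" using P(2) by (intro mult_left_mono) auto
          also have "\<dots> = (real N * s)\<^sup>2 / real N" using N by (simp add: power2_eq_square)
          also have "\<dots> \<le> (K * w x)\<^sup>2 / real N" using sw s0 by (intro divide_right_mono power_mono) auto
          finally have 2: "real N * cmod (P - R) \<le> (K * w x)\<^sup>2 / real N" .
          have "norm (g x) = real N * cmod (P - R)" by (simp only: g_def P_def R_def norm_mult norm_of_nat)
          thus ?case using 1 2 by (simp add: b_def)
        qed
      qed
      ultimately show ?thesis by simp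
    qed
    thus "\<exists>n0. \<forall>n\<ge>n0. cmod (of_nat N * ((CLINT x|\<Phi>. \<Prod>j<n. char (\<mu> N) (h j x)) - 1) - (\<Sum>j<n. CLINT x|\<Phi>. of_nat N * (char (\<mu> N) (h j x) - 1))) \<le> (LINT x|\<Phi>. b N x)" by blast
  qed
  show ?thesis
  proof (rule Lim_null_comparison)
    show "eventually (\<lambda>N. norm (of_nat N * (E N - 1) - (\<Sum>j. CLINT x|\<Phi>. of_nat N * (char (\<mu> N) (h j x) - 1))) \<le> (LINT x|\<Phi>. b N x)) sequentially"
      using eventually_ge_at_top[of 1] by eventually_elim (rule key)
    show "(\<lambda>N. LINT x|\<Phi>. b N x) \<longlonglongrightarrow> 0" using blim by simp
  qed
qed

lemma E_power_tendsto: "(\<lambda>N. E N ^ N) \<longlonglongrightarrow> exp (\<Sum>j. CLINT x|\<Phi>. V (h j x))"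
proof -
  have "(\<lambda>N. of_nat N * (E N - 1)) \<longlonglongrightarrow> (\<Sum>j. CLINT x|\<Phi>. V (h j x))"
    using tendsto_add[OF E_expansion scaled_sum_tendsto] by simp
  from power_tendsto_exp[OF this] show ?thesis by simp
qed

end

section \<open>Convergence of the aggregated process\<close>

lemma sets_fdd[simp]: "sets (fdd P J X) = sets (PiM J (\<lambda>_. borel))"
  by (simp add: fdd_def)

lemma
  assumes P: "prob_space P" and X: "\<And>t. t \<in> J \<Longrightarrow> X t \<in> borel_measurable P"
  shows prob_space_fdd: "prob_space (fdd P J X)"
    and vchar_fdd: "vchar J (fdd P J X) \<theta> = (CLINT \<omega>|P. iexp (\<Sum>t\<in>J. \<theta> t * X t \<omega>))"
    and measure_fdd: "A \<in> sets (PiM J (\<lambda>_. borel)) \<Longrightarrow>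
      measure (fdd P J X) A = measure P {\<omega>\<in>space P. (\<lambda>t\<in>J. X t \<omega>) \<in> A}"
proof -
  interpret prob_space P by fact
  have m: "(\<lambda>\<omega>. \<lambda>t\<in>J. X t \<omega>) \<in> measurable P (PiM J (\<lambda>_. borel))"
    by (intro measurable_restrict X)
  show "prob_space (fdd P J X)" unfolding fdd_def by (rule prob_space_distr[OF m])
  show "vchar J (fdd P J X) \<theta> = (CLINT \<omega>|P. iexp (\<Sum>t\<in>J. \<theta> t * X t \<omega>))"
    unfolding vchar_def fdd_def by (subst integral_distr[OF m]) (auto intro!: Bochner_Integration.integral_cong)
  show "measure (fdd P J X) A = measure P {\<omega>\<in>space P. (\<lambda>t\<in>J. X t \<omega>) \<in> A}"
    if "A \<in> sets (PiM J (\<lambda>_. borel))"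
    unfolding fdd_def measure_distr[OF m that] by (rule arg_cong[where f = "measure P"]) auto
qed

text \<open>The sum of n independent copies of \<open>\<nu>\<close> has the characteristic function
  of \<open>L\<close>, so uniqueness identifies the laws.\<close>

lemma infinitely_divisible_PiM_if_vchar_root:
  assumes J: "finite J" and L: "prob_space L" "sets L = sets (PiM J (\<lambda>_. borel))"
    and root: "\<And>n. 1 \<le> n \<Longrightarrow> \<exists>\<nu>. prob_space \<nu> \<and> sets \<nu> = sets (PiM J (\<lambda>_. borel)) \<and>
      (\<forall>\<theta>. vchar J \<nu> \<theta> ^ n = vchar J L \<theta>)"
  shows "infinitely_divisible_PiM J L"
  unfolding infinitely_divisible_PiM_def
proof (intro allI impI)
  fix n :: nat assume "1 \<le> n"
  from root[OF this] obtain \<nu> where \<nu>: "prob_space \<nu>" "sets \<nu> = sets (PiM J (\<lambda>_. borel))"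
    "\<And>\<theta>. vchar J \<nu> \<theta> ^ n = vchar J L \<theta>" by blast
  interpret \<nu>: prob_space \<nu> by fact
  interpret R: product_prob_space "\<lambda>_::nat. \<nu>" "{..<n}" by (intro product_prob_spaceI \<nu>)
  define T where "T y = (\<lambda>t\<in>J. \<Sum>k<n. y k t)" for y :: "nat \<Rightarrow> int \<Rightarrow> real"
  have comp: "(\<lambda>y. y k t) \<in> borel_measurable (PiM {..<n} (\<lambda>_. \<nu>))" if "k < n" "t \<in> J" for k t
  proof -
    have "(\<lambda>x. x t) \<in> borel_measurable \<nu>"
      unfolding measurable_cong_sets[OF \<nu>(2) refl] using that(2) by (rule measurable_component_singleton)
    thus ?thesis using that(1) by (intro measurable_compose[OF measurable_component_singleton]) auto
  qed
  have T: "T \<in> measurable (PiM {..<n} (\<lambda>_. \<nu>)) (PiM J (\<lambda>_. borel))"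
    unfolding T_def by (intro measurable_restrict borel_measurable_sum comp) auto
  have "distr (PiM {..<n} (\<lambda>_. \<nu>)) (PiM J (\<lambda>_. borel)) T = L"
  proof (rule vchar_unique[OF J _ _ L])
    show "prob_space (distr (PiM {..<n} (\<lambda>_. \<nu>)) (PiM J (\<lambda>_. borel)) T)"
      by (intro prob_space.prob_space_distr[OF prob_space_PiM T] \<nu>)
    fix \<theta>
    have m\<nu>: "(\<lambda>x. \<Sum>t\<in>J. \<theta> t * x t) \<in> borel_measurable \<nu>"
      unfolding measurable_cong_sets[OF \<nu>(2) refl]
      by (intro borel_measurable_sum borel_measurable_times borel_measurable_const measurable_component_singleton)
    have "vchar J (distr (PiM {..<n} (\<lambda>_. \<nu>)) (PiM J (\<lambda>_. borel)) T) \<theta> =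
        (CLINT y|PiM {..<n} (\<lambda>_. \<nu>). iexp (\<Sum>t\<in>J. \<theta> t * T y t))"
      unfolding vchar_def by (rule integral_distr[OF T]) measurable
    also have "\<dots> = (CLINT y|PiM {..<n} (\<lambda>_. \<nu>). \<Prod>k<n. iexp (\<Sum>t\<in>J. \<theta> t * y k t))"
    proof (intro Bochner_Integration.integral_cong refl)
      fix y :: "nat \<Rightarrow> int \<Rightarrow> real"
      have "(\<Sum>t\<in>J. \<theta> t * T y t) = (\<Sum>t\<in>J. \<Sum>k<n. \<theta> t * y k t)"
        by (intro sum.cong refl) (simp add: T_def sum_distrib_left)
      also have "\<dots> = (\<Sum>k<n. \<Sum>t\<in>J. \<theta> t * y k t)" by (rule sum.swap)
      finally have "iexp (\<Sum>t\<in>J. \<theta> t * T y t) = exp (\<Sum>k<n. \<i> * complex_of_real (\<Sum>t\<in>J. \<theta> t * y k t))"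
        by (simp only: of_real_sum sum_distrib_left)
      thus "iexp (\<Sum>t\<in>J. \<theta> t * T y t) = (\<Prod>k<n. iexp (\<Sum>t\<in>J. \<theta> t * y k t))"
        by (simp only: exp_sum[OF finite_lessThan])
    qed
    also have "\<dots> = (\<Prod>k<n. CLINT x|\<nu>. iexp (\<Sum>t\<in>J. \<theta> t * x t))"
    proof (rule R.product_integral_prod)
      show "complex_integrable \<nu> (\<lambda>x. iexp (\<Sum>t\<in>J. \<theta> t * x t))"
      proof (rule \<nu>.integrable_const_bound[where B = 1])
        show "(\<lambda>x. iexp (\<Sum>t\<in>J. \<theta> t * x t)) \<in> borel_measurable \<nu>"
          by (rule measurable_compose[OF m\<nu>]) measurable
      qed (simp only: norm_exp_i_times order_refl AE_I2)
    qed simp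
    also have "\<dots> = vchar J L \<theta>" using \<nu>(3)[of \<theta>] by (simp only: vchar_def prod_constant card_lessThan)
    finally show "vchar J (distr (PiM {..<n} (\<lambda>_. \<nu>)) (PiM J (\<lambda>_. borel)) T) \<theta> = vchar J L \<theta>" .
  qed simp
  thus "\<exists>\<nu>. prob_space \<nu> \<and> sets \<nu> = sets (PiM J (\<lambda>_. borel)) \<and>
      distr (PiM {..<n} (\<lambda>_. \<nu>)) (PiM J (\<lambda>_. borel)) (\<lambda>y. \<lambda>t\<in>J. \<Sum>k<n. y k t) = L"
    using \<nu> unfolding T_def by blast
qed

lemma finite_int_upper:
  fixes J :: "int set"
  assumes "finite J"
  obtains m where "\<And>t. t \<in> J \<Longrightarrow> t \<le> m"
  using that[of "Max (insert 0 J)"] assms by auto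

text \<open>The n-th root of the limit law is not extracted from \<open>X\<close> but built anew
  from the exponent V / n. The constant K still serves, and \<open>scaled\<close> for V at c / n
  yields it for V / n at c.\<close>

lemma (in levy_control) levy_control_divide:
  assumes n: "1 \<le> n"
  shows "levy_control (\<lambda>\<theta>. V \<theta> / of_nat n) K \<alpha> \<Phi>"
proof
  show "continuous_on UNIV (\<lambda>\<theta>. V \<theta> / of_nat n)"
    using n by (intro continuous_intros V_cont) auto
  show "cmod (V \<theta> / of_nat n) \<le> K * \<bar>\<theta>\<bar> powr \<alpha>" for \<theta>
  proof -
    have "cmod (V \<theta> / of_nat n) \<le> cmod (V \<theta>) / 1"
      unfolding norm_divide using n by (intro divide_left_mono) auto
    thus ?thesis using V_bound[of \<theta>] by simp
  qed
  show "Re (V \<theta> / of_nat n) \<le> 0" for \<theta>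
    using V_Re[of \<theta>] by (simp add: divide_nonpos_nonneg)
  show "\<exists>\<nu>. real_distribution \<nu> \<and> (\<forall>\<theta>. char \<nu> \<theta> = exp (of_real c * (V \<theta> / of_nat n)))" if "0 \<le> c" for c
    using scaled[of "c / real n"] that by simp
qed (use V_0 \<alpha> K \<Phi>_I \<Phi>_moment in auto)

lemma (in levy_control) X_infinitely_divisible:
  assumes J: "finite J"
  shows "infinitely_divisible_PiM J (fdd Q J X)"
proof (rule infinitely_divisible_PiM_if_vchar_root[OF J])
  show "prob_space (fdd Q J X)" by (rule prob_space_fdd[OF Q.prob_space_axioms X_measurable])
  obtain m where m: "\<And>t. t \<in> J \<Longrightarrow> t \<le> m" using finite_int_upper[OF J] by blast
  fix n :: nat assume n: "1 \<le> n"
  interpret D: levy_control "\<lambda>\<theta>. V \<theta> / of_nat n" K \<alpha> \<Phi> by (rule levy_control_divide[OF n])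
  have "vchar J (fdd D.Q J D.X) \<theta> ^ n = vchar J (fdd Q J X) \<theta>" for \<theta>
  proof -
    have "vchar J (fdd D.Q J D.X) \<theta> = exp (\<Sum>j. CLINT x|\<Phi>. V (moving_kernel m J \<theta> j x) / of_nat n)"
      unfolding vchar_fdd[OF D.Q.prob_space_axioms D.X_measurable] by (rule D.X_char[OF J m])
    hence "vchar J (fdd D.Q J D.X) \<theta> ^ n = exp (of_nat n * (\<Sum>j. CLINT x|\<Phi>. V (moving_kernel m J \<theta> j x) / of_nat n))"
      by (simp add: exp_of_nat_mult)
    also have "of_nat n * (\<Sum>j. CLINT x|\<Phi>. V (moving_kernel m J \<theta> j x) / of_nat n) =
        (\<Sum>j. CLINT x|\<Phi>. V (moving_kernel m J \<theta> j x))"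
      using n suminf_divide[OF moving_exponent_summable[OF J], of m \<theta> "of_nat n"] by simp
    also have "exp \<dots> = vchar J (fdd Q J X) \<theta>"
      unfolding vchar_fdd[OF Q.prob_space_axioms X_measurable] by (rule X_char[OF J m, symmetric])
    finally show ?thesis .
  qed
  thus "\<exists>\<nu>. prob_space \<nu> \<and> sets \<nu> = sets (PiM J (\<lambda>_. borel)) \<and> (\<forall>\<theta>. vchar J \<nu> \<theta> ^ n = vchar J (fdd Q J X) \<theta>)"
    using prob_space_fdd[OF D.Q.prob_space_axioms D.X_measurable] by (intro exI[of _ "fdd D.Q J D.X"]) auto
qed simp

locale aggregation = char_sequence \<mu> V K \<alpha> + LC: levy_control V K \<alpha> \<Phi> + P: prob_space P
  for \<mu> :: "nat \<Rightarrow> real measure" and V :: "real \<Rightarrow> complex" and K \<alpha> :: real and \<Phi> :: "real measure"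
    and P :: "'w measure" +
  fixes a' :: "nat \<Rightarrow> nat \<Rightarrow> 'w \<Rightarrow> real" and \<epsilon>' :: "nat \<Rightarrow> nat \<Rightarrow> int \<Rightarrow> 'w \<Rightarrow> real"
  assumes a'_law: "\<And>N i. 1 \<le> N \<Longrightarrow> i \<in> {1..N} \<Longrightarrow> distr P borel (a' N i) = \<Phi>"
    and \<epsilon>'_law: "\<And>N i t. 1 \<le> N \<Longrightarrow> i \<in> {1..N} \<Longrightarrow> distr P borel (\<epsilon>' N i t) = \<mu> N"
    and indep: "\<And>N. 1 \<le> N \<Longrightarrow> P.indep_vars (\<lambda>_. borel) (case_sum (a' N) (\<lambda>(i, t). \<epsilon>' N i t))
      ({1..N} <+> ({1..N} \<times> UNIV))"
begin

lemma
  assumes i: "i \<in> {1..N}"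
  shows a'_measurable: "a' N i \<in> borel_measurable P" and \<epsilon>'_measurable: "\<epsilon>' N i t \<in> borel_measurable P"
proof -
  have N: "1 \<le> N" using i by auto
  have rv: "case_sum (a' N) (\<lambda>(i, t). \<epsilon>' N i t) k \<in> borel_measurable P"
    if "k \<in> {1..N} <+> ({1..N} \<times> UNIV)" for k
    using indep[OF N] that by (auto simp: P.indep_vars_def)
  show "a' N i \<in> borel_measurable P" using rv[OF InlI[OF i]] by simp
  have "(i, t) \<in> {1..N} \<times> UNIV" using i by simp
  from rv[OF InrI[OF this]] show "\<epsilon>' N i t \<in> borel_measurable P" by simp
qed

abbreviation Y :: "nat \<Rightarrow> nat \<Rightarrow> int \<Rightarrow> 'w \<Rightarrow> real" where
  "Y N i \<equiv> ar1_series (a' N i) (\<epsilon>' N i)"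

lemma Y_measurable: "i \<in> {1..N} \<Longrightarrow> Y N i t \<in> borel_measurable P"
  by (intro ar1_series_measurable a'_measurable \<epsilon>'_measurable)

lemma sum_Y_measurable: "(\<lambda>\<omega>. \<Sum>i = 1..N. Y N i t \<omega>) \<in> borel_measurable P"
  by (intro borel_measurable_sum Y_measurable)

text \<open>The approximating integrals do not involve i, so uniqueness of limits will give all
  copies the same characteristic function.\<close>

lemma Y_char_tendsto:
  assumes i: "i \<in> {1..N}" and J: "finite J" "\<And>t. t \<in> J \<Longrightarrow> t \<le> m"
  shows "(\<lambda>n. CLINT x|\<Phi>. \<Prod>j<n. char (\<mu> N) (moving_kernel m J \<theta> j x)) \<longlonglongrightarrow>
    (CLINT \<omega>|P. iexp (\<Sum>t\<in>J. \<theta> t * Y N i t \<omega>))"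
proof -
  have N: "1 \<le> N" using i by auto
  define Z where "Z = case_sum (a' N) (\<lambda>(i, t). \<epsilon>' N i t)"
  have law: "distr P borel (a' N i) = \<Phi>" by (rule a'_law[OF N i])
  have "AE \<omega> in P. a' N i \<omega> \<in> unit_I"
    using LC.\<Phi>_I unfolding law[symmetric] by (rule AE_distrD[OF a'_measurable[OF i]])
  \<comment> \<open>The tail bound comes from \<open>bound\<close>, which treats all alpha alike,
    including the second-moment case alpha = 2.\<close>
  moreover have "P.prob {\<omega>\<in>space P. x < \<bar>\<epsilon>' N i t \<omega>\<bar>} \<le> 6 * (K / real N) * x powr (-\<alpha>)" if "0 < x" for t x
  proof (rule tail_bound_char[OF P.prob_space_axioms \<epsilon>'_measurable[OF i] \<alpha> _ _ that])
    show "cmod (char (distr P borel (\<epsilon>' N i t)) \<theta> - 1) \<le> K / real N * \<bar>\<theta>\<bar> powr \<alpha>" for \<theta>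
      using bound[OF N, of \<theta>] by (simp add: \<epsilon>'_law[OF N i])
  qed (use K in simp)
  ultimately have "(\<lambda>n. CLINT x|distr P borel (Z (Inl i)). \<Prod>j<n. char (\<mu> N) (moving_kernel m J \<theta> j x)) \<longlonglongrightarrow>
      (CLINT \<omega>|P. iexp (\<Sum>t\<in>J. \<theta> t * ar1_series (Z (Inl i)) (\<lambda>t. Z (Inr (i, t))) t \<omega>))"
    using i J indep[OF N] \<epsilon>'_law[OF N i] \<alpha>
    by (intro P.ar1_char_tendsto[where I = "{1..N} <+> ({1..N} \<times> UNIV)" and C = "6 * (K / real N)" and \<alpha> = \<alpha>])
       (auto simp: Z_def inj_def)
  thus ?thesis by (simp add: Z_def law)
qed

lemma sum_Y_char:
  assumes i: "i \<in> {1..N}" and J: "finite J"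
  shows "(CLINT \<omega>|P. iexp (\<Sum>t\<in>J. \<theta> t * (\<Sum>i = 1..N. Y N i t \<omega>))) = (CLINT \<omega>|P. iexp (\<Sum>t\<in>J. \<theta> t * Y N i t \<omega>)) ^ N"
proof -
  have N: "1 \<le> N" using i by auto
  obtain m where m: "\<And>t. t \<in> J \<Longrightarrow> t \<le> m" using finite_int_upper[OF J] by blast
  define Z where "Z k \<omega> = (\<Sum>t\<in>J. \<theta> t * Y N k t \<omega>)" for k \<omega>
  \<comment> \<open>The block of one copy: its coefficient together with its whole innovation
    sequence. Different blocks are disjoint, and \<open>f k\<close> writes the linear combination of
    copy k as a function of its own block.\<close>
  define grp :: "nat \<Rightarrow> (nat + nat \<times> int) set" where "grp k = {k} <+> ({k} \<times> UNIV)" for k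
  define f :: "nat \<Rightarrow> (nat + nat \<times> int \<Rightarrow> real) \<Rightarrow> real" where
    "f k y = (\<Sum>t\<in>J. \<theta> t * (\<Sum>n. y (Inl k) ^ n * y (Inr (k, t - int n))))" for k y
  have f: "f k \<in> borel_measurable (PiM (grp k) (\<lambda>_. borel))" for k
  proof -
    have "(\<lambda>y. y x) \<in> borel_measurable (PiM (grp k) (\<lambda>_. borel :: real measure))" if "x \<in> grp k" for x
      using that by (rule measurable_component_singleton)
    moreover have "Inl k \<in> grp k" "Inr (k, t) \<in> grp k" for t by (auto simp: grp_def)
    ultimately have "(\<lambda>y. y (Inl k)) \<in> borel_measurable (PiM (grp k) (\<lambda>_. borel :: real measure))"
      "(\<lambda>y. y (Inr (k, t))) \<in> borel_measurable (PiM (grp k) (\<lambda>_. borel :: real measure))" for t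
      by blast+
    note [measurable] = this
    show ?thesis unfolding f_def
      by (intro borel_measurable_sum borel_measurable_times borel_measurable_const borel_measurable_suminf borel_measurable_power) measurable
  qed
  have "P.indep_vars (\<lambda>k. PiM (grp k) (\<lambda>_. borel)) (\<lambda>k \<omega>. \<lambda>x\<in>grp k. case_sum (a' N) (\<lambda>(i, t). \<epsilon>' N i t) x \<omega>) {1..N}"
    by (rule P.indep_vars_restrict[OF indep[OF N]]) (auto simp: grp_def disjoint_family_on_def)
  hence "P.indep_vars (\<lambda>_. borel) (\<lambda>k \<omega>. f k (\<lambda>x\<in>grp k. case_sum (a' N) (\<lambda>(i, t). \<epsilon>' N i t) x \<omega>)) {1..N}"
    by (rule P.indep_vars_compose2) (rule f)
  moreover have "f k (\<lambda>x\<in>grp k. case_sum (a' N) (\<lambda>(i, t). \<epsilon>' N i t) x \<omega>) = Z k \<omega>" for k \<omega>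
  proof -
    have "Inl k \<in> grp k" "Inr (k, t) \<in> grp k" for t by (auto simp: grp_def)
    thus ?thesis by (simp add: f_def Z_def ar1_series_def)
  qed
  ultimately have "P.indep_vars (\<lambda>_. borel) Z {1..N}" by simp
  from P.char_distr_sum[OF this, of 1]
  have "char (distr P borel (\<lambda>\<omega>. \<Sum>k\<in>{1..N}. Z k \<omega>)) 1 = (\<Prod>k\<in>{1..N}. char (distr P borel (Z k)) 1)" .
  moreover have Zm: "Z k \<in> borel_measurable P" if "k \<in> {1..N}" for k
    unfolding Z_def by (intro borel_measurable_sum borel_measurable_times borel_measurable_const Y_measurable that)
  hence "char (distr P borel (\<lambda>\<omega>. \<Sum>k\<in>{1..N}. Z k \<omega>)) 1 = (CLINT \<omega>|P. iexp (\<Sum>k\<in>{1..N}. Z k \<omega>))"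
    by (simp add: char_def integral_distr)
  moreover have "char (distr P borel (Z k)) 1 = (CLINT \<omega>|P. iexp (Z i \<omega>))" if k: "k \<in> {1..N}" for k
  proof -
    have "char (distr P borel (Z k)) 1 = (CLINT \<omega>|P. iexp (Z k \<omega>))"
      using Zm[OF k] by (simp add: char_def integral_distr)
    also have "\<dots> = (CLINT \<omega>|P. iexp (Z i \<omega>))"
      unfolding Z_def by (rule LIMSEQ_unique[OF Y_char_tendsto[OF k J m] Y_char_tendsto[OF i J m]])
    finally show ?thesis .
  qed
  ultimately have "(CLINT \<omega>|P. iexp (\<Sum>k\<in>{1..N}. Z k \<omega>)) = (CLINT \<omega>|P. iexp (Z i \<omega>)) ^ N" by simp
  moreover have "(\<Sum>t\<in>J. \<theta> t * (\<Sum>k = 1..N. Y N k t \<omega>)) = (\<Sum>k\<in>{1..N}. Z k \<omega>)" for \<omega>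
    unfolding Z_def sum_distrib_left by (rule sum.swap)
  ultimately show ?thesis by (simp only: Z_def)
qed

lemma triangular_array_Y:
  assumes J: "finite J" "\<And>t. t \<in> J \<Longrightarrow> t \<le> m"
  shows "triangular_array \<mu> V K \<alpha> \<Phi> (\<lambda>N. CLINT \<omega>|P. iexp (\<Sum>t\<in>J. \<theta> t * Y N 1 t \<omega>)) m J \<theta>"
  by unfold_locales (use J Y_char_tendsto[OF _ J] in auto)

lemma sum_Y_vchar_tendsto:
  assumes J: "finite J"
  shows "(\<lambda>N. CLINT \<omega>|P. iexp (\<Sum>t\<in>J. \<theta> t * (\<Sum>i = 1..N. Y N i t \<omega>))) \<longlonglongrightarrow>
    (CLINT \<omega>|LC.Q. iexp (\<Sum>t\<in>J. \<theta> t * LC.X t \<omega>))"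
proof -
  obtain m where m: "\<And>t. t \<in> J \<Longrightarrow> t \<le> m" using finite_int_upper[OF J] by blast
  have ev: "eventually (\<lambda>N. (CLINT \<omega>|P. iexp (\<Sum>t\<in>J. \<theta> t * Y N 1 t \<omega>)) ^ N =
      (CLINT \<omega>|P. iexp (\<Sum>t\<in>J. \<theta> t * (\<Sum>i = 1..N. Y N i t \<omega>)))) sequentially"
    using eventually_ge_at_top[of 1] by eventually_elim (rule sum_Y_char[symmetric], use J in auto)
  interpret triangular_array \<mu> V K \<alpha> \<Phi> "\<lambda>N. CLINT \<omega>|P. iexp (\<Sum>t\<in>J. \<theta> t * Y N 1 t \<omega>)" m J \<theta>
    by (rule triangular_array_Y[OF J m])
  have ch: "(CLINT \<omega>|LC.Q. iexp (\<Sum>t\<in>J. \<theta> t * LC.X t \<omega>)) = exp (\<Sum>j. CLINT x|\<Phi>. V (moving_kernel m J \<theta> j x))"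
    by (rule LC.X_char[OF J m])
  show ?thesis unfolding ch by (rule Lim_transform_eventually[OF E_power_tendsto ev])
qed

text \<open>|E^N - 1| is at most N |E - 1|, and the 1 / N in \<open>E_bound\<close> absorbs the
  factor N. The resulting tail bound is uniform in N, which is the tightness needed for weak
  convergence.\<close>

lemma sum_Y_tail:
  assumes x: "0 < x"
  shows "P.prob {\<omega>\<in>space P. x < \<bar>\<Sum>i = 1..N. Y N i t \<omega>\<bar>} \<le>
    6 * (K * (\<Sum>k. LINT y|\<Phi>. \<bar>y ^ k\<bar> powr \<alpha>)) * x powr (-\<alpha>)"
proof (rule tail_bound_char[OF P.prob_space_axioms sum_Y_measurable \<alpha> _ _ x])
  have summ: "summable (\<lambda>k. LINT y|\<Phi>. \<bar>y ^ k\<bar> powr \<alpha>)"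
    using LC.moving_kernel_summable[of "{0}" 0 "\<lambda>_. 1"] by (simp add: moving_kernel_single)
  show q0: "0 \<le> K * (\<Sum>k. LINT y|\<Phi>. \<bar>y ^ k\<bar> powr \<alpha>)"
    using K by (intro mult_nonneg_nonneg suminf_nonneg summ) auto
  fix \<theta>
  have ch: "char (distr P borel (\<lambda>\<omega>. \<Sum>i = 1..N. Y N i t \<omega>)) \<theta> = (CLINT \<omega>|P. iexp (\<Sum>s\<in>{t}. \<theta> * (\<Sum>i = 1..N. Y N i s \<omega>)))"
    using sum_Y_measurable by (simp add: char_def integral_distr)
  show "cmod (char (distr P borel (\<lambda>\<omega>. \<Sum>i = 1..N. Y N i t \<omega>)) \<theta> - 1) \<le> K * (\<Sum>k. LINT y|\<Phi>. \<bar>y ^ k\<bar> powr \<alpha>) * \<bar>\<theta>\<bar> powr \<alpha>"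
  \<comment> \<open>The sequence of laws also has an entry at N = 0, where the sum is empty and
    equals 0.\<close>
  proof (cases "N = 0")
    case True
    thus ?thesis unfolding ch using q0 P.prob_space by simp
  next
    case False
    hence N: "1 \<le> N" by simp
    define E where "E = (CLINT \<omega>|P. iexp (\<Sum>s\<in>{t}. \<theta> * Y N 1 s \<omega>))"
    have "1 \<in> {1..N}" using N by simp
    hence E1: "cmod E \<le> 1"
      unfolding E_def using P.prob_space by (intro order_trans[OF integral_norm_bound]) simp
    have ker: "(LINT y|\<Phi>. \<bar>moving_kernel t {t} (\<lambda>_. \<theta>) k y\<bar> powr \<alpha>) = \<bar>\<theta>\<bar> powr \<alpha> * (LINT y|\<Phi>. \<bar>y ^ k\<bar> powr \<alpha>)" for k
      by (simp add: moving_kernel_def abs_mult powr_mult)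
    have "cmod (char (distr P borel (\<lambda>\<omega>. \<Sum>i = 1..N. Y N i t \<omega>)) \<theta> - 1) = cmod (E ^ N - 1 ^ N)"
      unfolding ch E_def by (subst sum_Y_char[of 1]) (use N in auto)
    also have "\<dots> \<le> real N * cmod (E - 1)"
      using E1 by (intro norm_power_diff) auto
    also have "\<dots> \<le> real N * (K / real N * (\<Sum>k. LINT y|\<Phi>. \<bar>moving_kernel t {t} (\<lambda>_. \<theta>) k y\<bar> powr \<alpha>))"
      unfolding E_def
      by (intro mult_left_mono triangular_array.E_bound[OF triangular_array_Y] N) auto
    also have "\<dots> = K * (\<Sum>k. LINT y|\<Phi>. \<bar>moving_kernel t {t} (\<lambda>_. \<theta>) k y\<bar> powr \<alpha>)" using N by simp
    also have "\<dots> = K * (\<Sum>k. LINT y|\<Phi>. \<bar>y ^ k\<bar> powr \<alpha>) * \<bar>\<theta>\<bar> powr \<alpha>"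
      unfolding ker suminf_mult[OF summ] by (simp add: mult_ac)
    finally show ?thesis .
  qed
qed

theorem sum_Y_weak_conv:
  assumes J: "finite J"
  shows "weak_conv_PiM J (\<lambda>N. fdd P J (\<lambda>t \<omega>. \<Sum>i = 1..N. Y N i t \<omega>)) (fdd LC.Q J LC.X)"
  unfolding weak_conv_PiM_def
proof (intro allI impI, elim conjE)
  fix g :: "(int \<Rightarrow> real) \<Rightarrow> real"
  assume g: "continuous_map (product_topology (\<lambda>_. euclideanreal) J) euclideanreal g" "bounded (g ` (J \<rightarrow>\<^sub>E UNIV))"
  note pY = prob_space_fdd[OF P.prob_space_axioms sum_Y_measurable]
  show "(\<lambda>n. LINT x|fdd P J (\<lambda>t \<omega>. \<Sum>i = 1..n. Y n i t \<omega>). g x) \<longlonglongrightarrow> (LINT x|fdd LC.Q J LC.X. g x)"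
  proof (rule vchar_tendsto_imp_weak_conv[OF J pY _ _ _ _ _ g])
    show "prob_space (fdd LC.Q J LC.X)" by (rule prob_space_fdd[OF LC.Q.prob_space_axioms LC.X_measurable])
    show "(\<lambda>N. vchar J (fdd P J (\<lambda>t \<omega>. \<Sum>i = 1..N. Y N i t \<omega>)) \<theta>) \<longlonglongrightarrow> vchar J (fdd LC.Q J LC.X) \<theta>" for \<theta>
      unfolding vchar_fdd[OF P.prob_space_axioms sum_Y_measurable] vchar_fdd[OF LC.Q.prob_space_axioms LC.X_measurable]
      by (rule sum_Y_vchar_tendsto[OF J])
    fix e :: real assume e: "0 < e"
    \<comment> \<open>A union bound over the coordinates in \<open>J\<close>; b is then taken so far
      out that their tails add up to less than e.\<close>
    define c where "c = 6 * (K * (\<Sum>k. LINT y|\<Phi>. \<bar>y ^ k\<bar> powr \<alpha>))"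
    have "((\<lambda>y. real (card J) * (c * y powr (-\<alpha>))) \<longlongrightarrow> real (card J) * (c * 0)) at_top"
      using \<alpha> by (intro tendsto_intros tendsto_neg_powr filterlim_ident) auto
    hence "eventually (\<lambda>y. real (card J) * (c * y powr (-\<alpha>)) < e) at_top"
      using e by (intro order_tendstoD(2)) auto
    with eventually_gt_at_top[of 0] have "eventually (\<lambda>y. 0 < y \<and> real (card J) * (c * y powr (-\<alpha>)) < e) at_top"
      by eventually_elim auto
    then obtain b where b: "0 < b" "real (card J) * (c * b powr (-\<alpha>)) < e"
      unfolding eventually_at_top_linorder by blast
    have "measure (fdd P J (\<lambda>t \<omega>. \<Sum>i = 1..N. Y N i t \<omega>)) {x \<in> space (fdd P J (\<lambda>t \<omega>. \<Sum>i = 1..N. Y N i t \<omega>)). \<exists>t\<in>J. b < \<bar>x t\<bar>} \<le> e" for N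
    proof -
      define A where "A = {x \<in> space (PiM J (\<lambda>_. borel :: real measure)). \<exists>t\<in>J. b < \<bar>x t\<bar>}"
      have A: "A \<in> sets (PiM J (\<lambda>_. borel))" unfolding A_def using J by measurable
      have Ym: "{\<omega>\<in>space P. b < \<bar>\<Sum>i = 1..N. Y N i t \<omega>\<bar>} \<in> sets P" for t
        using sum_Y_measurable[of N t] by measurable
      have "measure (fdd P J (\<lambda>t \<omega>. \<Sum>i = 1..N. Y N i t \<omega>)) A = P.prob {\<omega>\<in>space P. (\<lambda>t\<in>J. \<Sum>i = 1..N. Y N i t \<omega>) \<in> A}"
        by (rule measure_fdd[OF P.prob_space_axioms sum_Y_measurable A])
      also have "{\<omega>\<in>space P. (\<lambda>t\<in>J. \<Sum>i = 1..N. Y N i t \<omega>) \<in> A} = (\<Union>t\<in>J. {\<omega>\<in>space P. b < \<bar>\<Sum>i = 1..N. Y N i t \<omega>\<bar>})"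
        by (auto simp: A_def space_PiM)
      also have "P.prob \<dots> \<le> (\<Sum>t\<in>J. P.prob {\<omega>\<in>space P. b < \<bar>\<Sum>i = 1..N. Y N i t \<omega>\<bar>})"
        using J Ym by (intro P.finite_measure_subadditive_finite) auto
      also have "\<dots> \<le> (\<Sum>t\<in>J. c * b powr (-\<alpha>))"
        unfolding c_def by (intro sum_mono sum_Y_tail b)
      also have "\<dots> \<le> e" using b(2) by simp
      finally show ?thesis by (simp add: A_def fdd_def)
    qed
    thus "\<exists>K>0. \<forall>N. measure (fdd P J (\<lambda>t \<omega>. \<Sum>i = 1..N. Y N i t \<omega>)) {x \<in> space (fdd P J (\<lambda>t \<omega>. \<Sum>i = 1..N. Y N i t \<omega>)). \<exists>t\<in>J. K < \<bar>x t\<bar>} \<le> e"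
      using b(1) by blast
  qed simp_all
qed

end

text \<open>This converts the moment condition on \<open>a\<close> to the summability of \<open>E \<bar>a\<bar>\<^sup>k\<^sup>\<alpha>\<close> over \<open>k\<close>.\<close>

lemma one_minus_powr_ge:
  fixes u \<alpha> :: real
  assumes u: "0 \<le> u" "u \<le> 1" and \<alpha>: "0 < \<alpha>"
  shows "min 1 \<alpha> * (1 - u) \<le> 1 - u powr \<alpha>"
proof (cases "\<alpha> \<le> 1")
  case True
  show ?thesis
  proof (cases "u = 0")
    case False
    hence u0: "0 < u" using u by simp
    \<comment> \<open>Convexity of \<open>exp\<close> between 0 and ln u is Bernoulli's inequality
      u^alpha <= 1 - alpha + alpha u.\<close>
    have "exp ((1 - \<alpha>) *\<^sub>R 0 + \<alpha> *\<^sub>R ln u) \<le> (1 - \<alpha>) * exp 0 + \<alpha> * exp (ln u)"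
      using True \<alpha> by (intro convex_onD[OF exp_convex]) auto
    hence "u powr \<alpha> \<le> 1 - \<alpha> + \<alpha> * u" using u0 by (simp add: powr_def)
    thus ?thesis using True by (simp add: algebra_simps)
  qed (use True in simp)
next
  case False
  have "u powr \<alpha> \<le> u powr 1" using u False by (intro powr_mono') auto
  thus ?thesis using u False by simp
qed

theorem theorem2p6:
  fixes P :: "'w measure"
    and a W :: "'w \<Rightarrow> real"
    and \<epsilon> :: "nat \<Rightarrow> 'w \<Rightarrow> real"
    and \<mu> \<sigma> \<alpha> :: real and \<pi> :: "real measure"
    and a' :: "nat \<Rightarrow> nat \<Rightarrow> 'w \<Rightarrow> real"
    and \<epsilon>' :: "nat \<Rightarrow> nat \<Rightarrow> int \<Rightarrow> 'w \<Rightarrow> real"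
  assumes P: "prob_space P"
    and a_rv: "a \<in> borel_measurable P"
    and a_range: "\<And>\<omega>. \<omega> \<in> space P \<Longrightarrow> a \<omega> \<in> {-1<..<1}"
    and a_moment: "integrable P (\<lambda>\<omega>. 1 / (1 - \<bar>a \<omega>\<bar>))"
    and W: "ID_rv P W \<mu> \<sigma> \<pi>"
    and DW: "domain_of_attraction P \<epsilon> W"
    and \<alpha>: "0 < \<alpha>" "\<alpha> \<le> 2"
    and T: "class_T P \<alpha> \<epsilon>"
    and a'_law: "\<And>N i. 1 \<le> N \<Longrightarrow> i \<in> {1..N} \<Longrightarrow> distr P borel (a' N i) = distr P borel a"
    and \<epsilon>'_law: "\<And>N i t. 1 \<le> N \<Longrightarrow> i \<in> {1..N} \<Longrightarrow>
            distr P borel (\<epsilon>' N i t) = distr P borel (\<epsilon> N)"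
    and indep: "\<And>N. 1 \<le> N \<Longrightarrow>
            prob_space.indep_vars P (\<lambda>_. borel) (case_sum (a' N) (\<lambda>(i, t). \<epsilon>' N i t))
              ({1..N} <+> ({1..N} \<times> UNIV))"
  shows "\<exists>(Q :: (int \<Rightarrow> real set \<Rightarrow> real) measure) X M.
           prob_space Q \<and>
           (\<forall>t. X t \<in> borel_measurable Q) \<and>
           (\<forall>J. finite J \<longrightarrow>
              weak_conv_PiM J
                (\<lambda>N. fdd P J (\<lambda>t \<omega>. \<Sum>i = 1..N. ar1_series (a' N i) (\<epsilon>' N i) t \<omega>))
                (fdd Q J X)) \<and>
           stationary_process Q X \<and>
           ergodic_process Q X \<and>
           (\<forall>J. finite J \<longrightarrow> infinitely_divisible_PiM J (fdd Q J X)) \<and>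
           (\<forall>s. ID_random_measure Q (M s) (levy_exponent \<mu> \<sigma> \<pi>) (distr P borel a)) \<and>
           iid_random_measures Q M \<and>
           (\<exists>I. (\<forall>t s. s \<le> t \<longrightarrow>
                   has_random_integral Q (M s) (distr P borel a) (\<lambda>x. x ^ nat (t - s)) (I t s)) \<and>
                (\<forall>t. tendsto_in_prob Q (\<lambda>n \<omega>. \<Sum>s = t - int n..t. I t s \<omega>) (X t)))"
proof -
  interpret P: prob_space P by (rule P)
  define V where "V = levy_exponent \<mu> \<sigma> \<pi>"
  define \<Phi> where "\<Phi> = distr P borel a"
  have \<epsilon>_rv: "\<epsilon> N \<in> borel_measurable P" if "1 \<le> N" for N
    using DW that by (simp add: domain_of_attraction_def)
  have levy: "levy_measure \<pi>" and W_char: "\<And>\<theta>. char (distr P borel W) \<theta> = exp (V \<theta>)"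
    using W by (auto simp: ID_rv_def V_def)
  obtain K where K: "0 \<le> K"
    "\<And>N \<theta>. 1 \<le> N \<Longrightarrow> cmod (char (distr P borel (\<epsilon> N)) \<theta> - 1) \<le> K * \<bar>\<theta>\<bar> powr \<alpha> / real N"
    using class_T_char_bound[OF P \<epsilon>_rv T] by blast
  interpret CS: char_sequence "\<lambda>N. distr P borel (\<epsilon> N)" V K \<alpha>
  proof (rule char_sequence.intro)
    show "real_distribution (distr P borel (\<epsilon> N))" if "1 \<le> N" for N
      by (rule P.real_distribution_distr[OF \<epsilon>_rv[OF that]])
    show "(\<lambda>N. char (distr P borel (\<epsilon> N)) \<theta> ^ N) \<longlonglongrightarrow> exp (V \<theta>)" for \<theta>
      using DW by (simp add: domain_of_attraction_def W_char)
    show "continuous_on UNIV V" unfolding V_def by (rule levy_exponent_continuous[OF levy])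
    show "V 0 = 0" unfolding V_def by (rule levy_exponent_0)
  qed (use K \<alpha> in auto)
  have \<Phi>_I: "AE x in \<Phi>. x \<in> {-1<..<1}"
    unfolding \<Phi>_def by (subst AE_distr_iff[OF a_rv]) (use a_range in auto)
  \<comment> \<open>1 - |a|^alpha is at least min(1, alpha) times 1 - |a|, so the assumed moment
    dominates the one that \<open>levy_control\<close> uses.\<close>
  have \<Phi>_moment: "integrable \<Phi> (\<lambda>x. 1 / (1 - \<bar>x\<bar> powr \<alpha>))"
    unfolding \<Phi>_def
  proof (subst integrable_distr_eq[OF a_rv])
    have m: "0 < min 1 \<alpha>" using \<alpha> by simp
    show "integrable P (\<lambda>\<omega>. 1 / (1 - \<bar>a \<omega>\<bar> powr \<alpha>))"
    proof (rule Bochner_Integration.integrable_bound[OF integrable_mult_right[OF a_moment, of "1 / min 1 \<alpha>"]])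
      show "AE \<omega> in P. norm (1 / (1 - \<bar>a \<omega>\<bar> powr \<alpha>)) \<le> norm (1 / min 1 \<alpha> * (1 / (1 - \<bar>a \<omega>\<bar>)))"
      proof (rule AE_I2)
        fix \<omega> assume "\<omega> \<in> space P"
        hence u: "0 \<le> \<bar>a \<omega>\<bar>" "\<bar>a \<omega>\<bar> < 1" using a_range[of \<omega>] by auto
        have pos: "0 < min 1 \<alpha> * (1 - \<bar>a \<omega>\<bar>)" using m u by (intro mult_pos_pos) auto
        have "\<bar>min 1 \<alpha> * (1 - \<bar>a \<omega>\<bar>)\<bar> = min 1 \<alpha> * (1 - \<bar>a \<omega>\<bar>)" using pos by (rule abs_of_pos)
        moreover have le: "min 1 \<alpha> * (1 - \<bar>a \<omega>\<bar>) \<le> 1 - \<bar>a \<omega>\<bar> powr \<alpha>"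
          using u \<alpha> by (intro one_minus_powr_ge) auto
        moreover have "1 / (1 - \<bar>a \<omega>\<bar> powr \<alpha>) \<le> 1 / (min 1 \<alpha> * (1 - \<bar>a \<omega>\<bar>))"
          using pos le by (intro divide_left_mono mult_pos_pos[OF pos]) simp_all
        moreover have "0 \<le> 1 / (1 - \<bar>a \<omega>\<bar> powr \<alpha>)" using pos le by simp
        ultimately show "norm (1 / (1 - \<bar>a \<omega>\<bar> powr \<alpha>)) \<le> norm (1 / min 1 \<alpha> * (1 / (1 - \<bar>a \<omega>\<bar>)))"
          by simp
      qed
    qed (use a_rv in measurable)
  qed measurable
  interpret LC: levy_control V K \<alpha> \<Phi>
  proof (rule levy_control.intro)
    show "real_distribution \<Phi>" unfolding \<Phi>_def by (rule P.real_distribution_distr[OF a_rv])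
  qed (use CS.V CS.V_bound CS.V_Re CS.exp_scaled_exists K \<alpha> \<Phi>_I \<Phi>_moment in auto)
  interpret AG: aggregation "\<lambda>N. distr P borel (\<epsilon> N)" V K \<alpha> \<Phi> P a' \<epsilon>'
    by unfold_locales (use a'_law \<epsilon>'_law indep in \<open>auto simp: \<Phi>_def\<close>)
  \<comment> \<open>On the product space the coordinate at s is itself the random measure at time
    s.\<close>
  have "ID_random_measure LC.Q (\<lambda>A \<omega>. \<omega> s A) V \<Phi>" for s
    by (rule LC.char_field_ID[OF LC.char_field_Q])
  moreover have "\<exists>I. (\<forall>t s. s \<le> t \<longrightarrow> has_random_integral LC.Q (\<lambda>A \<omega>. \<omega> s A) \<Phi> (\<lambda>x. x ^ nat (t - s)) (I t s)) \<and>
      (\<forall>t. tendsto_in_prob LC.Q (\<lambda>n \<omega>. \<Sum>s = t - int n..t. I t s \<omega>) (LC.X t))"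
    using LC.power_has_random_integral LC.X_series
    by (intro exI[of _ "\<lambda>t s \<omega>. LC.power_integral (nat (t - s)) (\<omega> s)"]) blast
  ultimately show ?thesis
    unfolding V_def[symmetric] \<Phi>_def[symmetric]
    using LC.Q.prob_space_axioms LC.X_measurable AG.sum_Y_weak_conv LC.X_stationary LC.X_ergodic
      LC.X_infinitely_divisible LC.Q_iid
    by (intro exI[of _ LC.Q] exI[of _ LC.X] exI[of _ "\<lambda>s A \<omega>. \<omega> s A"]) simp
qed

end
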